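(* Given $n\ge2$ and $C_A\ge1$ there exist constants $\epsilon_2=\epsilon_2(n,C_A)$ and $C_2=C_2(n,C_A)$ (both positive and finite) such that if $E\in\mathcal{A}(C_A,r_0)$ (for some $r_0>0$) satisfies $$\sup_{r<r_0}\left(\frac{1}{\mathcal{H}^{n-1}(B(x,r)\cap\partial^*E)}\int_{B(x,r)\cap\partial^*E}|\nu_E-(\nu_E)_{x,r}|^2\,d\mathcal{H}^{n-1}\right)^{1/2}\le\epsilon_2$$ for some $x\in\partial E$, then $$\sup_{\rho<r_0/8}\Theta(x,\rho)\le C_2\,\epsilon_2^{\frac1{n-1}}.$$ In particular, if $\Omega\subset\mathbb{R}^n$ is a domain such that $\partial_*\Omega=\partial\Omega$, $\partial\Omega$ is $(n-1)$-Ahlfors regular (with constant $C_A$), and $\nu_\Omega$ satisfies (for some $r_0>0$) $$\sup_{r<r_0}\sup_{x\in\partial\Omega}\left(\frac{1}{\mathcal{H}^{n-1}(B(x,r)\cap\partial\Omega)}\int_{B(x,r)\cap\partial\Omega}|\nu_\Omega-(\nu_\Omega)_{x,r}|^2\,d\mathcal{H}^{n-1}\right)^{1/2}\le\epsilon_2,$$ then $\Omega$ is a $C_2\,\epsilon_2^{\frac{1}{n-1}}$-Reifenberg flat domain.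
   Context: For a set $E\subset\mathbb{R}^n$ of locally finite perimeter, $\mu_E$ is its Gauss–Green measure (the $\mathbb{R}^n$-valued Radon measure with $\int_E\operatorname{div}T\,dx=\int T\cdot d\mu_E$ for all $T\in C_c^1(\mathbb{R}^n;\mathbb{R}^n)$), $|\mu_E|$ is its total variation, $\partial^*E$ is the reduced boundary (the points $x\in\operatorname{spt}\mu_E$ at which $\nu_E(x)=\lim_{r\downarrow0}\mu_E(B(x,r))/|\mu_E|(B(x,r))$ exists and is a unit vector), $\nu_E$ is the measure-theoretic outer unit normal on $\partial^*E$ given by this limit, and $\partial_*E$ is the measure-theoretic boundary (the points at which both $E$ and its complement have positive upper Lebesgue density). $(\nu_E)_{x,r}$ is the average of $\nu_E$ over $B(x,r)\cap\partial^*E$ with respect to the Hausdorff measure $\mathcal{H}^{n-1}$; similarly for $\Omega$. $\mathcal{A}(C_A,r_0)$ is the class of sets $E\subset\mathbb{R}^n$ of locally finite perimeter with $\partial E=\operatorname{spt}\mu_E$ ($\partial E$ the topological boundary) such that $C_A^{-1}r^{n-1}\le|\mu_E|(B(x,r))\le C_Ar^{n-1}$ for all $x\in\operatorname{spt}\mu_E$ and $0<r<r_0$. A domain is an open connected set. A closed set $F\subset\mathbb{R}^n$ is $(n-1)$-Ahlfors regular, with constant $C_A$, if $C_A^{-1}r^{n-1}\le\mathcal{H}^{n-1}(F\cap B(x,r))\le C_Ar^{n-1}$ for all $x\in F$ and $0<r<\operatorname{diam}F$. For a closed set $\Sigma$ (above, $\Sigma=\partial E$ or $\Sigma=\partial\Omega$),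 $x\in\Sigma$ and $r>0$, $\Theta(x,r)=\inf_L\frac1rD[\Sigma\cap\overline{B(x,r)},L\cap\overline{B(x,r)}]$, the infimum being over all $(n-1)$-planes $L$ containing $x$, where $D[A,B]=\sup_{a\in A}d(a,B)+\sup_{b\in B}d(b,A)$. $\Sigma$ is $\delta$-Reifenberg flat if for each compact $K\subset\mathbb{R}^n$ there is $R_K>0$ with $\sup_{r\in(0,R_K]}\sup_{x\in K\cap\Sigma}\Theta(x,r)<\delta$. Let $\delta_n>0$ be an appropriately chosen constant depending only on $n$ (such that $\delta$-Reifenberg flat domains with $\delta<\delta_n$ are locally non-tangentially accessible domains). For $\delta\in(0,\delta_n)$, a domain $\Omega\subset\mathbb{R}^n$ is a $\delta$-Reifenberg flat domain if $\partial\Omega$ is $\delta$-Reifenberg flat and $\Omega$ has the separation property: for every compact $K\subset\mathbb{R}^n$ there is $R_K>0$ such that for any $y\in\partial\Omega\cap K$ and $0<r<R_K$ there is a unit vector $\vec n$ such that, for $x\in B(y,r)$, $\langle x-y,\vec n\rangle>\delta r$ implies $x\in\Omega^c$ and $\langle x-y,\vec n\rangle<-\delta r$ implies $x\in\Omega$. As part of this definition, if $\Omega$ is unbounded it is further required that $\mathbb{R}^n\setminus\partial\Omega$ consists of two connected components and that $\delta\le\delta_n$.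
   Formalization: For unbounded Ω, that ℝⁿ∖∂Ω has two components is assumed before calling Ω a Reifenberg flat domain, since the strip 0<x_n<1 meets all hypotheses but has three; flatness of ∂Ω, the separation property and δ<δ_n are proved for every Ω. *)

theory Defs
  imports "HOL-Analysis.Analysis"
begin

section \<open>Hausdorff measure and Ahlfors regularity\<close>

text \<open>The \<open>k\<close>-dimensional Hausdorff measure, with the normalisation for which it agrees with
  Lebesgue measure in dimension \<open>k\<close>.  The library's \<open>diameter\<close> is meaningful only for bounded sets,
  hence the boundedness condition on the covering sets.\<close>

definition hausdorff_content :: "nat \<Rightarrow> real \<Rightarrow> 'a::metric_space set \<Rightarrow> ennreal" where
  "hausdorff_content k d A =
     (INF C \<in> {C :: nat \<Rightarrow> 'a set.
                 A \<subseteq> (\<Union>i. C i) \<and> (\<forall>i. bounded (C i) \<and> diameter (C i) \<le> d)}.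
        \<Sum>i. if C i = {} then 0
             else ennreal (unit_ball_vol (real k) * (diameter (C i) / 2) ^ k))"

definition hausdorff_outer :: "nat \<Rightarrow> 'a::metric_space set \<Rightarrow> ennreal" where
  "hausdorff_outer k A = (SUP d \<in> {0<..}. hausdorff_content k d A)"

definition hausdorff_measure :: "nat \<Rightarrow> 'a::metric_space measure" where
  "hausdorff_measure k = measure_of UNIV (sets borel) (hausdorff_outer k)"

abbreviation codim1_measure :: "(real ^ 'n) measure" where
  "codim1_measure \<equiv> hausdorff_measure (CARD('n) - 1)"

text \<open>An unbounded set has infinite diameter, so all radii are then admissible.\<close>

definition ahlfors_regular :: "real \<Rightarrow> (real ^ 'n) set \<Rightarrow> bool" where
  "ahlfors_regular CA F \<longleftrightarrow> closed F \<and>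
     (\<forall>x\<in>F. \<forall>r>0. (bounded F \<longrightarrow> r < diameter F) \<longrightarrow>
        ennreal (r ^ (CARD('n) - 1) / CA) \<le> emeasure codim1_measure (F \<inter> ball x r) \<and>
        emeasure codim1_measure (F \<inter> ball x r) \<le> ennreal (CA * r ^ (CARD('n) - 1)))"


section \<open>Vector-valued Radon measures\<close>

text \<open>An \<open>\<real>\<^sup>n\<close>-valued Radon measure is a countably additive function on the bounded Borel sets
  (it need not have a value on unbounded ones).  It is set to \<open>0\<close> on all other sets, so that it is
  determined by its values on bounded Borel sets.  Countable additivity forces the variation to be
  finite on bounded sets.\<close>

definition vector_radon_measure :: "((real ^ 'n) set \<Rightarrow> real ^ 'n) \<Rightarrow> bool" where
  "vector_radon_measure \<mu> \<longleftrightarrow>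
     (\<forall>A :: nat \<Rightarrow> (real ^ 'n) set.
        range A \<subseteq> sets borel \<and> disjoint_family A \<and> bounded (\<Union>i. A i) \<longrightarrow>
          (\<lambda>i. \<mu> (A i)) sums \<mu> (\<Union>i. A i)) \<and>
     (\<forall>A. \<not> (A \<in> sets borel \<and> bounded A) \<longrightarrow> \<mu> A = 0)"

text \<open>The total variation: the supremum of \<open>\<Sum>\<^sub>i \<bar>\<mu>(F\<^sub>i)\<bar>\<close> over countable Borel partitions.\<close>

definition total_variation :: "((real ^ 'n) set \<Rightarrow> real ^ 'n) \<Rightarrow> (real ^ 'n) measure" where
  "total_variation \<mu> = measure_of UNIV (sets borel)
     (\<lambda>A. SUP F \<in> {F :: nat \<Rightarrow> (real ^ 'n) set. disjoint_family F \<and>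
                    (\<forall>i. F i \<in> sets borel \<and> bounded (F i)) \<and> (\<Union>i. F i) = A}.
            \<Sum>i. ennreal (norm (\<mu> (F i))))"

text \<open>The positive part in the Jordan decomposition of a real-valued Radon measure; \<open>ennreal\<close>
  sends negative values to \<open>0\<close>.\<close>

definition positive_variation :: "((real ^ 'n) set \<Rightarrow> real) \<Rightarrow> (real ^ 'n) measure" where
  "positive_variation \<nu> = measure_of UNIV (sets borel)
     (\<lambda>A. SUP B \<in> {B. B \<in> sets borel \<and> bounded B \<and> B \<subseteq> A}. ennreal (\<nu> B))"

definition vector_integral ::
    "((real ^ 'n) set \<Rightarrow> real ^ 'n) \<Rightarrow> (real ^ 'n \<Rightarrow> real ^ 'n) \<Rightarrow> real" where
  "vector_integral \<mu> T =
     (\<Sum>i\<in>UNIV. (LINT x|positive_variation (\<lambda>A. \<mu> A $ i). T x $ i)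
              - (LINT x|positive_variation (\<lambda>A. - (\<mu> A $ i)). T x $ i))"

definition measure_support :: "(real ^ 'n) measure \<Rightarrow> (real ^ 'n) set" where
  "measure_support M = {x. \<forall>r>0. emeasure M (ball x r) > 0}"


section \<open>Sets of locally finite perimeter\<close>

definition C1_compactly_supported :: "(real ^ 'n \<Rightarrow> real ^ 'n) \<Rightarrow> bool" where
  "C1_compactly_supported T \<longleftrightarrow>
     T differentiable_on UNIV \<and>
     (\<forall>v. continuous_on UNIV (\<lambda>x. frechet_derivative T (at x) v)) \<and>
     compact (closure {x. T x \<noteq> 0})"

definition divergence :: "(real ^ 'n \<Rightarrow> real ^ 'n) \<Rightarrow> real ^ 'n \<Rightarrow> real" where
  "divergence T x = (\<Sum>i\<in>UNIV. frechet_derivative T (at x) (axis i 1) $ i)"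

definition is_gauss_green_measure ::
    "(real ^ 'n) set \<Rightarrow> ((real ^ 'n) set \<Rightarrow> real ^ 'n) \<Rightarrow> bool" where
  "is_gauss_green_measure E \<mu> \<longleftrightarrow> vector_radon_measure \<mu> \<and>
     (\<forall>T. C1_compactly_supported T \<longrightarrow>
        (LINT x:E|lebesgue. divergence T x) = vector_integral \<mu> T)"

definition locally_finite_perimeter :: "(real ^ 'n) set \<Rightarrow> bool" where
  "locally_finite_perimeter E \<longleftrightarrow> E \<in> sets lebesgue \<and> (\<exists>\<mu>. is_gauss_green_measure E \<mu>)"

definition gauss_green_measure :: "(real ^ 'n) set \<Rightarrow> (real ^ 'n) set \<Rightarrow> real ^ 'n" where
  "gauss_green_measure E = (THE \<mu>. is_gauss_green_measure E \<mu>)"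

definition perimeter_measure :: "(real ^ 'n) set \<Rightarrow> (real ^ 'n) measure" where
  "perimeter_measure E = total_variation (gauss_green_measure E)"

definition normal_quotient :: "(real ^ 'n) set \<Rightarrow> real ^ 'n \<Rightarrow> real \<Rightarrow> real ^ 'n" where
  "normal_quotient E x r =
     gauss_green_measure E (ball x r) /\<^sub>R measure (perimeter_measure E) (ball x r)"

definition reduced_boundary :: "(real ^ 'n) set \<Rightarrow> (real ^ 'n) set" where
  "reduced_boundary E =
     {x \<in> measure_support (perimeter_measure E).
        \<exists>v. norm v = 1 \<and> (normal_quotient E x \<longlongrightarrow> v) (at_right 0)}"

text \<open>The normal exists only on the reduced boundary; elsewhere it is given the value \<open>0\<close>.\<close>

definition outer_normal :: "(real ^ 'n) set \<Rightarrow> real ^ 'n \<Rightarrow> real ^ 'n" where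
  "outer_normal E x =
     (if x \<in> reduced_boundary E then Lim (at_right 0) (normal_quotient E x) else 0)"

definition upper_density :: "(real ^ 'n) set \<Rightarrow> real ^ 'n \<Rightarrow> ennreal" where
  "upper_density E x =
     Limsup (at_right 0)
       (\<lambda>r. emeasure lebesgue (E \<inter> ball x r) / emeasure lebesgue (ball x r))"

definition measure_theoretic_boundary :: "(real ^ 'n) set \<Rightarrow> (real ^ 'n) set" where
  "measure_theoretic_boundary E = {x. upper_density E x > 0 \<and> upper_density (- E) x > 0}"

definition regular_perimeter_class :: "real \<Rightarrow> real \<Rightarrow> (real ^ 'n) set set" where
  "regular_perimeter_class CA r0 =
     {E. locally_finite_perimeter E \<and>
         frontier E = measure_support (perimeter_measure E) \<and>
         (\<forall>x \<in> measure_support (perimeter_measure E). \<forall>r. 0 < r \<and> r < r0 \<longrightarrow>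
            ennreal (r ^ (CARD('n) - 1) / CA) \<le> emeasure (perimeter_measure E) (ball x r) \<and>
            emeasure (perimeter_measure E) (ball x r) \<le> ennreal (CA * r ^ (CARD('n) - 1)))}"

definition normal_average :: "(real ^ 'n) set \<Rightarrow> real ^ 'n \<Rightarrow> real \<Rightarrow> real ^ 'n" where
  "normal_average E x r =
     (LINT y:(ball x r \<inter> reduced_boundary E)|codim1_measure. outer_normal E y)
       /\<^sub>R measure codim1_measure (ball x r \<inter> reduced_boundary E)"

text \<open>The oscillation is measured on \<open>S\<close>, which is either the reduced or the topological boundary;
  the average is always taken over the reduced boundary.\<close>

definition normal_oscillation ::
    "(real ^ 'n) set \<Rightarrow> (real ^ 'n) set \<Rightarrow> real ^ 'n \<Rightarrow> real \<Rightarrow> real" where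
  "normal_oscillation E S x r =
     sqrt (1 / measure codim1_measure (ball x r \<inter> S) *
       (LINT y:(ball x r \<inter> S)|codim1_measure. (norm (outer_normal E y - normal_average E x r))\<^sup>2))"


section \<open>Reifenberg flatness\<close>

text \<open>Only applied to nonempty bounded sets, where the suprema are over nonempty bounded sets of
  reals.\<close>

definition two_sided_distance :: "'a::metric_space set \<Rightarrow> 'a set \<Rightarrow> real" where
  "two_sided_distance A B = (SUP a\<in>A. infdist a B) + (SUP b\<in>B. infdist b A)"

definition flatness :: "(real ^ 'n) set \<Rightarrow> real ^ 'n \<Rightarrow> real \<Rightarrow> real" where
  "flatness S x r =
     (INF L \<in> {L. affine L \<and> aff_dim L = int CARD('n) - 1 \<and> x \<in> L}.
        1 / r * two_sided_distance (S \<inter> cball x r) (L \<inter> cball x r))"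

text \<open>The suprema are taken in the extended reals, so that a supremum over the empty set is harmless.\<close>

definition reifenberg_flat :: "real \<Rightarrow> (real ^ 'n) set \<Rightarrow> bool" where
  "reifenberg_flat \<delta> S \<longleftrightarrow>
     (\<forall>K. compact K \<longrightarrow>
        (\<exists>R>0. (SUP r\<in>{0<..R}. SUP x\<in>K \<inter> S. ereal (flatness S x r)) < ereal \<delta>))"

definition separation_property :: "real \<Rightarrow> (real ^ 'n) set \<Rightarrow> bool" where
  "separation_property \<delta> \<Omega> \<longleftrightarrow>
     (\<forall>K. compact K \<longrightarrow>
        (\<exists>R>0. \<forall>y \<in> frontier \<Omega> \<inter> K. \<forall>r. 0 < r \<and> r < R \<longrightarrow>
           (\<exists>v. norm v = 1 \<and>
              (\<forall>x \<in> ball y r.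
                 ((x - y) \<bullet> v > \<delta> * r \<longrightarrow> x \<in> - \<Omega>) \<and>
                 ((x - y) \<bullet> v < - \<delta> * r \<longrightarrow> x \<in> \<Omega>)))))"

definition is_domain :: "(real ^ 'n) set \<Rightarrow> bool" where
  "is_domain \<Omega> \<longleftrightarrow> open \<Omega> \<and> connected \<Omega>"

text \<open>A global condition that is not implied by local or scale-limited hypotheses on the boundary:
  the strip between two parallel hyperplanes and the whole space both violate it.\<close>

definition two_components_if_unbounded :: "(real ^ 'n) set \<Rightarrow> bool" where
  "two_components_if_unbounded \<Omega> \<longleftrightarrow>
     (\<not> bounded \<Omega> \<longrightarrow> card (components (- frontier \<Omega>)) = 2)"

text \<open>Here \<open>\<delta>n\<close> is the dimensional threshold below which the notion is considered; the requirement
  \<open>\<delta> \<le> \<delta>n\<close> on unbounded domains is subsumed by \<open>\<delta> < \<delta>n\<close>.\<close>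

definition reifenberg_flat_domain :: "real \<Rightarrow> real \<Rightarrow> (real ^ 'n) set \<Rightarrow> bool" where
  "reifenberg_flat_domain \<delta>n \<delta> \<Omega> \<longleftrightarrow>
     0 < \<delta> \<and> \<delta> < \<delta>n \<and> is_domain \<Omega> \<and>
     reifenberg_flat \<delta> (frontier \<Omega>) \<and> separation_property \<delta> \<Omega> \<and>
     two_components_if_unbounded \<Omega>"

end

theory Submission
  imports Defs
begin

text \<open>The constants may depend on \<open>\<delta>n\<close>, so it suffices to show that an oscillation below some threshold
  \<open>\<epsilon>2\<close> forces the flatness below a prescribed \<open>\<delta>\<close>; then \<open>C2\<close> is \<open>\<delta>\<close> divided by the power of \<open>\<epsilon>2\<close>.

  Write the Gauss--Green measure as \<open>f \<sigma>\<close>, where \<open>\<sigma>\<close> is the Hausdorff measure on the boundary. On a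
  ball on which the normal oscillates little there is a unit vector \<open>c\<close> for which the integral of
  \<open>\<bar>f - \<bar>f\<bar> c\<bar>\<close> is small. Testing the Gauss--Green formula with bumps then shows that the mollified
  indicator of \<open>E\<close> is almost decreasing in the direction \<open>c\<close>, while its \<open>L\<^sup>1\<close> distance from the indicator
  is at most the perimeter times the scale of mollification. Hence \<open>E\<close> is close in measure to a half-space
  with outer normal \<open>c\<close>. If moreover \<open>E\<close> and its complement both have substantial volume in small balls
  centred at the boundary, the boundary lies in a thin slab and separates its two sides.

  For sets in the regular perimeter class these volumes are bounded below because the perimeter is. For a
  domain with Ahlfors regular boundary one starts from a tiny ball in which both phases are balanced, and
  closeness to a half-space at every scale propagates the balance to larger concentric balls. In this case
  the Gauss--Green measure has to be constructed: cutting off the boundary shows that the integral of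
  \<open>\<partial>\<^sub>i \<phi>\<close> over the domain is bounded by the integral of \<open>\<bar>\<phi>\<bar>\<close> with respect to \<open>\<sigma>\<close>.\<close>

section \<open>Compactly supported \<open>C\<^sup>1\<close> functions\<close>

text \<open>The perimeter is compared with \<sigma> only up to constants: \<open>f\<close> is a
  bounded density and no value of |f| is prescribed. The hypothesis speaks of
  \<open>outer_normal\<close>, the estimates of \<open>f\<close>. The link: where
  \<open>f x \<noteq> 0\<close>, the quotient defining the normal is a quotient of two
  \<sigma>-averages, and Lebesgue differentiation for the doubling measure \<sigma> identifies its
  limit as f/|f|. The measures in the definitions are built by \<open>measure_of\<close>, which
  returns the null measure when the given set function is not a measure. No value of theirs is
  available before countable additivity is known; this accounts for much of the measure theory. The
  radius r0/8 comes from three halvings: oscillation on the ball of radius 8\<rho>, half-space on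
  4\<rho>, slab on 2\<rho>, plane at scale \<rho>. Parameters are fixed in the order slab width
  \<eta>, mollification scale \<theta> (its L^1 error must stay below the volume of each phase in a
  ball of relative radius \<eta>), oscillation \<epsilon> (the mollified indicator must be monotone
  up to 1/4).\<close>

text \<open>A support radius replaces compactness of the closure, and the codomain is general, so
  that test functions and test fields share one calculus.\<close>

definition C1c :: "(real ^ 'n \<Rightarrow> 'b::real_normed_vector) \<Rightarrow> bool" where
 "C1c \<phi> \<longleftrightarrow> (\<forall>x. \<phi> differentiable (at x)) \<and>
   (\<forall>v. continuous_on UNIV (\<lambda>x. frechet_derivative \<phi> (at x) v)) \<and>
   (\<exists>R. \<forall>x. \<phi> x \<noteq> 0 \<longrightarrow> norm x < R)"

lemma C1cI:
 assumes "\<And>x. (\<phi> has_derivative \<phi>' x) (at x)"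
  and "\<And>v. continuous_on UNIV (\<lambda>x. \<phi>' x v)"
  and "\<And>x. \<phi> x \<noteq> 0 \<Longrightarrow> norm x < R"
 shows "C1c \<phi>" "frechet_derivative \<phi> (at x) = \<phi>' x"
proof -
 have *: "frechet_derivative \<phi> (at x) = \<phi>' x" for x
  using frechet_derivative_at[OF assms(1)] by simp
 then show "frechet_derivative \<phi> (at x) = \<phi>' x" .
 show "C1c \<phi>"
  unfolding C1c_def * using assms by (auto simp: differentiable_def)
qed

lemma C1c_has_derivative:
 "C1c \<phi> \<Longrightarrow> (\<phi> has_derivative frechet_derivative \<phi> (at x)) (at x)"
 by (simp add: C1c_def frechet_derivative_works)

lemma C1c_continuous_deriv:
 "C1c \<phi> \<Longrightarrow> continuous_on UNIV (\<lambda>x. frechet_derivative \<phi> (at x) v)"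
 by (simp add: C1c_def)

lemma C1c_support:
 assumes "C1c \<phi>" obtains R where "R > 0" "\<And>x. \<phi> x \<noteq> 0 \<Longrightarrow> norm x < R"
proof -
 obtain R where "\<And>x. \<phi> x \<noteq> 0 \<Longrightarrow> norm x < R"
  using assms by (auto simp: C1c_def)
 then show ?thesis by (intro that[of "max R 1"]) (auto simp: less_max_iff_disj)
qed

lemma C1_compactly_supported_iff: "C1_compactly_supported T \<longleftrightarrow> C1c T"
proof -
 have "compact (closure {x. T x \<noteq> 0}) \<longleftrightarrow> (\<exists>R. \<forall>x. T x \<noteq> 0 \<longrightarrow> norm x < R)"
 proof -
  have "compact (closure {x. T x \<noteq> 0}) \<longleftrightarrow> bounded {x. T x \<noteq> 0}"
   by (meson bounded_closure bounded_subset closed_closure closure_subset compact_eq_bounded_closed)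
  also have "... \<longleftrightarrow> (\<exists>R. \<forall>x. T x \<noteq> 0 \<longrightarrow> norm x < R)"
   unfolding bounded_iff by (auto intro: less_imp_le) (meson gt_ex le_less_trans)
  finally show ?thesis .
 qed
 then show ?thesis
  unfolding C1_compactly_supported_def C1c_def differentiable_on_def by auto
qed

lemma C1c_continuous: "C1c \<phi> \<Longrightarrow> continuous_on UNIV \<phi>"
 by (meson C1c_has_derivative continuous_at_imp_continuous_on has_derivative_continuous)

lemma C1c_borel: "C1c (\<phi> :: real ^ 'n \<Rightarrow> 'b::{real_normed_vector, second_countable_topology}) \<Longrightarrow> \<phi> \<in> borel_measurable borel"
 by (simp add: C1c_continuous borel_measurable_continuous_onI)

lemma C1c_deriv_borel:
 fixes \<phi> :: "real ^ 'n \<Rightarrow> 'b::{real_normed_vector, second_countable_topology}"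
 shows "C1c \<phi> \<Longrightarrow> (\<lambda>x. frechet_derivative \<phi> (at x) v) \<in> borel_measurable borel"
 by (simp add: C1c_continuous_deriv borel_measurable_continuous_onI)

lemma C1c_deriv_zero_outside:
 assumes "C1c \<phi>" and R: "\<And>x. \<phi> x \<noteq> 0 \<Longrightarrow> norm x < R" and x: "norm x > R"
 shows "frechet_derivative \<phi> (at x) v = 0"
proof -
 have "open {y::real^'n. R < norm y}"
  by (intro open_Collect_less continuous_intros)
 moreover have "\<And>y. y \<in> {y. R < norm y} \<Longrightarrow> 0 = \<phi> y"
  using R by (metis less_asym mem_Collect_eq)
 moreover have "x \<in> {y. R < norm y}" using x by simp
 moreover have "((\<lambda>_. 0) has_derivative (\<lambda>_. 0)) (at x)" by simp
 ultimately have "(\<phi> has_derivative (\<lambda>_. 0)) (at x)"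
  using has_derivative_transform_within_open by blast
 then have "frechet_derivative \<phi> (at x) = (\<lambda>_. 0)"
  using frechet_derivative_at by metis
 then show ?thesis by simp
qed

lemma bounded_of_continuous_support:
 fixes h :: "real ^ 'n \<Rightarrow> 'b::real_normed_vector"
 assumes "continuous_on UNIV h" and "\<And>x. norm x > R \<Longrightarrow> h x = 0"
 obtains K where "K > 0" "\<And>x. norm (h x) \<le> K"
proof -
 have "compact (h ` cball 0 R)"
  using assms(1) by (intro compact_continuous_image) (auto intro: continuous_on_subset)
 then obtain K where K: "K > 0" "\<And>y. y \<in> h ` cball 0 R \<Longrightarrow> norm y \<le> K"
  using bounded_pos compact_imp_bounded by metis
 have "norm (h x) \<le> K" for x
 proof (cases "norm x > R")
  case True then show ?thesis using assms(2) K(1) by simp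
 next
  case False then show ?thesis using K(2)[of "h x"] by auto
 qed
 then show ?thesis using that K(1) by blast
qed

lemma C1c_bounded:
 assumes "C1c \<phi>" obtains K where "K > 0" "\<And>x. norm (\<phi> x) \<le> K"
proof -
 obtain R where R: "\<And>x. \<phi> x \<noteq> 0 \<Longrightarrow> norm x < R" using C1c_support[OF assms] by metis
 show ?thesis
  using bounded_of_continuous_support[OF C1c_continuous[OF assms], of R] R that by (metis less_asym)
qed

lemma C1c_deriv_bounded:
 assumes "C1c \<phi>" obtains K where "K > 0" "\<And>x. norm (frechet_derivative \<phi> (at x) v) \<le> K"
proof -
 obtain R where R: "\<And>x. \<phi> x \<noteq> 0 \<Longrightarrow> norm x < R" using C1c_support[OF assms] by metis
 show ?thesis
  using bounded_of_continuous_support[OF C1c_continuous_deriv[OF assms], of R]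
   C1c_deriv_zero_outside[OF assms R] that by metis
qed

lemma C1c_grad_bounded:
 fixes \<phi> :: "real ^ 'n \<Rightarrow> 'b::real_normed_vector"
 assumes "C1c \<phi>" obtains K where "K > 0" "\<And>x v. norm (frechet_derivative \<phi> (at x) v) \<le> K * norm v"
proof -
 have "\<exists>K. K > 0 \<and> (\<forall>x. norm (frechet_derivative \<phi> (at x) (axis i 1)) \<le> K)" for i
  using C1c_deriv_bounded[OF assms, of "axis i 1"] by metis
 then obtain K where K: "\<And>i. K i > 0" "\<And>i x. norm (frechet_derivative \<phi> (at x) (axis i 1)) \<le> K i"
  by metis
 have "norm (frechet_derivative \<phi> (at x) v) \<le> (\<Sum>i\<in>UNIV. K i) * norm v" for x v
 proof -
  have lin: "linear (frechet_derivative \<phi> (at x))"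
   using C1c_has_derivative[OF assms] has_derivative_linear by blast
  have "frechet_derivative \<phi> (at x) v = frechet_derivative \<phi> (at x) (\<Sum>i\<in>UNIV. (v $ i) *\<^sub>R axis i 1)"
   by (simp add: basis_expansion[of v, unfolded scalar_mult_eq_scaleR])
  also have "... = (\<Sum>i\<in>UNIV. (v $ i) *\<^sub>R frechet_derivative \<phi> (at x) (axis i 1))"
   by (simp add: linear_sum[OF lin] linear_scale[OF lin])
  also have "norm ... \<le> (\<Sum>i\<in>UNIV. K i * norm v)"
  proof (rule order_trans[OF norm_sum sum_mono])
   fix i
   show "norm ((v $ i) *\<^sub>R frechet_derivative \<phi> (at x) (axis i 1)) \<le> K i * norm v"
    using mult_mono[OF component_le_norm_cart[of v i] K(2)[of x i]]
    by (simp add: mult.commute)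
  qed
  finally show ?thesis by (simp add: sum_distrib_right)
 qed
 moreover have "(\<Sum>i\<in>UNIV. K i) > 0" using K(1) by (intro sum_pos) auto
 ultimately show ?thesis using that by blast
qed

lemma C1c_lipschitz:
 fixes \<phi> :: "real ^ 'n \<Rightarrow> real"
 assumes "C1c \<phi>" "\<And>x v. norm (frechet_derivative \<phi> (at x) v) \<le> K * norm v"
 shows "\<bar>\<phi> x - \<phi> y\<bar> \<le> K * norm (x - y)"
proof -
 have "norm (\<phi> x - \<phi> y) \<le> K * norm (x - y)"
 proof (rule differentiable_bound[of UNIV])
  show "(\<phi> has_derivative frechet_derivative \<phi> (at z)) (at z within UNIV)" for z
   using C1c_has_derivative[OF assms(1)] by simp
  show "onorm (frechet_derivative \<phi> (at z)) \<le> K" for z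
   by (rule onorm_le) (rule assms(2))
 qed auto
 then show ?thesis by simp
qed

lemma C1c_add:
 assumes "C1c \<phi>" "C1c \<psi>" shows "C1c (\<lambda>x. \<phi> x + \<psi> x)"
  "frechet_derivative (\<lambda>x. \<phi> x + \<psi> x) (at x) v = frechet_derivative \<phi> (at x) v + frechet_derivative \<psi> (at x) v"
proof -
 obtain R S where RS: "\<And>x. \<phi> x \<noteq> 0 \<Longrightarrow> norm x < R" "\<And>x. \<psi> x \<noteq> 0 \<Longrightarrow> norm x < S"
  using C1c_support assms by metis
 have *: "((\<lambda>x. \<phi> x + \<psi> x) has_derivative (\<lambda>v. frechet_derivative \<phi> (at x) v + frechet_derivative \<psi> (at x) v)) (at x)" for x
  by (intro has_derivative_add C1c_has_derivative assms)
 have s: "\<phi> x + \<psi> x \<noteq> 0 \<Longrightarrow> norm x < max R S" for x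
  using RS[of x] by (cases "\<phi> x = 0") (auto simp: less_max_iff_disj)
 show "C1c (\<lambda>x. \<phi> x + \<psi> x)"
  by (rule C1cI(1)[OF * _ s]) (intro continuous_intros C1c_continuous_deriv assms)+
 show "frechet_derivative (\<lambda>x. \<phi> x + \<psi> x) (at x) v = frechet_derivative \<phi> (at x) v + frechet_derivative \<psi> (at x) v"
  using frechet_derivative_at[OF *] by metis
qed

lemma C1c_scaleR_left:
 assumes "C1c \<phi>" shows "C1c (\<lambda>x. c *\<^sub>R \<phi> x)"
  "frechet_derivative (\<lambda>x. c *\<^sub>R \<phi> x) (at x) v = c *\<^sub>R frechet_derivative \<phi> (at x) v"
proof -
 obtain R where R: "\<And>x. \<phi> x \<noteq> 0 \<Longrightarrow> norm x < R" using C1c_support[OF assms] by metis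
 have *: "((\<lambda>x. c *\<^sub>R \<phi> x) has_derivative (\<lambda>v. c *\<^sub>R frechet_derivative \<phi> (at x) v)) (at x)" for x
  by (intro has_derivative_scaleR_right C1c_has_derivative assms)
 show "C1c (\<lambda>x. c *\<^sub>R \<phi> x)"
 proof (rule C1cI(1)[OF *])
  show "continuous_on UNIV (\<lambda>x. c *\<^sub>R frechet_derivative \<phi> (at x) v)" for v
   by (intro continuous_intros C1c_continuous_deriv assms)
  show "norm x < R" if "c *\<^sub>R \<phi> x \<noteq> 0" for x using R that by auto
 qed
 show "frechet_derivative (\<lambda>x. c *\<^sub>R \<phi> x) (at x) v = c *\<^sub>R frechet_derivative \<phi> (at x) v"
  using frechet_derivative_at[OF *] by metis
qed

lemma C1c_scaleR_C1:
 fixes \<phi> :: "real ^ 'n \<Rightarrow> real" and g :: "real ^ 'n \<Rightarrow> 'b::real_normed_vector"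
 assumes "C1c \<phi>" "\<And>x. (g has_derivative g' x) (at x)" "\<And>v. continuous_on UNIV (\<lambda>x. g' x v)"
 shows "C1c (\<lambda>x. \<phi> x *\<^sub>R g x)"
  "frechet_derivative (\<lambda>x. \<phi> x *\<^sub>R g x) (at x) v = \<phi> x *\<^sub>R g' x v + frechet_derivative \<phi> (at x) v *\<^sub>R g x"
proof -
 obtain R where R: "\<And>x. \<phi> x \<noteq> 0 \<Longrightarrow> norm x < R" using C1c_support[OF assms(1)] by metis
 have *: "((\<lambda>x. \<phi> x *\<^sub>R g x) has_derivative (\<lambda>v. \<phi> x *\<^sub>R g' x v + frechet_derivative \<phi> (at x) v *\<^sub>R g x)) (at x)" for x
  by (intro has_derivative_scaleR C1c_has_derivative assms)
 have g: "continuous_on UNIV g"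
  by (rule continuous_at_imp_continuous_on) (use assms(2) has_derivative_continuous in blast)
 show "C1c (\<lambda>x. \<phi> x *\<^sub>R g x)"
 proof (rule C1cI(1)[OF *])
  show "continuous_on UNIV (\<lambda>x. \<phi> x *\<^sub>R g' x v + frechet_derivative \<phi> (at x) v *\<^sub>R g x)" for v
   by (intro continuous_intros C1c_continuous_deriv C1c_continuous assms g)
  show "norm x < R" if "\<phi> x *\<^sub>R g x \<noteq> 0" for x using R that by auto
 qed
 show "frechet_derivative (\<lambda>x. \<phi> x *\<^sub>R g x) (at x) v = \<phi> x *\<^sub>R g' x v + frechet_derivative \<phi> (at x) v *\<^sub>R g x"
  using frechet_derivative_at[OF *] by metis
qed

lemma C1c_mult:
 fixes \<phi> \<psi> :: "real ^ 'n \<Rightarrow> real"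
 assumes "C1c \<phi>" "C1c \<psi>" shows "C1c (\<lambda>x. \<phi> x * \<psi> x)"
 using C1c_scaleR_C1(1)[OF assms(1) C1c_has_derivative[OF assms(2)] C1c_continuous_deriv[OF assms(2)]] by simp

lemma C1c_scaleR_const:
 fixes \<phi> :: "real ^ 'n \<Rightarrow> real"
 assumes "C1c \<phi>"
 shows "C1c (\<lambda>x. \<phi> x *\<^sub>R w)"
  "frechet_derivative (\<lambda>x. \<phi> x *\<^sub>R w) (at x) v = frechet_derivative \<phi> (at x) v *\<^sub>R w"
 using C1c_scaleR_C1[OF assms, of "\<lambda>_. w" "\<lambda>_ _. 0"] by auto

lemma C1c_component:
 fixes T :: "real ^ 'n \<Rightarrow> real ^ 'm"
 assumes "C1c T"
 shows "C1c (\<lambda>x. T x $ i)"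
  "frechet_derivative (\<lambda>x. T x $ i) (at x) v = frechet_derivative T (at x) v $ i"
proof -
 obtain R where R: "\<And>x. T x \<noteq> 0 \<Longrightarrow> norm x < R" using C1c_support[OF assms] by metis
 have *: "((\<lambda>x. T x $ i) has_derivative (\<lambda>v. frechet_derivative T (at x) v $ i)) (at x)" for x
  using bounded_linear.has_derivative[OF bounded_linear_vec_nth C1c_has_derivative[OF assms]] .
 show "C1c (\<lambda>x. T x $ i)"
 proof (rule C1cI(1)[OF *])
  show "continuous_on UNIV (\<lambda>x. frechet_derivative T (at x) v $ i)" for v
   by (intro continuous_intros C1c_continuous_deriv assms)
  show "norm x < R" if "T x $ i \<noteq> 0" for x using R that by (metis zero_index)
 qed
 show "frechet_derivative (\<lambda>x. T x $ i) (at x) v = frechet_derivative T (at x) v $ i"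
  using frechet_derivative_at[OF *] by metis
qed

lemma C1c_compose:
 fixes \<phi> :: "real ^ 'n \<Rightarrow> real" and h :: "real \<Rightarrow> real"
 assumes "C1c \<phi>" and h: "\<And>x. (h has_real_derivative h' (\<phi> x)) (at (\<phi> x))"
  and c: "continuous_on (range \<phi>) h'" and "h 0 = 0"
 shows "C1c (\<lambda>x. h (\<phi> x))"
  "frechet_derivative (\<lambda>x. h (\<phi> x)) (at x) v = h' (\<phi> x) * frechet_derivative \<phi> (at x) v"
proof -
 obtain R where R: "\<And>x. \<phi> x \<noteq> 0 \<Longrightarrow> norm x < R" using C1c_support[OF assms(1)] by metis
 have *: "((\<lambda>x. h (\<phi> x)) has_derivative (\<lambda>v. h' (\<phi> x) * frechet_derivative \<phi> (at x) v)) (at x)" for x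
  using has_derivative_compose[OF C1c_has_derivative[OF assms(1)] h[unfolded has_field_derivative_def]]
  by simp
 have c': "continuous_on UNIV (\<lambda>x. h' (\<phi> x))"
  by (rule continuous_on_compose2[OF c C1c_continuous[OF assms(1)]]) auto
 show "C1c (\<lambda>x. h (\<phi> x))"
 proof (rule C1cI(1)[OF *])
  show "continuous_on UNIV (\<lambda>x. h' (\<phi> x) * frechet_derivative \<phi> (at x) v)" for v
   by (intro continuous_intros C1c_continuous_deriv assms c')
  show "norm x < R" if "h (\<phi> x) \<noteq> 0" for x using R that \<open>h 0 = 0\<close> by metis
 qed
 show "frechet_derivative (\<lambda>x. h (\<phi> x)) (at x) v = h' (\<phi> x) * frechet_derivative \<phi> (at x) v"
  using frechet_derivative_at[OF *] by metis
qed

section \<open>Truncated polynomial bumps\<close>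

text \<open>The square makes the truncation at 0 continuously differentiable; both
  \<open>bump\<close> and the cut-off that removes the boundary rest on it.\<close>

lemma max_sq_has_real_derivative:
 "((\<lambda>t. (max 0 t)\<^sup>2) has_real_derivative 2 * max 0 t) (at (t::real))"
proof (cases "t = 0")
 case True
 have "((\<lambda>t::real. (max 0 t)\<^sup>2) has_real_derivative 0) (at 0)"
  unfolding has_field_derivative_iff
 proof (rule Lim_null_comparison[of _ "\<lambda>y::real. \<bar>y\<bar>"])
  show "\<forall>\<^sub>F y::real in at 0. norm (((max 0 y)\<^sup>2 - (max 0 0)\<^sup>2) / (y - 0)) \<le> \<bar>y\<bar>"
   by (auto intro!: always_eventually simp: max_def power2_eq_square)
  show "((\<lambda>y::real. \<bar>y\<bar>) \<longlongrightarrow> 0) (at 0)" by (intro tendsto_eq_intros) auto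
 qed
 then show ?thesis using True by simp
next
 case False
 show ?thesis
 proof (cases "t > 0")
  case True
  have "((\<lambda>t. t\<^sup>2) has_real_derivative 2 * max 0 t) (at t)"
   using True by (auto intro!: derivative_eq_intros)
  then show ?thesis
   by (rule has_field_derivative_transform_within_open[where S="{0<..}"]) (use True in auto)
 next
  case False
  have "((\<lambda>t::real. 0) has_real_derivative 2 * max 0 t) (at t)"
   using False by simp
  then show ?thesis
   by (rule has_field_derivative_transform_within_open[where S="{..<0}"]) (use False \<open>t \<noteq> 0\<close> in auto)
 qed
qed

text \<open>A truncated polynomial with explicit gradient, homogeneous of degree 4 in
  \<open>(s, z - y)\<close> jointly. It is not normalised: its maximum is \<open>s ^ 4\<close> and
  its integral scales like \<open>s ^ (CARD('n) + 4)\<close>, which is the origin of these powers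
  below.\<close>

definition bump :: "real \<Rightarrow> real ^ 'n \<Rightarrow> real ^ 'n \<Rightarrow> real" where
 "bump s y z = (max 0 (s\<^sup>2 - (norm (z - y))\<^sup>2))\<^sup>2"

lemma bump_nonneg: "bump s y z \<ge> 0" by (simp add: bump_def)

lemma bump_pos_iff: "s > 0 \<Longrightarrow> bump s y z > 0 \<longleftrightarrow> z \<in> ball y s"
 using power_strict_mono[of "norm (z - y)" s 2] power_mono[of s "norm (z - y)" 2]
 unfolding bump_def mem_ball dist_norm norm_minus_commute[of y z]
 by (cases "norm (z - y) < s") auto

lemma bump_le: "bump s y z \<le> s ^ 4"
proof -
 have "max 0 (s\<^sup>2 - (norm (z - y))\<^sup>2) \<le> s\<^sup>2" by simp
 then have "bump s y z \<le> (s\<^sup>2)\<^sup>2" unfolding bump_def by (intro power_mono) auto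
 then show ?thesis by (simp add: power_mult[symmetric])
qed

lemma bump_eq_0: "s > 0 \<Longrightarrow> z \<notin> ball y s \<Longrightarrow> bump s y z = 0"
 using bump_pos_iff bump_nonneg by (metis less_eq_real_def)

lemma bump_has_derivative:
 "(bump s y has_derivative (\<lambda>v. - 4 * max 0 (s\<^sup>2 - (norm (z - y))\<^sup>2) * ((z - y) \<bullet> v))) (at z)"
proof -
 have 1: "((\<lambda>z. s\<^sup>2 - (norm (z - y))\<^sup>2) has_derivative (\<lambda>v. - 2 * ((z - y) \<bullet> v))) (at z)"
  unfolding power2_norm_eq_inner
  by (auto intro!: derivative_eq_intros simp: inner_commute algebra_simps)
 show ?thesis
  using has_derivative_compose[OF 1 max_sq_has_real_derivative[unfolded has_field_derivative_def]]
  unfolding bump_def by (simp add: algebra_simps)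
qed

lemma C1c_bump:
 assumes "s > 0"
 shows "C1c (bump s y)"
  "frechet_derivative (bump s y) (at z) v = - 4 * max 0 (s\<^sup>2 - (norm (z - y))\<^sup>2) * ((z - y) \<bullet> v)"
proof -
 have *: "norm z < norm y + s" if "bump s y z \<noteq> 0" for z
 proof -
  have "z \<in> ball y s" using bump_eq_0[OF assms] that by blast
  then show ?thesis
   using norm_triangle_sub[of z y] by (simp add: dist_norm norm_minus_commute)
 qed
 show "C1c (bump s y)"
  by (rule C1cI(1)[OF bump_has_derivative _ *]) (intro continuous_intros)
 show "frechet_derivative (bump s y) (at z) v = - 4 * max 0 (s\<^sup>2 - (norm (z - y))\<^sup>2) * ((z - y) \<bullet> v)"
  using frechet_derivative_at[OF bump_has_derivative] by metis
qed

lemma integrable_bounded_support: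
 fixes h :: "real ^ 'n \<Rightarrow> 'b::{banach, second_countable_topology}"
 assumes "sets M = sets borel" "\<And>R. emeasure M (cball 0 R) < \<infinity>" "h \<in> borel_measurable borel"
  "\<And>x. norm (h x) \<le> K" "\<And>x. norm x > R \<Longrightarrow> h x = 0"
 shows "integrable M h"
proof -
 have [measurable_cong]: "sets M = sets borel" by fact
 have [measurable]: "h \<in> borel_measurable M" using assms(3) by simp
 have "cball 0 R \<in> sets M" by (simp add: assms(1))
 then have "integrable M (\<lambda>x. indicator (cball 0 R) x *\<^sub>R K)"
  using assms(2)[of R] by simp
 then show ?thesis
 proof (rule Bochner_Integration.integrable_bound)
  show "AE x in M. norm (h x) \<le> norm (indicator (cball 0 R) x *\<^sub>R K)"
   using assms(4,5) by (auto intro!: always_eventually simp: indicator_def) (meson abs_ge_self order_trans)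
 qed simp
qed

section \<open>Differentiation under the integral sign\<close>

text \<open>Dominated convergence for the difference quotients along sequences. The majorant is a
  Lipschitz bound in the parameter near \<open>t0\<close>; integrability of the derivative comes out
  as a conclusion.\<close>

lemma has_real_derivative_integral:
 fixes h :: "real \<Rightarrow> 'a \<Rightarrow> real"
 assumes int: "\<And>t. integrable L (h t)" and w: "integrable L w" and k: "k \<in> borel_measurable L"
  and lip: "\<And>t z. \<bar>t - t0\<bar> \<le> 1 \<Longrightarrow> \<bar>h t z - h t0 z\<bar> \<le> \<bar>t - t0\<bar> * w z"
  and der: "\<And>z. ((\<lambda>t. h t z) has_real_derivative k z) (at t0)"
 shows "integrable L k" "((\<lambda>t. LINT z|L. h t z) has_real_derivative (LINT z|L. k z)) (at t0)"
proof -
 let ?q = "\<lambda>t z. (h t z - h t0 z) / (t - t0)"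
 have dom: "integrable L k \<and> (\<lambda>i. LINT z|L. ?q (X i) z) \<longlonglongrightarrow> (LINT z|L. k z)"
  if X: "\<And>i :: nat. X i \<noteq> t0" "\<And>i. \<bar>X i - t0\<bar> \<le> 1" "X \<longlonglongrightarrow> t0" for X
 proof -
  have m: "?q (X i) \<in> borel_measurable L" for i
   using borel_measurable_integrable[OF int] by measurable
  have lim: "AE z in L. (\<lambda>i. ?q (X i) z) \<longlonglongrightarrow> k z"
  proof (intro always_eventually allI)
   fix z
   have "filterlim X (at t0) sequentially"
    using X(1,3) by (intro filterlim_atI) auto
   from filterlim_compose[OF der[of z, unfolded has_field_derivative_iff] this]
   show "(\<lambda>i. ?q (X i) z) \<longlonglongrightarrow> k z" .
  qed
  have bd: "AE z in L. norm (?q (X i) z) \<le> w z" for i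
   using lip[OF X(2)[of i]] X(1)[of i] by (intro always_eventually allI) (simp add: abs_divide divide_le_eq mult.commute)
  show ?thesis
   using integrable_dominated_convergence[OF k m w lim bd] integral_dominated_convergence[OF k m w lim bd] by blast
 qed
 have "(\<lambda>i. t0 + 1 / real (Suc i)) \<longlonglongrightarrow> t0 + 0" by (intro tendsto_intros lim_1_over_n[THEN LIMSEQ_Suc])
 then show "integrable L k" using dom[of "\<lambda>i. t0 + 1 / real (Suc i)"] by simp
 show "((\<lambda>t. LINT z|L. h t z) has_real_derivative (LINT z|L. k z)) (at t0)"
  unfolding has_field_derivative_iff tendsto_at_iff_sequentially comp_def
 proof (intro allI impI)
  fix X :: "nat \<Rightarrow> real" assume X: "\<forall>i. X i \<in> UNIV - {t0}" "X \<longlonglongrightarrow> t0"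
  have "\<forall>\<^sub>F i in sequentially. dist (X i) t0 < 1" by (rule tendstoD[OF X(2)]) simp
  then obtain N where N: "\<And>i. i \<ge> N \<Longrightarrow> dist (X i) t0 < 1" unfolding eventually_sequentially by blast
  \<comment> \<open>The shift by \<open>N\<close> brings all terms within distance 1 of
    \<open>t0\<close>, where the Lipschitz bound is available.\<close>
  have lim: "(\<lambda>i. LINT z|L. ?q (X (i + N)) z) \<longlonglongrightarrow> (LINT z|L. k z)"
   using X N LIMSEQ_ignore_initial_segment[OF X(2), of N] by (intro conjunct2[OF dom]) (auto simp: dist_real_def less_imp_le)
  have eq: "(LINT z|L. ?q t z) = ((LINT z|L. h t z) - (LINT z|L. h t0 z)) / (t - t0)" for t
   using int by simp
  show "(\<lambda>i. ((LINT z|L. h (X i) z) - (LINT z|L. h t0 z)) / (X i - t0)) \<longlonglongrightarrow> (LINT z|L. k z)"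
   by (rule LIMSEQ_offset[OF lim[unfolded eq]])
 qed
qed

text \<open>All translates with \<open>\<bar>t\<bar> \<le> 1\<close> live in the ball of radius
  \<open>R + norm v\<close>, which supplies the majorant. The set \<open>X\<close> is general: the
  whole space gives \<open>integral_deriv_C1c_eq_0\<close>, the set \<open>Eb\<close> the derivative
  of the mollified indicator.\<close>

lemma translation_derivative:
 fixes \<phi> :: "real ^ 'n \<Rightarrow> real"
 assumes \<phi>: "C1c \<phi>" and X: "X \<in> sets borel"
 shows "((\<lambda>t. LINT x|lborel. indicator X x * \<phi> (x + t *\<^sub>R v)) has_real_derivative
  (LINT x|lborel. indicator X x * frechet_derivative \<phi> (at x) v)) (at 0)"
proof -
 obtain R where R: "R > 0" "\<And>x. \<phi> x \<noteq> 0 \<Longrightarrow> norm x < R" using C1c_support[OF \<phi>] by metis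
 obtain K where K: "K > 0" "\<And>x v. norm (frechet_derivative \<phi> (at x) v) \<le> K * norm v"
  using C1c_grad_bounded[OF \<phi>] by metis
 obtain L where L: "\<And>x. norm (\<phi> x) \<le> L" using C1c_bounded[OF \<phi>] by metis
 have fin: "emeasure lborel (cball 0 R :: (real^'n) set) < \<infinity>" for R
  using emeasure_lborel_cball_finite[of 0 R] by (simp add: less_top)
 have out: "\<phi> (x + y) = 0" if "R + norm y < norm x" for x y
 proof -
  have "norm x \<le> norm (x + y) + norm y" using norm_triangle_ineq4[of "x + y" y] by simp
  then show ?thesis using that R(2)[of "x + y"] by linarith
 qed
 show ?thesis
 proof (rule has_real_derivative_integral(2)[where w="\<lambda>x. K * norm v * indicator (cball 0 (R + norm v)) x"])
  fix t
  show "integrable lborel (\<lambda>x. indicator X x * \<phi> (x + t *\<^sub>R v))"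
  proof (rule integrable_bounded_support[OF _ fin])
   have "(\<lambda>x. \<phi> (x + t *\<^sub>R v)) \<in> borel_measurable borel"
    by (intro borel_measurable_continuous_onI continuous_on_compose2[OF C1c_continuous[OF \<phi>]] continuous_intros) auto
   then show "(\<lambda>x. indicator X x * \<phi> (x + t *\<^sub>R v)) \<in> borel_measurable borel" using X by measurable
   show "norm (indicator X x * \<phi> (x + t *\<^sub>R v)) \<le> L" for x
    using L[of "x + t *\<^sub>R v"] order_trans[OF norm_ge_zero L] by (simp add: indicator_def)
   show "indicator X x * \<phi> (x + t *\<^sub>R v) = 0" if "R + norm (t *\<^sub>R v) < norm x" for x using out[OF that] by simp
  qed simp
 next
  show "integrable lborel (\<lambda>x::real^'n. K * norm v * indicator (cball 0 (R + norm v)) x)"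
   using fin by (intro integrable_mult_right integrable_real_indicator) auto
  show "(\<lambda>x. indicator X x * frechet_derivative \<phi> (at x) v) \<in> borel_measurable lborel"
   using C1c_deriv_borel[OF \<phi>] X by measurable
 next
  fix t :: real and x assume "\<bar>t - 0\<bar> \<le> 1"
  then have t: "norm (t *\<^sub>R v) \<le> norm v" by (simp add: mult_left_le_one_le)
  show "\<bar>indicator X x * \<phi> (x + t *\<^sub>R v) - indicator X x * \<phi> (x + 0 *\<^sub>R v)\<bar>
    \<le> \<bar>t - 0\<bar> * (K * norm v * indicator (cball 0 (R + norm v)) x)"
  proof (cases "norm x \<le> R + norm v")
   case True
   have "\<bar>\<phi> (x + t *\<^sub>R v) - \<phi> x\<bar> \<le> K * norm ((x + t *\<^sub>R v) - x)" by (rule C1c_lipschitz[OF \<phi> K(2)])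
   then show ?thesis using True by (cases "x \<in> X") (simp_all add: mult_ac K(1) less_imp_le)
  next
   case False
   then have "R + norm (t *\<^sub>R v) < norm x" "R < norm x" using t norm_ge_zero[of v] by linarith+
   then show ?thesis using out[of "t *\<^sub>R v" x] out[of 0 x] K(1) by simp
  qed
 next
  fix x
  have 1: "((\<lambda>t. x + t *\<^sub>R v) has_derivative (\<lambda>t. t *\<^sub>R v)) (at 0)" by (auto intro!: derivative_eq_intros)
  have 2: "(\<phi> has_derivative frechet_derivative \<phi> (at x)) (at (x + 0 *\<^sub>R v))" using C1c_has_derivative[OF \<phi>] by simp
  have "linear (frechet_derivative \<phi> (at x))" using C1c_has_derivative[OF \<phi>] has_derivative_linear by blast
  then have "((\<lambda>t. \<phi> (x + t *\<^sub>R v)) has_real_derivative frechet_derivative \<phi> (at x) v) (at 0)"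
   using has_derivative_compose[OF 1 2] unfolding has_field_derivative_def
   by (simp add: linear_scale mult.commute[of _ "frechet_derivative \<phi> (at x) v"])
  then show "((\<lambda>t. indicator X x * \<phi> (x + t *\<^sub>R v)) has_real_derivative indicator X x * frechet_derivative \<phi> (at x) v) (at 0)"
   by (rule DERIV_cmult)
 qed
qed

text \<open>Translation invariance makes the integral of the translates constant in
  \<open>t\<close>, so its derivative at 0 vanishes.\<close>

lemma integral_deriv_C1c_eq_0:
 fixes \<phi> :: "real ^ 'n \<Rightarrow> real"
 assumes "C1c \<phi>"
 shows "(LINT x|lborel. frechet_derivative \<phi> (at x) v) = 0"
proof -
 have "(LINT x|lborel. \<phi> (x + t *\<^sub>R v)) = (LINT x|distr lborel borel (\<lambda>x. t *\<^sub>R v + x). \<phi> x)" for t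
  by (subst integral_distr) (auto simp: C1c_borel[OF assms] add.commute)
 then have "((\<lambda>t. LINT x|lborel. \<phi> (x + t *\<^sub>R v)) has_real_derivative 0) (at 0)"
  by (simp add: lborel_distr_plus)
 moreover have "((\<lambda>t. LINT x|lborel. \<phi> (x + t *\<^sub>R v)) has_real_derivative (LINT x|lborel. frechet_derivative \<phi> (at x) v)) (at 0)"
  using translation_derivative[OF assms, of UNIV v] by simp
 ultimately show ?thesis by (rule DERIV_unique[symmetric])
qed

section \<open>Signed Radon measures\<close>

definition signed_radon :: "((real ^ 'n) set \<Rightarrow> real) \<Rightarrow> bool" where
 "signed_radon \<nu> \<longleftrightarrow>
   (\<forall>A :: nat \<Rightarrow> (real ^ 'n) set.
    range A \<subseteq> sets borel \<and> disjoint_family A \<and> bounded (\<Union>i. A i) \<longrightarrow>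
     (\<lambda>i. \<nu> (A i)) sums \<nu> (\<Union>i. A i))"

lemma signed_radon_sums:
 assumes "signed_radon \<nu>" "\<And>i::nat. A i \<in> sets borel" "disjoint_family A" "bounded (\<Union>i. A i)"
 shows "(\<lambda>i. \<nu> (A i)) sums \<nu> (\<Union>i. A i)"
 using assms unfolding signed_radon_def by (simp add: image_subset_iff)

lemma signed_radon_component: "vector_radon_measure \<mu> \<Longrightarrow> signed_radon (\<lambda>A. \<mu> A $ i)"
 unfolding vector_radon_measure_def signed_radon_def
 using bounded_linear.sums[OF bounded_linear_vec_nth] by blast

lemma signed_radon_uminus: "signed_radon \<nu> \<Longrightarrow> signed_radon (\<lambda>A. - \<nu> A)"
 unfolding signed_radon_def using sums_minus by blast

lemma signed_radon_empty: "signed_radon \<nu> \<Longrightarrow> \<nu> {} = 0"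
 using signed_radon_sums[of \<nu> "\<lambda>_. {}"]
 by (auto simp: disjoint_family_on_def sums_iff summable_const_iff)

lemma disjoint_family_binaryset: "A \<inter> B = {} \<Longrightarrow> disjoint_family (binaryset A B)"
 by (auto simp: disjoint_family_on_def binaryset_def)

lemma signed_radon_Un:
 assumes "signed_radon \<nu>" "A \<in> sets borel" "B \<in> sets borel" "bounded A" "bounded B" "A \<inter> B = {}"
 shows "\<nu> (A \<union> B) = \<nu> A + \<nu> B"
proof -
 have "(\<lambda>i. \<nu> (binaryset A B i)) sums \<nu> (\<Union>i. binaryset A B i)"
 proof (rule signed_radon_sums[OF assms(1)])
  show "binaryset A B i \<in> sets borel" for i using assms by (simp add: binaryset_def)
  show "bounded (\<Union>i. binaryset A B i)" using assms by (simp add: UN_binaryset_eq)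
 qed (rule disjoint_family_binaryset[OF assms(6)])
 moreover have "(\<lambda>i. \<nu> (binaryset A B i)) sums (\<nu> A + \<nu> B)"
  by (rule binaryset_sums) (rule signed_radon_empty[OF assms(1)])
 ultimately show ?thesis using sums_unique2 by (fastforce simp: UN_binaryset_eq)
qed

lemma signed_radon_Diff:
 assumes "signed_radon \<nu>" "A \<in> sets borel" "B \<in> sets borel" "bounded A" "B \<subseteq> A"
 shows "\<nu> (A - B) = \<nu> A - \<nu> B"
proof -
 have "\<nu> (B \<union> (A - B)) = \<nu> B + \<nu> (A - B)"
  using assms by (intro signed_radon_Un) (auto intro: bounded_subset)
 then show ?thesis using assms(5) by (simp add: Un_absorb1)
qed

lemma ennreal_sums_le:
 assumes "a sums s" shows "ennreal s \<le> (\<Sum>i::nat. ennreal (a i))"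
proof -
 have "(\<lambda>n. ennreal (\<Sum>i<n. a i)) \<longlonglongrightarrow> ennreal s"
  using assms unfolding sums_def by (rule tendsto_ennrealI)
 moreover have "ennreal (\<Sum>i<n. a i) \<le> (\<Sum>i. ennreal (a i))" for n
 proof -
  have "ennreal (\<Sum>i<n. a i) \<le> ennreal (\<Sum>i<n. max 0 (a i))"
   by (intro ennreal_leI sum_mono) auto
  also have "... = (\<Sum>i<n. ennreal (max 0 (a i)))"
   by (rule sum_ennreal[symmetric]) auto
  also have "... = (\<Sum>i<n. ennreal (a i))"
   by (intro sum.cong refl) (auto simp: max_def ennreal_neg)
  also have "... \<le> (\<Sum>i. ennreal (a i))"
   by (intro sum_le_suminf) auto
  finally show ?thesis .
 qed
 ultimately show ?thesis by (intro LIMSEQ_le_const2) auto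
qed

text \<open>\<open>measure_of\<close> returns the supremum only once that is countably additive.
  Superadditivity on disjoint sets comes from joining two test sets, countable subadditivity from
  cutting one test set along the pieces.\<close>

lemma emeasure_positive_variation:
 fixes \<nu> :: "(real ^ 'n) set \<Rightarrow> real"
 assumes \<nu>: "signed_radon \<nu>" and A: "A \<in> sets borel"
 shows "emeasure (positive_variation \<nu>) A =
   (SUP B \<in> {B. B \<in> sets borel \<and> bounded B \<and> B \<subseteq> A}. ennreal (\<nu> B))"
proof -
 define P :: "(real ^ 'n) set \<Rightarrow> ennreal" where "P A = (SUP B \<in> {B. B \<in> sets borel \<and> bounded B \<and> B \<subseteq> A}. ennreal (\<nu> B))" for A
 have upper: "ennreal (\<nu> B) \<le> P A" if "B \<in> sets borel" "bounded B" "B \<subseteq> A" for A B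
  unfolding P_def using that by (intro SUP_upper) auto
 have mono: "P A \<le> P B" if "A \<subseteq> B" for A B
  unfolding P_def using that by (intro SUP_subset_mono) auto
 have super: "P A + P C \<le> P (A \<union> C)" if "A \<inter> C = {}" for A C
 proof -
  have 1: "ennreal (\<nu> B) + ennreal (\<nu> D) \<le> P (A \<union> C)"
   if "B \<in> sets borel" "bounded B" "B \<subseteq> A" "D \<in> sets borel" "bounded D" "D \<subseteq> C" for B D
  proof (cases "\<nu> B \<ge> 0 \<and> \<nu> D \<ge> 0")
   case True
   have "\<nu> (B \<union> D) = \<nu> B + \<nu> D"
    using that \<open>A \<inter> C = {}\<close> by (intro signed_radon_Un[OF \<nu>]) auto
   then have "ennreal (\<nu> B) + ennreal (\<nu> D) = ennreal (\<nu> (B \<union> D))" using True by simp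
   also have "... \<le> P (A \<union> C)" using that by (intro upper) auto
   finally show ?thesis .
  next
   \<comment> \<open>A negative value is turned into 0 by \<open>ennreal\<close>, so the other test
     set alone suffices.\<close>
   case False
   then consider "ennreal (\<nu> B) = 0" | "ennreal (\<nu> D) = 0" using ennreal_neg by (metis linear)
   then show ?thesis
   proof cases
    case 1
    then show ?thesis using upper[of D "A \<union> C"] that by auto
   next
    case 2
    then show ?thesis using upper[of B "A \<union> C"] that by auto
   qed
  qed
  have ne: "{B. B \<in> sets borel \<and> bounded B \<and> B \<subseteq> X} \<noteq> {}" for X :: "(real ^ 'n) set"
   by (auto intro!: exI[of _ "{}"])
  have 2: "P A + ennreal (\<nu> D) \<le> P (A \<union> C)" if "D \<in> sets borel" "bounded D" "D \<subseteq> C" for D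
  proof -
   have "P A + ennreal (\<nu> D) = (SUP B \<in> {B. B \<in> sets borel \<and> bounded B \<and> B \<subseteq> A}. ennreal (\<nu> B) + ennreal (\<nu> D))"
    unfolding P_def by (rule ennreal_SUP_add_left[OF ne, symmetric])
   also have "... \<le> P (A \<union> C)" using that by (intro SUP_least 1) auto
   finally show ?thesis .
  qed
  have "P A + P C = (SUP D \<in> {B. B \<in> sets borel \<and> bounded B \<and> B \<subseteq> C}. P A + ennreal (\<nu> D))"
   unfolding P_def[of C] by (rule ennreal_SUP_add_right[OF ne])
  also have "... \<le> P (A \<union> C)" by (intro SUP_least 2) auto
  finally show ?thesis .
 qed
 have P0: "P {} = 0"
  unfolding P_def using signed_radon_empty[OF \<nu>] by (auto intro!: antisym SUP_least)
 show ?thesis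
  unfolding P_def[symmetric]
 proof (rule emeasure_measure_of[of _ UNIV "sets borel"])
  show "positive_variation \<nu> = measure_of UNIV (sets borel) P"
   unfolding positive_variation_def P_def ..
  have s: "sets (positive_variation \<nu>) = sets borel"
   unfolding positive_variation_def using sets.sigma_sets_eq[of borel] by (simp add: sets_measure_of_conv)
  show "A \<in> sets (positive_variation \<nu>)" using A s by simp
  show "positive (sets (positive_variation \<nu>)) P" by (simp add: positive_def P0)
  show "countably_additive (sets (positive_variation \<nu>)) P"
   unfolding countably_additive_def s
  proof (intro allI impI antisym)
   fix F :: "nat \<Rightarrow> (real ^ 'n) set"
   assume F: "range F \<subseteq> sets borel" "disjoint_family F"
   have FB: "F i \<in> sets borel" for i using F(1) by auto
   show "(\<Sum>i. P (F i)) \<le> P (\<Union>i. F i)"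
   proof (rule suminf_le_const)
    fix n
    have "(\<Sum>i<n. P (F i)) \<le> P (\<Union>i<n. F i)"
    proof (induction n)
     case 0 then show ?case by (simp add: P0)
    next
     case (Suc n)
     have "(\<Sum>i<Suc n. P (F i)) \<le> P (\<Union>i<n. F i) + P (F n)"
      using Suc by (simp add: add_mono)
     also have "... \<le> P ((\<Union>i<n. F i) \<union> F n)"
     proof (rule super)
      have "F i \<inter> F n = {}" if "i < n" for i
       by (rule disjoint_family_onD[OF F(2)]) (use that in auto)
      then show "(\<Union>i<n. F i) \<inter> F n = {}" by blast
     qed
     finally show ?case by (simp add: lessThan_Suc Un_commute)
    qed
    also have "... \<le> P (\<Union>i. F i)" by (intro mono) auto
    finally show "(\<Sum>i<n. P (F i)) \<le> P (\<Union>i. F i)" .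
   qed simp
   show "P (\<Union>i. F i) \<le> (\<Sum>i. P (F i))"
    unfolding P_def[of "\<Union>i. F i"]
   proof (rule SUP_least)
    fix B assume "B \<in> {B. B \<in> sets borel \<and> bounded B \<and> B \<subseteq> (\<Union>i. F i)}"
    then have B: "B \<in> sets borel" "bounded B" "B \<subseteq> (\<Union>i. F i)" by auto
    have eq: "(\<Union>i. B \<inter> F i) = B" using B(3) by auto
    have "(\<lambda>i. \<nu> (B \<inter> F i)) sums \<nu> (\<Union>i. B \<inter> F i)"
    proof (rule signed_radon_sums[OF \<nu>])
     show "B \<inter> F i \<in> sets borel" for i using B FB by auto
     show "disjoint_family (\<lambda>i. B \<inter> F i)" using F(2) by (auto simp: disjoint_family_on_def)
     show "bounded (\<Union>i. B \<inter> F i)" using eq B by simp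
    qed
    then have "ennreal (\<nu> B) \<le> (\<Sum>i. ennreal (\<nu> (B \<inter> F i)))"
     unfolding eq by (rule ennreal_sums_le)
    also have "... \<le> (\<Sum>i. P (F i))"
    proof (intro suminf_le upper)
     show "B \<inter> F i \<in> sets borel" for i using B FB by auto
     show "bounded (B \<inter> F i)" for i using B(2) by (rule bounded_subset) auto
    qed auto
    finally show "ennreal (\<nu> B) \<le> (\<Sum>i. P (F i))" .
   qed
  qed
 qed simp
qed

lemma sets_positive_variation [simp, measurable_cong]: "sets (positive_variation \<nu>) = sets borel"
 unfolding positive_variation_def using sets.sigma_sets_eq[of borel] by (simp add: sets_measure_of_conv)

lemma space_positive_variation [simp]: "space (positive_variation \<nu>) = UNIV"
 unfolding positive_variation_def by (simp add: space_measure_of_conv)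

text \<open>If a bounded set had infinite positive variation, one could split off infinitely many disjoint
 pieces of mass at least \<open>1\<close> in absolute value.\<close>

lemma positive_variation_finite:
 assumes \<nu>: "signed_radon \<nu>" and K: "K \<in> sets borel" "bounded K"
 shows "emeasure (positive_variation \<nu>) K < \<infinity>"
proof (rule ccontr)
 let ?V = "emeasure (positive_variation \<nu>)"
 let ?bad = "\<lambda>A. A \<in> sets borel \<and> A \<subseteq> K \<and> ?V A = \<infinity>"
 assume "\<not> ?V K < \<infinity>"
 then have K': "?bad K" using K by (simp add: less_top[symmetric])
 have step: "\<exists>A'. ?bad A' \<and> A' \<subseteq> A \<and> 1 \<le> \<bar>\<nu> (A - A')\<bar>" if A: "?bad A" for A
 proof -
  have bA: "bounded A" using A K(2) bounded_subset by blast
  \<comment> \<open>The surplus over \<open>\<bar>\<nu> A\<bar>\<close> guarantees that both \<nu> B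
    and \<nu> (A - B) have absolute value at least 1. Whichever of the two sets has infinite
    variation is kept, the other one is split off.\<close>
  have "ennreal (\<bar>\<nu> A\<bar> + 1) < ?V A" using A by simp
  then obtain B where B: "B \<in> sets borel" "bounded B" "B \<subseteq> A" "ennreal (\<bar>\<nu> A\<bar> + 1) < ennreal (\<nu> B)"
   using A unfolding emeasure_positive_variation[OF \<nu> conjunct1[OF A]] less_SUP_iff by blast
  then have B1: "\<bar>\<nu> A\<bar> + 1 < \<nu> B" by (subst (asm) ennreal_less_iff) auto
  have AB: "\<nu> (A - B) = \<nu> A - \<nu> B"
   using A B bA by (intro signed_radon_Diff[OF \<nu>]) auto
  have "?V B + ?V (A - B) = ?V (B \<union> (A - B))"
   using A B by (intro plus_emeasure) auto
  also have "B \<union> (A - B) = A" using B by auto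
  finally have "?V B = \<infinity> \<or> ?V (A - B) = \<infinity>" using A by auto
  then show ?thesis
  proof
   assume "?V B = \<infinity>"
   then show ?thesis using A B AB B1 by (intro exI[of _ B]) auto
  next
   assume 2: "?V (A - B) = \<infinity>"
   have "A - (A - B) = B" using B by auto
   then show ?thesis using 2 A B B1 by (intro exI[of _ "A - B"]) auto
  qed
 qed
 have "\<exists>F. \<forall>n. ?bad (F n) \<and> (F (Suc n) \<subseteq> F n \<and> 1 \<le> \<bar>\<nu> (F n - F (Suc n))\<bar>)"
 proof (rule dependent_nat_choice)
  show "\<exists>A. ?bad A" using K' by (rule exI)
  show "\<exists>A'. ?bad A' \<and> A' \<subseteq> A \<and> 1 \<le> \<bar>\<nu> (A - A')\<bar>" if "?bad A" for A
   by (rule step[OF that])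
 qed
 then obtain F where F: "\<And>n. ?bad (F n)" "\<And>n. F (Suc n) \<subseteq> F n \<and> 1 \<le> \<bar>\<nu> (F n - F (Suc n))\<bar>"
  by (elim exE) metis
 have dec: "decseq F" using F(2) by (simp add: decseq_Suc_iff)
 have disj: "disjoint_family (\<lambda>n. F n - F (Suc n))"
 proof -
  have "(F m - F (Suc m)) \<inter> (F n - F (Suc n)) = {}" if "m < n" for m n
   using decseqD[OF dec, of "Suc m" n] that by auto
  then show ?thesis unfolding disjoint_family_on_def by (metis Int_commute nat_neq_iff)
 qed
 have "(\<lambda>n. \<nu> (F n - F (Suc n))) sums \<nu> (\<Union>n. F n - F (Suc n))"
 proof (rule signed_radon_sums[OF \<nu> _ disj])
  show "F n - F (Suc n) \<in> sets borel" for n using F(1) by auto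
  show "bounded (\<Union>n. F n - F (Suc n))"
   by (rule bounded_subset[OF K(2)]) (use F(1) in auto)
 qed
 then have "(\<lambda>n. \<nu> (F n - F (Suc n))) \<longlonglongrightarrow> 0"
  using sums_summable summable_LIMSEQ_zero by blast
 then have "\<forall>\<^sub>F n in sequentially. \<bar>\<nu> (F n - F (Suc n))\<bar> < 1"
  by (drule_tac tendstoD[of _ 0 sequentially 1]) (simp_all add: dist_real_def)
 then obtain n where "\<bar>\<nu> (F n - F (Suc n))\<bar> < 1"
  by (auto simp: eventually_sequentially)
 then show False using F(2)[of n] by simp
qed

text \<open>For a test set \<open>B\<close> in \<open>A\<close>, additivity gives \<nu> B = \<nu> A
  - \<nu> (A - B), and - \<nu> (A - B) is at most the negative variation of \<open>A\<close>. This
  is one inequality; the same argument for -\<nu> is the other.\<close>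

lemma jordan_decomposition:
 assumes \<nu>: "signed_radon \<nu>" and A: "A \<in> sets borel" "bounded A"
 shows "\<nu> A = measure (positive_variation \<nu>) A - measure (positive_variation (\<lambda>A. - \<nu> A)) A"
proof -
 have one: "measure (positive_variation \<nu>) A \<le> \<nu> A + measure (positive_variation (\<lambda>A. - \<nu> A)) A"
  if \<nu>: "signed_radon \<nu>" for \<nu>
 proof -
  let ?q = "measure (positive_variation (\<lambda>A. - \<nu> A)) A"
  have fin: "emeasure (positive_variation (\<lambda>A. - \<nu> A)) A = ennreal ?q"
   using positive_variation_finite[OF signed_radon_uminus[OF \<nu>] A] by (simp add: emeasure_eq_ennreal_measure less_top)
  have le: "- \<nu> B \<le> ?q" if "B \<in> sets borel" "B \<subseteq> A" for B
  proof -
   have "ennreal (- \<nu> B) \<le> ennreal ?q"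
    unfolding fin[symmetric] emeasure_positive_variation[OF signed_radon_uminus[OF \<nu>] A(1)]
    using that A bounded_subset[OF A(2)] by (auto intro!: SUP_upper)
   then show ?thesis by (simp add: ennreal_le_iff)
  qed
  have "emeasure (positive_variation \<nu>) A \<le> ennreal (\<nu> A + ?q)"
   unfolding emeasure_positive_variation[OF \<nu> A(1)]
  proof (rule SUP_least, rule ennreal_leI)
   fix B assume "B \<in> {B. B \<in> sets borel \<and> bounded B \<and> B \<subseteq> A}"
   then have B: "B \<in> sets borel" "B \<subseteq> A" by auto
   show "\<nu> B \<le> \<nu> A + ?q"
    using le[of "A - B"] B A signed_radon_Diff[OF \<nu> A(1) B(1) A(2) B(2)] by auto
  qed
  moreover have "\<nu> A + ?q \<ge> 0" using le[of A] A by auto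
  ultimately show ?thesis
   unfolding measure_def by (rule enn2real_leI[rotated])
 qed
 show ?thesis using one[OF \<nu>] one[OF signed_radon_uminus[OF \<nu>]] by simp
qed

section \<open>Densities with respect to a Radon measure\<close>

lemma bounded_subset_cball_0:
 fixes A :: "'a::real_normed_vector set"
 assumes "bounded A" obtains R where "A \<subseteq> cball 0 R"
 using assms that by (metis bounded_iff mem_cball_0 subsetI)

lemma borel_measurable_nth_vec: "(\<lambda>x::real ^ 'm. x $ i) \<in> borel_measurable borel"
 by (intro borel_measurable_continuous_onI continuous_intros)

text \<open>Serves Lebesgue measure, Hausdorff measure restricted to a boundary, and positive
  variations alike.\<close>

locale borel_radon =
 fixes \<sigma> :: "(real ^ 'n) measure"
 assumes sets_eq [simp, measurable_cong]: "sets \<sigma> = sets borel"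
  and finite_cball: "\<And>R. emeasure \<sigma> (cball 0 R) < \<infinity>"
begin

lemma space_eq [simp]: "space \<sigma> = UNIV"
 using sets_eq_imp_space_eq[OF sets_eq] by simp

lemma finite_bounded:
 assumes "bounded A" shows "emeasure \<sigma> A < \<infinity>"
proof -
 obtain R where "A \<subseteq> cball 0 R" using assms bounded_subset_cball_0 by blast
 then have "emeasure \<sigma> A \<le> emeasure \<sigma> (cball 0 R)"
  by (intro emeasure_mono) auto
 then show ?thesis using finite_cball by (rule le_less_trans)
qed

lemma emeasure_eq_measure_bounded: "bounded A \<Longrightarrow> emeasure \<sigma> A = ennreal (measure \<sigma> A)"
 using finite_bounded[of A] by (simp add: emeasure_eq_ennreal_measure less_top[symmetric])

lemma fmeasurable_bounded: "A \<in> sets borel \<Longrightarrow> bounded A \<Longrightarrow> A \<in> fmeasurable \<sigma>"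
 using finite_bounded by (intro fmeasurableI) auto

lemma measure_mono_bounded: "A \<subseteq> B \<Longrightarrow> A \<in> sets borel \<Longrightarrow> B \<in> sets borel \<Longrightarrow> bounded B \<Longrightarrow> measure \<sigma> A \<le> measure \<sigma> B"
 by (intro measure_mono_fmeasurable fmeasurable_bounded) auto

lemma UN_cball: "(\<Union>k::nat. cball (0::real^'n) (real k)) = UNIV"
 using real_arch_simple by (auto simp: dist_norm)

lemma sigma_finite: "sigma_finite_measure \<sigma>"
proof
 show "\<exists>A. countable A \<and> A \<subseteq> sets \<sigma> \<and> \<Union> A = space \<sigma> \<and> (\<forall>a\<in>A. emeasure \<sigma> a \<noteq> \<infinity>)"
  using UN_cball finite_cball by (intro exI[of _ "range (\<lambda>k::nat. cball 0 (real k))"]) (auto simp: less_top)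
qed

sublocale sigma_finite_measure \<sigma> by (rule sigma_finite)

lemma integrable_bdd:
 fixes h :: "real ^ 'n \<Rightarrow> 'b::{banach, second_countable_topology}"
 assumes "h \<in> borel_measurable borel" "\<And>x. norm (h x) \<le> K" "\<And>x. norm x > R \<Longrightarrow> h x = 0"
 shows "integrable \<sigma> h"
 using integrable_bounded_support[OF sets_eq finite_cball] assms by blast

lemma set_integrable_bdd:
 fixes h :: "real ^ 'n \<Rightarrow> 'b::{banach, second_countable_topology}"
 assumes "h \<in> borel_measurable borel" "A \<in> sets borel" "bounded A" "\<And>x. norm (h x) \<le> K"
 shows "set_integrable \<sigma> A h"
proof -
 obtain R where "A \<subseteq> cball 0 R" using assms bounded_subset_cball_0 by blast
 then show ?thesis
  unfolding set_integrable_def using assms(1,2)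
  by (intro integrable_bdd[of _ K R])
    (auto simp: indicator_def intro: assms(4) order_trans[OF norm_ge_zero assms(4)])
qed

lemma integrable_C1c:
 fixes \<phi> :: "real ^ 'n \<Rightarrow> 'b::{banach, second_countable_topology}"
 assumes "C1c \<phi>" shows "integrable \<sigma> \<phi>"
proof -
 obtain R where R: "\<And>x. \<phi> x \<noteq> 0 \<Longrightarrow> norm x < R" using C1c_support[OF assms] by metis
 obtain K where K: "\<And>x. norm (\<phi> x) \<le> K" using C1c_bounded[OF assms] by metis
 show ?thesis
  by (rule integrable_bdd[OF C1c_borel[OF assms] K, of R]) (use R less_asym in blast)
qed

text \<open>On the set where the density exceeds \<open>M\<close> the integral of the excess
  vanishes. Cutting with balls makes the integral of the constant finite, so that it can be
  cancelled.\<close>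

lemma AE_le_of_density_le:
 assumes [measurable]: "p \<in> borel_measurable \<sigma>"
  and le: "\<And>A. A \<in> sets borel \<Longrightarrow> emeasure (density \<sigma> p) A \<le> ennreal M * emeasure \<sigma> A"
 shows "AE x in \<sigma>. p x \<le> ennreal M"
proof -
 have "AE x in \<sigma>. (p x - ennreal M) * indicator ({x. p x > ennreal M} \<inter> cball 0 (real j)) x = 0" for j
 proof -
  let ?Z = "{x. p x > ennreal M} \<inter> cball 0 (real j)"
  have "{x \<in> space \<sigma>. p x > ennreal M} \<in> sets \<sigma>" by measurable
  then have Z: "?Z \<in> sets borel" by simp
  then have [measurable]: "?Z \<in> sets \<sigma>" by simp
  let ?I = "\<integral>\<^sup>+x. ennreal M * indicator ?Z x \<partial>\<sigma>"
  have I: "?I = ennreal M * emeasure \<sigma> ?Z" by (simp add: nn_integral_cmult_indicator)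
  have "?I + (\<integral>\<^sup>+x. (p x - ennreal M) * indicator ?Z x \<partial>\<sigma>) =
    (\<integral>\<^sup>+x. ennreal M * indicator ?Z x + (p x - ennreal M) * indicator ?Z x \<partial>\<sigma>)"
   by (intro nn_integral_add[symmetric]) measurable
  also have "... = (\<integral>\<^sup>+x. p x * indicator ?Z x \<partial>\<sigma>)"
   by (intro nn_integral_cong) (auto simp: indicator_def intro!: add_diff_inverse_ennreal)
  also have "... = emeasure (density \<sigma> p) ?Z" by (simp add: emeasure_density)
  also have "... \<le> ?I + 0" using le[OF Z] by (simp add: I)
  finally have "(\<integral>\<^sup>+x. (p x - ennreal M) * indicator ?Z x \<partial>\<sigma>) \<le> 0"
   using finite_bounded[of ?Z] unfolding ennreal_add_left_cancel_le
   by (auto simp: I ennreal_mult_eq_top_iff bounded_Int)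
  then show ?thesis by (simp add: nn_integral_0_iff_AE)
 qed
 then have "AE x in \<sigma>. \<forall>j. (p x - ennreal M) * indicator ({x. p x > ennreal M} \<inter> cball 0 (real j)) x = 0"
  unfolding AE_all_countable by blast
 then show ?thesis
 proof eventually_elim
  case (elim x)
  obtain j where "norm x \<le> real j" using real_arch_simple by blast
  then show ?case using elim[rule_format, of j] by (cases "p x \<le> ennreal M") (auto simp: diff_eq_0_iff_ennreal)
 qed
qed

text \<open>Radon--Nikodym for the positive and the negative variation separately, each of which
  inherits the bound by \<open>M\<close> times \<sigma>.\<close>

lemma signed_radon_density:
 assumes \<nu>: "signed_radon \<nu>" and M: "M \<ge> 0"
  and le: "\<And>A. A \<in> sets borel \<Longrightarrow> bounded A \<Longrightarrow> ennreal \<bar>\<nu> A\<bar> \<le> ennreal M * emeasure \<sigma> A"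
 obtains f where "f \<in> borel_measurable borel" "\<And>x. \<bar>f x\<bar> \<le> M"
  "\<And>A. A \<in> sets borel \<Longrightarrow> bounded A \<Longrightarrow> \<nu> A = (LINT x:A|\<sigma>. f x)"
proof -
 have dens: "\<exists>g. g \<in> borel_measurable borel \<and> (\<forall>x. 0 \<le> g x \<and> g x \<le> M) \<and>
   (\<forall>A. A \<in> sets borel \<longrightarrow> bounded A \<longrightarrow> measure (positive_variation \<nu>) A = (LINT x:A|\<sigma>. g x))"
  if \<nu>: "signed_radon \<nu>" and le: "\<And>A. A \<in> sets borel \<Longrightarrow> bounded A \<Longrightarrow> ennreal \<bar>\<nu> A\<bar> \<le> ennreal M * emeasure \<sigma> A" for \<nu>
 proof -
  let ?P = "positive_variation \<nu>"
  have P: "emeasure ?P A \<le> ennreal M * emeasure \<sigma> A" if A: "A \<in> sets borel" for A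
   unfolding emeasure_positive_variation[OF \<nu> A]
  proof (rule SUP_least)
   fix B assume "B \<in> {B. B \<in> sets borel \<and> bounded B \<and> B \<subseteq> A}"
   then have B: "B \<in> sets borel" "bounded B" "B \<subseteq> A" by auto
   have "ennreal (\<nu> B) \<le> ennreal \<bar>\<nu> B\<bar>" by (intro ennreal_leI) auto
   also have "... \<le> ennreal M * emeasure \<sigma> B" using le B by auto
   also have "... \<le> ennreal M * emeasure \<sigma> A"
    using A B by (intro mult_left_mono emeasure_mono) auto
   finally show "ennreal (\<nu> B) \<le> ennreal M * emeasure \<sigma> A" .
  qed
  have "absolutely_continuous \<sigma> ?P"
  proof (unfold absolutely_continuous_def, rule subsetI)
   fix N assume "N \<in> null_sets \<sigma>"
   then show "N \<in> null_sets ?P" using P[of N] by (auto simp: null_sets_def)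
  qed
  then obtain p where p [measurable]: "p \<in> borel_measurable \<sigma>" and dp: "density \<sigma> p = ?P"
   using Radon_Nikodym[of ?P] by auto
  have pM: "AE x in \<sigma>. p x \<le> ennreal M"
   using P dp by (intro AE_le_of_density_le p) auto
  \<comment> \<open>Clipping at \<open>M\<close> changes the density on a null set and makes the
    bound hold at every point, so that later estimates carry no almost-everywhere clause.\<close>
  define g where "g x = enn2real (min (p x) (ennreal M))" for x
  have g [measurable]: "g \<in> borel_measurable borel"
  proof -
   have "g \<in> borel_measurable \<sigma>" unfolding g_def by measurable
   then show ?thesis by simp
  qed
  have g0: "0 \<le> g x" "g x \<le> M" for x
   unfolding g_def using M by (auto intro!: enn2real_leI)
  have gp: "AE x in \<sigma>. ennreal (g x) = p x"
   using pM
  proof eventually_elim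
   case (elim x)
   then have "p x < \<infinity>" using le_less_trans[OF elim ennreal_less_top] by simp
   then show ?case using elim by (simp add: g_def min_absorb1)
  qed
  have "measure ?P A = (LINT x:A|\<sigma>. g x)" if A: "A \<in> sets borel" "bounded A" for A
  proof -
   have int: "integrable \<sigma> (\<lambda>x. indicator A x *\<^sub>R g x)"
    using set_integrable_bdd[OF g A, of M] g0 unfolding set_integrable_def by simp
   have "emeasure ?P A = (\<integral>\<^sup>+x. p x * indicator A x \<partial>\<sigma>)"
    unfolding dp[symmetric] using A by (simp add: emeasure_density)
   also have "... = (\<integral>\<^sup>+x. ennreal (indicator A x *\<^sub>R g x) \<partial>\<sigma>)"
    using gp by (intro nn_integral_cong_AE) (auto simp: indicator_def)
   also have "... = ennreal (LINT x:A|\<sigma>. g x)"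
    unfolding set_lebesgue_integral_def
    using int g0 by (intro nn_integral_eq_integral) (auto simp: indicator_def)
   finally show ?thesis
    using g0 by (simp add: measure_def set_lebesgue_integral_def integral_nonneg_AE indicator_def)
  qed
  then show ?thesis using g g0 by blast
 qed
 obtain g where g: "g \<in> borel_measurable borel" "\<And>x. 0 \<le> g x \<and> g x \<le> M"
   "\<And>A. A \<in> sets borel \<Longrightarrow> bounded A \<Longrightarrow> measure (positive_variation \<nu>) A = (LINT x:A|\<sigma>. g x)"
  using dens[OF \<nu> le] by blast
 obtain h where h: "h \<in> borel_measurable borel" "\<And>x. 0 \<le> h x \<and> h x \<le> M"
   "\<And>A. A \<in> sets borel \<Longrightarrow> bounded A \<Longrightarrow> measure (positive_variation (\<lambda>A. - \<nu> A)) A = (LINT x:A|\<sigma>. h x)"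
 proof -
  have "ennreal \<bar>- \<nu> A\<bar> \<le> ennreal M * emeasure \<sigma> A" if "A \<in> sets borel" "bounded A" for A
   using le[OF that] by simp
  from dens[OF signed_radon_uminus[OF \<nu>] this] show ?thesis using that by blast
 qed
 show ?thesis
 proof
  show "(\<lambda>x. g x - h x) \<in> borel_measurable borel" using g h by simp
  show "\<bar>g x - h x\<bar> \<le> M" for x using g(2)[of x] h(2)[of x] by linarith
  show "\<nu> A = (LINT x:A|\<sigma>. g x - h x)" if A: "A \<in> sets borel" "bounded A" for A
  proof -
   have "set_integrable \<sigma> A g" "set_integrable \<sigma> A h"
    using g(2) h(2) by (auto intro!: set_integrable_bdd[OF _ A, of _ M] g(1) h(1))
   then show ?thesis
    using jordan_decomposition[OF \<nu> A] g(3)[OF A] h(3)[OF A]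
    by (simp add: set_integral_diff)
  qed
 qed
qed

end

locale density_field = borel_radon \<sigma> for \<sigma> :: "(real ^ 'n) measure" +
 fixes f :: "real ^ 'n \<Rightarrow> real ^ 'n" and M :: real
 assumes f_borel [measurable]: "f \<in> borel_measurable borel"
  and f_bound: "\<And>x. norm (f x) \<le> M"
begin

text \<open>The value 0 elsewhere is the convention of \<open>vector_radon_measure\<close>; it turns
  the comparison with the Gauss--Green measure into an equality of functions.\<close>

definition fm :: "(real ^ 'n) set \<Rightarrow> real ^ 'n" where
 "fm A = (if A \<in> sets borel \<and> bounded A then (LINT x:A|\<sigma>. f x) else 0)"

lemma M_nonneg: "M \<ge> 0" using f_bound norm_ge_zero order_trans by blast

lemma f_set_integrable: "A \<in> sets borel \<Longrightarrow> bounded A \<Longrightarrow> set_integrable \<sigma> A f"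
 by (rule set_integrable_bdd[OF f_borel _ _ f_bound])

lemma f_component_bound: "\<bar>f x $ i\<bar> \<le> M"
 using component_le_norm_cart f_bound order_trans by blast

lemma f_component_borel [measurable]: "(\<lambda>x. f x $ i) \<in> borel_measurable borel"
 by (rule measurable_compose[OF f_borel borel_measurable_nth_vec])

lemma fm_component:
 assumes "A \<in> sets borel" "bounded A"
 shows "fm A $ i = (LINT x:A|\<sigma>. f x $ i)"
 using integral_bounded_linear[OF bounded_linear_vec_nth f_set_integrable[OF assms, unfolded set_integrable_def], of i]
 by (simp add: fm_def assms set_lebesgue_integral_def)

lemma vector_radon_measure_fm: "vector_radon_measure fm"
 unfolding vector_radon_measure_def
proof (intro conjI allI impI)
 fix A :: "nat \<Rightarrow> (real ^ 'n) set"
 assume "range A \<subseteq> sets borel \<and> disjoint_family A \<and> bounded (\<Union>i. A i)"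
 then have A: "\<And>i. A i \<in> sets borel" "disjoint_family A" "bounded (\<Union>i. A i)" by auto
 have bA: "bounded (A i)" for i using A(3) by (rule bounded_subset) auto
 have UA: "(\<Union>i. A i) \<in> sets borel" using A by auto
 have "(\<lambda>n. \<Sum>i<n. fm (A i)) = (\<lambda>n. LINT x:(\<Union>i<n. A i)|\<sigma>. f x)"
 proof
  fix n
  have "(LINT x:(\<Union>i<n. A i)|\<sigma>. f x) = (\<Sum>i<n. LINT x:A i|\<sigma>. f x)"
   by (rule set_integral_finite_Union)
     (use A bA f_set_integrable in \<open>auto simp: disjoint_family_on_def\<close>)
  then show "(\<Sum>i<n. fm (A i)) = (LINT x:(\<Union>i<n. A i)|\<sigma>. f x)"
   using A bA by (simp add: fm_def)
 qed
 moreover have "(\<lambda>n. LINT x:(\<Union>i<n. A i)|\<sigma>. f x) \<longlonglongrightarrow> (LINT x:(\<Union>n. \<Union>i<n. A i)|\<sigma>. f x)"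
 proof (rule set_integral_cont_up)
  show "incseq (\<lambda>n. \<Union>i<n. A i)" by (auto simp: incseq_def) (metis lessThan_iff order_less_le_trans)
  have "(\<Union>n. \<Union>i<n. A i) = (\<Union>i. A i)" by auto
  then show "set_integrable \<sigma> (\<Union>n. \<Union>i<n. A i) f"
   using f_set_integrable[OF UA A(3)] by simp
 qed (use A in auto)
 moreover have "(\<Union>n. \<Union>i<n. A i) = (\<Union>i. A i)" by auto
 ultimately show "(\<lambda>i. fm (A i)) sums fm (\<Union>i. A i)"
  using UA A(3) by (simp add: sums_def fm_def)
qed (auto simp: fm_def)

text \<open>The supremum over test sets is approached by the bounded parts of \<open>A\<close> on
  which \<open>h\<close> is positive; \<open>ennreal\<close> performs the passage to the positive
  part of \<open>h\<close>.\<close>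

lemma positive_variation_eq_density:
 assumes h [measurable]: "h \<in> borel_measurable borel" and hM: "\<And>x. \<bar>h x\<bar> \<le> M"
  and \<nu>: "signed_radon \<nu>" and eq: "\<And>A. A \<in> sets borel \<Longrightarrow> bounded A \<Longrightarrow> \<nu> A = (LINT x:A|\<sigma>. h x)"
 shows "positive_variation \<nu> = density \<sigma> (\<lambda>x. ennreal (h x))"
proof (rule measure_eqI)
 fix A assume "A \<in> sets (positive_variation \<nu>)"
 then have A: "A \<in> sets borel" by simp
 have int: "integrable \<sigma> (\<lambda>x. indicator B x * h x)" "integrable \<sigma> (\<lambda>x. indicator B x * max 0 (h x))"
  if "B \<in> sets borel" "bounded B" for B
  using set_integrable_bdd[OF h that, of M] set_integrable_bdd[OF _ that, of "\<lambda>x. max 0 (h x)" M] hM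
  by (auto simp: set_integrable_def max_def M_nonneg abs_le_iff)
 show "emeasure (positive_variation \<nu>) A = emeasure (density \<sigma> (\<lambda>x. ennreal (h x))) A"
 proof (rule antisym)
  show "emeasure (positive_variation \<nu>) A \<le> emeasure (density \<sigma> (\<lambda>x. ennreal (h x))) A"
   unfolding emeasure_positive_variation[OF \<nu> A]
  proof (rule SUP_least)
   fix B assume "B \<in> {B. B \<in> sets borel \<and> bounded B \<and> B \<subseteq> A}"
   then have B: "B \<in> sets borel" "bounded B" "B \<subseteq> A" by auto
   have "ennreal (\<nu> B) \<le> ennreal (LINT x|\<sigma>. indicator B x * max 0 (h x))"
    unfolding eq[OF B(1,2)] set_lebesgue_integral_def using int[OF B(1,2)]
    by (intro ennreal_leI integral_mono) (auto simp: indicator_def)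
   also have "... = (\<integral>\<^sup>+x. ennreal (indicator B x * max 0 (h x)) \<partial>\<sigma>)"
    using int[OF B(1,2)] by (intro nn_integral_eq_integral[symmetric]) (auto simp: indicator_def)
   also have "... \<le> (\<integral>\<^sup>+x. ennreal (h x) * indicator A x \<partial>\<sigma>)"
    using B(3) by (intro nn_integral_mono) (auto simp: indicator_def max_def)
   also have "... = emeasure (density \<sigma> (\<lambda>x. ennreal (h x))) A"
    using A by (simp add: emeasure_density)
   finally show "ennreal (\<nu> B) \<le> emeasure (density \<sigma> (\<lambda>x. ennreal (h x))) A" .
  qed
  let ?A = "\<lambda>k::nat. A \<inter> {x. h x > 0} \<inter> cball 0 (real k)"
  have pos: "{x. h x > 0} \<in> sets borel"
   using measurable_sets[OF h, of "{0<..}"] by (simp add: vimage_def)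
  have Ak: "?A k \<in> sets borel" for k using A pos by auto
  have UA: "(\<Union>k. ?A k) = A \<inter> {x. h x > 0}" using UN_cball by fastforce
  have "emeasure (density \<sigma> (\<lambda>x. ennreal (h x))) A = (\<integral>\<^sup>+x. ennreal (h x) * indicator A x \<partial>\<sigma>)"
   using A by (simp add: emeasure_density)
  also have "... = (\<integral>\<^sup>+x. ennreal (h x) * indicator (A \<inter> {x. h x > 0}) x \<partial>\<sigma>)"
   by (intro nn_integral_cong) (auto simp: indicator_def not_less ennreal_neg)
  also have "... = emeasure (density \<sigma> (\<lambda>x. ennreal (h x))) (\<Union>k. ?A k)"
   unfolding UA using A pos by (simp add: emeasure_density)
  also have "... = (SUP k. emeasure (density \<sigma> (\<lambda>x. ennreal (h x))) (?A k))"
   using Ak by (intro SUP_emeasure_incseq[symmetric]) (auto simp: incseq_def)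
  also have "... \<le> emeasure (positive_variation \<nu>) A"
  proof (rule SUP_least)
   fix k
   have b: "bounded (?A k)" by (rule bounded_subset[OF bounded_cball]) auto
   have "emeasure (density \<sigma> (\<lambda>x. ennreal (h x))) (?A k) = (\<integral>\<^sup>+x. ennreal (h x) * indicator (?A k) x \<partial>\<sigma>)"
    using Ak by (simp add: emeasure_density)
   also have "... = (\<integral>\<^sup>+x. ennreal (indicator (?A k) x * h x) \<partial>\<sigma>)"
    by (intro nn_integral_cong) (auto simp: indicator_def)
   also have "... = ennreal (\<nu> (?A k))"
    unfolding eq[OF Ak b] set_lebesgue_integral_def using int(1)[OF Ak b]
    by (subst nn_integral_eq_integral) (auto simp: indicator_def)
   also have "... \<le> emeasure (positive_variation \<nu>) A"
    unfolding emeasure_positive_variation[OF \<nu> A]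
    by (rule SUP_upper) (use Ak b in auto)
   finally show "emeasure (density \<sigma> (\<lambda>x. ennreal (h x))) (?A k) \<le> emeasure (positive_variation \<nu>) A" .
  qed
  finally show "emeasure (density \<sigma> (\<lambda>x. ennreal (h x))) A \<le> emeasure (positive_variation \<nu>) A" .
 qed
qed simp

text \<open>In each coordinate the two variations have the positive and the negative part of
  \<open>f\<close> as densities, and their difference reassembles the coordinate.\<close>

lemma vector_integral_fm:
 assumes T [measurable]: "T \<in> borel_measurable borel" and TK: "\<And>x. norm (T x) \<le> K"
  and TR: "\<And>x. norm x > R \<Longrightarrow> T x = 0"
 shows "vector_integral fm T = (LINT x|\<sigma>. T x \<bullet> f x)"
proof -
 have Ti [measurable]: "(\<lambda>x. T x $ i) \<in> borel_measurable borel" for i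
  by (rule measurable_compose[OF T borel_measurable_nth_vec])
 have T1: "\<bar>T x $ i\<bar> \<le> K" for x i using component_le_norm_cart TK order_trans by blast
 have K: "K \<ge> 0" using TK norm_ge_zero order_trans by blast
 have int: "integrable \<sigma> (\<lambda>x. h x * T x $ i)" if "h \<in> borel_measurable borel" "\<And>x. \<bar>h x\<bar> \<le> M" for h i
 proof (rule integrable_bdd[of _ "M * K" R])
  show "(\<lambda>x. h x * T x $ i) \<in> borel_measurable borel" using that by simp
  show "norm (h x * T x $ i) \<le> M * K" for x
   using that(2)[of x] T1[of x i] M_nonneg by (auto simp: abs_mult intro!: mult_mono)
  show "norm x > R \<Longrightarrow> h x * T x $ i = 0" for x using TR[of x] by simp
 qed
 have part: "(LINT x|density \<sigma> (\<lambda>x. ennreal (h x)). T x $ i) = (LINT x|\<sigma>. max 0 (h x) * T x $ i)"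
  if h [measurable]: "h \<in> borel_measurable borel" for h i
 proof -
  have "density \<sigma> (\<lambda>x. ennreal (h x)) = density \<sigma> (\<lambda>x. ennreal (max 0 (h x)))"
   by (intro arg_cong[where f="density \<sigma>"] ext) (auto simp: max_def ennreal_neg)
  then show ?thesis by (simp add: integral_density)
 qed
 have comp: "(LINT x|positive_variation (\<lambda>A. fm A $ i). T x $ i)
       - (LINT x|positive_variation (\<lambda>A. - (fm A $ i)). T x $ i) = (LINT x|\<sigma>. T x $ i * f x $ i)" for i
 proof -
  have s: "signed_radon (\<lambda>A. fm A $ i)" by (rule signed_radon_component[OF vector_radon_measure_fm])
  have 1: "positive_variation (\<lambda>A. fm A $ i) = density \<sigma> (\<lambda>x. ennreal (f x $ i))"
   by (rule positive_variation_eq_density[OF f_component_borel f_component_bound s fm_component])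
  have 2: "positive_variation (\<lambda>A. - (fm A $ i)) = density \<sigma> (\<lambda>x. ennreal (- (f x $ i)))"
   using f_component_bound
   by (intro positive_variation_eq_density signed_radon_uminus[OF s])
     (auto simp: fm_component set_lebesgue_integral_def)
  have "(LINT x|\<sigma>. max 0 (f x $ i) * T x $ i) - (LINT x|\<sigma>. max 0 (- (f x $ i)) * T x $ i)
    = (LINT x|\<sigma>. max 0 (f x $ i) * T x $ i - max 0 (- (f x $ i)) * T x $ i)"
   using f_component_bound M_nonneg
   by (intro Bochner_Integration.integral_diff[symmetric] int) (auto simp: max_def abs_le_iff)
  also have "... = (LINT x|\<sigma>. T x $ i * f x $ i)"
   by (intro Bochner_Integration.integral_cong) (auto simp: max_def)
  finally show ?thesis by (simp add: 1 2 part)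
 qed
 have "vector_integral fm T = (\<Sum>i\<in>UNIV. (LINT x|\<sigma>. T x $ i * f x $ i))"
  unfolding vector_integral_def comp ..
 also have "... = (LINT x|\<sigma>. (\<Sum>i\<in>UNIV. T x $ i * f x $ i))"
  using int[OF f_component_borel f_component_bound]
  by (intro Bochner_Integration.integral_sum[symmetric]) (simp add: mult.commute)
 finally show ?thesis by (simp add: inner_vec_def)
qed

end

text \<open>Balls of radius half of \<delta> about a countable dense set, made disjoint.\<close>

lemma borel_partition_small_diameter:
 assumes "\<delta> > 0"
 obtains D :: "nat \<Rightarrow> 'a::{real_normed_vector, second_countable_topology} set"
 where "disjoint_family D" "(\<Union>j. D j) = UNIV"
  "\<And>j. D j \<in> sets borel" "\<And>j v w. v \<in> D j \<Longrightarrow> w \<in> D j \<Longrightarrow> norm (v - w) \<le> \<delta>"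
proof -
 obtain X :: "'a set" where X: "countable X" "\<And>U. open U \<Longrightarrow> U \<noteq> {} \<Longrightarrow> \<exists>d\<in>X. d \<in> U"
  by (rule countable_dense_setE) blast
 have ne: "X \<noteq> {}" using X(2)[of UNIV] by auto
 define B where "B j = ball (from_nat_into X j) (\<delta> / 2)" for j
 have UB: "(\<Union>j. B j) = UNIV"
 proof -
  have "x \<in> (\<Union>j. B j)" for x
  proof -
   obtain d where "d \<in> X" "d \<in> ball x (\<delta> / 2)" using X(2)[of "ball x (\<delta> / 2)"] assms by auto
   then have "x \<in> B (to_nat_on X d)" using X(1) by (simp add: B_def dist_commute)
   then show ?thesis by blast
  qed
  then show ?thesis by blast
 qed
 have "norm (v - w) \<le> \<delta>" if "v \<in> B j" "w \<in> B j" for v w j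
 proof -
  have "dist v w \<le> dist (from_nat_into X j) v + dist (from_nat_into X j) w" by (rule dist_triangle3)
  then show ?thesis using that by (simp add: B_def dist_norm)
 qed
 note B2 = this
 show ?thesis
 proof
  show "disjoint_family (disjointed B)" by (rule disjoint_family_disjointed)
  show "(\<Union>j. disjointed B j) = UNIV" using UB by (simp add: UN_disjointed_eq)
  show "disjointed B j \<in> sets borel" for j
  proof -
   have "range B \<subseteq> sets borel" by (auto simp: B_def)
   then show ?thesis using sets.range_disjointed_sets by blast
  qed
  show "norm (v - w) \<le> \<delta>" if "v \<in> disjointed B j" "w \<in> disjointed B j" for j v w
   using B2[of v j w] that disjointed_subset[of B j] by blast
 qed
qed

section \<open>Total variation and uniqueness of the Gauss--Green measure\<close>

context density_field
begin

lemma norm_f_set_integrable: "A \<in> sets borel \<Longrightarrow> bounded A \<Longrightarrow> set_integrable \<sigma> A (\<lambda>x. norm (f x))"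
 by (rule set_integrable_bdd[where K=M]) (auto simp: f_bound)

lemma emeasure_norm_density:
 assumes "A \<in> sets borel" "bounded A"
 shows "emeasure (density \<sigma> (\<lambda>x. ennreal (norm (f x)))) A = ennreal (LINT x:A|\<sigma>. norm (f x))"
proof -
 have "emeasure (density \<sigma> (\<lambda>x. ennreal (norm (f x)))) A = (\<integral>\<^sup>+x. ennreal (norm (f x)) * indicator A x \<partial>\<sigma>)"
  using assms by (simp add: emeasure_density)
 also have "... = (\<integral>\<^sup>+x. ennreal (indicator A x *\<^sub>R norm (f x)) \<partial>\<sigma>)"
  by (intro nn_integral_cong) (auto simp: indicator_def)
 also have "... = ennreal (LINT x:A|\<sigma>. norm (f x))"
  unfolding set_lebesgue_integral_def
  using norm_f_set_integrable[OF assms] unfolding set_integrable_def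
  by (intro nn_integral_eq_integral) auto
 finally show ?thesis .
qed

lemma norm_fm_le:
 assumes "A \<in> sets borel" "bounded A"
 shows "norm (fm A) \<le> (LINT x:A|\<sigma>. norm (f x))"
proof -
 have "norm (fm A) \<le> (LINT x|\<sigma>. norm (indicator A x *\<^sub>R f x))"
  unfolding fm_def set_lebesgue_integral_def using assms by (simp only: simp_thms if_True) (rule integral_norm_bound)
 then show ?thesis by (simp add: set_lebesgue_integral_def)
qed

text \<open>Replacing \<open>f\<close> by the constant \<open>v\<close> costs \<delta> times the
  measure of \<open>A\<close> once in the integral of |f| and once in the norm of the integral of
  \<open>f\<close>; hence the factor 2.\<close>

lemma norm_density_small_oscillation:
 assumes A: "A \<in> sets borel" "bounded A" and v: "\<And>x. x \<in> A \<Longrightarrow> norm (f x - v) \<le> \<delta>"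
 shows "emeasure (density \<sigma> (\<lambda>x. ennreal (norm (f x)))) A \<le> ennreal (norm (fm A)) + ennreal (2 * \<delta> * measure \<sigma> A)"
proof (cases "A = {}")
 case False
 then have \<delta>: "\<delta> \<ge> 0" using v norm_ge_zero order_trans by blast
 have c: "set_integrable \<sigma> A (\<lambda>x. c)" for c :: "'b::{banach, second_countable_topology}"
  by (rule set_integrable_bdd[OF _ A, where K="norm c"]) auto
 have lint_c: "(LINT x:A|\<sigma>. c) = measure \<sigma> A *\<^sub>R c" for c :: "'b::{banach, second_countable_topology}"
  using A finite_bounded[OF A(2)] by (simp add: set_lebesgue_integral_def)
 have "norm (fm A - measure \<sigma> A *\<^sub>R v) = norm (LINT x:A|\<sigma>. f x - v)"
  using f_set_integrable[OF A] c[of v] A by (simp add: set_integral_diff lint_c fm_def)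
 also have "... \<le> (LINT x|\<sigma>. norm (indicator A x *\<^sub>R (f x - v)))"
  unfolding set_lebesgue_integral_def by (rule integral_norm_bound)
 also have "... \<le> (LINT x:A|\<sigma>. \<delta>)"
  unfolding set_lebesgue_integral_def
  using set_integral_diff(1)[OF f_set_integrable[OF A] c[of v]] c[of \<delta>] v
  unfolding set_integrable_def
  by (intro integral_mono integrable_norm) (auto simp: indicator_def)
 finally have 1: "norm (fm A - measure \<sigma> A *\<^sub>R v) \<le> measure \<sigma> A * \<delta>"
  by (simp add: lint_c)
 have "(LINT x:A|\<sigma>. norm (f x)) \<le> (LINT x:A|\<sigma>. norm v + \<delta>)"
 proof (rule set_integral_mono[OF norm_f_set_integrable[OF A] c])
  show "norm (f x) \<le> norm v + \<delta>" if "x \<in> A" for x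
   using v[OF that] norm_triangle_sub[of "f x" v] by linarith
 qed
 also have "... = norm (measure \<sigma> A *\<^sub>R v) + measure \<sigma> A * \<delta>"
  by (simp add: lint_c distrib_left)
 also have "norm (measure \<sigma> A *\<^sub>R v) \<le> norm (fm A) + measure \<sigma> A * \<delta>"
  using 1 norm_triangle_sub[of "measure \<sigma> A *\<^sub>R v" "fm A"] by (simp add: norm_minus_commute)
 finally have "(LINT x:A|\<sigma>. norm (f x)) \<le> norm (fm A) + 2 * \<delta> * measure \<sigma> A"
  by (simp add: algebra_simps)
 then show ?thesis
  using \<delta> by (simp add: emeasure_norm_density[OF A] ennreal_plus[symmetric] ennreal_leI del: ennreal_plus)
qed simp

text \<open>One inequality is the triangle inequality on each piece. For the other the set is cut
  into bounded shells and then along preimages on which \<open>f\<close> is nearly constant, so that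
  hardly any cancellation is left.\<close>

lemma total_variation_fm: "total_variation fm = density \<sigma> (\<lambda>x. ennreal (norm (f x)))"
proof -
 let ?d = "density \<sigma> (\<lambda>x. ennreal (norm (f x)))"
 define parts where "parts A = {F :: nat \<Rightarrow> (real ^ 'n) set. disjoint_family F \<and>
          (\<forall>i. F i \<in> sets borel \<and> bounded (F i)) \<and> (\<Union>i. F i) = A}" for A
 have eq: "(SUP F \<in> parts A. \<Sum>i. ennreal (norm (fm (F i)))) = emeasure ?d A" if A: "A \<in> sets borel" for A
 proof (rule antisym)
  show "(SUP F \<in> parts A. \<Sum>i. ennreal (norm (fm (F i)))) \<le> emeasure ?d A"
  proof (rule SUP_least)
   fix F assume "F \<in> parts A"
   then have F: "disjoint_family F" "\<And>i. F i \<in> sets borel" "\<And>i. bounded (F i)" "(\<Union>i. F i) = A"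
    by (auto simp: parts_def)
   have "(\<Sum>i. ennreal (norm (fm (F i)))) \<le> (\<Sum>i. emeasure ?d (F i))"
    using F norm_fm_le by (intro suminf_le) (auto simp: emeasure_norm_density intro!: ennreal_leI)
   also have "... = emeasure ?d A"
    unfolding F(4)[symmetric] using F by (intro suminf_emeasure) auto
   finally show "(\<Sum>i. ennreal (norm (fm (F i)))) \<le> emeasure ?d A" .
  qed
  show "emeasure ?d A \<le> (SUP F \<in> parts A. \<Sum>i. ennreal (norm (fm (F i))))"
  proof (rule ennreal_le_epsilon)
   fix e :: real assume e: "e > 0"
   define R where "R = disjointed (\<lambda>k::nat. cball (0::real^'n) (real k))"
   have R: "disjoint_family R" "(\<Union>k. R k) = UNIV" "\<And>k. R k \<in> sets borel" "\<And>k. bounded (R k)"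
   proof -
    show "disjoint_family R" unfolding R_def by (rule disjoint_family_disjointed)
    show "(\<Union>k. R k) = UNIV" unfolding R_def UN_disjointed_eq by (rule UN_cball)
    have "range (\<lambda>k::nat. cball (0::real^'n) (real k)) \<subseteq> sets borel" by auto
    then show "R k \<in> sets borel" for k unfolding R_def using sets.range_disjointed_sets by blast
    show "bounded (R k)" for k
     unfolding R_def by (rule bounded_subset[OF bounded_cball disjointed_subset])
   qed
   \<comment> \<open>Tolerance for shell \<open>k\<close>, making its error at most
     \<open>e * (1/2) ^ Suc k\<close>; the summand 1 guards against shells of measure 0.\<close>
   define \<delta> where "\<delta> k = e * (1/2) ^ Suc k / (2 * (1 + measure \<sigma> (R k)))" for k
   have \<delta>: "\<delta> k > 0" for k using e by (auto simp: \<delta>_def intro!: divide_pos_pos add_pos_nonneg)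
   have \<delta>2: "2 * \<delta> k * measure \<sigma> (R k) \<le> e * (1/2) ^ Suc k" for k
   proof -
    have *: "2 * (c / (2 * (1 + m))) * m \<le> c" if "c \<ge> 0" "m \<ge> 0" for c m :: real
     using that by (simp add: divide_le_eq add_pos_nonneg) (simp add: algebra_simps)
    show ?thesis unfolding \<delta>_def using e by (intro *) auto
   qed
   have "\<exists>D :: nat \<Rightarrow> (real ^ 'n) set. disjoint_family D \<and> (\<Union>j. D j) = UNIV \<and>
     (\<forall>j. D j \<in> sets borel) \<and> (\<forall>j v w. v \<in> D j \<longrightarrow> w \<in> D j \<longrightarrow> norm (v - w) \<le> \<delta> k)" for k
    using borel_partition_small_diameter[OF \<delta>[of k]] by metis
   then obtain D :: "nat \<Rightarrow> nat \<Rightarrow> (real ^ 'n) set" where D: "\<And>k. disjoint_family (D k)" "\<And>k. (\<Union>j. D k j) = UNIV"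
     "\<And>k j. D k j \<in> sets borel" "\<And>k j v w. v \<in> D k j \<Longrightarrow> w \<in> D k j \<Longrightarrow> norm (v - w) \<le> \<delta> k"
    by metis
   define F where "F p = A \<inter> R (fst p) \<inter> f -` D (fst p) (snd p)" for p
   have FB: "F p \<in> sets borel" for p
    unfolding F_def using A R(3) measurable_sets[OF f_borel D(3)] by auto
   have Fb: "bounded (F p)" for p
    unfolding F_def by (rule bounded_subset[OF R(4)[of "fst p"]]) auto
   have Fdisj: "F p \<inter> F q = {}" if "p \<noteq> q" for p q
   proof (cases "fst p = fst q")
    case True
    then have "snd p \<noteq> snd q" using that by (auto simp: prod_eq_iff)
    then have "D (fst p) (snd p) \<inter> D (fst p) (snd q) = {}"
     using D(1) by (auto simp: disjoint_family_on_def)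
    then show ?thesis using True by (auto simp: F_def)
   next
    case False
    then have "R (fst p) \<inter> R (fst q) = {}" using R(1) by (auto simp: disjoint_family_on_def)
    then show ?thesis by (auto simp: F_def)
   qed
   have FU: "(\<Union>j. F (k, j)) = A \<inter> R k" for k
   proof -
    have "f x \<in> (\<Union>j. D k j)" for x using D(2) by simp
    then show ?thesis by (fastforce simp: F_def)
   qed
   have G: "(\<lambda>i. F (prod_decode i)) \<in> parts A"
   proof -
    have "disjoint_family (\<lambda>i. F (prod_decode i))"
     unfolding disjoint_family_on_def using Fdisj by (metis prod_decode_eq)
    moreover have "(\<Union>i. F (prod_decode i)) = A"
    proof -
     have "(\<Union>i. F (prod_decode i)) = (\<Union>p. F p)"
      using surj_prod_decode by (metis image_image)
     also have "... = (\<Union>k. \<Union>j. F (k, j))" by auto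
     finally show ?thesis using FU R(2) by auto
    qed
    ultimately show ?thesis using FB Fb by (auto simp: parts_def)
   qed
   have row: "emeasure ?d (A \<inter> R k) \<le> (\<Sum>j. ennreal (norm (fm (F (k, j))))) + ennreal (e * (1/2) ^ Suc k)" for k
   proof -
    have disj: "disjoint_family (\<lambda>j. F (k, j))" using Fdisj by (auto simp: disjoint_family_on_def)
    have "emeasure ?d (A \<inter> R k) = (\<Sum>j. emeasure ?d (F (k, j)))"
     unfolding FU[symmetric] using FB disj by (intro suminf_emeasure[symmetric]) auto
    also have "... \<le> (\<Sum>j. ennreal (norm (fm (F (k, j)))) + ennreal (2 * \<delta> k) * emeasure \<sigma> (F (k, j)))"
    proof (intro suminf_le)
     fix j
     obtain v where "\<And>x. x \<in> F (k, j) \<Longrightarrow> norm (f x - v) \<le> \<delta> k"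
     proof (cases "F (k, j) = {}")
      case False
      then obtain y where "y \<in> F (k, j)" by auto
      then show ?thesis using D(4)[of _ k j "f y"] by (intro that[of "f y"]) (auto simp: F_def)
     qed auto
     from norm_density_small_oscillation[OF FB Fb this]
     show "emeasure ?d (F (k, j)) \<le> ennreal (norm (fm (F (k, j)))) + ennreal (2 * \<delta> k) * emeasure \<sigma> (F (k, j))"
      using \<delta>[of k] by (simp add: emeasure_eq_measure_bounded[OF Fb] ennreal_mult''[symmetric])
    qed auto
    also have "... = (\<Sum>j. ennreal (norm (fm (F (k, j))))) + ennreal (2 * \<delta> k) * (\<Sum>j. emeasure \<sigma> (F (k, j)))"
     by (simp add: suminf_add[symmetric])
    also have "(\<Sum>j. emeasure \<sigma> (F (k, j))) = emeasure \<sigma> (A \<inter> R k)"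
     unfolding FU[symmetric] using FB disj by (intro suminf_emeasure) auto
    also have "(\<Sum>j. ennreal (norm (fm (F (k, j))))) + ennreal (2 * \<delta> k) * emeasure \<sigma> (A \<inter> R k)
      \<le> (\<Sum>j. ennreal (norm (fm (F (k, j))))) + ennreal (e * (1/2) ^ Suc k)"
    proof (rule add_left_mono)
     have "ennreal (2 * \<delta> k) * emeasure \<sigma> (A \<inter> R k) \<le> ennreal (2 * \<delta> k) * emeasure \<sigma> (R k)"
      using R(3) by (intro mult_left_mono emeasure_mono) auto
     also have "... = ennreal (2 * \<delta> k * measure \<sigma> (R k))"
      using \<delta>[of k] by (simp add: emeasure_eq_measure_bounded[OF R(4)] ennreal_mult'')
     also have "... \<le> ennreal (e * (1/2) ^ Suc k)"
      by (rule ennreal_leI[OF \<delta>2])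
     finally show "ennreal (2 * \<delta> k) * emeasure \<sigma> (A \<inter> R k) \<le> ennreal (e * (1/2) ^ Suc k)" .
    qed
    finally show ?thesis .
   qed
   have "(\<Union>k. A \<inter> R k) = A" using R(2) by (simp add: Int_UN_distrib[symmetric])
   then have "emeasure ?d A = emeasure ?d (\<Union>k. A \<inter> R k)" by simp
   also have "... = (\<Sum>k. emeasure ?d (A \<inter> R k))"
    using A R by (intro suminf_emeasure[symmetric]) (auto simp: disjoint_family_on_def)
   also have "... \<le> (\<Sum>k. (\<Sum>j. ennreal (norm (fm (F (k, j))))) + ennreal (e * (1/2) ^ Suc k))"
    by (intro suminf_le row summableI)
   also have "... = (\<Sum>k. \<Sum>j. ennreal (norm (fm (F (k, j))))) + (\<Sum>k. ennreal (e * (1/2) ^ Suc k))"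
    by (intro suminf_add[symmetric] summableI)
   also have "(\<Sum>k. ennreal (e * (1/2) ^ Suc k)) = ennreal e"
    using sums_mult[OF power_half_series, of e] e by (intro suminf_ennreal_eq) auto
   also have "(\<Sum>k. \<Sum>j. ennreal (norm (fm (F (k, j))))) = (\<Sum>i. ennreal (norm (fm (F (prod_decode i)))))"
    by (rule suminf_ennreal_2dimen[where f="\<lambda>p. ennreal (norm (fm (F p)))", OF refl, symmetric])
   also have "(\<Sum>i. ennreal (norm (fm (F (prod_decode i))))) + ennreal e
     \<le> (SUP F \<in> parts A. \<Sum>i. ennreal (norm (fm (F i)))) + ennreal e"
    by (intro add_right_mono SUP_upper2[OF G]) simp
   finally show "emeasure ?d A \<le> (SUP F \<in> parts A. \<Sum>i. ennreal (norm (fm (F i)))) + ennreal e" .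
  qed
 qed
 have sb: "sigma_sets UNIV (sets borel :: (real^'n) set set) = sets borel"
  using sets.sigma_sets_eq[of borel] by simp
 have "total_variation fm = measure_of UNIV (sets borel) (emeasure ?d)"
  unfolding total_variation_def parts_def[symmetric]
  by (rule measure_of_eq) (auto simp: sb eq)
 also have "... = ?d"
  using measure_of_of_measure[of ?d] by simp
 finally show ?thesis .
qed

end

text \<open>An intersection-stable generator of the Borel sets whose indicators are bounded limits of
 compactly supported \<open>C\<^sup>1\<close> functions; it replaces the Riesz representation theorem.\<close>

definition positivity_sets :: "(real ^ 'n) set set" where
 "positivity_sets = {{x. \<phi> x > 0} |\<phi>. C1c \<phi> \<and> (\<forall>x. \<phi> x \<ge> (0::real))}"

lemma positivity_sets_Int_stable: "Int_stable (positivity_sets :: (real ^ 'n) set set)"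
proof (rule Int_stableI)
 fix A B :: "(real ^ 'n) set" assume "A \<in> positivity_sets" "B \<in> positivity_sets"
 then obtain \<phi> \<psi> where *: "A = {x. \<phi> x > 0}" "C1c \<phi>" "\<And>x. \<phi> x \<ge> (0::real)"
   "B = {x. \<psi> x > 0}" "C1c \<psi>" "\<And>x. \<psi> x \<ge> (0::real)"
  by (auto simp: positivity_sets_def)
 have "A \<inter> B = {x. \<phi> x * \<psi> x > 0}"
  using *(3,6) by (auto simp: *(1,4) zero_less_mult_iff dest: less_le_not_le[THEN iffD1])
 moreover have "C1c (\<lambda>x. \<phi> x * \<psi> x)" by (rule C1c_mult[OF *(2,5)])
 ultimately show "A \<inter> B \<in> positivity_sets"
  using *(3,6) unfolding positivity_sets_def
  by (intro CollectI exI[of _ "\<lambda>x. \<phi> x * \<psi> x"]) auto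
qed

lemma ball_in_positivity_sets: "ball y s \<in> positivity_sets" for y :: "real ^ 'n"
proof (cases "s > 0")
 case True
 then have "ball y s = {x. bump s y x > 0}" using bump_pos_iff by blast
 then show ?thesis
  unfolding positivity_sets_def using C1c_bump(1)[OF True] bump_nonneg by blast
next
 case False
 have "C1c (\<lambda>x::real^'n. 0::real)" by (rule C1cI[where \<phi>'="\<lambda>_ _. 0"]) auto
 moreover have "ball y s = {x. (0::real) > 0}" using False by auto
 ultimately show ?thesis
  unfolding positivity_sets_def by (intro CollectI exI[of _ "\<lambda>x. 0"] conjI) simp_all
qed

lemma positivity_sets_borel: "A \<in> positivity_sets \<Longrightarrow> A \<in> sets borel" for A :: "(real ^ 'n) set"
proof -
 assume "A \<in> positivity_sets"
 then obtain \<phi> where \<phi>: "A = {x. \<phi> x > (0::real)}" "C1c \<phi>" by (auto simp: positivity_sets_def)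
 show ?thesis
  using measurable_sets[OF C1c_borel[OF \<phi>(2)], of "{0<..}"] by (simp add: vimage_def \<phi>(1))
qed

lemma sigma_sets_positivity_sets:
 "sigma_sets UNIV (positivity_sets :: (real ^ 'n) set set) = sets borel"
proof
 show "sigma_sets UNIV (positivity_sets :: (real ^ 'n) set set) \<subseteq> sets borel"
  using sets.sigma_sets_subset[of positivity_sets borel] positivity_sets_borel by auto
 have op: "S \<in> sigma_sets UNIV positivity_sets" if "open S" for S :: "(real ^ 'n) set"
 proof -
  let ?B = "{B. \<exists>x e. B = ball x e \<and> B \<subseteq> S}"
  obtain F where F: "F \<subseteq> ?B" "countable F" "\<Union>F = \<Union>?B"
  proof (rule Lindelof[of ?B])
   show "open B" if "B \<in> ?B" for B using that by auto
  qed
  have "\<Union>?B = S"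
  proof -
   have "x \<in> \<Union>?B" if x: "x \<in> S" for x
   proof -
    obtain e where "e > 0" "ball x e \<subseteq> S" using \<open>open S\<close> x open_contains_ball by blast
    have "ball x e \<in> ?B" using \<open>ball x e \<subseteq> S\<close> by blast
    moreover have "x \<in> ball x e" using \<open>e > 0\<close> by simp
    ultimately show ?thesis by (rule UnionI)
   qed
   then show ?thesis by blast
  qed
  moreover have "\<Union>F \<in> sigma_sets UNIV positivity_sets"
  proof (rule sigma_sets_UNION[OF F(2)])
   fix B assume "B \<in> F"
   then have "B \<in> positivity_sets" using F(1) ball_in_positivity_sets by blast
   then show "B \<in> sigma_sets UNIV positivity_sets" by (rule sigma_sets.Basic)
  qed
  ultimately show ?thesis using F(3) by simp
 qed
 have "sets borel = sigma_sets UNIV {S :: (real^'n) set. open S}"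
  unfolding borel_def by (rule sets_measure_of) simp
 then show "sets borel \<subseteq> sigma_sets UNIV (positivity_sets :: (real ^ 'n) set set)"
  using sigma_sets_mono[of "{S. open S}" UNIV positivity_sets] op by blast
qed

text \<open>The function t \<mapsto> kt/(1+kt) vanishes at 0, is continuously differentiable on t
  \<ge> 0 and tends to the indicator of t > 0; composition with \<phi> therefore stays in the
  class.\<close>

lemma positivity_sets_approx:
 assumes "C1c \<phi>" "\<And>x::real ^ 'n. \<phi> x \<ge> (0::real)"
 defines "\<phi>k \<equiv> \<lambda>k x. real k * \<phi> x / (1 + real k * \<phi> x)"
 shows "C1c (\<phi>k k)" "0 \<le> \<phi>k k x" "\<phi>k k x \<le> 1" "\<phi> x = 0 \<Longrightarrow> \<phi>k k x = 0"
  "(\<lambda>k. \<phi>k k x) \<longlonglongrightarrow> indicator {x. \<phi> x > 0} x"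
proof -
 have pos: "1 + real k * t > 0" if "t \<ge> 0" for k t using that by (simp add: add_pos_nonneg)
 show "C1c (\<phi>k k)"
  unfolding \<phi>k_def
 proof (rule C1c_compose(1)[OF assms(1), where h="\<lambda>t. real k * t / (1 + real k * t)" and h'="\<lambda>t. real k / (1 + real k * t)\<^sup>2"])
  fix x
  have "1 + real k * \<phi> x \<noteq> 0" using pos[OF assms(2)[of x], of k] by simp
  then show "((\<lambda>t. real k * t / (1 + real k * t)) has_real_derivative real k / (1 + real k * \<phi> x)\<^sup>2) (at (\<phi> x))"
   by (auto intro!: derivative_eq_intros simp: field_simps power2_eq_square)
 next
  have "1 + real k * t \<noteq> 0" if "t \<in> range \<phi>" for t
   using that pos[of t k] assms(2) by fastforce
  then show "continuous_on (range \<phi>) (\<lambda>t. real k / (1 + real k * t)\<^sup>2)"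
   by (intro continuous_intros) auto
 qed simp
 show "0 \<le> \<phi>k k x" using assms(2)[of x] pos[of "\<phi> x" k] by (simp add: \<phi>k_def)
 show "\<phi>k k x \<le> 1" using assms(2)[of x] pos[of "\<phi> x" k] by (simp add: \<phi>k_def)
 show "\<phi> x = 0 \<Longrightarrow> \<phi>k k x = 0" by (simp add: \<phi>k_def)
 show "(\<lambda>k. \<phi>k k x) \<longlonglongrightarrow> indicator {x. \<phi> x > 0} x"
 proof (cases "\<phi> x = 0")
  case False
  then have px: "\<phi> x > 0" using assms(2)[of x] by simp
  have "(\<lambda>k. real k * \<phi> x / (1 + real k * \<phi> x)) \<longlonglongrightarrow> 1"
  proof -
   have "filterlim (\<lambda>k. 1 + real k * \<phi> x) at_top sequentially"
    using px by (intro filterlim_tendsto_add_at_top[OF tendsto_const] filterlim_at_top_mult_tendsto_pos[OF tendsto_const px filterlim_real_sequentially])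
   then have "(\<lambda>k. 1 - 1 / (1 + real k * \<phi> x)) \<longlonglongrightarrow> 1 - 0"
    by (intro tendsto_diff tendsto_const real_tendsto_divide_at_top[OF tendsto_const])
   moreover have "1 - 1 / (1 + real k * \<phi> x) = real k * \<phi> x / (1 + real k * \<phi> x)" for k
    using pos[of "\<phi> x" k] px by (simp add: field_simps)
   ultimately show ?thesis by simp
  qed
  then show ?thesis using px by (simp add: \<phi>k_def)
 qed (simp add: \<phi>k_def)
qed

lemma (in borel_radon) integral_positivity_sets_approx:
 assumes "C1c \<phi>" "\<And>x. \<phi> x \<ge> (0::real)"
 shows "(\<lambda>k. LINT x|\<sigma>. real k * \<phi> x / (1 + real k * \<phi> x)) \<longlonglongrightarrow> measure \<sigma> {x. \<phi> x > 0}"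
proof -
 note ap = positivity_sets_approx[OF assms]
 obtain R where R: "\<And>x. \<phi> x \<noteq> 0 \<Longrightarrow> norm x < R" using C1c_support[OF assms(1)] by metis
 have m: "{x. \<phi> x > 0} \<in> sets borel"
  using measurable_sets[OF C1c_borel[OF assms(1)], of "{0<..}"] by (simp add: vimage_def)
 have "(\<lambda>k. LINT x|\<sigma>. real k * \<phi> x / (1 + real k * \<phi> x)) \<longlonglongrightarrow> (LINT x|\<sigma>. indicator {x. \<phi> x > 0} x)"
 proof (rule integral_dominated_convergence[where w="indicator (cball 0 R)"])
  show "indicat_real {x. \<phi> x > 0} \<in> borel_measurable \<sigma>" using m by simp
  show "(\<lambda>x. real k * \<phi> x / (1 + real k * \<phi> x)) \<in> borel_measurable \<sigma>" for k
   using C1c_borel[OF ap(1)[of k]] by simp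
  show "integrable \<sigma> (indicat_real (cball 0 R))"
   using finite_cball by (intro integrable_real_indicator) (auto simp: less_top)
  show "AE x in \<sigma>. (\<lambda>k. real k * \<phi> x / (1 + real k * \<phi> x)) \<longlonglongrightarrow> indicator {x. \<phi> x > 0} x"
   using ap(5) by simp
  show "AE x in \<sigma>. norm (real k * \<phi> x / (1 + real k * \<phi> x)) \<le> indicator (cball 0 R) x" for k
  proof (intro always_eventually allI)
   fix x
   show "norm (real k * \<phi> x / (1 + real k * \<phi> x)) \<le> indicator (cball 0 R) x"
    using ap(2)[of k x] ap(3)[of k x] ap(4)[of x k] R[of x]
    unfolding real_norm_def abs_of_nonneg[OF ap(2)[of k x]] by (cases "\<phi> x = 0") (simp_all add: less_imp_le)
  qed
 qed
 then show ?thesis using m by simp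
qed

lemma borel_radon_positive_variation: "signed_radon \<nu> \<Longrightarrow> borel_radon (positive_variation \<nu>)"
 by unfold_locales (use positive_variation_finite[OF _ borel_closed[OF closed_cball] bounded_cball] in auto)

text \<open>Agreement on test functions passes to \<open>positivity_sets\<close> by bounded limits
  in both variations. The Dynkin induction runs on intersections with one fixed ball, because
  complements would leave the bounded sets on which the measures are additive.\<close>

lemma signed_radon_eqI:
 fixes \<nu> \<nu>' :: "(real ^ 'n) set \<Rightarrow> real"
 assumes \<nu>: "signed_radon \<nu>" and \<nu>': "signed_radon \<nu>'"
  and eq: "\<And>\<phi> :: real ^ 'n \<Rightarrow> real. C1c \<phi> \<Longrightarrow>
   (LINT x|positive_variation \<nu>. \<phi> x) - (LINT x|positive_variation (\<lambda>A. - \<nu> A). \<phi> x) =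
   (LINT x|positive_variation \<nu>'. \<phi> x) - (LINT x|positive_variation (\<lambda>A. - \<nu>' A). \<phi> x)"
  and A: "A \<in> sets borel" "bounded (A :: (real ^ 'n) set)"
 shows "\<nu> A = \<nu>' A"
proof -
 have G: "\<nu> G = \<nu>' G" if pG: "G \<in> positivity_sets" for G
 proof -
  obtain \<phi> where \<phi>: "G = {x. \<phi> x > 0}" "C1c \<phi>" "\<And>x. \<phi> x \<ge> (0::real)"
   using pG unfolding positivity_sets_def by blast
  obtain R where R: "\<And>x. \<phi> x \<noteq> 0 \<Longrightarrow> norm x < R" using C1c_support[OF \<phi>(2)] by metis
  have G: "G \<in> sets borel"
   using measurable_sets[OF C1c_borel[OF \<phi>(2)], of "{0<..}"] by (simp add: vimage_def \<phi>(1))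
  have "G \<subseteq> cball 0 R"
  proof
   fix x assume "x \<in> G"
   then have "\<phi> x \<noteq> 0" by (simp add: \<phi>(1))
   then show "x \<in> cball 0 R" using R[of x] by simp
  qed
  then have b: "bounded G" by (rule bounded_subset[OF bounded_cball])
  have lim: "(\<lambda>k. (LINT x|positive_variation \<nu>. real k * \<phi> x / (1 + real k * \<phi> x)) -
     (LINT x|positive_variation (\<lambda>A. - \<nu> A). real k * \<phi> x / (1 + real k * \<phi> x))) \<longlonglongrightarrow> \<nu> G"
   if \<nu>: "signed_radon \<nu>" for \<nu>
   unfolding jordan_decomposition[OF \<nu> G b]
   using borel_radon.integral_positivity_sets_approx[OF borel_radon_positive_variation[OF \<nu>] \<phi>(2,3)]
    borel_radon.integral_positivity_sets_approx[OF borel_radon_positive_variation[OF signed_radon_uminus[OF \<nu>]] \<phi>(2,3)]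
   unfolding \<phi>(1)[symmetric] by (rule tendsto_diff)
  show ?thesis
   using LIMSEQ_unique[OF lim[OF \<nu>]] lim[OF \<nu>'] eq[OF positivity_sets_approx(1)[OF \<phi>(2,3)]] by simp
 qed
 obtain R where R: "A \<subseteq> ball 0 R"
  using bounded_subset_ballD[OF A(2), of 0] by blast
 let ?B = "ball (0::real^'n) R"
 have sub: "(positivity_sets :: (real^'n) set set) \<subseteq> Pow UNIV" by simp
 have "A \<in> sigma_sets UNIV positivity_sets" using A(1) by (simp add: sigma_sets_positivity_sets)
 with positivity_sets_Int_stable sub have "\<nu> (A \<inter> ?B) = \<nu>' (A \<inter> ?B)"
 proof (induction rule: sigma_sets_induct_disjoint)
  case (basic G)
  then show ?case
   using positivity_sets_Int_stable ball_in_positivity_sets G unfolding Int_stable_def by blast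
 next
  case empty
  then show ?case using signed_radon_empty[OF \<nu>] signed_radon_empty[OF \<nu>'] by simp
 next
  case (compl C)
  have C: "C \<in> sets borel" using compl(1) by (simp add: sigma_sets_positivity_sets)
  have "(UNIV - C) \<inter> ?B = ?B - C \<inter> ?B" by auto
  then show ?case
   using compl C G[OF ball_in_positivity_sets[of 0 R]]
    signed_radon_Diff[OF \<nu>, of ?B "C \<inter> ?B"] signed_radon_Diff[OF \<nu>', of ?B "C \<inter> ?B"] by simp
 next
  case (union C)
  have C: "C i \<in> sets borel" for i using union(2) by (auto simp: sigma_sets_positivity_sets)
  have b: "bounded (\<Union>i. C i \<inter> ?B)" by (rule bounded_subset[OF bounded_ball]) auto
  have d: "disjoint_family (\<lambda>i. C i \<inter> ?B)" using union(1) by (auto simp: disjoint_family_on_def)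
  have m: "C i \<inter> ?B \<in> sets borel" for i using C by auto
  have "(\<Union>i. C i \<inter> ?B) = (\<Union>i. C i) \<inter> ?B" by auto
  then show ?case
   using signed_radon_sums[OF \<nu> m d b] signed_radon_sums[OF \<nu>' m d b] union(3) sums_unique2 by fastforce
 qed
 moreover have "A \<inter> ?B = A" using R by auto
 ultimately show ?thesis by simp
qed

text \<open>The fields \<open>\<phi> x *\<^sub>R axis i 1\<close> isolate the components. Uniqueness
  gives meaning to the definite description in \<open>gauss_green_measure\<close>.\<close>

lemma gauss_green_measure_unique:
 fixes E :: "(real ^ 'n) set"
 assumes "is_gauss_green_measure E \<mu>" "is_gauss_green_measure E \<mu>'"
 shows "\<mu> = \<mu>'"
proof
 fix A :: "(real ^ 'n) set"
 have rad: "vector_radon_measure \<mu>" "vector_radon_measure \<mu>'"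
  using assms by (auto simp: is_gauss_green_measure_def)
 show "\<mu> A = \<mu>' A"
 proof (cases "A \<in> sets borel \<and> bounded A")
  case True
  show ?thesis
  proof (rule vec_eq_iff[THEN iffD2], rule allI)
   fix i
   have T: "vector_integral \<kappa> (\<lambda>x. \<phi> x *\<^sub>R axis i 1) =
     (LINT x|positive_variation (\<lambda>A. \<kappa> A $ i). \<phi> x) - (LINT x|positive_variation (\<lambda>A. - (\<kappa> A $ i)). \<phi> x)"
    for \<kappa> :: "(real ^ 'n) set \<Rightarrow> real ^ 'n" and \<phi>
   proof -
    have "vector_integral \<kappa> (\<lambda>x. \<phi> x *\<^sub>R axis i 1) =
     (\<Sum>j\<in>UNIV. if j = i then (LINT x|positive_variation (\<lambda>A. \<kappa> A $ i). \<phi> x) - (LINT x|positive_variation (\<lambda>A. - (\<kappa> A $ i)). \<phi> x) else 0)"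
     unfolding vector_integral_def by (intro sum.cong refl) (auto simp: axis_def)
    then show ?thesis by simp
   qed
   show "\<mu> A $ i = \<mu>' A $ i"
   proof (rule signed_radon_eqI[where A=A])
    fix \<phi> :: "real ^ 'n \<Rightarrow> real" assume "C1c \<phi>"
    then have "C1_compactly_supported (\<lambda>x. \<phi> x *\<^sub>R axis i 1 :: real ^ 'n)"
     by (simp add: C1_compactly_supported_iff C1c_scaleR_const)
    then have "vector_integral \<mu> (\<lambda>x. \<phi> x *\<^sub>R axis i 1) = vector_integral \<mu>' (\<lambda>x. \<phi> x *\<^sub>R axis i 1)"
     using assms unfolding is_gauss_green_measure_def by metis
    then show "(LINT x|positive_variation (\<lambda>A. \<mu> A $ i). \<phi> x) - (LINT x|positive_variation (\<lambda>A. - (\<mu> A $ i)). \<phi> x) =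
     (LINT x|positive_variation (\<lambda>A. \<mu>' A $ i). \<phi> x) - (LINT x|positive_variation (\<lambda>A. - (\<mu>' A $ i)). \<phi> x)"
     unfolding T .
   qed (use True rad signed_radon_component in auto)
  qed
 next
  case False
  then show ?thesis using rad unfolding vector_radon_measure_def by metis
 qed
qed

lemma gauss_green_measure_eq: "is_gauss_green_measure E \<mu> \<Longrightarrow> gauss_green_measure E = \<mu>"
 unfolding gauss_green_measure_def
 by (rule the_equality) (auto intro: gauss_green_measure_unique)

lemma (in density_field) is_gauss_green_measure_fm_iff:
 "is_gauss_green_measure E fm \<longleftrightarrow>
   (\<forall>T. C1c T \<longrightarrow> (LINT x:E|lebesgue. divergence T x) = (LINT x|\<sigma>. T x \<bullet> f x))"
proof -
 have "vector_integral fm T = (LINT x|\<sigma>. T x \<bullet> f x)" if T: "C1c T" for T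
 proof -
  obtain R where R: "\<And>x. T x \<noteq> 0 \<Longrightarrow> norm x < R" using C1c_support[OF T] by metis
  obtain K where K: "\<And>x. norm (T x) \<le> K" using C1c_bounded[OF T] by metis
  show ?thesis
   by (rule vector_integral_fm[OF C1c_borel[OF T] K, of R]) (use R less_asym in blast)
 qed
 then show ?thesis
  unfolding is_gauss_green_measure_def C1_compactly_supported_iff
  using vector_radon_measure_fm by auto
qed

lemma (in borel_radon) density_field_components:
 assumes g: "\<And>i. g i \<in> borel_measurable borel" "\<And>i x. \<bar>g i x\<bar> \<le> M"
 shows "density_field \<sigma> (\<lambda>x. \<chi> i. g i x) (real CARD('n) * M)"
proof
 have fsum: "(\<lambda>x. \<chi> i. g i x) = (\<lambda>x. \<Sum>i\<in>UNIV. g i x *\<^sub>R axis i 1)"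
 proof
  fix x show "(\<chi> i. g i x) = (\<Sum>i\<in>UNIV. g i x *\<^sub>R axis i 1)"
   using basis_expansion[of "\<chi> i. g i x", unfolded scalar_mult_eq_scaleR] by simp
 qed
 show "(\<lambda>x. \<chi> i. g i x) \<in> borel_measurable borel" unfolding fsum using g(1) by measurable
 show "norm (\<chi> i. g i x) \<le> real CARD('n) * M" for x
 proof -
  have "norm (\<chi> i. g i x) \<le> (\<Sum>i\<in>UNIV. \<bar>(\<chi> i. g i x) $ i\<bar>)" by (rule norm_le_l1_cart)
  also have "... \<le> (\<Sum>i\<in>(UNIV :: 'n set). M)" using g(2) by (intro sum_mono) simp
  finally show ?thesis by simp
 qed
qed

lemma (in borel_radon) vector_radon_density:
 assumes \<mu>: "vector_radon_measure \<mu>" and M: "M \<ge> 0"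
  and le: "\<And>A i. A \<in> sets borel \<Longrightarrow> bounded A \<Longrightarrow> ennreal \<bar>\<mu> A $ i\<bar> \<le> ennreal M * emeasure \<sigma> A"
 obtains f where "density_field \<sigma> f (real CARD('n) * M)" "\<mu> = density_field.fm \<sigma> f"
proof -
 have "\<exists>g. g \<in> borel_measurable borel \<and> (\<forall>x. \<bar>g x\<bar> \<le> M) \<and>
   (\<forall>A. A \<in> sets borel \<longrightarrow> bounded A \<longrightarrow> \<mu> A $ i = (LINT x:A|\<sigma>. g x))" for i
  using signed_radon_density[OF signed_radon_component[OF \<mu>, of i] M le] by metis
 then obtain g where g: "\<And>i. g i \<in> borel_measurable borel" "\<And>i x. \<bar>g i x\<bar> \<le> M"
   "\<And>i A. A \<in> sets borel \<Longrightarrow> bounded A \<Longrightarrow> \<mu> A $ i = (LINT x:A|\<sigma>. g i x)"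
  by metis
 let ?f = "\<lambda>x. \<chi> i. g i x"
 interpret density_field \<sigma> ?f "real CARD('n) * M" by (rule density_field_components[OF g(1,2)])
 have "\<mu> = fm"
 proof
  fix A
  show "\<mu> A = fm A"
  proof (cases "A \<in> sets borel \<and> bounded A")
   case True
   then show ?thesis
    by (intro vec_eq_iff[THEN iffD2] allI) (simp add: fm_component g(3))
  next
   case False
   then show ?thesis using \<mu> unfolding vector_radon_measure_def fm_def by metis
  qed
 qed
 then show ?thesis using that density_field_axioms by blast
qed

section \<open>Lebesgue points of doubling measures\<close>

text \<open>The exceptional sets of the differentiation theorem are not known to be measurable, so
  nullity is expressed by a measurable null superset.\<close>

lemma null_sets_of_small_covers:
 assumes "\<And>e::real. e > 0 \<Longrightarrow> \<exists>B\<in>sets M. N \<subseteq> B \<and> emeasure M B \<le> ennreal e"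
 shows "\<exists>Z\<in>null_sets M. N \<subseteq> Z"
proof -
 have "\<exists>B. B \<in> sets M \<and> N \<subseteq> B \<and> emeasure M B \<le> ennreal (1 / real (Suc k))" for k
  using assms[of "1 / real (Suc k)"] by auto
 then obtain B where B: "\<And>k. B k \<in> sets M" "\<And>k. N \<subseteq> B k" "\<And>k. emeasure M (B k) \<le> ennreal (1 / real (Suc k))"
  by metis
 have Z: "(\<Inter>k. B k) \<in> sets M" using B(1) by auto
 have "emeasure M (\<Inter>k. B k) \<le> ennreal (1 / real (Suc k))" for k
  using B(1,3)[of k] by (intro order_trans[OF emeasure_mono B(3)]) auto
 moreover have "(\<lambda>k. ennreal (1 / real (Suc k))) \<longlonglongrightarrow> ennreal 0"
  by (intro tendsto_ennrealI lim_1_over_n[THEN LIMSEQ_Suc])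
 ultimately have "emeasure M (\<Inter>k. B k) \<le> ennreal 0"
  by (intro LIMSEQ_le_const) auto
 then have "(\<Inter>k. B k) \<in> null_sets M" using Z by (auto simp: null_sets_def)
 then show ?thesis using B(2) by blast
qed

text \<open>The set \<open>S\<close> carries the measure and contains the centres of the doubling
  balls; 5 is the enlargement factor of the Vitali covering lemma.\<close>

locale doubling_radon = borel_radon \<sigma> for \<sigma> :: "(real ^ 'n) measure" +
 fixes S :: "(real ^ 'n) set" and D r1 :: real
 assumes S_borel: "S \<in> sets borel" and S_null: "emeasure \<sigma> (- S) = 0"
  and r1_pos: "r1 > 0" and D_nonneg: "D \<ge> 0"
  and doubling: "\<And>x r. x \<in> S \<Longrightarrow> 0 < r \<Longrightarrow> r < r1 \<Longrightarrow>
    measure \<sigma> (cball x (5 * r)) \<le> D * measure \<sigma> (ball x r)"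
  and ball_pos: "\<And>x r. x \<in> S \<Longrightarrow> 0 < r \<Longrightarrow> r < r1 \<Longrightarrow> measure \<sigma> (ball x r) > 0"
begin

lemma AE_in_S: "AE x in \<sigma>. x \<in> S"
proof -
 have "- S \<in> null_sets \<sigma>" using S_null S_borel by (auto simp: null_sets_def)
 from AE_not_in[OF this] show ?thesis by simp
qed

text \<open>The restriction \<tau> of \<sigma> to the complement of \<open>A\<close> gives
  \<open>A\<close> mass 0, so \<open>A\<close> lies in an open set of tiny \<tau>-mass. The thin
  balls inside it have at least the share \<open>c\<close> of their \<sigma>-mass in \<tau>; a
  disjoint selection bounds their total mass, and by doubling also that of the fivefold balls, which
  cover \<open>N\<close>.\<close>

lemma small_cover_of_thin_points:
 assumes A: "A \<in> sets borel" and N: "N \<subseteq> A \<inter> S \<inter> ball 0 R" and c: "c > 0"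
  and thin: "\<And>x \<delta>. x \<in> N \<Longrightarrow> \<delta> > 0 \<Longrightarrow>
   \<exists>r. 0 < r \<and> r < \<delta> \<and> c * measure \<sigma> (ball x r) < measure \<sigma> (ball x r - A)"
  and e: "e > 0"
 shows "\<exists>B\<in>sets \<sigma>. N \<subseteq> B \<and> emeasure \<sigma> B \<le> ennreal e"
proof -
 let ?W = "ball (0::real^'n) (R + 1) - A"
 have W: "?W \<in> sets borel" using A by auto
 \<comment> \<open>Cutting to a bounded ball makes \<tau> finite, as outer regularity requires; the
   radius is \<open>R + 1\<close> because the selected radii are at most 1.\<close>
 define \<tau> where "\<tau> = density \<sigma> (indicator ?W)"
 have \<tau>: "emeasure \<tau> X = emeasure \<sigma> (?W \<inter> X)" if "X \<in> sets borel" for X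
  unfolding \<tau>_def using that W by (simp add: emeasure_restricted)
 define e' where "e' = e * c / (D + 1)"
 have e': "e' > 0" using e c D_nonneg by (simp add: e'_def)
 have sp: "sets \<tau> = sets borel" "space \<tau> = UNIV" by (auto simp: \<tau>_def)
 have \<tau>A: "emeasure \<tau> A = 0"
 proof -
  have "?W \<inter> A = {}" by auto
  then show ?thesis using \<tau>[OF A] by simp
 qed
 have "emeasure \<tau> (space \<tau>) \<noteq> \<infinity>"
  using \<tau>[of UNIV] finite_bounded[OF bounded_subset[OF bounded_ball[of 0 "R + 1"], of ?W]] by (auto simp: sp)
 then have "emeasure \<tau> A = (INF U\<in>{U. A \<subseteq> U \<and> open U}. emeasure \<tau> U)"
  by (rule outer_regular[OF sp(1)]) (rule A)
 then have "(INF U\<in>{U. A \<subseteq> U \<and> open U}. emeasure \<tau> U) < ennreal e'" using \<tau>A e' by simp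
 then obtain U where U: "A \<subseteq> U" "open U" "emeasure \<tau> U < ennreal e'"
  by (auto simp: INF_less_iff)
 have "\<exists>r. 0 < r \<and> r \<le> 1 \<and> r < r1 \<and> ball x r \<subseteq> U \<inter> ball 0 (R + 1) \<and>
   c * measure \<sigma> (ball x r) < measure \<sigma> (ball x r - A)" if x: "x \<in> N" for x
 proof -
  have "x \<in> U" using x N U(1) by auto
  then obtain d where d: "d > 0" "ball x d \<subseteq> U" using U(2) open_contains_ball by blast
  obtain r where r: "0 < r" "r < min d (min 1 r1)" "c * measure \<sigma> (ball x r) < measure \<sigma> (ball x r - A)"
   using thin[OF x, of "min d (min 1 r1)"] d(1) r1_pos by auto
  have "ball x r \<subseteq> ball 0 (R + 1)"
  proof
   fix y assume "y \<in> ball x r"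
   then have "dist 0 y < R + 1"
    using x N r(2) dist_triangle[of 0 y x] by force
   then show "y \<in> ball 0 (R + 1)" by simp
  qed
  moreover have "ball x r \<subseteq> U" using d(2) r(2) by (meson less_imp_le min_less_iff_conj order_trans subset_ball)
  ultimately show ?thesis using r by auto
 qed
 then obtain r where r: "\<And>x. x \<in> N \<Longrightarrow> 0 < r x \<and> r x \<le> 1" "\<And>x. x \<in> N \<Longrightarrow> r x < r1"
  "\<And>x. x \<in> N \<Longrightarrow> ball x (r x) \<subseteq> U \<inter> ball 0 (R + 1)"
  "\<And>x. x \<in> N \<Longrightarrow> c * measure \<sigma> (ball x (r x)) < measure \<sigma> (ball x (r x) - A)"
  by metis
 have "N \<subseteq> (\<Union>x\<in>N. cball x (r x))" using r(1) by (auto intro!: bexI simp: less_imp_le)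
 from Vitali_covering_lemma_cballs[where S=N and K=N and a="\<lambda>x. x" and r=r and B=1, OF this r(1)]
 obtain C where C: "countable C" "C \<subseteq> N" "pairwise (\<lambda>i j. disjnt (cball i (r i)) (cball j (r j))) C"
   "N \<subseteq> (\<Union>i\<in>C. cball i (5 * r i))" by auto
 define X where "X i = (if i \<in> to_nat_on C ` C then cball (from_nat_into C i) (5 * r (from_nat_into C i)) else {})" for i
 define Y where "Y i = (if i \<in> to_nat_on C ` C then ball (from_nat_into C i) (r (from_nat_into C i)) else {})" for i
 have inC: "from_nat_into C i \<in> C" if "i \<in> to_nat_on C ` C" for i using that C(1) by auto
 have XB: "X i \<in> sets borel" "Y i \<in> sets borel" for i by (auto simp: X_def Y_def)
 have "N \<subseteq> (\<Union>i. X i)"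
 proof
  fix x assume "x \<in> N"
  then obtain z where z: "z \<in> C" "x \<in> cball z (5 * r z)" using C(4) by auto
  then have "x \<in> X (to_nat_on C z)" using C(1) by (simp add: X_def)
  then show "x \<in> (\<Union>i. X i)" by blast
 qed
 moreover have "emeasure \<sigma> (\<Union>i. X i) \<le> ennreal e"
 proof -
  have Ydisj: "disjoint_family Y"
   unfolding disjoint_family_on_def
  proof (intro ballI impI)
   fix i j :: nat assume ij: "i \<noteq> j"
   show "Y i \<inter> Y j = {}"
   proof (cases "i \<in> to_nat_on C ` C \<and> j \<in> to_nat_on C ` C")
    case True
    then have "from_nat_into C i \<noteq> from_nat_into C j"
     using C(1) ij by (metis to_nat_on_from_nat_into)
    then have "disjnt (cball (from_nat_into C i) (r (from_nat_into C i))) (cball (from_nat_into C j) (r (from_nat_into C j)))"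
     using C(3) inC True unfolding pairwise_def by blast
    then have "disjnt (ball (from_nat_into C i) (r (from_nat_into C i))) (ball (from_nat_into C j) (r (from_nat_into C j)))"
     by (meson ball_subset_cball disjnt_subset1 disjnt_subset2)
    then show ?thesis
     using True by (simp add: Y_def disjnt_def)
   qed (auto simp: Y_def)
  qed
  have YU: "(\<Union>i. Y i) \<subseteq> U"
  proof (rule UN_least)
   fix i
   show "Y i \<subseteq> U"
   proof (cases "i \<in> to_nat_on C ` C")
    case True
    then have "from_nat_into C i \<in> N" using inC C(2) by blast
    from r(3)[OF this] show ?thesis using True by (simp add: Y_def)
   qed (simp add: Y_def)
  qed
  have step: "emeasure \<sigma> (X i) \<le> ennreal (D / c) * emeasure \<tau> (Y i)" for i
  proof (cases "i \<in> to_nat_on C ` C")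
   case True
   define x where "x = from_nat_into C i"
   have x: "x \<in> N" using inC[OF True] C(2) by (auto simp: x_def)
   have xS: "x \<in> S" using x N by auto
   have "measure \<sigma> (cball x (5 * r x)) \<le> D * measure \<sigma> (ball x (r x))"
    using doubling[OF xS] r(1,2)[OF x] by auto
   also have "... \<le> D * (measure \<sigma> (ball x (r x) - A) / c)"
    using r(4)[OF x] c D_nonneg by (intro mult_left_mono) (auto simp: pos_le_divide_eq mult.commute)
   finally have 1: "measure \<sigma> (cball x (5 * r x)) \<le> D / c * measure \<sigma> (ball x (r x) - A)" by simp
   have "?W \<inter> ball x (r x) = ball x (r x) - A" using r(3)[OF x] by auto
   then have "emeasure \<tau> (ball x (r x)) = emeasure \<sigma> (ball x (r x) - A)" by (simp add: \<tau>)
   also have "... = ennreal (measure \<sigma> (ball x (r x) - A))"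
    by (intro emeasure_eq_measure_bounded bounded_subset[OF bounded_ball]) auto
   finally have 2: "emeasure \<tau> (ball x (r x)) = ennreal (measure \<sigma> (ball x (r x) - A))" .
   have "emeasure \<sigma> (cball x (5 * r x)) \<le> ennreal (D / c) * emeasure \<tau> (ball x (r x))"
    unfolding 2 emeasure_eq_measure_bounded[OF bounded_cball]
    using 1 D_nonneg c by (simp add: ennreal_mult''[symmetric] ennreal_leI)
   then show ?thesis using True by (simp add: X_def Y_def x_def)
  qed (simp add: X_def)
  have "emeasure \<sigma> (\<Union>i. X i) \<le> (\<Sum>i. emeasure \<sigma> (X i))"
   using XB by (intro emeasure_subadditive_countably) auto
  also have "... \<le> (\<Sum>i. ennreal (D / c) * emeasure \<tau> (Y i))"
   by (intro suminf_le step summableI)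
  also have "... = ennreal (D / c) * (\<Sum>i. emeasure \<tau> (Y i))" by simp
  also have "(\<Sum>i. emeasure \<tau> (Y i)) = emeasure \<tau> (\<Union>i. Y i)"
   using XB Ydisj by (intro suminf_emeasure) (auto simp: sp)
  also have "ennreal (D / c) * emeasure \<tau> (\<Union>i. Y i) \<le> ennreal (D / c) * ennreal e'"
  proof (rule mult_left_mono)
   have "emeasure \<tau> (\<Union>i. Y i) \<le> emeasure \<tau> U"
    using YU U(2) by (intro emeasure_mono) (auto simp: sp)
   then show "emeasure \<tau> (\<Union>i. Y i) \<le> ennreal e'" using U(3) by simp
  qed simp
  also have "... = ennreal (D / c * e')" using e' by (intro ennreal_mult''[symmetric]) simp
  also have "... \<le> ennreal e"
  proof (rule ennreal_leI)
   have "D / c * e' = D * e / (D + 1)" using c by (simp add: e'_def)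
   also have "... \<le> e" using D_nonneg e by (simp add: divide_le_eq algebra_simps)
   finally show "D / c * e' \<le> e" .
  qed
  finally show ?thesis .
 qed
 moreover have "(\<Union>i. X i) \<in> sets \<sigma>" using XB by auto
 ultimately show ?thesis by blast
qed

text \<open>A point of \<open>A\<close> that is not a density point is thin for some ratio
  \<open>1 / real (Suc k)\<close> at arbitrarily small radii; countably many null sets collect these
  points.\<close>

theorem density_points:
 assumes A: "A \<in> sets borel"
 shows "AE x in \<sigma>. x \<in> A \<longrightarrow> ((\<lambda>r. measure \<sigma> (ball x r - A) / measure \<sigma> (ball x r)) \<longlongrightarrow> 0) (at_right 0)"
proof -
 define N where "N R k = {x \<in> A \<inter> S \<inter> ball 0 (real R). \<forall>\<delta>>0. \<exists>r. 0 < r \<and> r < \<delta> \<and>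
   1 / real (Suc k) * measure \<sigma> (ball x r) < measure \<sigma> (ball x r - A)}" for R k
 have "\<exists>Z\<in>null_sets \<sigma>. N R k \<subseteq> Z" for R k
 proof (rule null_sets_of_small_covers, rule small_cover_of_thin_points[OF A])
  show "N R k \<subseteq> A \<inter> S \<inter> ball 0 (real R)" by (auto simp: N_def)
  show "1 / real (Suc k) > 0" by simp
 qed (auto simp: N_def)
 then obtain Z where Z: "\<And>R k. Z R k \<in> null_sets \<sigma>" "\<And>R k. N R k \<subseteq> Z R k" by metis
 have "AE x in \<sigma>. x \<notin> Z R k" for R k by (rule AE_not_in[OF Z(1)])
 then have "AE x in \<sigma>. \<forall>R k. x \<notin> Z R k" by (simp add: AE_all_countable)
 then show ?thesis using AE_in_S
 proof eventually_elim
  case (elim x)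
  show ?case
  proof (intro impI tendstoI)
   fix e :: real assume x: "x \<in> A" and e: "e > 0"
   obtain k where k: "1 / real (Suc k) < e" using e nat_approx_posE by blast
   obtain R where R: "norm x < real R" using reals_Archimedean2 by blast
   have "x \<notin> N R k" using elim Z(2) by blast
   then have "\<not> (\<forall>\<delta>>0. \<exists>r. 0 < r \<and> r < \<delta> \<and>
     1 / real (Suc k) * measure \<sigma> (ball x r) < measure \<sigma> (ball x r - A))"
    using x elim R by (simp add: N_def)
   then obtain \<delta> where \<delta>: "\<delta> > 0" "\<And>r. 0 < r \<Longrightarrow> r < \<delta> \<Longrightarrow>
     measure \<sigma> (ball x r - A) \<le> 1 / real (Suc k) * measure \<sigma> (ball x r)"
    by (meson not_less)
   have "\<bar>measure \<sigma> (ball x r - A) / measure \<sigma> (ball x r)\<bar> < e" if "0 < r" "r < min \<delta> r1" for r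
   proof -
    have p: "measure \<sigma> (ball x r) > 0" using ball_pos elim that by simp
    have "measure \<sigma> (ball x r - A) / measure \<sigma> (ball x r) \<le> 1 / real (Suc k)"
     using \<delta>(2)[of r] that p by (simp add: pos_divide_le_eq)
    then show ?thesis using k p by simp
   qed
   moreover have "min \<delta> r1 > 0" using \<delta>(1) r1_pos by simp
   ultimately show "\<forall>\<^sub>F r in at_right 0. dist (measure \<sigma> (ball x r - A) / measure \<sigma> (ball x r)) 0 < e"
    unfolding eventually_at_right_field by (intro exI[of _ "min \<delta> r1"]) (auto simp: dist_real_def)
  qed
 qed
qed

text \<open>The values are cut into countably many pieces of small diameter. At a density point of
  the preimage of its own piece, \<open>h\<close> is nearly constant on that preimage, and the rest
  has vanishing relative mass, where boundedness of \<open>h\<close> suffices.\<close>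

theorem lebesgue_points:
 fixes h :: "real ^ 'n \<Rightarrow> 'b::{banach, second_countable_topology}"
 assumes h [measurable]: "h \<in> borel_measurable borel" and K: "\<And>x. norm (h x) \<le> K"
 shows "AE x in \<sigma>. ((\<lambda>r. (LINT y:ball x r|\<sigma>. h y) /\<^sub>R measure \<sigma> (ball x r)) \<longlongrightarrow> h x) (at_right 0)"
proof -
 have K0: "K \<ge> 0" using K norm_ge_zero order_trans by blast
 have "\<exists>P :: nat \<Rightarrow> 'b set. (\<Union>j. P j) = UNIV \<and> (\<forall>j. P j \<in> sets borel) \<and>
   (\<forall>j v w. v \<in> P j \<longrightarrow> w \<in> P j \<longrightarrow> norm (v - w) \<le> 1 / real (Suc m))" for m
 proof -
  obtain P :: "nat \<Rightarrow> 'b set" where "(\<Union>j. P j) = UNIV" "\<And>j. P j \<in> sets borel"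
    "\<And>j v w. v \<in> P j \<Longrightarrow> w \<in> P j \<Longrightarrow> norm (v - w) \<le> 1 / real (Suc m)"
   by (rule borel_partition_small_diameter[of "1 / real (Suc m)", where 'a='b]) (auto simp del: of_nat_Suc)
  then show ?thesis by (intro exI[of _ P]) blast
 qed
 then obtain P :: "nat \<Rightarrow> nat \<Rightarrow> 'b set" where P: "\<And>m. (\<Union>j. P m j) = UNIV" "\<And>m j. P m j \<in> sets borel"
   "\<And>m j v w. v \<in> P m j \<Longrightarrow> w \<in> P m j \<Longrightarrow> norm (v - w) \<le> 1 / real (Suc m)"
  by metis
 have m: "h -` P m j \<in> sets borel" for m j
  using measurable_sets[OF h P(2)] by simp
 have "AE x in \<sigma>. x \<in> h -` P m j \<longrightarrow>
   ((\<lambda>r. measure \<sigma> (ball x r - h -` P m j) / measure \<sigma> (ball x r)) \<longlongrightarrow> 0) (at_right 0)" for m j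
  by (rule density_points[OF m])
 then have "AE x in \<sigma>. \<forall>m j. x \<in> h -` P m j \<longrightarrow>
   ((\<lambda>r. measure \<sigma> (ball x r - h -` P m j) / measure \<sigma> (ball x r)) \<longlongrightarrow> 0) (at_right 0)"
  by (simp only: AE_all_countable) blast
 then show ?thesis using AE_in_S
 proof eventually_elim
  case (elim x)
  show ?case
  proof (rule tendstoI)
   fix e :: real assume e: "e > 0"
   obtain m where m1: "1 / real (Suc m) < e / 2" using e nat_approx_posE[of "e/2"] by auto
   obtain j where j: "h x \<in> P m j" using P(1)[of m] by (metis UNIV_I UN_E)
   let ?A = "h -` P m j"
   have "((\<lambda>r. measure \<sigma> (ball x r - ?A) / measure \<sigma> (ball x r)) \<longlongrightarrow> 0) (at_right 0)"
    using elim j by blast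
   then have "((\<lambda>r. 2 * K * (measure \<sigma> (ball x r - ?A) / measure \<sigma> (ball x r))) \<longlongrightarrow> 2 * K * 0) (at_right 0)"
    by (intro tendsto_mult tendsto_const)
   then have ev: "\<forall>\<^sub>F r in at_right 0. 2 * K * (measure \<sigma> (ball x r - ?A) / measure \<sigma> (ball x r)) < e / 2"
    using e by (intro order_tendstoD(2)) auto
   have ev2: "\<forall>\<^sub>F r in at_right 0. 0 < r \<and> r < r1"
    unfolding eventually_at_right_field using r1_pos by auto
   from ev ev2 show "\<forall>\<^sub>F r in at_right 0. dist ((LINT y:ball x r|\<sigma>. h y) /\<^sub>R measure \<sigma> (ball x r)) (h x) < e"
   proof eventually_elim
    case (elim r)
    let ?B = "ball x r" and ?m = "measure \<sigma> (ball x r)"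
    have p: "?m > 0" using ball_pos \<open>x \<in> S\<close> elim by simp
    have Bb: "?B \<in> sets borel" "bounded ?B" by auto
    have BA: "?B - ?A \<in> sets borel" "bounded (?B - ?A)" using m by (auto intro: bounded_subset[OF bounded_ball])
    have ih: "integrable \<sigma> (\<lambda>y. indicator ?B y *\<^sub>R h y)"
     using set_integrable_bdd[OF h Bb K] unfolding set_integrable_def .
    have ic: "integrable \<sigma> (\<lambda>y. indicator ?B y *\<^sub>R c)" for c :: "'c::{banach, second_countable_topology}"
     using set_integrable_bdd[OF _ Bb, of "\<lambda>_. c" "norm c"] unfolding set_integrable_def by simp
    have ic2: "integrable \<sigma> (\<lambda>y. indicator (?B - ?A) y *\<^sub>R (2 * K))"
     using set_integrable_bdd[OF _ BA, of "\<lambda>_. 2 * K" "norm (2 * K)"] unfolding set_integrable_def by simp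
    have "(LINT y:?B|\<sigma>. h y) - ?m *\<^sub>R h x = (LINT y|\<sigma>. indicator ?B y *\<^sub>R h y - indicator ?B y *\<^sub>R h x)"
     unfolding set_lebesgue_integral_def using ih ic[of "h x"] Bb finite_bounded[OF Bb(2)] by simp
    also have "norm ... \<le> (LINT y|\<sigma>. norm (indicator ?B y *\<^sub>R h y - indicator ?B y *\<^sub>R h x))"
     by (rule integral_norm_bound)
    also have "... \<le> (LINT y|\<sigma>. indicator ?B y *\<^sub>R (1 / real (Suc m)) + indicator (?B - ?A) y *\<^sub>R (2 * K))"
    proof (intro integral_mono integrable_norm Bochner_Integration.integrable_diff Bochner_Integration.integrable_add ih ic ic2)
     fix y
     have "norm (h y - h x) \<le> 2 * K" using norm_triangle_ineq4[of "h y" "h x"] K[of x] K[of y] by linarith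
     moreover have "norm (h y - h x) \<le> 1 / real (Suc m)" if "y \<in> ?A" using P(3)[of "h y" m j "h x"] j that by simp
     ultimately show "norm (indicator ?B y *\<^sub>R h y - indicator ?B y *\<^sub>R h x) \<le>
       indicator ?B y *\<^sub>R (1 / real (Suc m)) + indicator (?B - ?A) y *\<^sub>R (2 * K)"
      by (cases "y \<in> ?B"; cases "y \<in> ?A") (auto simp: add_increasing)
    qed
    also have "... = 1 / real (Suc m) * ?m + 2 * K * measure \<sigma> (?B - ?A)"
     using ic[of "1 / real (Suc m)"] ic2 finite_bounded[OF Bb(2)] finite_bounded[OF BA(2)] Bb BA
     by (subst Bochner_Integration.integral_add) (auto simp: mult.commute)
    finally have 1: "norm ((LINT y:?B|\<sigma>. h y) - ?m *\<^sub>R h x) \<le> 1 / real (Suc m) * ?m + 2 * K * measure \<sigma> (?B - ?A)" .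
    have "(LINT y:?B|\<sigma>. h y) /\<^sub>R ?m - h x = ((LINT y:?B|\<sigma>. h y) - ?m *\<^sub>R h x) /\<^sub>R ?m"
     using p by (simp add: scaleR_diff_right)
    then have "dist ((LINT y:?B|\<sigma>. h y) /\<^sub>R ?m) (h x) = norm ((LINT y:?B|\<sigma>. h y) - ?m *\<^sub>R h x) / ?m"
     using p by (simp add: dist_norm divide_inverse mult.commute)
    also have "... \<le> (1 / real (Suc m) * ?m + 2 * K * measure \<sigma> (?B - ?A)) / ?m"
     using 1 p by (intro divide_right_mono) auto
    also have "... = 1 / real (Suc m) + 2 * K * (measure \<sigma> (?B - ?A) / ?m)"
     using p by (simp add: add_divide_distrib)
    also have "... < e" using elim(1) m1 by simp
    finally show ?case .
   qed
  qed
 qed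
qed

end

section \<open>The reduced boundary\<close>

locale gauss_green_density = density_field \<sigma> f M for \<sigma> :: "(real ^ 'n) measure" and f M +
 fixes E :: "(real ^ 'n) set"
 assumes E_lebesgue: "E \<in> sets lebesgue"
  and gg_fm: "is_gauss_green_measure E fm"
begin

lemma gauss_green_measure_E: "gauss_green_measure E = fm"
 by (rule gauss_green_measure_eq[OF gg_fm])

lemma perimeter_measure_E: "perimeter_measure E = density \<sigma> (\<lambda>x. ennreal (norm (f x)))"
 unfolding perimeter_measure_def gauss_green_measure_E by (rule total_variation_fm)

lemma gauss_green: "C1c T \<Longrightarrow> (LINT x:E|lebesgue. divergence T x) = (LINT x|\<sigma>. T x \<bullet> f x)"
 using gg_fm unfolding is_gauss_green_measure_fm_iff by blast

lemma measure_perimeter_bounded: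
 assumes "A \<in> sets borel" "bounded A"
 shows "emeasure (perimeter_measure E) A = ennreal (LINT x:A|\<sigma>. norm (f x))"
  "measure (perimeter_measure E) A = (LINT x:A|\<sigma>. norm (f x))"
proof -
 show 1: "emeasure (perimeter_measure E) A = ennreal (LINT x:A|\<sigma>. norm (f x))"
  unfolding perimeter_measure_E by (rule emeasure_norm_density[OF assms])
 have "(LINT x:A|\<sigma>. norm (f x)) \<ge> 0"
  unfolding set_lebesgue_integral_def by (intro integral_nonneg_AE) auto
 then show "measure (perimeter_measure E) A = (LINT x:A|\<sigma>. norm (f x))"
  by (simp add: measure_def 1)
qed

lemma normal_quotient_E:
 "normal_quotient E x r = (LINT y:ball x r|\<sigma>. f y) /\<^sub>R (LINT y:ball x r|\<sigma>. norm (f y))"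
 by (simp add: normal_quotient_def gauss_green_measure_E measure_perimeter_bounded fm_def)

lemma support_iff:
 "x \<in> measure_support (perimeter_measure E) \<longleftrightarrow> (\<forall>r>0. (LINT y:ball x r|\<sigma>. norm (f y)) > 0)"
 by (simp add: measure_support_def measure_perimeter_bounded)

lemma closed_support: "closed (measure_support (perimeter_measure E))"
proof -
 have "open (- measure_support (perimeter_measure E))"
  unfolding open_contains_ball
 proof
  fix x assume "x \<in> - measure_support (perimeter_measure E)"
  then obtain r where r: "r > 0" "emeasure (perimeter_measure E) (ball x r) = 0"
   by (auto simp: measure_support_def)
  have "ball x r \<subseteq> - measure_support (perimeter_measure E)"
  proof
   fix y assume "y \<in> ball x r"
   then have y: "r - dist x y > 0" "ball y (r - dist x y) \<subseteq> ball x r"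
    by (auto simp: ball_subset_ball_iff dist_commute)
   have "emeasure (perimeter_measure E) (ball y (r - dist x y)) \<le> emeasure (perimeter_measure E) (ball x r)"
    using y(2) by (intro emeasure_mono) (auto simp: perimeter_measure_E)
   then have "\<not> emeasure (perimeter_measure E) (ball y (r - dist x y)) > 0" using r(2) by simp
   then have "\<not> (\<forall>s>0. emeasure (perimeter_measure E) (ball y s) > 0)" using y(1) by blast
   then show "y \<in> - measure_support (perimeter_measure E)"
    unfolding measure_support_def by simp
  qed
  then show "\<exists>e>0. ball x e \<subseteq> - measure_support (perimeter_measure E)" using r(1) by blast
 qed
 then show ?thesis by (simp add: closed_def)
qed

lemma ball_integral_borel:
 fixes h :: "real ^ 'n \<Rightarrow> 'b::{banach, second_countable_topology}"
 assumes [measurable]: "h \<in> borel_measurable borel"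
 shows "(\<lambda>x. LINT y:ball x r|\<sigma>. h y) \<in> borel_measurable borel"
proof -
 have "(\<lambda>x. LINT y|\<sigma>. indicator {p. dist (fst p) (snd p) < r} (x, y) *\<^sub>R h y) \<in> borel_measurable borel"
 proof (rule borel_measurable_lebesgue_integral)
  have "open {p :: (real^'n) \<times> (real^'n). dist (fst p) (snd p) < r}"
   by (intro open_Collect_less continuous_intros)
  then have [measurable]: "{p :: (real^'n) \<times> (real^'n). dist (fst p) (snd p) < r} \<in> sets (borel \<Otimes>\<^sub>M borel)"
   unfolding borel_prod by (rule borel_open)
  have "(\<lambda>p. indicator {p. dist (fst p) (snd p) < r} p *\<^sub>R h (snd p)) \<in> borel_measurable (borel \<Otimes>\<^sub>M borel)"
   by measurable
  then show "(\<lambda>(x, y). indicator {p. dist (fst p) (snd p) < r} (x, y) *\<^sub>R h y) \<in> borel_measurable (borel \<Otimes>\<^sub>M \<sigma>)"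
   by (simp add: case_prod_beta' cong: measurable_cong_sets)
 qed
 moreover have "indicator {p. dist (fst p) (snd p) < r} (x, y) *\<^sub>R h y = indicator (ball x r) y *\<^sub>R h y" for x y
  by (simp add: indicator_def)
 ultimately show ?thesis by (simp add: set_lebesgue_integral_def)
qed

lemma ball_integral_left_continuous:
 fixes h :: "real ^ 'n \<Rightarrow> 'b::{banach, second_countable_topology}"
 assumes [measurable]: "h \<in> borel_measurable borel" and K: "\<And>x. norm (h x) \<le> K"
  and q: "q \<longlonglongrightarrow> r" "\<And>k. q k < r"
 shows "(\<lambda>k. LINT y:ball x (q k)|\<sigma>. h y) \<longlonglongrightarrow> (LINT y:ball x r|\<sigma>. h y)"
 unfolding set_lebesgue_integral_def
proof (rule integral_dominated_convergence[where w="\<lambda>y. K * indicator (ball x r) y"])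
 have [measurable]: "ball x s \<in> sets borel" for s by simp
 show "(\<lambda>y. indicator (ball x r) y *\<^sub>R h y) \<in> borel_measurable \<sigma>"
  "(\<lambda>y. indicator (ball x (q k)) y *\<^sub>R h y) \<in> borel_measurable \<sigma>" for k by measurable
 show "integrable \<sigma> (\<lambda>y. K * indicator (ball x r) y)"
  using finite_bounded[of "ball x r"] by (intro integrable_mult_right integrable_real_indicator) auto
 show "AE y in \<sigma>. (\<lambda>k. indicator (ball x (q k)) y *\<^sub>R h y) \<longlonglongrightarrow> indicator (ball x r) y *\<^sub>R h y"
 proof (rule always_eventually, rule allI, rule tendsto_eventually)
  fix y
  show "\<forall>\<^sub>F k in sequentially. indicator (ball x (q k)) y *\<^sub>R h y = indicator (ball x r) y *\<^sub>R h y"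
  proof (cases "dist x y < r")
   case True
   from order_tendstoD(1)[OF q(1) this] show ?thesis by eventually_elim (use True in simp)
  next
   case False
   then have "\<not> dist x y < q k" for k using q(2)[of k] by linarith
   then show ?thesis using False by (intro always_eventually) simp
  qed
 qed
 show "AE y in \<sigma>. norm (indicator (ball x (q k)) y *\<^sub>R h y) \<le> K * indicator (ball x r) y" for k
  using K less_trans[OF _ q(2)[of k]] order_trans[OF norm_ge_zero K] by (intro always_eventually) (auto simp: indicator_def)
qed

lemma normal_quotient_borel: "(\<lambda>x. normal_quotient E x r) \<in> borel_measurable borel"
 unfolding normal_quotient_E using ball_integral_borel[OF f_borel, of r]
  ball_integral_borel[of "\<lambda>y. norm (f y)" r] by measurable

text \<open>Smaller open balls exhaust an open ball, so numerator and denominator are continuous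
  from the left; the support condition keeps the denominator away from 0.\<close>

lemma normal_quotient_left_continuous:
 assumes "x \<in> measure_support (perimeter_measure E)" "r > 0"
  and q: "q \<longlonglongrightarrow> r" "\<And>k. q k < r"
 shows "(\<lambda>k. normal_quotient E x (q k)) \<longlonglongrightarrow> normal_quotient E x r"
proof -
 have "(LINT y:ball x r|\<sigma>. norm (f y)) \<noteq> 0" using assms(1,2) support_iff by force
 then show ?thesis
  unfolding normal_quotient_E
  by (intro tendsto_scaleR tendsto_inverse ball_integral_left_continuous[OF _ _ q, where K=M]) (auto simp: f_bound)
qed

lemma rational_sequence_below:
 assumes "(0::real) < r"
 obtains q where "q \<longlonglongrightarrow> r" "\<And>k. q k < r" "\<And>k. 0 < q k" "\<And>k. q k \<in> \<rat>"
proof -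
 have "\<exists>q\<in>\<rat>. max 0 (r - 1 / real (Suc k)) < q \<and> q < r" for k
  by (rule Rats_dense_in_real) (use assms in simp)
 then obtain q where q: "\<And>k. q k \<in> \<rat>" "\<And>k. 0 < q k" "\<And>k. r - 1 / real (Suc k) < q k" "\<And>k. q k < r"
  unfolding max_less_iff_conj by metis
 have "(\<lambda>k. r - 1 / real (Suc k)) \<longlonglongrightarrow> r - 0" by (intro tendsto_intros lim_1_over_n[THEN LIMSEQ_Suc])
 then have "q \<longlonglongrightarrow> r"
  by (intro tendsto_sandwich[of "\<lambda>k. r - 1 / real (Suc k)" q _ "\<lambda>k. r"] always_eventually allI less_imp_le q) simp_all
 then show ?thesis using that q by blast
qed

text \<open>\<open>lim\<close> along one sequence of radii is a total measurable function, and it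
  equals the limit of \<open>normal_quotient\<close> wherever that exists.\<close>

definition limit_normal :: "real ^ 'n \<Rightarrow> real ^ 'n" where
 "limit_normal x = lim (\<lambda>k. normal_quotient E x (1 / real (Suc k)))"

lemma limit_normal_borel: "limit_normal \<in> borel_measurable borel"
 unfolding limit_normal_def using normal_quotient_borel by (intro borel_measurable_lim_metric)

lemma limit_normal_eq:
 assumes "(normal_quotient E x \<longlongrightarrow> v) (at_right 0)" shows "limit_normal x = v"
proof -
 have "filterlim (\<lambda>k. 1 / real (Suc k)) (at_right 0) sequentially"
  using lim_1_over_n[THEN LIMSEQ_Suc] by (intro filterlim_at[THEN iffD2] conjI) (auto intro!: always_eventually)
 from filterlim_compose[OF assms this] show ?thesis
  unfolding limit_normal_def by (rule limI)
qed

lemma outer_normal_eq: "outer_normal E x = (if x \<in> reduced_boundary E then limit_normal x else 0)"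
proof (cases "x \<in> reduced_boundary E")
 case True
 then obtain v where "(normal_quotient E x \<longlongrightarrow> v) (at_right 0)" by (auto simp: reduced_boundary_def)
 then show ?thesis using True limit_normal_eq tendsto_Lim[OF trivial_limit_at_right_real] by (simp add: outer_normal_def)
qed (simp add: outer_normal_def)

text \<open>The normal quotient is left continuous in the radius, so rational radii suffice.\<close>

lemma reduced_boundary_eq:
 "reduced_boundary E = measure_support (perimeter_measure E) \<inter> {x. norm (limit_normal x) = 1} \<inter>
   (\<Inter>m::nat. \<Union>k::nat. \<Inter>q\<in>{q. q \<in> \<rat> \<and> 0 < q \<and> q < 1 / real (Suc k)}.
    {x. norm (normal_quotient E x q - limit_normal x) \<le> 1 / real (Suc m)})"
 (is "_ = ?S \<inter> _ \<inter> ?I")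
proof (rule set_eqI)
 fix x
 show "x \<in> reduced_boundary E \<longleftrightarrow> x \<in> ?S \<inter> {x. norm (limit_normal x) = 1} \<inter> ?I"
 proof
  assume x: "x \<in> reduced_boundary E"
  then obtain v where v: "norm v = 1" "(normal_quotient E x \<longlongrightarrow> v) (at_right 0)" "x \<in> ?S"
   by (auto simp: reduced_boundary_def)
  have lv: "limit_normal x = v" by (rule limit_normal_eq[OF v(2)])
  have "\<exists>k. \<forall>q. q \<in> \<rat> \<and> 0 < q \<and> q < 1 / real (Suc k) \<longrightarrow> norm (normal_quotient E x q - limit_normal x) \<le> 1 / real (Suc m)" for m
  proof -
   have "\<forall>\<^sub>F r in at_right 0. dist (normal_quotient E x r) v < 1 / real (Suc m)"
    by (rule tendstoD[OF v(2)]) simp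
   then obtain b where b: "b > 0" "\<And>r. 0 < r \<Longrightarrow> r < b \<Longrightarrow> dist (normal_quotient E x r) v < 1 / real (Suc m)"
    unfolding eventually_at_right_field by blast
   obtain k where k: "1 / real (Suc k) < b" using b(1) nat_approx_posE by blast
   have "norm (normal_quotient E x q - limit_normal x) \<le> 1 / real (Suc m)" if "0 < q" "q < 1 / real (Suc k)" for q
    using b(2)[of q] that k by (simp add: dist_norm lv)
   then show ?thesis by blast
  qed
  then show "x \<in> ?S \<inter> {x. norm (limit_normal x) = 1} \<inter> ?I"
   using v lv by auto
 next
  assume x: "x \<in> ?S \<inter> {x. norm (limit_normal x) = 1} \<inter> ?I"
  have "(normal_quotient E x \<longlongrightarrow> limit_normal x) (at_right 0)"
  proof (rule tendstoI)
   fix e :: real assume "e > 0"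
   then obtain m where m: "1 / real (Suc m) < e" using nat_approx_posE by blast
   obtain k where k: "\<And>q. q \<in> \<rat> \<Longrightarrow> 0 < q \<Longrightarrow> q < 1 / real (Suc k) \<Longrightarrow> norm (normal_quotient E x q - limit_normal x) \<le> 1 / real (Suc m)"
   proof -
    have "x \<in> (\<Union>k::nat. \<Inter>q\<in>{q. q \<in> \<rat> \<and> 0 < q \<and> q < 1 / real (Suc k)}.
     {x. norm (normal_quotient E x q - limit_normal x) \<le> 1 / real (Suc m)})" using x by blast
    then show ?thesis using that by blast
   qed
   have "dist (normal_quotient E x r) (limit_normal x) < e" if r: "0 < r" "r < 1 / real (Suc k)" for r
   proof -
    obtain q where q: "q \<longlonglongrightarrow> r" "\<And>k. q k < r" "\<And>k. 0 < q k" "\<And>k. q k \<in> \<rat>"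
     by (rule rational_sequence_below[OF r(1)]) blast
    have "(\<lambda>i. norm (normal_quotient E x (q i) - limit_normal x)) \<longlonglongrightarrow> norm (normal_quotient E x r - limit_normal x)"
     using x r(1) q(1,2) by (intro tendsto_norm tendsto_diff tendsto_const normal_quotient_left_continuous) auto
    moreover have "norm (normal_quotient E x (q i) - limit_normal x) \<le> 1 / real (Suc m)" for i
     using k[OF q(4) q(3)] q(2)[of i] r(2) by (meson less_trans)
    ultimately have "norm (normal_quotient E x r - limit_normal x) \<le> 1 / real (Suc m)"
     by (intro LIMSEQ_le_const2) auto
    then show ?thesis using m by (simp add: dist_norm)
   qed
   then show "\<forall>\<^sub>F r in at_right 0. dist (normal_quotient E x r) (limit_normal x) < e"
    unfolding eventually_at_right_field by (intro exI[of _ "1 / real (Suc k)"]) auto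
  qed
  then show "x \<in> reduced_boundary E" using x by (auto simp: reduced_boundary_def)
 qed
qed

lemma reduced_boundary_borel: "reduced_boundary E \<in> sets borel"
proof -
 note [measurable] = limit_normal_borel normal_quotient_borel
 have 1: "measure_support (perimeter_measure E) \<in> sets borel"
  using closed_support by (rule borel_closed)
 have 2: "{x. norm (limit_normal x) = 1} \<in> sets borel" by measurable
 have 3: "{x. norm (normal_quotient E x q - limit_normal x) \<le> c} \<in> sets borel" for q c by measurable
 have c: "countable {q. q \<in> \<rat> \<and> 0 < q \<and> q < 1 / real (Suc k)}" for k
  by (rule countable_subset[OF _ countable_rat]) auto
 have "(\<Inter>q\<in>{q. q \<in> \<rat> \<and> 0 < q \<and> q < 1 / real (Suc k)}.
    {x. norm (normal_quotient E x q - limit_normal x) \<le> 1 / real (Suc m)}) \<in> sets borel" for k m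
 proof (rule sets.countable_INT'[OF c])
  obtain q where "q \<in> \<rat>" "0 < q" "q < 1 / real (Suc k)" using Rats_dense_in_real[of 0 "1 / real (Suc k)"] by auto
  then show "{q. q \<in> \<rat> \<and> 0 < q \<and> q < 1 / real (Suc k)} \<noteq> {}" by blast
 qed (use 3 in auto)
 then have "(\<Inter>m::nat. \<Union>k::nat. \<Inter>q\<in>{q. q \<in> \<rat> \<and> 0 < q \<and> q < 1 / real (Suc k)}.
    {x. norm (normal_quotient E x q - limit_normal x) \<le> 1 / real (Suc m)}) \<in> sets borel"
  by (intro sets.countable_INT sets.countable_UN) auto
 then show ?thesis unfolding reduced_boundary_eq using 1 2 by (intro sets.Int)
qed

lemma outer_normal_borel: "outer_normal E \<in> borel_measurable borel"
proof -
 note [measurable] = limit_normal_borel reduced_boundary_borel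
 have "outer_normal E = (\<lambda>x. if x \<in> reduced_boundary E then limit_normal x else 0)"
  using outer_normal_eq by auto
 then show ?thesis by simp
qed

lemma norm_outer_normal: "norm (outer_normal E x) = (if x \<in> reduced_boundary E then 1 else 0)"
proof -
 have "reduced_boundary E \<subseteq> {x. norm (limit_normal x) = 1}" using reduced_boundary_eq by blast
 then show ?thesis using outer_normal_eq[of x] by auto
qed

end

locale doubling_gauss_green = gauss_green_density \<sigma> f M E + doubling_radon \<sigma> S D r1
 for \<sigma> :: "(real ^ 'n) measure" and f M E S D r1
begin

text \<open>At a Lebesgue point of both \<open>f\<close> and |f| the measures of the ball cancel in
  \<open>normal_quotient\<close>, which therefore tends to f/|f|. Doubling of \<sigma> enters
  through \<open>lebesgue_points\<close>.\<close>

lemma AE_outer_normal: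
 "AE x in \<sigma>. f x \<noteq> 0 \<longrightarrow> x \<in> reduced_boundary E \<and> f x = norm (f x) *\<^sub>R outer_normal E x"
proof -
 have nb: "(\<lambda>x. norm (f x)) \<in> borel_measurable borel" by measurable
 have "norm (norm (f x)) \<le> M" for x using f_bound by simp
 note lp = lebesgue_points[OF nb this]
 show ?thesis
  using lebesgue_points[OF f_borel f_bound] lp AE_in_S
 proof eventually_elim
  case (elim x)
  show ?case
  proof
   assume fx: "f x \<noteq> 0"
   have l1: "((\<lambda>r. (LINT y:ball x r|\<sigma>. f y) /\<^sub>R measure \<sigma> (ball x r)) \<longlongrightarrow> f x) (at_right 0)"
    using elim by blast
   have l2: "((\<lambda>r. (LINT y:ball x r|\<sigma>. norm (f y)) /\<^sub>R measure \<sigma> (ball x r)) \<longlongrightarrow> norm (f x)) (at_right 0)"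
    using elim f_bound by auto
   have ev: "\<forall>\<^sub>F r in at_right 0. 0 < r \<and> r < r1"
    unfolding eventually_at_right_field using r1_pos by auto
   have "((\<lambda>r. ((LINT y:ball x r|\<sigma>. f y) /\<^sub>R measure \<sigma> (ball x r)) /\<^sub>R
     ((LINT y:ball x r|\<sigma>. norm (f y)) /\<^sub>R measure \<sigma> (ball x r))) \<longlongrightarrow> f x /\<^sub>R norm (f x)) (at_right 0)"
    using fx by (intro tendsto_scaleR tendsto_inverse l1 l2) auto
   moreover have "\<forall>\<^sub>F r in at_right 0. ((LINT y:ball x r|\<sigma>. f y) /\<^sub>R measure \<sigma> (ball x r)) /\<^sub>R
     ((LINT y:ball x r|\<sigma>. norm (f y)) /\<^sub>R measure \<sigma> (ball x r)) = normal_quotient E x r"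
    using ev
   proof eventually_elim
    case (elim r)
    have "measure \<sigma> (ball x r) > 0" using ball_pos \<open>x \<in> S\<close> elim by simp
    then show ?case by (simp add: normal_quotient_E)
   qed
   ultimately have lim: "(normal_quotient E x \<longlongrightarrow> f x /\<^sub>R norm (f x)) (at_right 0)"
    by (rule Lim_transform_eventually)
   have "\<forall>\<^sub>F r in at_right 0. 0 < (LINT y:ball x r|\<sigma>. norm (f y)) /\<^sub>R measure \<sigma> (ball x r)"
    using fx by (intro order_tendstoD(1)[OF l2]) auto
   then obtain b where b: "b > 0" "\<And>r. 0 < r \<Longrightarrow> r < b \<Longrightarrow> 0 < (LINT y:ball x r|\<sigma>. norm (f y)) /\<^sub>R measure \<sigma> (ball x r)"
    unfolding eventually_at_right_field by blast
   have "x \<in> measure_support (perimeter_measure E)"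
    unfolding support_iff
   proof (intro allI impI)
    fix r :: real assume r: "r > 0"
    define s where "s = min r (b / 2)"
    have s: "0 < s" "s < b" "s \<le> r" using r b(1) by (auto simp: s_def)
    have "(LINT y:ball x s|\<sigma>. norm (f y)) > 0"
     using b(2)[OF s(1,2)] by (simp add: zero_less_mult_iff)
    moreover have "(LINT y:ball x s|\<sigma>. norm (f y)) \<le> (LINT y:ball x r|\<sigma>. norm (f y))"
     using s(3) norm_f_set_integrable[of "ball x s"] norm_f_set_integrable[of "ball x r"]
     unfolding set_lebesgue_integral_def set_integrable_def
     by (intro integral_mono) (auto simp: indicator_def)
    ultimately show "(LINT y:ball x r|\<sigma>. norm (f y)) > 0" by simp
   qed
   moreover have "norm (f x /\<^sub>R norm (f x)) = 1" using fx by simp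
   ultimately have R: "x \<in> reduced_boundary E"
    using lim unfolding reduced_boundary_def by blast
   have "outer_normal E x = f x /\<^sub>R norm (f x)"
    using R limit_normal_eq[OF lim] by (simp add: outer_normal_eq)
   then show "x \<in> reduced_boundary E \<and> f x = norm (f x) *\<^sub>R outer_normal E x"
    using R fx by simp
  qed
 qed
qed

end

section \<open>Mollified indicator functions\<close>

lemma lborel_integral_affine:
 fixes h :: "real ^ 'n \<Rightarrow> real"
 assumes [measurable]: "h \<in> borel_measurable borel" and s: "s > 0"
 shows "(LINT z|lborel. h z) = s ^ CARD('n) * (LINT x|lborel. h (y + s *\<^sub>R x))"
proof -
 have m: "(\<lambda>x. y + s *\<^sub>R x) \<in> borel_measurable (borel :: (real ^ 'n) measure)"
  by (intro borel_measurable_continuous_onI continuous_intros)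
 have "(LINT z|lborel. h z) = (LINT z|density (distr lborel borel (\<lambda>x. y + s *\<^sub>R x)) (\<lambda>_. ennreal (\<bar>s\<bar> ^ DIM(real ^ 'n))). h z)"
  using lborel_affine[of s y] s by simp
 also have "... = (LINT z|distr lborel borel (\<lambda>x. y + s *\<^sub>R x). (\<bar>s\<bar> ^ DIM(real ^ 'n)) * h z)"
  by (subst integral_density) auto
 also have "... = (LINT x|lborel. (\<bar>s\<bar> ^ DIM(real ^ 'n)) * h (y + s *\<^sub>R x))"
  using m by (subst integral_distr) auto
 finally show ?thesis using s by simp
qed

definition bump_mass :: "'n::finite itself \<Rightarrow> real" where
 "bump_mass _ = (LINT z|lborel. bump 1 (0 :: real ^ 'n) z)"

abbreviation ball_vol :: "'n::finite itself \<Rightarrow> real" where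
 "ball_vol _ \<equiv> unit_ball_vol (real CARD('n))"

lemma borel_radon_lborel: "borel_radon (lborel :: (real ^ 'n) measure)"
 by unfold_locales (use emeasure_lborel_cball_finite in \<open>auto simp: less_top\<close>)

interpretation leb: borel_radon "lborel :: (real ^ 'n) measure"
 by (rule borel_radon_lborel)

lemma bump_borel: "bump s y \<in> borel_measurable borel"
 unfolding bump_def by (intro borel_measurable_continuous_onI continuous_intros)

lemma integrable_bump: "s > 0 \<Longrightarrow> integrable lborel (bump s y)"
 by (intro leb.integrable_C1c C1c_bump)

lemma integral_bump:
 assumes "s > 0"
 shows "(LINT z|lborel. bump s (y :: real ^ 'n) z) = bump_mass TYPE('n) * s ^ (CARD('n) + 4)"
proof -
 have "bump s y (y + s *\<^sub>R x) = s ^ 4 * bump 1 0 x" for x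
 proof -
  have "s\<^sup>2 - (norm (s *\<^sub>R x))\<^sup>2 = s\<^sup>2 * (1 - (norm x)\<^sup>2)"
   by (simp add: power_mult_distrib algebra_simps)
  moreover have "max 0 (s\<^sup>2 * t) = s\<^sup>2 * max 0 t" for t
   using assms by (simp add: max_def mult_le_0_iff zero_le_mult_iff)
  ultimately show ?thesis
   by (simp add: bump_def power_mult_distrib power_mult[symmetric])
 qed
 then show ?thesis
  using lborel_integral_affine[OF bump_borel assms, of s y y] by (simp add: bump_mass_def power_add)
qed

lemma measure_ball: "s \<ge> 0 \<Longrightarrow> measure lborel (ball (y :: real ^ 'n) s) = ball_vol TYPE('n) * s ^ CARD('n)"
 using content_ball[of s y] by simp

lemma ball_vol_pos: "ball_vol TYPE('n::finite) > 0" by simp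

text \<open>On the ball of radius 1/2 the bump is at least (1 - 1/4)^2 = 9/16.\<close>

lemma bump_mass_pos: "bump_mass TYPE('n::finite) > 0"
proof -
 let ?B = "ball (0 :: real ^ 'n) (1 / 2)"
 have "0 < 9 / 16 * measure lborel ?B" by (simp add: measure_ball ball_vol_pos)
 also have "... = (LINT z|lborel. 9 / 16 * indicator ?B z)"
  by simp
 also have "... \<le> (LINT z|lborel. bump 1 (0 :: real ^ 'n) z)"
 proof (rule integral_mono)
  show "integrable lborel (\<lambda>z :: real ^ 'n. bump 1 0 z)" by (rule integrable_bump) simp
  show "integrable lborel (\<lambda>z. 9 / 16 * indicat_real ?B z)"
   using leb.finite_bounded[of ?B] by (intro integrable_mult_right integrable_real_indicator) auto
  fix z :: "real ^ 'n"
  show "9 / 16 * indicator ?B z \<le> bump 1 0 z"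
  proof (cases "z \<in> ?B")
   case True
   then have "(norm z)\<^sup>2 \<le> (1/2)\<^sup>2" by (intro power_mono) auto
   then have "3/4 \<le> max 0 (1 - (norm z)\<^sup>2)" by (simp add: power2_eq_square)
   then have "(3/4)\<^sup>2 \<le> (max 0 (1 - (norm z)\<^sup>2))\<^sup>2" by (rule power_mono) simp
   moreover have "bump 1 0 z = (max 0 (1 - (norm z)\<^sup>2))\<^sup>2" by (simp add: bump_def)
   moreover have "9 / 16 * indicator ?B z = (3/4 :: real)\<^sup>2" using True by (simp add: power2_eq_square)
   ultimately show ?thesis by (simp only:)
  qed (simp add: bump_nonneg)
 qed
 finally show ?thesis by (simp add: bump_mass_def)
qed

section \<open>Derivatives of the mollified indicator in position and in scale\<close>

context gauss_green_density
begin

text \<open>A Borel representative of \<open>E\<close>.\<close>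

definition Eb :: "(real ^ 'n) set" where
 "Eb = (SOME B. B \<in> sets borel \<and> (AE x in lebesgue. x \<in> E \<longleftrightarrow> x \<in> B))"

lemma Eb: "Eb \<in> sets borel" "AE x in lebesgue. x \<in> E \<longleftrightarrow> x \<in> Eb"
proof -
 obtain B N N' where B: "E = B \<union> N" "N \<subseteq> N'" "N' \<in> null_sets lborel" "B \<in> sets lborel"
  using sets_completionE[OF E_lebesgue] by blast
 have "AE x in lborel. x \<notin> N'" by (rule AE_not_in[OF B(3)])
 then have "AE x in lborel. x \<in> E \<longleftrightarrow> x \<in> B" using B(1,2) by (auto elim: eventually_mono)
 then have "\<exists>B. B \<in> sets borel \<and> (AE x in lebesgue. x \<in> E \<longleftrightarrow> x \<in> B)"
  using B(4) by (intro exI[of _ B]) (auto simp: AE_completion_iff)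
 from someI_ex[OF this] show "Eb \<in> sets borel" "AE x in lebesgue. x \<in> E \<longleftrightarrow> x \<in> Eb"
  unfolding Eb_def by blast+
qed

lemma measure_Eb:
 assumes "X \<in> sets borel"
 shows "measure lebesgue (X \<inter> E) = measure lborel (X \<inter> Eb)" "measure lebesgue (X - E) = measure lborel (X - Eb)"
  "emeasure lebesgue (X \<inter> E) = emeasure lborel (X \<inter> Eb)" "emeasure lebesgue (X - E) = emeasure lborel (X - Eb)"
proof -
 have X: "X \<in> sets lebesgue" using assms by auto
 have 1: "X \<inter> E \<in> sets lebesgue" "X - E \<in> sets lebesgue" using X E_lebesgue by (auto intro: sets.Int sets.Diff)
 have 2: "X \<inter> Eb \<in> sets borel" "X - Eb \<in> sets borel" using assms Eb(1) by auto
 show e: "emeasure lebesgue (X \<inter> E) = emeasure lborel (X \<inter> Eb)"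
 proof -
  have "emeasure lebesgue (X \<inter> E) = emeasure lebesgue (X \<inter> Eb)"
   using Eb(2) 1 2 by (intro emeasure_eq_AE) (auto elim: eventually_mono)
  then show ?thesis using 2 by simp
 qed
 show e': "emeasure lebesgue (X - E) = emeasure lborel (X - Eb)"
 proof -
  have "emeasure lebesgue (X - E) = emeasure lebesgue (X - Eb)"
   using Eb(2) 1 2 by (intro emeasure_eq_AE) (auto elim: eventually_mono)
  then show ?thesis using 2 by simp
 qed
 show "measure lebesgue (X \<inter> E) = measure lborel (X \<inter> Eb)" "measure lebesgue (X - E) = measure lborel (X - Eb)"
  by (simp_all add: measure_def e e')
qed

lemma set_integral_Eb:
 assumes h [measurable]: "h \<in> borel_measurable borel"
 shows "(LINT x:E|lebesgue. h x) = (LINT x|lborel. indicator Eb x * (h x :: real))"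
proof -
 note [measurable] = Eb(1)
 have hl: "h \<in> borel_measurable lebesgue" by (rule measurable_completion) simp
 have "(LINT x:E|lebesgue. h x) = (LINT x|lebesgue. indicator Eb x * h x)"
  unfolding set_lebesgue_integral_def
 proof (rule integral_cong_AE)
  show "(\<lambda>x. indicat_real E x *\<^sub>R h x) \<in> borel_measurable lebesgue"
   using E_lebesgue hl by measurable
  show "(\<lambda>x. indicat_real Eb x * h x) \<in> borel_measurable lebesgue"
   by (rule measurable_completion) measurable
  show "AE x in lebesgue. indicat_real E x *\<^sub>R h x = indicat_real Eb x * h x"
   using Eb(2) by eventually_elim (auto simp: indicator_def)
 qed
 also have "... = (LINT x|lborel. indicator Eb x * h x)"
  by (rule integral_completion) measurable
 finally show ?thesis .
qed

lemma divergence_borel: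
 fixes T :: "real ^ 'n \<Rightarrow> real ^ 'n"
 assumes "C1c T" shows "divergence T \<in> borel_measurable borel"
proof -
 have "divergence T = (\<lambda>x. \<Sum>i\<in>UNIV. frechet_derivative T (at x) (axis i 1) $ i)"
  by (auto simp: divergence_def)
 then show ?thesis
  by (simp only:) (intro borel_measurable_continuous_onI continuous_intros C1c_continuous_deriv assms)
qed

lemma gauss_green_Eb:
 "C1c T \<Longrightarrow> (LINT z|lborel. indicator Eb z * divergence T z) = (LINT x|\<sigma>. T x \<bullet> f x)"
 using gauss_green set_integral_Eb[OF divergence_borel] by simp

lemma divergence_scaleR_const:
 fixes \<phi> :: "real ^ 'n \<Rightarrow> real"
 assumes "C1c \<phi>" shows "divergence (\<lambda>x. \<phi> x *\<^sub>R w) z = frechet_derivative \<phi> (at z) w"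
proof -
 have lin: "linear (frechet_derivative \<phi> (at z))"
  using C1c_has_derivative[OF assms] has_derivative_linear by blast
 have "divergence (\<lambda>x. \<phi> x *\<^sub>R w) z = (\<Sum>i\<in>UNIV. w $ i *\<^sub>R frechet_derivative \<phi> (at z) (axis i 1))"
  by (simp add: divergence_def C1c_scaleR_const(2)[OF assms] mult.commute)
 also have "... = frechet_derivative \<phi> (at z) (\<Sum>i\<in>UNIV. w $ i *\<^sub>R axis i 1)"
  by (simp add: linear_sum[OF lin] linear_scale[OF lin])
 also have "(\<Sum>i\<in>UNIV. w $ i *\<^sub>R axis i 1) = w"
  using basis_expansion[of w] by (simp add: scalar_mult_eq_scaleR)
 finally show ?thesis .
qed

lemma gauss_green_directional:
 assumes "C1c \<phi>"
 shows "(LINT z|lborel. indicator Eb z * frechet_derivative \<phi> (at z) w) = (LINT x|\<sigma>. \<phi> x * (w \<bullet> f x))"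
 using gauss_green_Eb[OF C1c_scaleR_const(1)[OF assms], of w] divergence_scaleR_const[OF assms, of w] by simp

definition U :: "real ^ 'n \<Rightarrow> real \<Rightarrow> real" where
 "U y s = (LINT z|lborel. indicator Eb z * bump s y z)"

lemma integrable_Eb_mult:
 assumes "integrable lborel h" shows "integrable lborel (\<lambda>z. indicator Eb z * (h z :: real))"
 using integrable_mult_indicator[of Eb lborel h] Eb(1) assms by simp

text \<open>Moving the centre of the bump along \<open>w\<close> amounts to differentiating the bump
  in direction \<open>- w\<close>; Gauss--Green turns that derivative into a boundary
  integral.\<close>

lemma U_line_derivative:
 assumes s: "s > 0"
 shows "((\<lambda>\<tau>. U (y + \<tau> *\<^sub>R w) s) has_real_derivative - (LINT x|\<sigma>. bump s (y + \<tau>0 *\<^sub>R w) x * (w \<bullet> f x))) (at \<tau>0)"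
proof -
 define y0 where "y0 = y + \<tau>0 *\<^sub>R w"
 have eq: "bump s y0 (z + (\<tau> + - \<tau>0) *\<^sub>R - w) = bump s (y + \<tau> *\<^sub>R w) z" for \<tau> z
  by (simp add: bump_def y0_def algebra_simps)
 have "((\<lambda>\<tau>. LINT z|lborel. indicator Eb z * bump s y0 (z + (\<tau> + - \<tau>0) *\<^sub>R - w)) has_real_derivative
   (LINT z|lborel. indicator Eb z * frechet_derivative (bump s y0) (at z) (- w))) (at \<tau>0)"
  using translation_derivative[OF C1c_bump(1)[OF s] Eb(1), of y0 "- w"]
  by (subst DERIV_shift[symmetric]) simp
 moreover have "(LINT z|lborel. indicator Eb z * frechet_derivative (bump s y0) (at z) (- w)) = - (LINT x|\<sigma>. bump s y0 x * (w \<bullet> f x))"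
  using gauss_green_directional[OF C1c_bump(1)[OF s], of y0 "- w"] by simp
 ultimately show ?thesis unfolding eq by (simp add: U_def y0_def)
qed

text \<open>The majorant for differentiating in the scale: the difference of squares factorises, and
  outside \<open>ball y (s + 1)\<close> both bumps vanish.\<close>

lemma bump_scale_lipschitz:
 fixes y z :: "real ^ 'n"
 assumes h: "\<bar>t - s\<bar> \<le> 1" and s: "s > 0"
 shows "\<bar>bump t y z - bump s y z\<bar> \<le> \<bar>t - s\<bar> * ((2 * s + 1) * (2 * (s + 1)\<^sup>2) * indicator (ball y (s + 1)) z)"
proof (cases "z \<in> ball y (s + 1)")
 case True
 define p where "p r = r\<^sup>2 - (norm (z - y))\<^sup>2" for r
 have "t\<^sup>2 \<le> (s + 1)\<^sup>2" "s\<^sup>2 \<le> (s + 1)\<^sup>2" using h s by (auto simp: abs_le_square_iff[symmetric])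
 then have le: "max 0 (p t) \<le> (s + 1)\<^sup>2" "max 0 (p s) \<le> (s + 1)\<^sup>2"
  unfolding p_def using zero_le_power2[of "norm (z - y)"] zero_le_power2[of "s + 1"] by linarith+
 have "p t - p s = (t - s) * (t + s)" by (simp add: p_def power2_eq_square algebra_simps)
 then have "\<bar>p t - p s\<bar> \<le> \<bar>t - s\<bar> * (2 * s + 1)"
  using h s by (auto simp: abs_mult intro!: mult_left_mono)
 then have 1: "\<bar>max 0 (p t) - max 0 (p s)\<bar> \<le> \<bar>t - s\<bar> * (2 * s + 1)" by linarith
 have "bump t y z - bump s y z = (max 0 (p t) - max 0 (p s)) * (max 0 (p t) + max 0 (p s))"
  by (simp add: bump_def p_def power2_eq_square algebra_simps)
 also have "\<bar>...\<bar> \<le> \<bar>t - s\<bar> * (2 * s + 1) * (2 * (s + 1)\<^sup>2)"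
 proof -
  have "\<bar>max 0 (p t) + max 0 (p s)\<bar> \<le> 2 * (s + 1)\<^sup>2" using le by linarith
  with 1 show ?thesis unfolding abs_mult using s by (intro mult_mono) auto
 qed
 finally show ?thesis using True by (simp add: mult.assoc)
next
 case False
 then have far: "norm (z - y) \<ge> s + 1" by (simp add: dist_norm norm_minus_commute)
 have "t\<^sup>2 \<le> (norm (z - y))\<^sup>2" "s\<^sup>2 \<le> (norm (z - y))\<^sup>2"
  using h s far by (auto simp: abs_le_square_iff[symmetric])
 then show ?thesis using False by (simp add: bump_def max_def)
qed

text \<open>Euler's identity. As the bump is homogeneous of degree 4 in \<open>(s, z - y)\<close>,
  its radial derivative is 4 times the bump minus \<open>s\<close> times its scale derivative; the
  divergence of \<open>z - y\<close> adds \<open>CARD('n)\<close> times the bump.\<close>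

lemma divergence_bump_radial:
 fixes y z :: "real ^ 'n"
 assumes s: "s > 0"
 shows "C1c (\<lambda>z. bump s y z *\<^sub>R (z - y))"
  "divergence (\<lambda>z. bump s y z *\<^sub>R (z - y)) z =
    (real CARD('n) + 4) * bump s y z - s * (4 * s * max 0 (s\<^sup>2 - (norm (z - y))\<^sup>2))"
proof -
 have g: "((\<lambda>z. z - y) has_derivative (\<lambda>v. v)) (at z)" for z by (auto intro!: derivative_eq_intros)
 note C = C1c_scaleR_C1[OF C1c_bump(1)[OF s, of y] g continuous_on_const]
 show "C1c (\<lambda>z. bump s y z *\<^sub>R (z - y))" by (rule C(1))
 let ?p = "max 0 (s\<^sup>2 - (norm (z - y))\<^sup>2)"
 have "divergence (\<lambda>z. bump s y z *\<^sub>R (z - y)) z =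
   (\<Sum>i\<in>UNIV. bump s y z + (- 4 * ?p * ((z - y) \<bullet> axis i 1)) * (z - y) $ i)"
  unfolding divergence_def C(2) by (simp add: C1c_bump(2)[OF s] axis_def)
 also have "... = real CARD('n) * bump s y z - 4 * ?p * (\<Sum>i\<in>UNIV. (z - y) $ i * (z - y) $ i)"
 proof -
  have "bump s y z + (- 4 * ?p * ((z - y) \<bullet> axis i 1)) * (z - y) $ i
    = bump s y z + (- 4 * ?p) * ((z - y) $ i * (z - y) $ i)" for i
   by (simp only: inner_axis) simp
  then have "(\<Sum>i\<in>UNIV. bump s y z + (- 4 * ?p * ((z - y) \<bullet> axis i 1)) * (z - y) $ i)
    = (\<Sum>i\<in>(UNIV :: 'n set). bump s y z) + (- 4 * ?p) * (\<Sum>i\<in>UNIV. (z - y) $ i * (z - y) $ i)"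
   by (simp only: sum.distrib sum_distrib_left[symmetric])
  then show ?thesis by simp
 qed
 also have "(\<Sum>i\<in>UNIV. (z - y) $ i * (z - y) $ i) = (norm (z - y))\<^sup>2"
  unfolding power2_norm_eq_inner inner_vec_def by simp
 also have "real CARD('n) * bump s y z - 4 * ?p * (norm (z - y))\<^sup>2 = (real CARD('n) + 4) * bump s y z - s * (4 * s * ?p)"
 proof -
  have "bump s y z = ?p * (s\<^sup>2 - (norm (z - y))\<^sup>2)" by (simp add: bump_def max_def power2_eq_square)
  then show ?thesis by (simp add: power2_eq_square algebra_simps)
 qed
 finally show "divergence (\<lambda>z. bump s y z *\<^sub>R (z - y)) z =
    (real CARD('n) + 4) * bump s y z - s * (4 * s * ?p)" .
qed

end

lemma doubling_radon_lborel: "doubling_radon (lborel :: (real ^ 'n) measure) UNIV (5 ^ CARD('n)) 1"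
proof
 fix x :: "real ^ 'n" and r :: real
 assume r: "0 < r"
 have "measure lborel (cball x (5 * r)) = ball_vol TYPE('n) * (5 * r) ^ CARD('n)"
  using content_cball[of "5 * r" x] r by simp
 then show "measure lborel (cball x (5 * r)) \<le> 5 ^ CARD('n) * measure lborel (ball x r)"
  using r by (simp add: measure_ball power_mult_distrib)
 show "measure lborel (ball x r) > 0" using r by (simp add: measure_ball)
qed auto

lemma bump_eq_abs: "bump s y z = bump \<bar>s\<bar> y z"
 by (simp add: bump_def)

lemma integrable_bump_all: "integrable lborel (bump s y)"
proof (cases "s = 0")
 case True
 then have "bump s y = (\<lambda>_. 0)" by (auto simp: bump_def max_def)
 then show ?thesis by simp
next
 case False
 then have "integrable lborel (bump \<bar>s\<bar> y)" by (intro integrable_bump) auto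
 then show ?thesis using bump_eq_abs[of s y] by (simp cong: Bochner_Integration.integrable_cong)
qed

lemma integral_indicator_bump_le:
 fixes y :: "real ^ 'n"
 assumes X: "X \<in> sets borel" and s: "s > 0"
 shows "(LINT z|lborel. indicator X z * bump s y z) \<le> s ^ 4 * measure lborel (ball y s \<inter> X)"
  "0 \<le> (LINT z|lborel. indicator X z * bump s y z)"
proof -
 have fin: "emeasure lborel (ball y s \<inter> X) < \<infinity>"
  by (rule leb.finite_bounded) (auto intro: bounded_subset[OF bounded_ball])
 have "(LINT z|lborel. indicator X z * bump s y z) \<le> (LINT z|lborel. s ^ 4 * indicator (ball y s \<inter> X) z)"
 proof (rule integral_mono)
  show "integrable lborel (\<lambda>z. indicator X z * bump s y z)"
   using integrable_mult_indicator[of X lborel "bump s y"] X integrable_bump_all[of s y] by simp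
  show "integrable lborel (\<lambda>z. s ^ 4 * indicat_real (ball y s \<inter> X) z)"
   using X fin by (intro integrable_mult_right integrable_real_indicator) auto
  show "indicator X z * bump s y z \<le> s ^ 4 * indicator (ball y s \<inter> X) z" for z
   using bump_le[of s y z] bump_eq_0[OF s, of z y] by (auto simp: indicator_def)
 qed
 then show "(LINT z|lborel. indicator X z * bump s y z) \<le> s ^ 4 * measure lborel (ball y s \<inter> X)"
  using X fin by simp
 show "0 \<le> (LINT z|lborel. indicator X z * bump s y z)"
  by (intro integral_nonneg_AE) (auto simp: bump_nonneg)
qed

context gauss_green_density
begin

definition gmass :: "(real ^ 'n) set \<Rightarrow> real" where
 "gmass B = (LINT x:B|\<sigma>. norm (f x))"

lemma gmass_nonneg: "gmass B \<ge> 0"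
 unfolding gmass_def set_lebesgue_integral_def by (intro integral_nonneg_AE) auto

lemma gmass_mono:
 assumes "A \<subseteq> B" "A \<in> sets borel" "B \<in> sets borel" "bounded B"
 shows "gmass A \<le> gmass B"
 using norm_f_set_integrable[of A] norm_f_set_integrable[of B] assms bounded_subset[OF assms(4,1)]
 unfolding gmass_def set_lebesgue_integral_def set_integrable_def
 by (intro integral_mono) (auto simp: indicator_def)

text \<open>By Euler's identity the scale derivative of the bump is a multiple of the bump minus a
  divergence, up to the factor \<open>1 / s\<close>, and Gauss--Green converts the divergence into a
  boundary integral.\<close>

lemma U_scale_derivative:
 assumes s: "s > 0"
 shows "((\<lambda>s. U y s) has_real_derivative
   ((real CARD('n) + 4) * U y s - (LINT x|\<sigma>. bump s y x * ((x - y) \<bullet> f x))) / s) (at s)"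
proof -
 let ?d = "\<lambda>z. 4 * s * max 0 (s\<^sup>2 - (norm (z - y))\<^sup>2)"
 let ?k = "\<lambda>z. indicator Eb z * ?d z"
 let ?T = "\<lambda>z. bump s y z *\<^sub>R (z - y)"
 have iU: "integrable lborel (\<lambda>z. indicator Eb z * bump s y z)"
  by (intro integrable_Eb_mult integrable_bump s)
 let ?w = "\<lambda>z. (2 * s + 1) * (2 * (s + 1)\<^sup>2) * indicator (ball y (s + 1)) z"
 have hyps: "integrable lborel (\<lambda>z. indicator Eb z * bump t y z)" "integrable lborel ?w" "?k \<in> borel_measurable lborel"
  "\<bar>t - s\<bar> \<le> 1 \<Longrightarrow> \<bar>indicator Eb z * bump t y z - indicator Eb z * bump s y z\<bar> \<le> \<bar>t - s\<bar> * ?w z"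
  "((\<lambda>t. indicator Eb z * bump t y z) has_real_derivative ?k z) (at s)" for t z
 proof -
  show "integrable lborel (\<lambda>z. indicator Eb z * bump t y z)" by (intro integrable_Eb_mult integrable_bump_all)
  show "integrable lborel ?w"
   by (intro integrable_mult_right integrable_real_indicator leb.finite_bounded) auto
  have "?d \<in> borel_measurable borel" by (intro borel_measurable_continuous_onI continuous_intros)
  then show "?k \<in> borel_measurable lborel" using Eb(1) by measurable
  show "\<bar>indicator Eb z * bump t y z - indicator Eb z * bump s y z\<bar> \<le> \<bar>t - s\<bar> * ?w z" if "\<bar>t - s\<bar> \<le> 1"
   using order_trans[OF abs_ge_zero bump_scale_lipschitz[OF that s]] bump_scale_lipschitz[OF that s, of y z] by (cases "z \<in> Eb") auto
  have "((\<lambda>t. t\<^sup>2 - (norm (z - y))\<^sup>2) has_real_derivative 2 * s) (at s)" by (auto intro!: derivative_eq_intros)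
  from DERIV_cmult[OF DERIV_chain2[OF max_sq_has_real_derivative this], of "indicator Eb z"]
  show "((\<lambda>t. indicator Eb z * bump t y z) has_real_derivative ?k z) (at s)" by (simp add: bump_def mult_ac)
 qed
 note ik = has_real_derivative_integral(1)[OF hyps] and der = has_real_derivative_integral(2)[OF hyps]
 have "((\<lambda>t. LINT z|lborel. indicator Eb z * bump t y z) has_real_derivative (LINT z|lborel. ?k z)) (at s)" by (rule der)
 moreover have "(LINT z|lborel. ?k z) = ((real CARD('n) + 4) * U y s - (LINT x|\<sigma>. bump s y x * ((x - y) \<bullet> f x))) / s"
 proof -
  have "(LINT x|\<sigma>. bump s y x * ((x - y) \<bullet> f x)) = (LINT z|lborel. indicator Eb z * divergence ?T z)"
   using gauss_green_Eb[OF divergence_bump_radial(1)[OF s, of y]] by simp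
  also have "... = (LINT z|lborel. (real CARD('n) + 4) * (indicator Eb z * bump s y z) - s * ?k z)"
   by (intro Bochner_Integration.integral_cong refl) (simp only: divergence_bump_radial(2)[OF s], simp add: algebra_simps)
  also have "... = (real CARD('n) + 4) * U y s - s * (LINT z|lborel. ?k z)"
   unfolding U_def using iU ik by (subst Bochner_Integration.integral_diff) auto
  finally show ?thesis using s by (simp add: field_simps)
 qed
 ultimately show ?thesis by (simp add: U_def)
qed

lemma integrable_bump_f:
 assumes s: "s > 0" and g: "continuous_on UNIV g" "\<And>x. x \<in> ball y s \<Longrightarrow> norm (g x :: real ^ 'n) \<le> K"
 shows "integrable \<sigma> (\<lambda>x. bump s y x * (g x \<bullet> f x))"
  "\<bar>LINT x|\<sigma>. bump s y x * (g x \<bullet> f x)\<bar> \<le> s ^ 4 * K * gmass (ball y s)"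
proof -
 have gb: "g \<in> borel_measurable borel" using g(1) by (rule borel_measurable_continuous_onI)
 have m: "(\<lambda>x. bump s y x * (g x \<bullet> f x)) \<in> borel_measurable borel"
  using bump_borel gb f_borel by measurable
 have K: "K \<ge> 0" by (rule order_trans[OF norm_ge_zero g(2)[of y]]) (use s in simp)
 have pt: "\<bar>bump s y x * (g x \<bullet> f x)\<bar> \<le> s ^ 4 * K * (indicator (ball y s) x * norm (f x))" for x
 proof (cases "x \<in> ball y s")
  case True
  have gK: "\<bar>g x \<bullet> f x\<bar> \<le> K * norm (f x)"
   using Cauchy_Schwarz_ineq2[of "g x" "f x"] mult_right_mono[OF g(2)[OF True] norm_ge_zero[of "f x"]] by linarith
  have "\<bar>bump s y x * (g x \<bullet> f x)\<bar> = bump s y x * \<bar>g x \<bullet> f x\<bar>"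
   by (simp add: abs_mult bump_nonneg)
  also have "... \<le> s ^ 4 * (K * norm (f x))"
   by (rule mult_mono[OF bump_le gK]) (use s in auto)
  finally show ?thesis using True by (simp only: indicator_simps mult_1 mult.assoc)
 qed (simp add: bump_eq_0[OF s])
 have i: "integrable \<sigma> (\<lambda>x. s ^ 4 * K * (indicator (ball y s) x * norm (f x)))"
  using norm_f_set_integrable[of "ball y s"] unfolding set_integrable_def by (intro integrable_mult_right) auto
 show int: "integrable \<sigma> (\<lambda>x. bump s y x * (g x \<bullet> f x))"
 proof (rule Bochner_Integration.integrable_bound[OF i])
  show "(\<lambda>x. bump s y x * (g x \<bullet> f x)) \<in> borel_measurable \<sigma>" using m by simp
  show "AE x in \<sigma>. norm (bump s y x * (g x \<bullet> f x)) \<le> norm (s ^ 4 * K * (indicator (ball y s) x * norm (f x)))"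
   unfolding real_norm_def by (intro always_eventually allI order_trans[OF pt abs_ge_self])
 qed
 have "\<bar>LINT x|\<sigma>. bump s y x * (g x \<bullet> f x)\<bar> \<le> (LINT x|\<sigma>. \<bar>bump s y x * (g x \<bullet> f x)\<bar>)"
  by (rule integral_abs_bound)
 also have "... \<le> (LINT x|\<sigma>. s ^ 4 * K * (indicator (ball y s) x * norm (f x)))"
  by (intro integral_mono integrable_abs int i pt)
 finally show "\<bar>LINT x|\<sigma>. bump s y x * (g x \<bullet> f x)\<bar> \<le> s ^ 4 * K * gmass (ball y s)"
  by (simp add: gmass_def set_lebesgue_integral_def)
qed

text \<open>The indicator of \<open>E\<close>, mollified at scale \<open>s\<close>.\<close>

definition u :: "real ^ 'n \<Rightarrow> real \<Rightarrow> real" where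
 "u y s = U y s / (bump_mass TYPE('n) * s ^ (CARD('n) + 4))"

lemma U_complement:
 assumes "s > 0"
 shows "U y s + (LINT z|lborel. indicator (- Eb) z * bump s y z) = bump_mass TYPE('n) * s ^ (CARD('n) + 4)"
proof -
 have "integrable lborel (\<lambda>z. indicator (- Eb) z * bump s y z)"
  using integrable_mult_indicator[of "- Eb" lborel "bump s y"] Eb(1) integrable_bump_all[of s y] by auto
 then have "U y s + (LINT z|lborel. indicator (- Eb) z * bump s y z)
   = (LINT z|lborel. indicator Eb z * bump s y z + indicator (- Eb) z * bump s y z)"
  unfolding U_def using integrable_Eb_mult[OF integrable_bump_all] by simp
 also have "... = (LINT z|lborel. bump s y z)"
  by (intro Bochner_Integration.integral_cong refl) (auto simp: indicator_def)
 finally show ?thesis using integral_bump[OF assms] by simp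
qed

lemma u_bounds: assumes "s > 0" shows "0 \<le> u y s" "u y s \<le> 1"
proof -
 have p: "bump_mass TYPE('n) * s ^ (CARD('n) + 4) > 0" using assms bump_mass_pos[where 'n='n] by simp
 show "0 \<le> u y s" unfolding u_def U_def
  using integral_indicator_bump_le(2)[OF Eb(1) assms] p by (intro divide_nonneg_pos)
 show "u y s \<le> 1" unfolding u_def
  using U_complement[OF assms, of y] integral_indicator_bump_le(2)[of "- Eb" s y] Eb(1) assms p by simp
qed

text \<open>The bump is at most \<open>s ^ 4\<close> on its ball. The second estimate is the first
  one for the complement, by \<open>U_complement\<close>.\<close>

lemma u_le_density:
 assumes "s > 0"
 shows "u y s \<le> ball_vol TYPE('n) / bump_mass TYPE('n) * (measure lborel (ball y s \<inter> Eb) / measure lborel (ball y s))"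
  "1 - u y s \<le> ball_vol TYPE('n) / bump_mass TYPE('n) * (measure lborel (ball y s - Eb) / measure lborel (ball y s))"
proof -
 let ?m = "bump_mass TYPE('n)" and ?n = "CARD('n)"
 have p: "?m * s ^ (?n + 4) > 0" using assms bump_mass_pos[where 'n='n] by simp
 have key: "I / (?m * s ^ (?n + 4)) \<le> ball_vol TYPE('n) / ?m * (a / measure lborel (ball y s))"
  if "I \<le> s ^ 4 * a" for I a
 proof -
  have "I / (?m * s ^ (?n + 4)) \<le> s ^ 4 * a / (?m * s ^ (?n + 4))"
   using that p by (intro divide_right_mono) auto
  also have "... = a / (?m * s ^ ?n)" using assms by (simp add: power_add)
  also have "... = ball_vol TYPE('n) / ?m * (a / measure lborel (ball y s))"
  proof -
   have "ball_vol TYPE('n) \<noteq> 0" by (metis less_irrefl ball_vol_pos)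
   then show ?thesis using assms by (simp add: measure_ball field_simps)
  qed
  finally show ?thesis .
 qed
 show "u y s \<le> ball_vol TYPE('n) / ?m * (measure lborel (ball y s \<inter> Eb) / measure lborel (ball y s))"
  unfolding u_def U_def by (rule key[OF integral_indicator_bump_le(1)[OF Eb(1) assms]])
 have "1 - u y s = (LINT z|lborel. indicator (- Eb) z * bump s y z) / (?m * s ^ (?n + 4))"
 proof -
  have "1 - a / d = b / d" if "a + b = d" "d > 0" for a b d :: real
   using that by (simp add: diff_divide_eq_iff)
  from this[OF U_complement[OF assms, of y] p] show ?thesis by (simp only: u_def)
 qed
 then show "1 - u y s \<le> ball_vol TYPE('n) / ?m * (measure lborel (ball y s - Eb) / measure lborel (ball y s))"
  using key[OF integral_indicator_bump_le(1)[of "- Eb" s y]] Eb(1) assms by (simp add: Diff_eq)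
qed

text \<open>The Lebesgue density theorem for \<open>Eb\<close> and for its complement, transported
  to \<open>u\<close> by the sandwich of \<open>u_le_density\<close> and
  \<open>u_bounds\<close>.\<close>

lemma u_tendsto: "AE y in lborel. ((\<lambda>s. u y s) \<longlongrightarrow> indicator Eb y) (at_right 0)"
proof -
 interpret D: doubling_radon "lborel :: (real ^ 'n) measure" UNIV "5 ^ CARD('n)" 1
  by (rule doubling_radon_lborel)
 let ?c = "ball_vol TYPE('n) / bump_mass TYPE('n)"
 have nE: "- Eb \<in> sets borel" using Eb(1) by auto
 have pos: "\<forall>\<^sub>F s::real in at_right 0. 0 < s" by (rule eventually_at_right_less)
 show ?thesis
  using D.density_points[OF Eb(1)] D.density_points[OF nE]
 proof eventually_elim
  case (elim y)
  show ?case
  proof (cases "y \<in> Eb")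
   case True
   then have "((\<lambda>s. 1 - ?c * (measure lborel (ball y s - Eb) / measure lborel (ball y s))) \<longlongrightarrow> 1 - ?c * 0) (at_right 0)"
    using elim by (intro tendsto_diff tendsto_mult tendsto_const) auto
   then have l: "((\<lambda>s. 1 - ?c * (measure lborel (ball y s - Eb) / measure lborel (ball y s))) \<longlongrightarrow> 1) (at_right 0)" by simp
   have "((\<lambda>s. u y s) \<longlongrightarrow> 1) (at_right 0)"
   proof (rule tendsto_sandwich[OF _ _ l tendsto_const])
    show "\<forall>\<^sub>F s in at_right 0. 1 - ?c * (measure lborel (ball y s - Eb) / measure lborel (ball y s)) \<le> u y s"
     using pos
    proof eventually_elim
     case (elim s)
     show ?case using u_le_density(2)[OF elim, of y] by linarith
    qed
    show "\<forall>\<^sub>F s in at_right 0. u y s \<le> 1" using pos by eventually_elim (rule u_bounds)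
   qed
   then show ?thesis using True by simp
  next
   case False
   have eq: "ball y s - - Eb = ball y s \<inter> Eb" for s by auto
   have "((\<lambda>s. ?c * (measure lborel (ball y s \<inter> Eb) / measure lborel (ball y s))) \<longlongrightarrow> ?c * 0) (at_right 0)"
    using elim False unfolding eq by (intro tendsto_mult tendsto_const) auto
   then have l: "((\<lambda>s. ?c * (measure lborel (ball y s \<inter> Eb) / measure lborel (ball y s))) \<longlongrightarrow> 0) (at_right 0)" by simp
   have "((\<lambda>s. u y s) \<longlongrightarrow> 0) (at_right 0)"
   proof (rule tendsto_sandwich[OF _ _ tendsto_const l])
    show "\<forall>\<^sub>F s in at_right 0. u y s \<le> ?c * (measure lborel (ball y s \<inter> Eb) / measure lborel (ball y s))"
     using pos by eventually_elim (rule u_le_density)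
    show "\<forall>\<^sub>F s in at_right 0. 0 \<le> u y s" using pos by eventually_elim (rule u_bounds)
   qed
   then show ?thesis using False by simp
  qed
 qed
qed

lemma u_borel: "(\<lambda>y. u y s) \<in> borel_measurable borel"
proof -
 have "(\<lambda>y. LINT z|lborel. indicator Eb z * bump s y z) \<in> borel_measurable borel"
 proof (rule lborel.borel_measurable_lebesgue_integral)
  have "(\<lambda>p :: (real^'n) \<times> (real^'n). bump s (fst p) (snd p)) \<in> borel_measurable (borel \<Otimes>\<^sub>M borel)"
   unfolding bump_def borel_prod by (intro borel_measurable_continuous_onI continuous_intros)
  then have "(\<lambda>p. indicator Eb (snd p) * bump s (fst p) (snd p)) \<in> borel_measurable (borel \<Otimes>\<^sub>M borel)"
   using Eb(1) by measurable
  then show "(\<lambda>(y, z). indicat_real Eb z * bump s y z) \<in> borel_measurable (borel \<Otimes>\<^sub>M lborel)"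
   by (simp add: case_prod_beta' cong: measurable_cong_sets)
 qed
 then show ?thesis unfolding u_def U_def by measurable
qed

text \<open>Division by \<open>s ^ (CARD('n) + 4)\<close> removes the term with \<open>U\<close>
  from \<open>U_scale_derivative\<close>. The remaining boundary integral is at most
  \<open>s ^ 5\<close> times the perimeter in the ball, since \<open>norm (x - y) \<le> s\<close>
  there. On scales between \<open>t / 2\<close> and \<open>t\<close> the mean value theorem yields
  \<open>t / 2\<close> times \<open>(2 / t) ^ CARD('n)\<close>.\<close>

lemma u_scale_difference:
 assumes t: "t > 0"
 shows "\<bar>u y t - u y (t / 2)\<bar> \<le> 2 ^ (CARD('n) - 1) * t / (bump_mass TYPE('n) * t ^ CARD('n)) * gmass (ball y t)"
proof -
 let ?n = "CARD('n)" and ?m = "bump_mass TYPE('n)"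
 define v where "v s = U y s / s ^ (?n + 4)" for s
 let ?I = "\<lambda>s. LINT x|\<sigma>. bump s y x * ((x - y) \<bullet> f x)"
 have dv: "(v has_real_derivative - ?I s / s ^ (?n + 5)) (at s)" if "s > 0" for s
 proof -
  have "((\<lambda>s. U y s / s ^ (?n + 4)) has_real_derivative
    (((real ?n + 4) * U y s - ?I s) / s * s ^ (?n + 4) - U y s * (real (?n + 4) * s ^ (?n + 4 - 1))) / (s ^ (?n + 4) * s ^ (?n + 4))) (at s)"
   using that by (intro DERIV_divide U_scale_derivative DERIV_pow[THEN DERIV_cong]) auto
  also have "(((real ?n + 4) * U y s - ?I s) / s * s ^ (?n + 4) - U y s * (real (?n + 4) * s ^ (?n + 4 - 1))) / (s ^ (?n + 4) * s ^ (?n + 4))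
    = - ?I s / s ^ (?n + 5)"
  proof -
   define a where "a = s ^ (?n + 3)"
   have a: "s ^ (?n + 4) = s * a" "s ^ (?n + 4 - 1) = a" "s ^ (?n + 5) = s * (s * a)" "a \<noteq> 0"
    using that by (simp_all add: a_def power_add eval_nat_numeral)
   show ?thesis unfolding a(1-3) using a(4) that by (simp add: field_simps)
  qed
  finally show ?thesis unfolding v_def .
 qed
 have bound: "\<bar>- ?I s / s ^ (?n + 5)\<bar> \<le> gmass (ball y t) / (t / 2) ^ ?n" if s: "t / 2 < s" "s < t" for s
 proof -
  have s0: "s > 0" using s t by simp
  have "\<bar>?I s\<bar> \<le> s ^ 4 * s * gmass (ball y s)"
   by (rule integrable_bump_f(2)[OF s0]) (auto intro!: continuous_intros simp: dist_norm norm_minus_commute)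
  then have "\<bar>- ?I s / s ^ (?n + 5)\<bar> \<le> s ^ 4 * s * gmass (ball y s) / s ^ (?n + 5)"
   using s0 by (simp add: abs_divide divide_right_mono)
  also have "... = gmass (ball y s) / s ^ ?n"
   using s0 by (simp add: power_add eval_nat_numeral)
  also have "... \<le> gmass (ball y t) / (t / 2) ^ ?n"
   using s s0 t by (intro frac_le gmass_nonneg gmass_mono power_mono subset_ball) auto
  finally show ?thesis .
 qed
 obtain \<xi> where \<xi>: "t / 2 < \<xi>" "\<xi> < t" "v t - v (t / 2) = (t - t / 2) * (- ?I \<xi> / \<xi> ^ (?n + 5))"
  using MVT2[of "t / 2" t v "\<lambda>s. - ?I s / s ^ (?n + 5)"] dv t by auto
 have "\<bar>v t - v (t / 2)\<bar> = t / 2 * \<bar>- ?I \<xi> / \<xi> ^ (?n + 5)\<bar>"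
  using t unfolding \<xi>(3) abs_mult by simp
 also have "... \<le> t / 2 * (gmass (ball y t) / (t / 2) ^ ?n)"
  using t by (intro mult_left_mono bound[OF \<xi>(1,2)]) auto
 also have "... = 2 ^ (?n - 1) * t / t ^ ?n * gmass (ball y t)"
 proof -
  have "(2::real) ^ ?n = 2 * 2 ^ (?n - 1)" by (simp add: power_eq_if)
  then show ?thesis by (simp add: power_divide field_simps)
 qed
 finally have v: "\<bar>v t - v (t / 2)\<bar> \<le> 2 ^ (?n - 1) * t / t ^ ?n * gmass (ball y t)" .
 have "u y s = v s / ?m" for s by (simp add: u_def v_def field_simps)
 then have "\<bar>u y t - u y (t / 2)\<bar> = \<bar>v t - v (t / 2)\<bar> / ?m"
  using bump_mass_pos[where 'n='n] by (simp add: diff_divide_distrib[symmetric] abs_divide)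
 also have "... \<le> 2 ^ (?n - 1) * t / t ^ ?n * gmass (ball y t) / ?m"
  using v bump_mass_pos[where 'n='n] by (intro divide_right_mono) (auto simp: less_imp_le)
 also have "... = 2 ^ (?n - 1) * t / (?m * t ^ ?n) * gmass (ball y t)" by simp
 finally show ?thesis .
qed

end

section \<open>Approximation by half-spaces\<close>

lemma half_space_borel:
 "{z \<in> ball x \<rho>. (z - x) \<bullet> c < t} \<in> sets borel" "{z \<in> ball x \<rho>. (z - x) \<bullet> c > t} \<in> sets borel"
 for x :: "real ^ 'n"
proof -
 have "open (ball x \<rho> \<inter> {z. (z - x) \<bullet> c < t})" "open (ball x \<rho> \<inter> {z. (z - x) \<bullet> c > t})"
  by (intro open_Int open_Collect_less continuous_intros open_ball)+
 then show "{z \<in> ball x \<rho>. (z - x) \<bullet> c < t} \<in> sets borel" "{z \<in> ball x \<rho>. (z - x) \<bullet> c > t} \<in> sets borel"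
  by (auto dest!: borel_open simp: Collect_conj_eq)
qed

context gauss_green_density
begin

lemma ennreal_gmass:
 assumes "B \<in> sets borel" "bounded B"
 shows "ennreal (gmass B) = (\<integral>\<^sup>+z. ennreal (norm (f z)) * indicator B z \<partial>\<sigma>)"
 using emeasure_norm_density[OF assms] assms by (simp add: gmass_def emeasure_density)

lemma gmass_ball_borel: "(\<lambda>y. gmass (ball y t)) \<in> borel_measurable borel"
 unfolding gmass_def by (rule ball_integral_borel) measurable

text \<open>Fubini: a boundary point \<open>z\<close> contributes to \<open>gmass (ball y t)\<close>
  exactly when \<open>y\<close> lies in \<open>ball z t\<close>.\<close>

lemma integral_gmass_ball:
 assumes t: "t > 0"
 shows "(\<integral>\<^sup>+y. indicator (ball x \<rho>) y * ennreal (gmass (ball y t)) \<partial>lborel)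
   \<le> ennreal (ball_vol TYPE('n) * t ^ CARD('n) * gmass (ball x (\<rho> + t)))"
proof -
 interpret P: pair_sigma_finite \<sigma> "lborel :: (real ^ 'n) measure" ..
 let ?D = "{p :: (real^'n) \<times> (real^'n). dist (fst p) (snd p) < t}"
 let ?F = "\<lambda>z y. (indicator (ball x \<rho>) y :: ennreal) * (ennreal (norm (f z)) * indicator ?D (z, y))"
 have "open ?D" by (intro open_Collect_less continuous_intros)
 then have D [measurable]: "?D \<in> sets (borel \<Otimes>\<^sub>M borel)" unfolding borel_prod by (rule borel_open)
 have [measurable]: "ball x \<rho> \<in> sets borel" by simp
 have m: "case_prod ?F \<in> borel_measurable (\<sigma> \<Otimes>\<^sub>M lborel)"
 proof -
  have "(\<lambda>p. (indicator (ball x \<rho>) (snd p) :: ennreal) * (ennreal (norm (f (fst p))) * indicator ?D p)) \<in> borel_measurable (borel \<Otimes>\<^sub>M borel)"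
   by measurable
  then show ?thesis by (simp add: case_prod_beta' cong: measurable_cong_sets)
 qed
 have "(\<integral>\<^sup>+y. indicator (ball x \<rho>) y * ennreal (gmass (ball y t)) \<partial>lborel) = (\<integral>\<^sup>+y. (\<integral>\<^sup>+z. ?F z y \<partial>\<sigma>) \<partial>lborel)"
 proof (rule nn_integral_cong)
  fix y
  have "ennreal (gmass (ball y t)) = (\<integral>\<^sup>+z. ennreal (norm (f z)) * indicator ?D (z, y) \<partial>\<sigma>)"
   by (subst ennreal_gmass) (auto intro!: nn_integral_cong simp: indicator_def dist_commute)
  moreover have "(\<lambda>z. ennreal (norm (f z)) * indicator ?D (z, y)) \<in> borel_measurable \<sigma>"
  proof -
   have "(\<lambda>z. indicator ?D (z, y) :: ennreal) = indicator (ball y t)"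
    by (auto simp: indicator_def dist_commute fun_eq_iff)
   then show ?thesis by simp
  qed
  ultimately show "indicator (ball x \<rho>) y * ennreal (gmass (ball y t)) = (\<integral>\<^sup>+z. ?F z y \<partial>\<sigma>)"
   by (simp add: nn_integral_cmult)
 qed
 also have "... = (\<integral>\<^sup>+z. (\<integral>\<^sup>+y. ?F z y \<partial>lborel) \<partial>\<sigma>)" by (rule P.Fubini'[OF m])
 also have "... \<le> (\<integral>\<^sup>+z. ennreal (ball_vol TYPE('n) * t ^ CARD('n)) * (ennreal (norm (f z)) * indicator (ball x (\<rho> + t)) z) \<partial>\<sigma>)"
 proof (rule nn_integral_mono)
  fix z
  have "(\<integral>\<^sup>+y. ?F z y \<partial>lborel) \<le> (\<integral>\<^sup>+y. ennreal (norm (f z)) * indicator (ball x (\<rho> + t)) z * indicator (ball z t) y \<partial>lborel)"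
  proof (rule nn_integral_mono)
   fix y
   show "?F z y \<le> ennreal (norm (f z)) * indicator (ball x (\<rho> + t)) z * indicator (ball z t) y"
   proof (cases "y \<in> ball x \<rho> \<and> dist z y < t")
    case True
    then have "dist x z < \<rho> + t" using dist_triangle_less_add[of x y \<rho> z t] by (simp add: dist_commute)
    then show ?thesis using True by simp
   next
    case False
    then have "?F z y = 0" by (auto simp: indicator_def)
    then show ?thesis by (simp only: zero_le)
   qed
  qed
  also have "... = ennreal (norm (f z)) * indicator (ball x (\<rho> + t)) z * emeasure lborel (ball z t)"
   by (simp add: nn_integral_cmult_indicator)
  also have "emeasure lborel (ball z t) = ennreal (ball_vol TYPE('n) * t ^ CARD('n))"
   using t by (simp add: leb.emeasure_eq_measure_bounded measure_ball)
  finally show "(\<integral>\<^sup>+y. ?F z y \<partial>lborel) \<le> ennreal (ball_vol TYPE('n) * t ^ CARD('n)) * (ennreal (norm (f z)) * indicator (ball x (\<rho> + t)) z)"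
   by (simp add: mult.commute)
 qed
 also have "... = ennreal (ball_vol TYPE('n) * t ^ CARD('n)) * ennreal (gmass (ball x (\<rho> + t)))"
 proof (subst ennreal_gmass)
  have [measurable]: "ball x (\<rho> + t) \<in> sets borel" by simp
  have "(\<lambda>z. ennreal (norm (f z)) * indicator (ball x (\<rho> + t)) z) \<in> borel_measurable \<sigma>" by measurable
  then show "(\<integral>\<^sup>+z. ennreal (ball_vol TYPE('n) * t ^ CARD('n)) * (ennreal (norm (f z)) * indicator (ball x (\<rho> + t)) z) \<partial>\<sigma>)
   = ennreal (ball_vol TYPE('n) * t ^ CARD('n)) * (\<integral>\<^sup>+z. ennreal (norm (f z)) * indicator (ball x (\<rho> + t)) z \<partial>\<sigma>)"
   by (rule nn_integral_cmult)
 qed auto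
 also have "... = ennreal (ball_vol TYPE('n) * t ^ CARD('n) * gmass (ball x (\<rho> + t)))"
  by (rule ennreal_mult''[symmetric]) (rule gmass_nonneg)
 finally show ?thesis .
qed

definition mollify_const :: real where
 "mollify_const = ball_vol TYPE('n) * 2 ^ (CARD('n) - 1) / bump_mass TYPE('n)"

lemma mollify_const_pos: "mollify_const > 0"
 unfolding mollify_const_def using bump_mass_pos[where 'n='n] by (intro divide_pos_pos mult_pos_pos) auto

lemma integral_u_scale_difference:
 assumes t: "t > 0"
 shows "(\<integral>\<^sup>+y. indicator (ball x \<rho>) y * ennreal \<bar>u y t - u y (t / 2)\<bar> \<partial>lborel)
   \<le> ennreal (mollify_const * t * gmass (ball x (\<rho> + t)))"
proof -
 let ?c = "2 ^ (CARD('n) - 1) * t / (bump_mass TYPE('n) * t ^ CARD('n))"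
 have c: "?c \<ge> 0" using t bump_mass_pos[where 'n='n] by simp
 have "(\<integral>\<^sup>+y. indicator (ball x \<rho>) y * ennreal \<bar>u y t - u y (t / 2)\<bar> \<partial>lborel)
   \<le> (\<integral>\<^sup>+y. ennreal ?c * (indicator (ball x \<rho>) y * ennreal (gmass (ball y t))) \<partial>lborel)"
 proof (rule nn_integral_mono)
  fix y
  have "ennreal \<bar>u y t - u y (t / 2)\<bar> \<le> ennreal (?c * gmass (ball y t))"
   by (rule ennreal_leI[OF u_scale_difference[OF t]])
  also have "... = ennreal ?c * ennreal (gmass (ball y t))"
   by (rule ennreal_mult''[OF gmass_nonneg])
  finally show "indicator (ball x \<rho>) y * ennreal \<bar>u y t - u y (t / 2)\<bar> \<le> ennreal ?c * (indicator (ball x \<rho>) y * ennreal (gmass (ball y t)))"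
   by (simp add: indicator_def)
 qed
 also have "... = ennreal ?c * (\<integral>\<^sup>+y. indicator (ball x \<rho>) y * ennreal (gmass (ball y t)) \<partial>lborel)"
 proof (rule nn_integral_cmult)
  note [measurable] = gmass_ball_borel[of t]
  have [measurable]: "ball x \<rho> \<in> sets borel" by simp
  show "(\<lambda>y. indicator (ball x \<rho>) y * ennreal (gmass (ball y t))) \<in> borel_measurable lborel" by measurable
 qed
 also have "... \<le> ennreal ?c * ennreal (ball_vol TYPE('n) * t ^ CARD('n) * gmass (ball x (\<rho> + t)))"
  by (intro mult_left_mono integral_gmass_ball t) simp
 also have "... = ennreal (?c * (ball_vol TYPE('n) * t ^ CARD('n) * gmass (ball x (\<rho> + t))))"
  using c by (intro ennreal_mult'[symmetric])
 also have "?c * (ball_vol TYPE('n) * t ^ CARD('n) * gmass (ball x (\<rho> + t))) = mollify_const * t * gmass (ball x (\<rho> + t))"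
  using t unfolding mollify_const_def by simp
 finally show ?thesis .
qed

text \<open>The errors at dyadic scales are proportional to the scale; \<open>2 - 2 / 2 ^ k\<close>
  is the partial sum of the geometric series.\<close>

lemma integral_u_telescope:
 assumes s: "s > 0"
 shows "(\<integral>\<^sup>+y. indicator (ball x \<rho>) y * ennreal \<bar>u y s - u y (s / 2 ^ k)\<bar> \<partial>lborel)
   \<le> ennreal (mollify_const * s * gmass (ball x (\<rho> + s)) * (2 - 2 / 2 ^ k))"
proof (induction k)
 case 0
 then show ?case by simp
next
 case (Suc k)
 let ?G = "gmass (ball x (\<rho> + s))" and ?t = "s / 2 ^ k"
 have t: "?t > 0" "?t \<le> s" using s by (auto simp: divide_le_eq mult_le_cancel_left1)
 note [measurable] = u_borel
 have [measurable]: "ball x \<rho> \<in> sets borel" by simp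
 have m: "(\<lambda>y. indicator (ball x \<rho>) y * ennreal \<bar>u y a - u y b\<bar>) \<in> borel_measurable lborel" for a b
  by measurable
 have "(\<integral>\<^sup>+y. indicator (ball x \<rho>) y * ennreal \<bar>u y s - u y (s / 2 ^ Suc k)\<bar> \<partial>lborel)
   \<le> (\<integral>\<^sup>+y. indicator (ball x \<rho>) y * ennreal \<bar>u y s - u y ?t\<bar> + indicator (ball x \<rho>) y * ennreal \<bar>u y ?t - u y (?t / 2)\<bar> \<partial>lborel)"
 proof (rule nn_integral_mono)
  fix y
  have "ennreal \<bar>u y s - u y (s / 2 ^ Suc k)\<bar> \<le> ennreal (\<bar>u y s - u y ?t\<bar> + \<bar>u y ?t - u y (?t / 2)\<bar>)"
   by (intro ennreal_leI) (simp add: mult.commute)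
  then show "indicator (ball x \<rho>) y * ennreal \<bar>u y s - u y (s / 2 ^ Suc k)\<bar>
    \<le> indicator (ball x \<rho>) y * ennreal \<bar>u y s - u y ?t\<bar> + indicator (ball x \<rho>) y * ennreal \<bar>u y ?t - u y (?t / 2)\<bar>"
   by (simp add: indicator_def)
 qed
 also have "... = (\<integral>\<^sup>+y. indicator (ball x \<rho>) y * ennreal \<bar>u y s - u y ?t\<bar> \<partial>lborel) + (\<integral>\<^sup>+y. indicator (ball x \<rho>) y * ennreal \<bar>u y ?t - u y (?t / 2)\<bar> \<partial>lborel)"
  by (rule nn_integral_add[OF m m])
 also have "... \<le> ennreal (mollify_const * s * ?G * (2 - 2 / 2 ^ k)) + ennreal (mollify_const * ?t * ?G)"
 proof (intro add_mono Suc order_trans[OF integral_u_scale_difference[OF t(1)]] ennreal_leI mult_left_mono)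
  show "gmass (ball x (\<rho> + ?t)) \<le> ?G" using t by (intro gmass_mono subset_ball) auto
 qed (use mollify_const_pos t in \<open>simp add: less_imp_le\<close>)
 also have "... = ennreal (mollify_const * s * ?G * (2 - 2 / 2 ^ k) + mollify_const * ?t * ?G)"
 proof (rule ennreal_plus[symmetric])
  have "2 / 2 ^ k \<le> (2::real)" by (simp add: divide_le_eq)
  then show "0 \<le> mollify_const * s * ?G * (2 - 2 / 2 ^ k)"
   using mollify_const_pos s gmass_nonneg by (intro mult_nonneg_nonneg) auto
  show "0 \<le> mollify_const * ?t * ?G"
   using mollify_const_pos t gmass_nonneg by (intro mult_nonneg_nonneg) auto
 qed
 also have "mollify_const * s * ?G * (2 - 2 / 2 ^ k) + mollify_const * ?t * ?G = mollify_const * s * ?G * (2 - 2 / 2 ^ Suc k)"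
  by (simp add: algebra_simps)
 finally show ?case .
qed

text \<open>Fatou's lemma along the scales \<open>s / 2 ^ k\<close>, at which \<open>u\<close>
  converges to the indicator almost everywhere; the geometric series costs the factor 2.\<close>

lemma integral_u_minus_indicator:
 assumes s: "s > 0"
 shows "(\<integral>\<^sup>+y. indicator (ball x \<rho>) y * ennreal \<bar>u y s - indicator Eb y\<bar> \<partial>lborel)
   \<le> ennreal (2 * mollify_const * s * gmass (ball x (\<rho> + s)))"
proof -
 let ?b = "ennreal (2 * mollify_const * s * gmass (ball x (\<rho> + s)))"
 let ?F = "\<lambda>k y. indicator (ball x \<rho>) y * ennreal \<bar>u y s - u y (s / 2 ^ k)\<bar>"
 note [measurable] = u_borel
 have [measurable]: "ball x \<rho> \<in> sets borel" by simp
 have m: "?F k \<in> borel_measurable lborel" for k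
  by measurable
 have lim0: "filterlim (\<lambda>k. s / 2 ^ k) (at_right 0) sequentially"
 proof -
  have "(\<lambda>k. s * (1/2) ^ k) \<longlonglongrightarrow> s * 0" by (intro tendsto_mult tendsto_const LIMSEQ_power_zero) simp
  moreover have "s * (1/2) ^ k = s / 2 ^ k" for k by (simp add: power_divide)
  ultimately have "(\<lambda>k. s / 2 ^ k) \<longlonglongrightarrow> 0" by simp
  moreover have "\<forall>\<^sub>F k in sequentially. s / 2 ^ k \<in> {0<..} \<and> s / 2 ^ k \<noteq> 0"
   using s by (intro always_eventually) simp
  ultimately show ?thesis by (simp add: filterlim_at)
 qed
 have "(\<integral>\<^sup>+y. indicator (ball x \<rho>) y * ennreal \<bar>u y s - indicator Eb y\<bar> \<partial>lborel) = (\<integral>\<^sup>+y. liminf (\<lambda>k. ?F k y) \<partial>lborel)"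
 proof (rule nn_integral_cong_AE)
  show "AE y in lborel. indicator (ball x \<rho>) y * ennreal \<bar>u y s - indicator Eb y\<bar> = liminf (\<lambda>k. ?F k y)"
   using u_tendsto
  proof eventually_elim
   case (elim y)
   have "(\<lambda>k. u y (s / 2 ^ k)) \<longlonglongrightarrow> indicator Eb y" by (rule filterlim_compose[OF elim lim0])
   then have "(\<lambda>k. ennreal \<bar>u y s - u y (s / 2 ^ k)\<bar>) \<longlonglongrightarrow> ennreal \<bar>u y s - indicator Eb y\<bar>"
    by (intro tendsto_ennrealI tendsto_rabs tendsto_diff tendsto_const)
   then have "(\<lambda>k. ?F k y) \<longlonglongrightarrow> indicator (ball x \<rho>) y * ennreal \<bar>u y s - indicator Eb y\<bar>"
    by (cases "y \<in> ball x \<rho>") auto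
   from lim_imp_Liminf[OF sequentially_bot this] show ?case by simp
  qed
 qed
 also have "... \<le> liminf (\<lambda>k. integral\<^sup>N lborel (?F k))" by (rule nn_integral_liminf[OF m])
 also have "... \<le> liminf (\<lambda>k::nat. ?b)"
 proof (rule Liminf_mono, rule always_eventually, rule allI)
  fix k
  have "mollify_const * s * gmass (ball x (\<rho> + s)) * (2 - 2 / 2 ^ k) \<le> mollify_const * s * gmass (ball x (\<rho> + s)) * 2"
   using mollify_const_pos s gmass_nonneg by (intro mult_left_mono mult_nonneg_nonneg) auto
  then have "ennreal (mollify_const * s * gmass (ball x (\<rho> + s)) * (2 - 2 / 2 ^ k)) \<le> ?b"
   by (intro ennreal_leI) (simp add: mult_ac)
  then show "integral\<^sup>N lborel (?F k) \<le> ?b" by (rule order_trans[OF integral_u_telescope[OF s]])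
 qed
 also have "... = ?b" by (intro lim_imp_Liminf sequentially_bot tendsto_const)
 finally show ?thesis .
qed

text \<open>The derivative along the segment is minus the boundary integral of the bump times
  \<open>w \<bullet> f\<close>. The part of \<open>f\<close> along \<open>c\<close> has a sign
  because \<open>w \<bullet> c \<ge> 0\<close>; only the deviation of \<open>f\<close> from |f| c,
  weighted by at most \<open>s ^ 4 * norm w\<close>, can make \<open>U\<close> grow.\<close>

lemma U_almost_monotone:
 assumes s: "s > 0" and c: "norm c = 1" and wc: "w \<bullet> c \<ge> 0"
  and sub: "\<And>\<tau>. 0 \<le> \<tau> \<Longrightarrow> \<tau> \<le> 1 \<Longrightarrow> ball (y + \<tau> *\<^sub>R w) s \<subseteq> ball x r"
  and osc: "(LINT z:ball x r|\<sigma>. norm (f z - norm (f z) *\<^sub>R c)) \<le> \<eta>"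
 shows "U (y + w) s \<le> U y s + s ^ 4 * norm w * \<eta>"
proof -
 let ?I = "\<lambda>\<tau>. LINT z|\<sigma>. bump s (y + \<tau> *\<^sub>R w) z * (w \<bullet> f z)"
 let ?h = "\<lambda>z. norm (f z - norm (f z) *\<^sub>R c)"
 have d: "((\<lambda>\<tau>. U (y + \<tau> *\<^sub>R w) s) has_real_derivative - ?I \<tau>) (at \<tau>)" for \<tau>
  by (rule U_line_derivative[OF s])
 obtain \<xi> where \<xi>: "0 < \<xi>" "\<xi> < 1" "U (y + 1 *\<^sub>R w) s - U (y + 0 *\<^sub>R w) s = (1 - 0) * (- ?I \<xi>)"
  using MVT2[of 0 1 "\<lambda>\<tau>. U (y + \<tau> *\<^sub>R w) s" "\<lambda>\<tau>. - ?I \<tau>"] d by auto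
 have hb: "?h \<in> borel_measurable borel" by measurable
 have hK: "norm (?h z) \<le> 2 * M" for z
 proof -
  have "?h z \<le> norm (f z) + norm (norm (f z) *\<^sub>R c)" by (rule norm_triangle_ineq4)
  then show ?thesis using f_bound[of z] c by simp
 qed
 have ih: "integrable \<sigma> (\<lambda>z. indicator (ball x r) z * ?h z)"
  using set_integrable_bdd[OF hb _ _ hK, of "ball x r"] unfolding set_integrable_def by simp
 have ib: "integrable \<sigma> (\<lambda>z. bump s (y + \<xi> *\<^sub>R w) z * (w \<bullet> f z))"
  by (rule integrable_bump_f(1)[OF s continuous_on_const, of _ w "norm w"]) simp
 have "- ?I \<xi> = (LINT z|\<sigma>. - (bump s (y + \<xi> *\<^sub>R w) z * (w \<bullet> f z)))" by simp
 also have "... \<le> (LINT z|\<sigma>. s ^ 4 * norm w * (indicator (ball x r) z * ?h z))"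
 proof (rule integral_mono)
  show "integrable \<sigma> (\<lambda>z. - (bump s (y + \<xi> *\<^sub>R w) z * (w \<bullet> f z)))" using ib by simp
  show "integrable \<sigma> (\<lambda>z. s ^ 4 * norm w * (indicator (ball x r) z * ?h z))" by (intro integrable_mult_right ih)
  fix z
  show "- (bump s (y + \<xi> *\<^sub>R w) z * (w \<bullet> f z)) \<le> s ^ 4 * norm w * (indicator (ball x r) z * ?h z)"
  proof (cases "z \<in> ball (y + \<xi> *\<^sub>R w) s")
   case False
   then show ?thesis by (simp add: bump_eq_0[OF s] indicator_def)
  next
   case True
   then have zr: "z \<in> ball x r" using sub[of \<xi>] \<xi> by auto
   have "w \<bullet> f z = norm (f z) * (w \<bullet> c) + w \<bullet> (f z - norm (f z) *\<^sub>R c)"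
    by (simp add: inner_diff_right)
   moreover have "norm (f z) * (w \<bullet> c) \<ge> 0" using wc by simp
   moreover have "\<bar>w \<bullet> (f z - norm (f z) *\<^sub>R c)\<bar> \<le> norm w * ?h z" by (rule Cauchy_Schwarz_ineq2)
   ultimately have 1: "- (w \<bullet> f z) \<le> norm w * ?h z" by linarith
   have "bump s (y + \<xi> *\<^sub>R w) z * (- (w \<bullet> f z)) \<le> bump s (y + \<xi> *\<^sub>R w) z * (norm w * ?h z)"
    by (intro mult_left_mono 1 bump_nonneg)
   also have "... \<le> s ^ 4 * (norm w * ?h z)" by (intro mult_right_mono bump_le) simp
   finally show ?thesis using zr by (simp add: mult.assoc)
  qed
 qed
 also have "... = s ^ 4 * norm w * (LINT z:ball x r|\<sigma>. ?h z)"
  by (simp add: set_lebesgue_integral_def)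
 also have "... \<le> s ^ 4 * norm w * \<eta>" using s by (intro mult_left_mono osc) auto
 finally show ?thesis using \<xi>(3) by simp
qed

text \<open>At scale \<open>\<theta> * r\<close> the function \<open>u\<close> grows by at most 1/4
  in direction \<open>c\<close>. With the plane placed at the top of the superlevel set of height
  1/2, \<open>u\<close> is at least 1/4 below and less than 1/2 above, so each point of the wrong
  phase contributes at least 1/4 to the L^1 distance. The 8 is 4 from Markov's inequality times the
  2 of \<open>integral_u_minus_indicator\<close>.\<close>

theorem half_space_approximation:
 assumes r: "r > 0" and c: "norm c = 1" and \<theta>: "0 < \<theta>" "\<theta> \<le> 1 / 4"
  and mass: "gmass (ball x r) \<le> M0 * r ^ (CARD('n) - 1)"
  and osc: "(LINT z:ball x r|\<sigma>. norm (f z - norm (f z) *\<^sub>R c)) \<le> \<epsilon> * r ^ (CARD('n) - 1)"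
  and \<epsilon>: "\<epsilon> \<le> bump_mass TYPE('n) * \<theta> ^ CARD('n) / 4"
 shows "\<exists>t. measure lebesgue ({z \<in> ball x (r / 2). (z - x) \<bullet> c < t} - E) \<le> 8 * mollify_const * M0 * \<theta> * r ^ CARD('n) \<and>
   measure lebesgue ({z \<in> ball x (r / 2). (z - x) \<bullet> c > t} \<inter> E) \<le> 8 * mollify_const * M0 * \<theta> * r ^ CARD('n)"
proof -
 let ?n = "CARD('n)" and ?m = "bump_mass TYPE('n)"
 \<comment> \<open>At this scale the condition on \<epsilon> bounds the increment
   \<open>s ^ 4 * (\<epsilon> * r ^ ?n)\<close> of \<open>U\<close> by a quarter of its normalising
   factor \<open>?m * s ^ (?n + 4)\<close>.\<close>
 define s where "s = \<theta> * r"
 have s: "s > 0" "s \<le> r / 4" using \<theta> r by (auto simp: s_def)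
 have rn: "r ^ ?n = r * r ^ (?n - 1)" by (simp add: power_eq_if)
 have mono: "u y' s \<le> u y s + 1 / 4"
  if y: "y \<in> ball x (r / 2)" and y': "y' \<in> ball x (r / 2)" and le: "(y' - y) \<bullet> c \<ge> 0" for y y'
 proof -
  have sub: "ball (y + \<tau> *\<^sub>R (y' - y)) s \<subseteq> ball x r" if "0 \<le> \<tau>" "\<tau> \<le> 1" for \<tau>
  proof -
   have "y + \<tau> *\<^sub>R (y' - y) = (1 - \<tau>) *\<^sub>R y + \<tau> *\<^sub>R y'" by (simp add: algebra_simps)
   then have "y + \<tau> *\<^sub>R (y' - y) \<in> ball x (r / 2)"
    using convexD[OF convex_ball y y', of "1 - \<tau>" \<tau>] that by simp
   then show ?thesis using s by (simp add: ball_subset_ball_iff dist_commute)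
  qed
  have "norm (y' - y) \<le> r"
  proof -
   have "dist y' y < r / 2 + r / 2" using y y' dist_triangle_less_add[of y' x "r/2" y "r/2"] by (simp add: dist_commute)
   then show ?thesis by (simp add: dist_norm)
  qed
  have osc0: "0 \<le> \<epsilon> * r ^ (?n - 1)"
  proof -
   have "0 \<le> (LINT z:ball x r|\<sigma>. norm (f z - norm (f z) *\<^sub>R c))"
    unfolding set_lebesgue_integral_def by (intro integral_nonneg_AE) auto
   then show ?thesis using osc by simp
  qed
  have "U y' s \<le> U y s + s ^ 4 * norm (y' - y) * (\<epsilon> * r ^ (?n - 1))"
   using U_almost_monotone[OF s(1) c le sub osc] by simp
  also have "s ^ 4 * norm (y' - y) * (\<epsilon> * r ^ (?n - 1)) \<le> s ^ 4 * r * (\<epsilon> * r ^ (?n - 1))"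
   using s \<open>norm (y' - y) \<le> r\<close> osc0 by (intro mult_right_mono mult_left_mono) auto
  also have "... = s ^ 4 * (\<epsilon> * r ^ ?n)" by (simp add: rn)
  also have "... \<le> s ^ 4 * (?m * \<theta> ^ ?n / 4 * r ^ ?n)"
   using \<epsilon> s r by (intro mult_left_mono mult_right_mono) auto
  also have "... = (?m * s ^ (?n + 4)) * (1 / 4)" by (simp add: s_def power_add power_mult_distrib)
  finally have "U y' s \<le> U y s + (?m * s ^ (?n + 4)) * (1 / 4)" by simp
  moreover have p: "?m * s ^ (?n + 4) > 0" using s bump_mass_pos[where 'n='n] by simp
  ultimately have "U y' s / (?m * s ^ (?n + 4)) \<le> (U y s + (?m * s ^ (?n + 4)) * (1 / 4)) / (?m * s ^ (?n + 4))"
   by (intro divide_right_mono) auto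
  also have "... = U y s / (?m * s ^ (?n + 4)) + 1 / 4"
  proof -
   have "(a + d * (1 / 4)) / d = a / d + 1 / 4" if "d > 0" for a d :: real using that by (simp add: add_divide_distrib)
   from this[OF p] show ?thesis .
  qed
  finally show ?thesis by (simp add: u_def)
 qed
 let ?J = "\<integral>\<^sup>+y. indicator (ball x (r / 2)) y * ennreal \<bar>u y s - indicator Eb y\<bar> \<partial>lborel"
 let ?b = "8 * mollify_const * M0 * \<theta> * r ^ ?n"
 have J: "4 * ?J \<le> ennreal ?b"
 proof -
  have "gmass (ball x (r / 2 + s)) \<le> M0 * r ^ (?n - 1)"
   using s r by (intro order_trans[OF gmass_mono mass] subset_ball) auto
  then have "2 * mollify_const * s * gmass (ball x (r / 2 + s)) \<le> 2 * mollify_const * s * (M0 * r ^ (?n - 1))"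
   using s mollify_const_pos by (intro mult_left_mono) auto
  also have "... = 2 * mollify_const * M0 * \<theta> * r ^ ?n" by (simp add: s_def rn)
  finally have "?J \<le> ennreal (2 * mollify_const * M0 * \<theta> * r ^ ?n)"
   by (intro order_trans[OF integral_u_minus_indicator[OF s(1)]] ennreal_leI)
  then have "4 * ?J \<le> 4 * ennreal (2 * mollify_const * M0 * \<theta> * r ^ ?n)" by (intro mult_left_mono) auto
  also have "... = ennreal (4 * (2 * mollify_const * M0 * \<theta> * r ^ ?n))"
   by (subst ennreal_mult') auto
  also have "4 * (2 * mollify_const * M0 * \<theta> * r ^ ?n) = ?b" by linarith
  finally show ?thesis .
 qed
 have b: "?b \<ge> 0"
 proof -
  have "0 \<le> M0 * r ^ (?n - 1)" using mass gmass_nonneg[of "ball x r"] by linarith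
  moreover have "r ^ (?n - 1) > 0" using r by simp
  ultimately have "M0 \<ge> 0" by (metis mult.commute not_le mult_pos_neg)
  then show ?thesis using mollify_const_pos \<theta> r by simp
 qed
 have markov: "measure lborel A \<le> ?b"
  if A: "A \<in> sets borel" "A \<subseteq> ball x (r / 2)" and lo: "\<And>y. y \<in> A \<Longrightarrow> 1 / 4 \<le> \<bar>u y s - indicator Eb y\<bar>" for A
 proof -
  have "emeasure lborel A = (\<integral>\<^sup>+y. indicator A y \<partial>lborel)" using A(1) by simp
  also have "... \<le> (\<integral>\<^sup>+y. 4 * (indicator (ball x (r / 2)) y * ennreal \<bar>u y s - indicator Eb y\<bar>) \<partial>lborel)"
  proof (rule nn_integral_mono)
   fix y
   show "indicator A y \<le> 4 * (indicator (ball x (r / 2)) y * ennreal \<bar>u y s - indicator Eb y\<bar>)"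
   proof (cases "y \<in> A")
    case True
    have "ennreal 1 \<le> ennreal (4 * \<bar>u y s - indicator Eb y\<bar>)" using lo[OF True] by (intro ennreal_leI) auto
    then show ?thesis using True A(2) by (auto simp: ennreal_mult')
   qed simp
  qed
  also have "... = 4 * ?J"
  proof (rule nn_integral_cmult)
   note [measurable] = u_borel Eb(1)
   have [measurable]: "ball x (r / 2) \<in> sets borel" by simp
   show "(\<lambda>y. indicator (ball x (r / 2)) y * ennreal \<bar>u y s - indicator Eb y\<bar>) \<in> borel_measurable lborel" by measurable
  qed
  finally have "emeasure lborel A \<le> ennreal ?b" using J by (rule order_trans)
  then show ?thesis using b unfolding measure_def by (intro enn2real_leI)
 qed
 define Z where "Z = {y \<in> ball x (r / 2). u y s \<ge> 1 / 2}"
 \<comment> \<open>If \<open>u\<close> stays below 1/2, the whole ball counts as lying above the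
   plane: \<open>- r\<close> is less than every value of \<open>(y - x) \<bullet> c\<close> on
   \<open>ball x (r / 2)\<close>.\<close>
 define t where "t = (if Z = {} then - r else Sup ((\<lambda>y. (y - x) \<bullet> c) ` Z))"
 have inner_le: "\<bar>(y - x) \<bullet> c\<bar> < r / 2" if "y \<in> ball x (r / 2)" for y
  using Cauchy_Schwarz_ineq2[of "y - x" c] that c by (simp add: dist_norm norm_minus_commute)
 have bdd: "bdd_above ((\<lambda>y. (y - x) \<bullet> c) ` Z)"
  by (rule bdd_aboveI[of _ "r / 2"]) (use inner_le in \<open>fastforce simp: Z_def\<close>)
 have below: "u y s \<ge> 1 / 4" if y: "y \<in> ball x (r / 2)" "(y - x) \<bullet> c < t" for y
 proof -
  have ne: "Z \<noteq> {}"
  proof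
   assume "Z = {}"
   then have "(y - x) \<bullet> c < - r" using y by (simp add: t_def)
   then show False using inner_le[OF y(1)] r by linarith
  qed
  then obtain y1 where y1: "y1 \<in> Z" "(y - x) \<bullet> c < (y1 - x) \<bullet> c"
   using y(2) less_cSup_iff[of "(\<lambda>y. (y - x) \<bullet> c) ` Z" "(y - x) \<bullet> c"] bdd by (auto simp: t_def)
  have "u y1 s \<le> u y s + 1 / 4"
   using y1 y by (intro mono) (auto simp: Z_def inner_diff_left)
  then show ?thesis using y1(1) by (simp add: Z_def)
 qed
 have above: "u y s < 1 / 2" if y: "y \<in> ball x (r / 2)" "(y - x) \<bullet> c > t" for y
 proof (rule ccontr)
  assume "\<not> u y s < 1 / 2"
  then have "y \<in> Z" using y by (simp add: Z_def)
  then have "(y - x) \<bullet> c \<le> t" using bdd by (auto simp: t_def intro!: cSup_upper)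
  then show False using y(2) by simp
 qed
 note B1 = half_space_borel(1)[of x "r / 2" c t] and B2 = half_space_borel(2)[of x "r / 2" t c]
 have "measure lborel ({z \<in> ball x (r / 2). (z - x) \<bullet> c < t} - Eb) \<le> ?b"
 proof (rule markov)
  show "{z \<in> ball x (r / 2). (z - x) \<bullet> c < t} - Eb \<in> sets borel" using B1 Eb(1) by (rule sets.Diff)
  fix y assume "y \<in> {z \<in> ball x (r / 2). (z - x) \<bullet> c < t} - Eb"
  then show "1 / 4 \<le> \<bar>u y s - indicator Eb y\<bar>" using below[of y] by simp
 qed auto
 moreover have "measure lborel ({z \<in> ball x (r / 2). (z - x) \<bullet> c > t} \<inter> Eb) \<le> ?b"
 proof (rule markov)
  show "{z \<in> ball x (r / 2). (z - x) \<bullet> c > t} \<inter> Eb \<in> sets borel" using B2 Eb(1) by (rule sets.Int)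
  fix y assume "y \<in> {z \<in> ball x (r / 2). (z - x) \<bullet> c > t} \<inter> Eb"
  then show "1 / 4 \<le> \<bar>u y s - indicator Eb y\<bar>" using above[of y] by simp
 qed auto
 ultimately show ?thesis unfolding measure_Eb(2)[OF B1, symmetric] measure_Eb(1)[OF B2, symmetric] by blast
qed

end

section \<open>Flatness of the boundary\<close>

text \<open>Here \<open>c\<close> points out of \<open>E\<close>; measuring the defects relative to
  \<open>\<rho> ^ CARD('n)\<close> makes \<tau> scale invariant.\<close>

definition half_space_close ::
  "(real ^ 'n) set \<Rightarrow> real ^ 'n \<Rightarrow> real ^ 'n \<Rightarrow> real \<Rightarrow> real \<Rightarrow> real \<Rightarrow> bool" where
 "half_space_close E x c t \<rho> \<tau> \<longleftrightarrow>
   measure lebesgue ({z \<in> ball x \<rho>. (z - x) \<bullet> c < t} - E) \<le> \<tau> * \<rho> ^ CARD('n) \<and>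
   measure lebesgue ({z \<in> ball x \<rho>. (z - x) \<bullet> c > t} \<inter> E) \<le> \<tau> * \<rho> ^ CARD('n)"

definition balanced :: "(real ^ 'n) set \<Rightarrow> real ^ 'n \<Rightarrow> real \<Rightarrow> real \<Rightarrow> bool" where
 "balanced E x \<rho> \<alpha> \<longleftrightarrow>
   \<alpha> * \<rho> ^ CARD('n) \<le> measure lebesgue (ball x \<rho> \<inter> E) \<and>
   \<alpha> * \<rho> ^ CARD('n) \<le> measure lebesgue (ball x \<rho> - E)"

lemma lmeasurable_bounded_subset:
 "E \<in> sets lebesgue \<Longrightarrow> B \<in> sets lebesgue \<Longrightarrow> bounded B \<Longrightarrow> B \<inter> E \<in> lmeasurable \<and> B - E \<in> lmeasurable"
 for B :: "(real ^ 'n) set"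
 by (intro conjI bounded_set_imp_lmeasurable) (auto intro: bounded_subset)

lemma half_space_close_below:
 fixes E :: "(real ^ 'n) set"
 assumes E: "E \<in> sets lebesgue" and hs: "half_space_close E x c t \<rho> \<tau>"
  and B: "B \<in> sets lebesgue" "B \<subseteq> ball x \<rho>" "\<And>z. z \<in> B \<Longrightarrow> (z - x) \<bullet> c < t"
 shows "measure lebesgue (B - E) \<le> \<tau> * \<rho> ^ CARD('n)"
proof -
 have "measure lebesgue (B - E) \<le> measure lebesgue ({z \<in> ball x \<rho>. (z - x) \<bullet> c < t} - E)"
 proof (rule measure_mono_fmeasurable)
  show "{z \<in> ball x \<rho>. (z - x) \<bullet> c < t} - E \<in> lmeasurable"
  proof -
   have "bounded {z \<in> ball x \<rho>. (z - x) \<bullet> c < t}" by (rule bounded_subset[OF bounded_ball]) auto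
   then show ?thesis using lmeasurable_bounded_subset[OF E] half_space_borel(1) by auto
  qed
 qed (use B E in auto)
 then show ?thesis using hs by (simp add: half_space_close_def)
qed

lemma half_space_close_above:
 fixes E :: "(real ^ 'n) set"
 assumes E: "E \<in> sets lebesgue" and hs: "half_space_close E x c t \<rho> \<tau>"
  and B: "B \<in> sets lebesgue" "B \<subseteq> ball x \<rho>" "\<And>z. z \<in> B \<Longrightarrow> (z - x) \<bullet> c > t"
 shows "measure lebesgue (B \<inter> E) \<le> \<tau> * \<rho> ^ CARD('n)"
proof -
 have "measure lebesgue (B \<inter> E) \<le> measure lebesgue ({z \<in> ball x \<rho>. (z - x) \<bullet> c > t} \<inter> E)"
 proof (rule measure_mono_fmeasurable)
  show "{z \<in> ball x \<rho>. (z - x) \<bullet> c > t} \<inter> E \<in> lmeasurable"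
  proof -
   have "bounded {z \<in> ball x \<rho>. (z - x) \<bullet> c > t}" by (rule bounded_subset[OF bounded_ball]) auto
   then show ?thesis using lmeasurable_bounded_subset[OF E] half_space_borel(2) by auto
  qed
 qed (use B E in auto)
 then show ?thesis using hs by (simp add: half_space_close_def)
qed

lemma inner_ball_bound:
 fixes c :: "real ^ 'n"
 assumes "norm c = 1" "z \<in> ball y s"
 shows "(z - x) \<bullet> c < (y - x) \<bullet> c + s" "(z - x) \<bullet> c > (y - x) \<bullet> c - s"
proof -
 have "\<bar>(z - y) \<bullet> c\<bar> \<le> norm (z - y) * norm c" by (rule Cauchy_Schwarz_ineq2)
 then have "\<bar>(z - y) \<bullet> c\<bar> < s" using assms by (simp add: dist_norm norm_minus_commute)
 moreover have "(z - x) \<bullet> c = (y - x) \<bullet> c + (z - y) \<bullet> c" by (simp add: inner_diff_left)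
 ultimately show "(z - x) \<bullet> c < (y - x) \<bullet> c + s" "(z - x) \<bullet> c > (y - x) \<bullet> c - s" by linarith+
qed

lemma ball_subset_ball_of_dist: "dist x y + s \<le> \<rho> \<Longrightarrow> ball y s \<subseteq> ball x \<rho>" for x y :: "real ^ 'n"
 by (cases "s \<le> 0") (auto simp: ball_subset_ball_iff dist_commute)

lemma measure_lebesgue_ball: "measure lebesgue (ball y s) = measure lebesgue (ball x s)" for x y :: "real ^ 'n"
 using measure_ball[of s y] measure_ball[of s x] by (cases "s \<ge> 0") (auto simp: ball_empty)

text \<open>The boundary of a set that is close to a half-space but has both phases near each of its
 boundary points lies in a thin slab; connectedness then decides the two sides of the slab.\<close>

lemma slab_separation:
 fixes E :: "(real ^ 'n) set"
 assumes E: "E \<in> sets lebesgue" and x: "x \<in> frontier E" and c: "norm c = 1" and \<rho>: "\<rho> > 0"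
  and \<eta>: "0 < \<eta>" "\<eta> \<le> 1 / 16" and hs: "half_space_close E x c t \<rho> \<tau>"
  and both: "\<And>y. y \<in> frontier E \<Longrightarrow> y \<in> ball x (\<rho> / 2) \<Longrightarrow>
    measure lebesgue (ball y (\<eta> * \<rho>) \<inter> E) > \<tau> * \<rho> ^ CARD('n) \<and>
    measure lebesgue (ball y (\<eta> * \<rho>) - E) > \<tau> * \<rho> ^ CARD('n)"
 shows "\<And>y. y \<in> frontier E \<Longrightarrow> y \<in> ball x (\<rho> / 2) \<Longrightarrow> \<bar>(y - x) \<bullet> c\<bar> \<le> 2 * \<eta> * \<rho>"
  "\<And>z. z \<in> ball x (\<rho> / 2) \<Longrightarrow> (z - x) \<bullet> c > 2 * \<eta> * \<rho> \<Longrightarrow> z \<notin> E"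
  "\<And>z. z \<in> ball x (\<rho> / 2) \<Longrightarrow> (z - x) \<bullet> c < - 2 * \<eta> * \<rho> \<Longrightarrow> z \<in> E"
proof -
 have \<eta>\<rho>: "0 < \<eta> * \<rho>" "\<eta> * \<rho> \<le> \<rho> / 16" using \<eta> \<rho> by auto
 have bl: "ball y s \<in> sets lebesgue" for y :: "real ^ 'n" and s by simp
 have near: "\<bar>(y - x) \<bullet> c - t\<bar> \<le> \<eta> * \<rho>" if y: "y \<in> frontier E" "y \<in> ball x (\<rho> / 2)" for y
 proof (rule ccontr)
  assume far: "\<not> \<bar>(y - x) \<bullet> c - t\<bar> \<le> \<eta> * \<rho>"
  have sub: "ball y (\<eta> * \<rho>) \<subseteq> ball x \<rho>"
   using y(2) \<eta>\<rho> by (intro ball_subset_ball_of_dist) simp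
  consider "(y - x) \<bullet> c - \<eta> * \<rho> > t" | "(y - x) \<bullet> c + \<eta> * \<rho> < t" using far by linarith
  then show False
  proof cases
   case 1
   then have "measure lebesgue (ball y (\<eta> * \<rho>) \<inter> E) \<le> \<tau> * \<rho> ^ CARD('n)"
    using inner_ball_bound(2)[OF c] by (intro half_space_close_above[OF E hs bl sub]) (meson less_trans)
   then show False using both[OF y] by linarith
  next
   case 2
   then have "measure lebesgue (ball y (\<eta> * \<rho>) - E) \<le> \<tau> * \<rho> ^ CARD('n)"
    using inner_ball_bound(1)[OF c] by (intro half_space_close_below[OF E hs bl sub]) (meson less_trans)
   then show False using both[OF y] by linarith
  qed
 qed
 have xb: "x \<in> ball x (\<rho> / 2)" using \<rho> by simp
 \<comment> \<open>The frontier point \<open>x\<close> forces the plane to pass near the centre. The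
   slab around height \<open>t\<close> thus becomes one around height 0, at the cost of doubling its
   width.\<close>
 have t: "\<bar>t\<bar> \<le> \<eta> * \<rho>" using near[OF x xb] by simp
 show slab: "\<bar>(y - x) \<bullet> c\<bar> \<le> 2 * \<eta> * \<rho>" if "y \<in> frontier E" "y \<in> ball x (\<rho> / 2)" for y
  using near[OF that] t by linarith
 have big: "measure lebesgue (ball y (\<eta> * \<rho>)) > \<tau> * \<rho> ^ CARD('n)" for y :: "real ^ 'n"
 proof -
  have "\<tau> * \<rho> ^ CARD('n) < measure lebesgue (ball x (\<eta> * \<rho>) \<inter> E)" using both[OF x xb] by simp
  also have "... \<le> measure lebesgue (ball x (\<eta> * \<rho>))"
   using E by (intro measure_mono_fmeasurable) (auto intro: sets.Int)
  finally show ?thesis using measure_lebesgue_ball[of y "\<eta> * \<rho>" x] by simp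
 qed
 let ?W = "\<lambda>v. {z. (z - x) \<bullet> v > 2 * \<eta> * \<rho>} \<inter> ball x (\<rho> / 2)"
 have conn: "connected (?W v)" for v
 proof -
  have "{z. (z - x) \<bullet> v > 2 * \<eta> * \<rho>} = {z. v \<bullet> z > 2 * \<eta> * \<rho> + v \<bullet> x}"
  proof -
   have "(z - x) \<bullet> v = v \<bullet> z - v \<bullet> x" for z by (simp add: inner_diff_left inner_commute[of v])
   then show ?thesis by auto
  qed
  then have "convex {z. (z - x) \<bullet> v > 2 * \<eta> * \<rho>}" by (simp add: convex_halfspace_gt)
  then show ?thesis by (intro convex_connected convex_Int convex_ball)
 qed
 have dis: "?W v \<inter> frontier E = {}" if "v = c \<or> v = - c" for v
  using slab that by fastforce
 \<comment> \<open>A test ball beyond the slab: if that whole side belonged to the wrong phase, the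
   half-space defect would be violated on this ball.\<close>
 have in_W: "ball (x + (\<rho> / 4) *\<^sub>R v) (\<eta> * \<rho>) \<subseteq> ?W v" if "norm v = 1" for v
 proof
  fix z assume z: "z \<in> ball (x + (\<rho> / 4) *\<^sub>R v) (\<eta> * \<rho>)"
  have "v \<bullet> v = 1" using that by (simp add: dot_square_norm)
  then have "(z - x) \<bullet> v > \<rho> / 4 - \<eta> * \<rho>"
   using inner_ball_bound(2)[OF that z, of x] by simp
  moreover have "ball (x + (\<rho> / 4) *\<^sub>R v) (\<eta> * \<rho>) \<subseteq> ball x (\<rho> / 2)"
   using that \<rho> \<eta>\<rho> by (intro ball_subset_ball_of_dist) (simp add: dist_norm)
  moreover have "2 * \<eta> * \<rho> < \<rho> / 4 - \<eta> * \<rho>" using \<eta>\<rho> \<rho> by linarith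
  ultimately show "z \<in> ?W v" using z by auto
 qed
 show "z \<notin> E" if z: "z \<in> ball x (\<rho> / 2)" "(z - x) \<bullet> c > 2 * \<eta> * \<rho>" for z
 proof
  assume "z \<in> E"
  then have "?W c \<inter> E \<noteq> {}" using z by auto
  then have sub: "?W c \<subseteq> E" using connected_Int_frontier[OF conn[of c], of E] dis[of c] by auto
  let ?B = "ball (x + (\<rho> / 4) *\<^sub>R c) (\<eta> * \<rho>)"
  have "measure lebesgue (?B \<inter> E) \<le> \<tau> * \<rho> ^ CARD('n)"
  proof (rule half_space_close_above[OF E hs bl])
   show "?B \<subseteq> ball x \<rho>" using in_W[OF c] \<rho> subset_ball[of "\<rho> / 2" \<rho> x] by auto
   show "(z - x) \<bullet> c > t" if "z \<in> ?B" for z using in_W[OF c] that t \<eta>\<rho> by force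
  qed
  moreover have "?B \<inter> E = ?B" using in_W[OF c] sub by auto
  ultimately show False using big[of "x + (\<rho> / 4) *\<^sub>R c"] by simp
 qed
 show "z \<in> E" if z: "z \<in> ball x (\<rho> / 2)" "(z - x) \<bullet> c < - 2 * \<eta> * \<rho>" for z
 proof (rule ccontr)
  assume "z \<notin> E"
  moreover have "2 * \<eta> * \<rho> < (z - x) \<bullet> (- c)" using z(2) by simp
  ultimately have "?W (- c) - E \<noteq> {}" using z(1) by blast
  then have sub: "?W (- c) \<inter> E = {}" using connected_Int_frontier[OF conn[of "- c"], of E] dis[of "- c"] by auto
  have nc: "norm (- c) = 1" using c by simp
  let ?B = "ball (x + (\<rho> / 4) *\<^sub>R (- c)) (\<eta> * \<rho>)"
  have "measure lebesgue (?B - E) \<le> \<tau> * \<rho> ^ CARD('n)"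
  proof (rule half_space_close_below[OF E hs bl])
   show "?B \<subseteq> ball x \<rho>" using in_W[OF nc] \<rho> subset_ball[of "\<rho> / 2" \<rho> x] by auto
   show "(z - x) \<bullet> c < t" if "z \<in> ?B" for z using in_W[OF nc] that t \<eta>\<rho> by force
  qed
  moreover have "?B - E = ?B" using in_W[OF nc] sub by blast
  ultimately show False using big[of "x + (\<rho> / 4) *\<^sub>R (- c)"] by simp
 qed
qed

section \<open>Flatness from a slab that separates the phases\<close>

text \<open>Provides the lower bound that makes the real infimum in \<open>flatness\<close> well
  behaved.\<close>

lemma two_sided_distance_nonneg:
 fixes A B :: "(real ^ 'n) set"
 assumes "x \<in> A" "x \<in> B" "bounded A" "bounded B"
 shows "two_sided_distance A B \<ge> 0"
proof -
 have *: "0 \<le> (SUP a\<in>A. infdist a B)" if xA: "x \<in> A" and xB: "x \<in> B" and bA: "bounded A" for A B :: "(real ^ 'n) set"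
 proof -
  obtain R where R: "\<And>a. a \<in> A \<Longrightarrow> dist x a \<le> R"
   using bA unfolding bounded_any_center[where a=x] by blast
  have "bdd_above ((\<lambda>a. infdist a B) ` A)"
  proof (rule bdd_aboveI2)
   fix a assume "a \<in> A"
   have "infdist a B \<le> dist a x" by (rule infdist_le[OF xB])
   also have "... \<le> R" using R[OF \<open>a \<in> A\<close>] by (simp add: dist_commute)
   finally show "infdist a B \<le> R" .
  qed
  then have "infdist x B \<le> (SUP a\<in>A. infdist a B)" using xA by (rule cSUP_upper[rotated])
  then show ?thesis using infdist_nonneg[of x B] by linarith
 qed
 show ?thesis unfolding two_sided_distance_def using assms by (intro add_nonneg_nonneg *)
qed

lemma flatness_le:
 fixes S :: "(real ^ 'n) set"
 assumes x: "x \<in> S" and r: "r > 0" and L: "affine L" "aff_dim L = int CARD('n) - 1" "x \<in> L"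
  and a: "\<And>a. a \<in> S \<Longrightarrow> a \<in> cball x r \<Longrightarrow> infdist a (L \<inter> cball x r) \<le> d1"
  and b: "\<And>b. b \<in> L \<Longrightarrow> b \<in> cball x r \<Longrightarrow> infdist b (S \<inter> cball x r) \<le> d2"
 shows "flatness S x r \<le> (d1 + d2) / r"
proof -
 have xr: "x \<in> cball x r" using r by simp
 have "flatness S x r \<le> 1 / r * two_sided_distance (S \<inter> cball x r) (L \<inter> cball x r)"
  unfolding flatness_def
 proof (rule cINF_lower)
  show "bdd_below ((\<lambda>L. 1 / r * two_sided_distance (S \<inter> cball x r) (L \<inter> cball x r)) `
    {L. affine L \<and> aff_dim L = int CARD('n) - 1 \<and> x \<in> L})"
  proof (rule bdd_belowI2[where m=0])
   fix L :: "(real ^ 'n) set" assume "L \<in> {L. affine L \<and> aff_dim L = int CARD('n) - 1 \<and> x \<in> L}"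
   then have "two_sided_distance (S \<inter> cball x r) (L \<inter> cball x r) \<ge> 0"
    using x xr by (intro two_sided_distance_nonneg[of x]) (auto intro: bounded_subset[OF bounded_cball])
   then show "0 \<le> 1 / r * two_sided_distance (S \<inter> cball x r) (L \<inter> cball x r)" using r by simp
  qed
 qed (use L in simp)
 also have "two_sided_distance (S \<inter> cball x r) (L \<inter> cball x r) \<le> d1 + d2"
  unfolding two_sided_distance_def using x L xr a b by (intro add_mono cSUP_least) auto
 finally show ?thesis using r by (simp add: mult_left_mono divide_right_mono)
qed

text \<open>A boundary point lies within the slab width of its projection to the plane. Conversely a
  short segment in direction \<open>c\<close> near a point of the plane joins the two phases and so
  meets the boundary. The distances 2 \<eta> \<rho> and 6 \<eta> \<rho>, divided by \<rho>/4, add up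
  to 32 \<eta>.\<close>

lemma slab_flatness:
 fixes E :: "(real ^ 'n) set"
 assumes x: "x \<in> frontier E" and c: "norm c = 1" and \<rho>: "\<rho> > 0" and \<eta>: "0 < \<eta>" "\<eta> \<le> 1 / 16"
  and slab: "\<And>y. y \<in> frontier E \<Longrightarrow> y \<in> ball x (\<rho> / 2) \<Longrightarrow> \<bar>(y - x) \<bullet> c\<bar> \<le> 2 * \<eta> * \<rho>"
  and up: "\<And>z. z \<in> ball x (\<rho> / 2) \<Longrightarrow> (z - x) \<bullet> c > 2 * \<eta> * \<rho> \<Longrightarrow> z \<notin> E"
  and lo: "\<And>z. z \<in> ball x (\<rho> / 2) \<Longrightarrow> (z - x) \<bullet> c < - 2 * \<eta> * \<rho> \<Longrightarrow> z \<in> E"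
 shows "flatness (frontier E) x (\<rho> / 4) \<le> 32 * \<eta>"
proof -
 define L where "L = {z. c \<bullet> z = c \<bullet> x}"
 have c0: "c \<noteq> 0" using c by auto
 have cc: "c \<bullet> c = 1" using c by (simp add: dot_square_norm)
 have L: "affine L" "aff_dim L = int CARD('n) - 1" "x \<in> L"
  using affine_hyperplane[of c "c \<bullet> x"] aff_dim_hyperplane[OF c0, of "c \<bullet> x"] by (simp_all add: L_def)
 let ?r = "\<rho> / 4"
 have sub: "cball x ?r \<subseteq> ball x (\<rho> / 2)" using \<rho> by auto
 have "flatness (frontier E) x ?r \<le> (2 * \<eta> * \<rho> + 6 * \<eta> * \<rho>) / ?r"
 proof (rule flatness_le[OF x _ L])
  show "?r > 0" using \<rho> by simp
  fix a assume a: "a \<in> frontier E" "a \<in> cball x ?r"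
  define p where "p = a - ((a - x) \<bullet> c) *\<^sub>R c"
  have "p \<in> L" using cc by (simp add: L_def p_def inner_diff_right inner_diff_left inner_commute)
  moreover have "norm (p - x) \<le> norm (a - x)"
  proof -
   have "(norm (a - x))\<^sup>2 = (norm (p - x))\<^sup>2 + ((a - x) \<bullet> c)\<^sup>2"
   proof -
    have "(norm v)\<^sup>2 = (norm (v - (v \<bullet> c) *\<^sub>R c))\<^sup>2 + (v \<bullet> c)\<^sup>2" for v
     unfolding power2_norm_eq_inner using cc
     by (simp add: inner_diff_left inner_diff_right inner_commute power2_eq_square)
    from this[of "a - x"] show ?thesis by (simp add: p_def algebra_simps)
   qed
   then have "(norm (p - x))\<^sup>2 \<le> (norm (a - x))\<^sup>2" by simp
   then show ?thesis by (simp add: power2_le_iff_abs_le)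
  qed
  ultimately have pL: "p \<in> L \<inter> cball x ?r" using a(2) by (simp add: dist_norm norm_minus_commute)
  have "infdist a (L \<inter> cball x ?r) \<le> dist a p" by (rule infdist_le[OF pL])
  also have "dist a p = \<bar>(a - x) \<bullet> c\<bar>" using c by (simp add: p_def dist_norm)
  also have "... \<le> 2 * \<eta> * \<rho>" using slab[OF a(1)] a(2) sub by auto
  finally show "infdist a (L \<inter> cball x ?r) \<le> 2 * \<eta> * \<rho>" .
 next
  fix b assume b: "b \<in> L" "b \<in> cball x ?r"
  \<comment> \<open>Larger than the half-width 2 \<eta> \<rho> of the slab, so the ends of a segment
    of half-length \<open>k\<close> lie beyond it on opposite sides.\<close>
  define k where "k = 3 * \<eta> * \<rho>"
  have k: "0 < k" "k \<le> ?r" "2 * \<eta> * \<rho> < k" using \<eta> \<rho> by (auto simp: k_def)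
  \<comment> \<open>Pulling \<open>b\<close> towards the centre by at most \<open>k\<close> keeps
    the whole segment of half-length \<open>k\<close> inside the ball.\<close>
  define b' where "b' = x + (1 - k / ?r) *\<^sub>R (b - x)"
  have nb: "norm (b - x) \<le> ?r" using b(2) by (simp add: dist_norm norm_minus_commute)
  have f: "0 \<le> 1 - k / ?r" using k \<rho> by (simp add: divide_le_eq)
  have "norm (b' - x) = (1 - k / ?r) * norm (b - x)" using f by (simp add: b'_def)
  also have "... \<le> (1 - k / ?r) * ?r" using nb f by (rule mult_left_mono)
  also have "... = ?r - k" using \<rho> by (simp add: left_diff_distrib)
  finally have nb': "norm (b' - x) \<le> ?r - k" .
  have "b - b' = (k / ?r) *\<^sub>R (b - x)" by (simp add: b'_def algebra_simps)
  then have "norm (b - b') = k / ?r * norm (b - x)" using k \<rho> by simp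
  also have "... \<le> k / ?r * ?r" using nb k \<rho> by (intro mult_left_mono) auto
  finally have bb': "norm (b - b') \<le> k" using \<rho> by simp
  have cb: "(b' - x) \<bullet> c = 0"
  proof -
   have "(b - x) \<bullet> c = c \<bullet> b - c \<bullet> x" unfolding inner_commute[of "b - x" c] by (rule inner_diff_right)
   then have "(b - x) \<bullet> c = 0" using b(1) by (simp add: L_def)
   then show ?thesis by (simp add: b'_def)
  qed
  have in_cball: "b' + v \<in> cball x ?r" if "norm v \<le> k" for v
  proof -
   have "norm (b' + v - x) \<le> norm (b' - x) + norm v"
    using norm_triangle_ineq[of "b' - x" v] by (simp add: algebra_simps)
   then show ?thesis using nb' that by (simp add: dist_norm norm_minus_commute)
  qed
  let ?p = "b' + k *\<^sub>R c" and ?q = "b' - k *\<^sub>R c"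
  have pq: "?p \<in> cball x ?r" "?q \<in> cball x ?r"
   using in_cball[of "k *\<^sub>R c"] in_cball[of "- (k *\<^sub>R c)"] c k by auto
  have "(?p - x) \<bullet> c = k" "(?q - x) \<bullet> c = - k"
   using cb cc by (simp_all add: inner_diff_left inner_add_left)
  then have "?p \<notin> E" "?q \<in> E"
   using up[of ?p] lo[of ?q] pq sub k by auto
  then have "closed_segment ?q ?p \<inter> frontier E \<noteq> {}"
   by (intro connected_Int_frontier connected_segment) auto
  then obtain q where q: "q \<in> closed_segment ?q ?p" "q \<in> frontier E" by auto
  have "closed_segment ?q ?p \<subseteq> cball x ?r" using pq by (intro closed_segment_subset convex_cball)
  then have qF: "q \<in> frontier E \<inter> cball x ?r" using q by auto
  have "closed_segment ?q ?p \<subseteq> cball b' k"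
   using c k by (intro closed_segment_subset convex_cball) (auto simp: dist_norm)
  then have "dist b' q \<le> k" using q by auto
  moreover have "dist b b' \<le> k" using bb' by (simp add: dist_norm)
  ultimately have "dist b q \<le> 6 * \<eta> * \<rho>" using dist_triangle[of b q b'] by (simp add: k_def)
  then show "infdist b (frontier E \<inter> cball x ?r) \<le> 6 * \<eta> * \<rho>"
   using infdist_le[OF qF, of b] by linarith
 qed
 also have "... = 32 * \<eta>" using \<rho> by simp
 finally show ?thesis .
qed

section \<open>Propagation of the balance of the phases to larger scales\<close>

text \<open>If the plane missed \<open>ball x \<rho>\<close>, one phase would be almost absent
  there, contradicting the balance. So it passes at height below \<rho> \<le> \<rho>'/4, and the two
  balls of radius \<rho>'/4 about x \<plusminus> (\<rho>'/2) c lie on its two sides. The new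
  constant depends on the dimension alone, whatever \<alpha> was, which permits iteration.\<close>

lemma balanced_propagates:
 fixes E :: "(real ^ 'n) set"
 assumes E: "E \<in> sets lebesgue" and b: "balanced E x \<rho> \<alpha>" and \<rho>: "0 < \<rho>" "4 * \<rho> \<le> \<rho>'" "\<rho>' \<le> 16 * \<rho>"
  and c: "norm c = 1" and hs: "half_space_close E x c t \<rho>' \<tau>" and \<tau>: "0 \<le> \<tau>" "\<tau> * 16 ^ CARD('n) < \<alpha>"
  "\<tau> \<le> ball_vol TYPE('n) / 4 ^ CARD('n) / 2"
 shows "balanced E x \<rho>' (ball_vol TYPE('n) / 4 ^ CARD('n) / 2)"
proof -
 let ?n = "CARD('n)"
 have bl: "ball y s \<in> sets lebesgue" for y :: "real ^ 'n" and s by simp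
 have \<rho>': "\<rho>' > 0" using \<rho> by simp
 have small: "\<tau> * \<rho>' ^ ?n < \<alpha> * \<rho> ^ ?n"
 proof -
  have "\<tau> * \<rho>' ^ ?n \<le> \<tau> * (16 * \<rho>) ^ ?n" using \<rho> \<tau> by (intro mult_left_mono power_mono) auto
  also have "... = (\<tau> * 16 ^ ?n) * \<rho> ^ ?n" by (simp add: power_mult_distrib)
  also have "... < \<alpha> * \<rho> ^ ?n" using \<tau> \<rho> by (intro mult_strict_right_mono) auto
  finally show ?thesis .
 qed
 have sub: "ball x \<rho> \<subseteq> ball x \<rho>'" using \<rho> by (intro subset_ball) simp
 have t1: "t < \<rho>"
 proof (rule ccontr)
  assume "\<not> t < \<rho>"
  then have "measure lebesgue (ball x \<rho> - E) \<le> \<tau> * \<rho>' ^ ?n"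
   using inner_ball_bound(1)[OF c, of _ x \<rho> x] by (intro half_space_close_below[OF E hs bl sub]) force
  then show False using b small by (simp add: balanced_def)
 qed
 have t2: "- \<rho> < t"
 proof (rule ccontr)
  assume "\<not> - \<rho> < t"
  then have "measure lebesgue (ball x \<rho> \<inter> E) \<le> \<tau> * \<rho>' ^ ?n"
   using inner_ball_bound(2)[OF c, of _ x \<rho> x] by (intro half_space_close_above[OF E hs bl sub]) force
  then show False using b small by (simp add: balanced_def)
 qed
 have cc: "c \<bullet> c = 1" using c by (simp add: dot_square_norm)
 have half: "ball (x + (\<rho>' / 2) *\<^sub>R v) (\<rho>' / 4) \<subseteq> ball x \<rho>'" if "norm v = 1" for v
  using that \<rho>' by (intro ball_subset_ball_of_dist) (simp add: dist_norm)
 have vol: "measure lebesgue (ball y (\<rho>' / 4)) = ball_vol TYPE('n) / 4 ^ ?n * \<rho>' ^ ?n" for y :: "real ^ 'n"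
  using measure_ball[of "\<rho>' / 4" y] \<rho>' by (simp add: power_divide)
 have lm: "ball y s \<inter> E \<in> lmeasurable" "ball y s - E \<in> lmeasurable" for y s
  using lmeasurable_bounded_subset[OF E bl bounded_ball] by auto
 have split: "measure lebesgue (ball y s) = measure lebesgue (ball y s \<inter> E) + measure lebesgue (ball y s - E)" for y s
 proof -
  have "measure lebesgue ((ball y s \<inter> E) \<union> (ball y s - E)) = measure lebesgue (ball y s \<inter> E) + measure lebesgue (ball y s - E)"
  proof -
   have "ball y s \<inter> E \<inter> (ball y s - E) = {}" by auto
   then show ?thesis using measure_Un3[OF lm(1)[of y s] lm(2)[of y s]] by simp
  qed
  then show ?thesis by (simp add: Int_Diff_Un)
 qed
 have bound: "\<tau> * \<rho>' ^ ?n \<le> ball_vol TYPE('n) / 4 ^ ?n / 2 * \<rho>' ^ ?n"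
  using \<tau>(3) \<rho>' by (intro mult_right_mono) auto
 have "ball_vol TYPE('n) / 4 ^ ?n / 2 * \<rho>' ^ ?n \<le> measure lebesgue (ball x \<rho>' - E)"
 proof -
  let ?B = "ball (x + (\<rho>' / 2) *\<^sub>R c) (\<rho>' / 4)"
  have "measure lebesgue (?B \<inter> E) \<le> \<tau> * \<rho>' ^ ?n"
  proof (rule half_space_close_above[OF E hs bl half[OF c]])
   show "(z - x) \<bullet> c > t" if "z \<in> ?B" for z
    using inner_ball_bound(2)[OF c that, of x] cc t1 \<rho> by simp
  qed
  moreover have "measure lebesgue (?B - E) \<le> measure lebesgue (ball x \<rho>' - E)"
   using half[OF c] lm by (intro measure_mono_fmeasurable) auto
  ultimately show ?thesis using split[of "x + (\<rho>' / 2) *\<^sub>R c" "\<rho>' / 4"] vol[of "x + (\<rho>' / 2) *\<^sub>R c"] bound by linarith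
 qed
 moreover have "ball_vol TYPE('n) / 4 ^ ?n / 2 * \<rho>' ^ ?n \<le> measure lebesgue (ball x \<rho>' \<inter> E)"
 proof -
  let ?B = "ball (x + (\<rho>' / 2) *\<^sub>R (- c)) (\<rho>' / 4)"
  have nc: "norm (- c) = 1" using c by simp
  have "measure lebesgue (?B - E) \<le> \<tau> * \<rho>' ^ ?n"
  proof (rule half_space_close_below[OF E hs bl half[OF nc]])
   show "(z - x) \<bullet> c < t" if "z \<in> ?B" for z
    using inner_ball_bound(1)[OF c that, of x] cc t2 \<rho> by simp
  qed
  moreover have "measure lebesgue (?B \<inter> E) \<le> measure lebesgue (ball x \<rho>' \<inter> E)"
   using half[OF nc] lm by (intro measure_mono_fmeasurable) auto
  ultimately show ?thesis using split[of "x + (\<rho>' / 2) *\<^sub>R (- c)" "\<rho>' / 4"] vol[of "x + (\<rho>' / 2) *\<^sub>R (- c)"] bound by linarith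
 qed
 ultimately show ?thesis by (simp add: balanced_def)
qed

lemma balanced_mono:
 fixes E :: "(real ^ 'n) set"
 assumes E: "E \<in> sets lebesgue" and b: "balanced E y \<rho> \<alpha>" and "ball y \<rho> \<subseteq> ball x (m * \<rho>)" "m > 0"
 shows "balanced E x (m * \<rho>) (\<alpha> / m ^ CARD('n))"
proof -
 have lm: "ball y s \<inter> E \<in> lmeasurable" "ball y s - E \<in> lmeasurable" for y s
  using lmeasurable_bounded_subset[OF E _ bounded_ball] by auto
 have "measure lebesgue (ball y \<rho> \<inter> E) \<le> measure lebesgue (ball x (m * \<rho>) \<inter> E)"
  "measure lebesgue (ball y \<rho> - E) \<le> measure lebesgue (ball x (m * \<rho>) - E)"
  using assms(3) lm by (intro measure_mono_fmeasurable; auto)+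
 then show ?thesis using b assms(4) by (simp add: balanced_def power_mult_distrib)
qed

text \<open>The initial \<alpha> is used in the first step, the dimensional constant in all later
  ones. Ratios from 4 to 16 in one step leave no gap: a radius above 16 \<rho>0 divided by 4 is
  still at least 4 \<rho>0.\<close>

lemma balanced_all_scales:
 fixes E :: "(real ^ 'n) set"
 assumes E: "E \<in> sets lebesgue"
  and hs: "\<And>\<rho>. 0 < \<rho> \<Longrightarrow> \<rho> < R \<Longrightarrow> \<exists>c t. norm c = 1 \<and> half_space_close E x c t \<rho> \<tau>"
  and b: "balanced E x \<rho>0 \<alpha>" "\<rho>0 > 0" and \<tau>: "0 \<le> \<tau>" "\<tau> * 16 ^ CARD('n) < \<alpha>"
  "\<tau> * 16 ^ CARD('n) < ball_vol TYPE('n) / 4 ^ CARD('n) / 2"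
  and \<rho>: "4 * \<rho>0 \<le> \<rho>" "\<rho> < R"
 shows "balanced E x \<rho> (ball_vol TYPE('n) / 4 ^ CARD('n) / 2)"
proof -
 let ?\<beta> = "ball_vol TYPE('n) / 4 ^ CARD('n) / 2"
 have "\<tau> * 1 \<le> \<tau> * 16 ^ CARD('n)" using \<tau>(1) by (intro mult_left_mono) auto
 then have \<tau>3: "\<tau> \<le> ?\<beta>" using \<tau>(3) by simp
 have *: "balanced E x \<rho> ?\<beta>" if "4 * \<rho>0 \<le> \<rho>" "\<rho> \<le> 16 * 4 ^ k * \<rho>0" "\<rho> < R" for k \<rho>
  using that
 proof (induction k arbitrary: \<rho>)
  case 0
  then obtain c t where "norm c = 1" "half_space_close E x c t \<rho> \<tau>" using hs[of \<rho>] b(2) by auto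
  then show ?case using 0 b(2) \<tau>3 by (intro balanced_propagates[OF E b(1) b(2) _ _ _ _ \<tau>(1,2)]) auto
 next
  case (Suc k)
  show ?case
  proof (cases "\<rho> \<le> 16 * 4 ^ k * \<rho>0")
   case True
   then show ?thesis using Suc by auto
  next
   case False
   have "16 * 4 ^ k * \<rho>0 \<ge> 16 * 1 * \<rho>0" using b(2) by (intro mult_right_mono mult_left_mono) auto
   then have q: "4 * \<rho>0 \<le> \<rho> / 4" using False by linarith
   have bq: "balanced E x (\<rho> / 4) ?\<beta>" using Suc q b(2) by (intro Suc.IH) auto
   obtain c t where "norm c = 1" "half_space_close E x c t \<rho> \<tau>" using hs[of \<rho>] Suc.prems b(2) by auto
   then show ?thesis using q b(2) \<tau>3 by (intro balanced_propagates[OF E bq _ _ _ _ _ \<tau>(1,3)]) auto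
  qed
 qed
 obtain k where "\<rho> / \<rho>0 < 4 ^ k" using real_arch_pow[of 4 "\<rho> / \<rho>0"] by auto
 then have "\<rho> < 4 ^ k * \<rho>0" using b(2) by (simp add: divide_less_eq)
 moreover have "0 < 4 ^ k * \<rho>0" using b(2) by simp
 ultimately have "\<rho> \<le> 16 * 4 ^ k * \<rho>0" by linarith
 then show ?thesis using * \<rho> by blast
qed

context gauss_green_density
begin

text \<open>Almost every point is a density point of its own phase, so at one small scale
  \<open>t\<close> the mollified indicator exceeds 1/2 at some \<open>y0\<close> and is below 1/2 at
  some \<open>y1\<close>. By continuity it equals 1/2 in between, and \<open>u_le_density\<close>
  converts this into volume of both phases.\<close>

lemma balanced_seed:
 assumes e: "e > 0" and in_pos: "measure lebesgue (ball x e \<inter> E) > 0" and out_pos: "measure lebesgue (ball x e - E) > 0"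
 shows "\<exists>y t. y \<in> ball x e \<and> 0 < t \<and> t < e \<and> balanced E y t (bump_mass TYPE('n) / 2)"
proof -
 have pos: "measure lborel (ball x e \<inter> Eb) > 0" "measure lborel (ball x e - Eb) > 0"
  using in_pos out_pos measure_Eb(1,2)[of "ball x e"] by auto
 have ex: "\<exists>y\<in>A. ((\<lambda>s. u y s) \<longlongrightarrow> indicator Eb y) (at_right 0)" if A: "A \<in> sets borel" "measure lborel A > 0" for A
 proof (rule ccontr)
  assume "\<not> ?thesis"
  then have "AE y in lborel. y \<notin> A" using u_tendsto by (auto elim: eventually_mono)
  then have "emeasure lborel A = 0" using A(1) by (subst (asm) AE_iff_null_sets[symmetric]) auto
  then show False using A(2) by (simp add: measure_def)
 qed
 obtain y0 where y0: "y0 \<in> ball x e \<inter> Eb" "((\<lambda>s. u y0 s) \<longlongrightarrow> indicator Eb y0) (at_right 0)"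
  using ex[OF _ pos(1)] Eb(1) by auto
 obtain y1 where y1: "y1 \<in> ball x e - Eb" "((\<lambda>s. u y1 s) \<longlongrightarrow> indicator Eb y1) (at_right 0)"
  using ex[OF _ pos(2)] Eb(1) by auto
 have "\<forall>\<^sub>F s in at_right 0. 1 / 2 < u y0 s" using y0 by (intro order_tendstoD(1)) auto
 moreover have "\<forall>\<^sub>F s in at_right 0. u y1 s < 1 / 2" using y1 by (intro order_tendstoD(2)) auto
 moreover have "\<forall>\<^sub>F s in at_right 0. 0 < s \<and> s < e" unfolding eventually_at_right_field using e by auto
 ultimately have "\<forall>\<^sub>F s in at_right 0. 1 / 2 < u y0 s \<and> u y1 s < 1 / 2 \<and> 0 < s \<and> s < e"
  by eventually_elim auto
 then obtain t where t: "1 / 2 < u y0 t" "u y1 t < 1 / 2" "0 < t" "t < e"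
  using eventually_happens[of _ "at_right (0::real)"] trivial_limit_at_right_real by blast
 have cont: "continuous_on {0..1} (\<lambda>\<tau>. u (y0 + \<tau> *\<^sub>R (y1 - y0)) t)"
 proof -
  have "isCont (\<lambda>\<tau>. U (y0 + \<tau> *\<^sub>R (y1 - y0)) t) \<tau>" for \<tau>
   using U_line_derivative[OF t(3), of y0 "y1 - y0" \<tau>] by (rule DERIV_isCont)
  then have "continuous_on {0..1} (\<lambda>\<tau>. U (y0 + \<tau> *\<^sub>R (y1 - y0)) t)"
   by (intro continuous_at_imp_continuous_on) auto
  then show ?thesis unfolding u_def using t(3) bump_mass_pos[where 'n='n]
   by (intro continuous_intros) auto
 qed
 obtain \<tau> where \<tau>: "0 \<le> \<tau>" "\<tau> \<le> 1" "u (y0 + \<tau> *\<^sub>R (y1 - y0)) t = 1 / 2"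
  using IVT2'[of "\<lambda>\<tau>. u (y0 + \<tau> *\<^sub>R (y1 - y0)) t" 1 "1 / 2" 0] t cont by auto
 define y where "y = y0 + \<tau> *\<^sub>R (y1 - y0)"
 have "y = (1 - \<tau>) *\<^sub>R y0 + \<tau> *\<^sub>R y1" by (simp add: y_def algebra_simps)
 then have "y \<in> ball x e"
  using convexD[OF convex_ball, of y0 x e y1 "1 - \<tau>" \<tau>] y0(1) y1(1) \<tau> by simp
 moreover have "balanced E y t (bump_mass TYPE('n) / 2)"
 proof -
  let ?\<omega> = "ball_vol TYPE('n)" and ?m = "bump_mass TYPE('n)"
  have key: "?m / 2 * t ^ CARD('n) \<le> a" if "1 / 2 \<le> ?\<omega> / ?m * (a / measure lborel (ball y t))" for a
  proof -
   have w: "?\<omega> > 0" "?m > 0" "t ^ CARD('n) > 0" using t(3) bump_mass_pos[where 'n='n] by auto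
   have "?\<omega> / ?m * (a / measure lborel (ball y t)) = a / (?m * t ^ CARD('n))"
    using t(3) w(1) by (simp only: measure_ball less_imp_le) (simp add: less_imp_neq[THEN not_sym])
   then have "1 / 2 \<le> a / (?m * t ^ CARD('n))" using that by simp
   then show ?thesis using w by (simp add: pos_le_divide_eq)
  qed
  show ?thesis
   unfolding balanced_def measure_Eb(1)[OF borel_open[OF open_ball]] measure_Eb(2)[OF borel_open[OF open_ball]]
   using u_le_density[OF t(3), of y] \<tau>(3)[folded y_def] by (intro conjI key) auto
 qed
 ultimately show ?thesis using t(3,4) by blast
qed

end

section \<open>Two sources of volume for both phases: half-spaces at all scales, and
  perimeter\<close>

context gauss_green_density
begin

text \<open>The seed ball may be arbitrarily tiny, but it contains a frontier point
  \<open>z\<close>. Recentring at \<open>z\<close> doubles its radius, propagation from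
  \<open>z\<close> reaches radius \<rho>'/2, and recentring at the given point \<open>y\<close>
  costs another factor \<open>2 ^ CARD('n)\<close>. The volumes so obtained feed
  \<open>slab_separation\<close>.\<close>

lemma flat_of_half_spaces:
 assumes hs: "\<And>x \<rho>. x \<in> frontier E \<Longrightarrow> 0 < \<rho> \<Longrightarrow> \<rho> < R \<Longrightarrow> \<exists>c t. norm c = 1 \<and> half_space_close E x c t \<rho> \<tau>"
  and both: "\<And>x e. x \<in> frontier E \<Longrightarrow> e > 0 \<Longrightarrow>
    measure lebesgue (ball x e \<inter> E) > 0 \<and> measure lebesgue (ball x e - E) > 0"
  and \<eta>: "0 < \<eta>" "\<eta> \<le> 1 / 16"
  and \<tau>: "0 \<le> \<tau>" "\<tau> * 16 ^ CARD('n) < bump_mass TYPE('n) / 2 / 2 ^ CARD('n)"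
   "\<tau> * 16 ^ CARD('n) < ball_vol TYPE('n) / 4 ^ CARD('n) / 2"
   "\<tau> < ball_vol TYPE('n) / 4 ^ CARD('n) / 2 / 2 ^ CARD('n) * \<eta> ^ CARD('n)"
  and x: "x \<in> frontier E" and \<rho>: "0 < \<rho>" "\<rho> < R"
 shows "flatness (frontier E) x (\<rho> / 4) \<le> 32 * \<eta> \<and>
  (\<exists>c. norm c = 1 \<and> (\<forall>z \<in> ball x (\<rho> / 2).
    ((z - x) \<bullet> c > 2 * \<eta> * \<rho> \<longrightarrow> z \<notin> E) \<and> ((z - x) \<bullet> c < - 2 * \<eta> * \<rho> \<longrightarrow> z \<in> E)))"
proof -
 let ?n = "CARD('n)" and ?m = "bump_mass TYPE('n)"
 let ?\<beta> = "ball_vol TYPE('n) / 4 ^ ?n / 2"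
 have bal: "balanced E y \<rho>' (?\<beta> / 2 ^ ?n)" if y: "y \<in> frontier E" and \<rho>': "0 < \<rho>'" "\<rho>' < R" for y \<rho>'
 proof -
  have e: "\<rho>' / 16 > 0" using \<rho>' by simp
  \<comment> \<open>The bound \<rho>'/16 leaves room for both recentrings: it gives
    \<open>4 * (2 * t) \<le> \<rho>' / 2\<close>, as the propagation requires, and a distance from
    \<open>y\<close> to \<open>z\<close> below \<rho>'/8.\<close>
  obtain y' t where y': "y' \<in> ball y (\<rho>' / 16)" "0 < t" "t < \<rho>' / 16" "balanced E y' t (?m / 2)"
   using balanced_seed[OF e] both[OF y e] by blast
  have "0 < ?m / 2 * t ^ ?n" using y'(2) bump_mass_pos[where 'n='n] by simp
  then have "measure lebesgue (ball y' t \<inter> E) > 0" "measure lebesgue (ball y' t - E) > 0"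
   using y'(4) unfolding balanced_def by linarith+
  then have "ball y' t \<inter> E \<noteq> {}" "ball y' t - E \<noteq> {}" by (metis less_irrefl measure_empty)+
  then have "ball y' t \<inter> frontier E \<noteq> {}" by (intro connected_Int_frontier) auto
  then obtain z where z: "z \<in> frontier E" "dist y' z < t" by auto
  have "ball y' t \<subseteq> ball z (2 * t)" using z by (intro ball_subset_ball_of_dist) (simp add: dist_commute)
  from balanced_mono[OF E_lebesgue y'(4) this]
  have bz: "balanced E z (2 * t) (?m / 2 / 2 ^ ?n)" by simp
  have "balanced E z (\<rho>' / 2) ?\<beta>"
   using hs[OF z(1)] y' \<rho>' by (intro balanced_all_scales[OF E_lebesgue _ bz _ \<tau>(1-3)]) auto
  moreover have "ball z (\<rho>' / 2) \<subseteq> ball y (2 * (\<rho>' / 2))"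
  proof (rule ball_subset_ball_of_dist)
   show "dist y z + \<rho>' / 2 \<le> 2 * (\<rho>' / 2)"
    using dist_triangle[of y z y'] y' z by simp
  qed
  ultimately have "balanced E y (2 * (\<rho>' / 2)) (?\<beta> / 2 ^ ?n)"
   by (intro balanced_mono[OF E_lebesgue]) auto
  then show ?thesis by simp
 qed
 obtain c t where c: "norm c = 1" and ct: "half_space_close E x c t \<rho> \<tau>" using hs[OF x \<rho>] by blast
 have b2: "measure lebesgue (ball y (\<eta> * \<rho>) \<inter> E) > \<tau> * \<rho> ^ ?n \<and> measure lebesgue (ball y (\<eta> * \<rho>) - E) > \<tau> * \<rho> ^ ?n"
  if y: "y \<in> frontier E" "y \<in> ball x (\<rho> / 2)" for y
 proof -
  have "\<eta> * \<rho> \<le> 1 / 16 * \<rho>" using \<eta> \<rho> by (intro mult_right_mono) auto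
  then have "\<eta> * \<rho> < R" using \<rho> by linarith
  then have "balanced E y (\<eta> * \<rho>) (?\<beta> / 2 ^ ?n)" using \<eta> \<rho> by (intro bal[OF y(1)]) auto
  moreover have "\<tau> * \<rho> ^ ?n < ?\<beta> / 2 ^ ?n * (\<eta> * \<rho>) ^ ?n"
  proof -
   have "\<tau> * \<rho> ^ ?n < (?\<beta> / 2 ^ ?n * \<eta> ^ ?n) * \<rho> ^ ?n" using \<tau>(4) \<rho> by (intro mult_strict_right_mono) auto
   then show ?thesis by (simp add: power_mult_distrib)
  qed
  ultimately show ?thesis unfolding balanced_def by linarith
 qed
 note sep = slab_separation[OF E_lebesgue x c \<rho>(1) \<eta> ct b2]
 have "flatness (frontier E) x (\<rho> / 4) \<le> 32 * \<eta>"
  by (rule slab_flatness[OF x c \<rho>(1) \<eta> sep])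
 then show ?thesis using sep(2,3) c by blast
qed

lemma integral_deriv_bump_le:
 assumes X: "X \<in> sets borel" and s: "s > 0" and c: "norm c = 1"
 shows "\<bar>LINT z|lborel. indicator X z * frechet_derivative (bump s y) (at z) c\<bar> \<le> 4 * s ^ 3 * measure lborel (ball y s \<inter> X)"
  "integrable lborel (\<lambda>z. indicator X z * frechet_derivative (bump s y) (at z) c)"
proof -
 let ?d = "\<lambda>z. frechet_derivative (bump s y) (at z) c"
 have pt: "\<bar>?d z\<bar> \<le> 4 * s ^ 3 * indicator (ball y s) z" for z
 proof (cases "z \<in> ball y s")
  case True
  have "\<bar>(z - y) \<bullet> c\<bar> \<le> s"
   using Cauchy_Schwarz_ineq2[of "z - y" c] True c by (simp add: dist_norm norm_minus_commute)
  moreover have "max 0 (s\<^sup>2 - (norm (z - y))\<^sup>2) \<le> s\<^sup>2" by simp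
  ultimately have "max 0 (s\<^sup>2 - (norm (z - y))\<^sup>2) * \<bar>(z - y) \<bullet> c\<bar> \<le> s\<^sup>2 * s"
   by (intro mult_mono) auto
  then show ?thesis using True by (simp add: C1c_bump(2)[OF s] abs_mult power2_eq_square power3_eq_cube)
 next
  case False
  then have "s \<le> norm (z - y)" by (simp add: dist_norm norm_minus_commute)
  then have "s\<^sup>2 \<le> (norm (z - y))\<^sup>2" using s by (intro power_mono) auto
  then show ?thesis using False by (simp add: C1c_bump(2)[OF s])
 qed
 have fin: "emeasure lborel (ball y s \<inter> X) < \<infinity>"
  by (rule leb.finite_bounded) (auto intro: bounded_subset[OF bounded_ball])
 have i: "integrable lborel (\<lambda>z. 4 * s ^ 3 * indicat_real (ball y s \<inter> X) z)"
  using X fin by (intro integrable_mult_right integrable_real_indicator) auto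
 have pt': "\<bar>indicator X z * ?d z\<bar> \<le> 4 * s ^ 3 * indicator (ball y s \<inter> X) z" for z
 proof (cases "z \<in> X")
  case True
  then show ?thesis using pt[of z] by (simp add: indicator_inter_arith)
 qed (use s in simp)
 show int: "integrable lborel (\<lambda>z. indicator X z * ?d z)"
 proof (rule Bochner_Integration.integrable_bound[OF i])
  have [measurable]: "?d \<in> borel_measurable borel" by (rule C1c_deriv_borel[OF C1c_bump(1)[OF s]])
  show "(\<lambda>z. indicat_real X z * ?d z) \<in> borel_measurable lborel" using X by measurable
  show "AE z in lborel. norm (indicat_real X z * ?d z) \<le> norm (4 * s ^ 3 * indicat_real (ball y s \<inter> X) z)"
   unfolding real_norm_def by (intro always_eventually allI order_trans[OF pt' abs_ge_self])
 qed
 have "\<bar>LINT z|lborel. indicator X z * ?d z\<bar> \<le> (LINT z|lborel. \<bar>indicator X z * ?d z\<bar>)"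
  by (rule integral_abs_bound)
 also have "... \<le> (LINT z|lborel. 4 * s ^ 3 * indicator (ball y s \<inter> X) z)"
  by (intro integral_mono integrable_abs int i pt')
 finally show "\<bar>LINT z|lborel. indicator X z * ?d z\<bar> \<le> 4 * s ^ 3 * measure lborel (ball y s \<inter> X)"
  using X fin by simp
qed

text \<open>Testing with a bump in the direction \<open>c\<close>: perimeter inside a ball on which the normal is almost
 constant forces both phases to have volume in that ball.\<close>

lemma both_phases_of_mass:
 assumes s: "s > 0" and c: "norm c = 1" and sub: "ball y s \<subseteq> ball x r"
  and osc: "(LINT z:ball x r|\<sigma>. norm (f z - norm (f z) *\<^sub>R c)) \<le> \<eta>0"
  and mass: "b * s ^ (CARD('n) - 1) \<le> gmass (ball y (s / 2))" and \<eta>0: "\<eta>0 \<le> b / 16 * s ^ (CARD('n) - 1)"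
 shows "b / 8 * s ^ CARD('n) \<le> measure lebesgue (ball y s \<inter> E)" "b / 8 * s ^ CARD('n) \<le> measure lebesgue (ball y s - E)"
proof -
 let ?h = "\<lambda>z. norm (f z - norm (f z) *\<^sub>R c)" and ?n = "CARD('n)"
 let ?I = "LINT z|\<sigma>. bump s y z * (c \<bullet> f z)"
 have hb: "?h \<in> borel_measurable borel" by measurable
 have hK: "norm (?h z) \<le> 2 * M" for z
 proof -
  have "?h z \<le> norm (f z) + norm (norm (f z) *\<^sub>R c)" by (rule norm_triangle_ineq4)
  then show ?thesis using f_bound[of z] c by simp
 qed
 have ih: "integrable \<sigma> (\<lambda>z. indicator (ball x r) z * ?h z)"
  using set_integrable_bdd[OF hb _ _ hK, of "ball x r"] unfolding set_integrable_def by simp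
 have ig: "integrable \<sigma> (\<lambda>z. indicator (ball y (s / 2)) z * norm (f z))"
  using norm_f_set_integrable[of "ball y (s / 2)"] unfolding set_integrable_def by simp
 have ib: "integrable \<sigma> (\<lambda>z. bump s y z * (c \<bullet> f z))"
  by (rule integrable_bump_f(1)[OF s continuous_on_const, of _ c "norm c"]) simp
 \<comment> \<open>On the half ball the bump is at least \<open>(3 / 4 * s\<^sup>2)\<^sup>2\<close>.
   This keeps 9/16 of the mass; the oscillation takes away at most 1/16, so 1/2 remains.\<close>
 have "(LINT z|\<sigma>. 9 / 16 * s ^ 4 * (indicator (ball y (s / 2)) z * norm (f z)) - s ^ 4 * (indicator (ball x r) z * ?h z)) \<le> ?I"
 proof (rule integral_mono)
  fix z
  show "9 / 16 * s ^ 4 * (indicator (ball y (s / 2)) z * norm (f z)) - s ^ 4 * (indicator (ball x r) z * ?h z) \<le> bump s y z * (c \<bullet> f z)"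
  proof (cases "z \<in> ball y s")
   case False
   then have "z \<notin> ball y (s / 2)" using s by simp
   then show ?thesis using False s by (simp add: bump_eq_0[OF s] indicator_def)
  next
   case True
   have cc: "c \<bullet> c = 1" using c by (simp add: dot_square_norm)
   have "c \<bullet> f z = norm (f z) + c \<bullet> (f z - norm (f z) *\<^sub>R c)" using cc by (simp add: inner_diff_right)
   moreover have "\<bar>c \<bullet> (f z - norm (f z) *\<^sub>R c)\<bar> \<le> ?h z" using Cauchy_Schwarz_ineq2[of c "f z - norm (f z) *\<^sub>R c"] c by simp
   ultimately have "norm (f z) - ?h z \<le> c \<bullet> f z" by linarith
   then have 1: "bump s y z * (norm (f z) - ?h z) \<le> bump s y z * (c \<bullet> f z)" by (intro mult_left_mono bump_nonneg)
   have 2: "bump s y z * ?h z \<le> s ^ 4 * ?h z" by (intro mult_right_mono bump_le) simp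
   have 3: "9 / 16 * s ^ 4 * (indicator (ball y (s / 2)) z * norm (f z)) \<le> bump s y z * norm (f z)"
   proof (cases "z \<in> ball y (s / 2)")
    case True
    then have "(norm (z - y))\<^sup>2 \<le> (s / 2)\<^sup>2" by (intro power_mono) (auto simp: dist_norm norm_minus_commute)
    then have "4 * (norm (z - y))\<^sup>2 \<le> s\<^sup>2" by (simp add: power_divide)
    then have "3 / 4 * s\<^sup>2 \<le> max 0 (s\<^sup>2 - (norm (z - y))\<^sup>2)" unfolding le_max_iff_disj by linarith
    then have "(3 / 4 * s\<^sup>2)\<^sup>2 \<le> bump s y z" unfolding bump_def by (rule power_mono) simp
    moreover have "(3 / 4 * s\<^sup>2)\<^sup>2 = 9 / 16 * s ^ 4" by (simp add: power_mult_distrib power_divide power_mult[symmetric])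
    ultimately have "9 / 16 * s ^ 4 \<le> bump s y z" by simp
    then have "9 / 16 * s ^ 4 * norm (f z) \<le> bump s y z * norm (f z)" by (rule mult_right_mono) simp
    then show ?thesis using True by simp
   qed (simp add: bump_nonneg)
   have "z \<in> ball x r" using True sub by auto
   then have "s ^ 4 * (indicator (ball x r) z * ?h z) = s ^ 4 * ?h z" by simp
   then show ?thesis using 1[unfolded right_diff_distrib] 2 3 by linarith
  qed
 qed (use ih ig ib in auto)
 moreover have "(LINT z|\<sigma>. 9 / 16 * s ^ 4 * (indicator (ball y (s / 2)) z * norm (f z)) - s ^ 4 * (indicator (ball x r) z * ?h z))
   = 9 / 16 * s ^ 4 * gmass (ball y (s / 2)) - s ^ 4 * (LINT z:ball x r|\<sigma>. ?h z)"
  using ih ig by (subst Bochner_Integration.integral_diff) (auto simp: gmass_def set_lebesgue_integral_def)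
 moreover have "9 / 16 * s ^ 4 * (b * s ^ (?n - 1)) \<le> 9 / 16 * s ^ 4 * gmass (ball y (s / 2))"
  using s by (intro mult_left_mono mass) auto
 moreover have "s ^ 4 * (LINT z:ball x r|\<sigma>. ?h z) \<le> s ^ 4 * (b / 16 * s ^ (?n - 1))"
  using s osc \<eta>0 by (intro mult_left_mono) auto
 ultimately have "9 / 16 * s ^ 4 * (b * s ^ (?n - 1)) - s ^ 4 * (b / 16 * s ^ (?n - 1)) \<le> ?I" by linarith
 then have I: "s ^ 4 * (b / 2 * s ^ (?n - 1)) \<le> ?I" by (simp add: algebra_simps)
 have sn: "s ^ ?n = s * s ^ (?n - 1)" by (simp add: power_eq_if)
 have conv: "b / 8 * s ^ ?n \<le> a" if "s ^ 4 * (b / 2 * s ^ (?n - 1)) \<le> 4 * s ^ 3 * a" for a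
 proof -
  have eq: "4 * s ^ 3 * (b / 8 * s ^ ?n) = s ^ 4 * (b / 2 * s ^ (?n - 1))" by (simp add: sn eval_nat_numeral)
  have "4 * s ^ 3 * (b / 8 * s ^ ?n) \<le> 4 * s ^ 3 * a" unfolding eq by (rule that)
  then show ?thesis by (rule mult_left_le_imp_le) (use s in simp)
 qed
 let ?d = "\<lambda>z. frechet_derivative (bump s y) (at z) c"
 have nE: "- Eb \<in> sets borel" using Eb(1) by auto
 have gg: "(LINT z|lborel. indicator Eb z * ?d z) = ?I"
  by (rule gauss_green_directional[OF C1c_bump(1)[OF s]])
 \<comment> \<open>The derivative of the bump integrates to 0 over the whole space, so the
   complement carries the opposite integral and obeys the same lower bound.\<close>
 have "(LINT z|lborel. indicator Eb z * ?d z) + (LINT z|lborel. indicator (- Eb) z * ?d z)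
   = (LINT z|lborel. indicator Eb z * ?d z + indicator (- Eb) z * ?d z)"
  using integral_deriv_bump_le(2)[OF Eb(1) s c] integral_deriv_bump_le(2)[OF nE s c] by simp
 also have "... = (LINT z|lborel. ?d z)"
  by (intro Bochner_Integration.integral_cong refl) (auto simp: indicator_def)
 also have "... = 0" by (rule integral_deriv_C1c_eq_0[OF C1c_bump(1)[OF s]])
 finally have gg': "(LINT z|lborel. indicator (- Eb) z * ?d z) = - ?I" using gg by simp
 have "s ^ 4 * (b / 2 * s ^ (?n - 1)) \<le> 4 * s ^ 3 * measure lborel (ball y s \<inter> Eb)"
  using integral_deriv_bump_le(1)[OF Eb(1) s c, of y] I unfolding gg by linarith
 then show "b / 8 * s ^ ?n \<le> measure lebesgue (ball y s \<inter> E)"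
  unfolding measure_Eb(1)[OF borel_open[OF open_ball]] by (rule conv)
 have "s ^ 4 * (b / 2 * s ^ (?n - 1)) \<le> 4 * s ^ 3 * measure lborel (ball y s \<inter> - Eb)"
  using integral_deriv_bump_le(1)[OF nE s c, of y] I unfolding gg' by linarith
 then show "b / 8 * s ^ ?n \<le> measure lebesgue (ball y s - E)"
  unfolding measure_Eb(2)[OF borel_open[OF open_ball]] by (intro conv) (simp add: Diff_eq)
qed

end

context doubling_gauss_green
begin

text \<open>The normalised average \<open>c\<close> of the unit normals satisfies \<open>\<bar>\<nu> - c\<bar> \<le> 2 \<bar>\<nu> - a\<bar>\<close> for every unit
 vector \<open>\<nu>\<close>, where \<open>a\<close> is the average itself; if \<open>a = 0\<close> any unit vector will do.\<close>

lemma excess_of_oscillation: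
 assumes \<epsilon>: "\<epsilon> > 0" and V: "measure \<sigma> (ball x r) \<le> V"
  and osc: "(LINT y:ball x r \<inter> reduced_boundary E|\<sigma>. (norm (outer_normal E y - a))\<^sup>2) \<le> \<epsilon>\<^sup>2 * V"
 shows "\<exists>c. norm c = 1 \<and> (LINT z:ball x r|\<sigma>. norm (f z - norm (f z) *\<^sub>R c)) \<le> 2 * M * \<epsilon> * V"
proof -
 let ?R = "reduced_boundary E" and ?\<nu> = "outer_normal E" and ?B = "ball x r"
 define c where "c = (if a = 0 then axis undefined 1 else a /\<^sub>R norm a)"
 have c: "norm c = 1" by (simp add: c_def)
 have 2: "norm (v - c) \<le> 2 * norm (v - a)" if v: "norm v = 1" for v
 proof (cases "a = 0")
  case True
  then show ?thesis using norm_triangle_ineq4[of v c] v c by simp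
 next
  case False
  then have "a = norm a *\<^sub>R c" by (simp add: c_def)
  then have "a - c = (norm a - 1) *\<^sub>R c" by (metis scaleR_diff_left scaleR_one)
  then have "norm (a - c) = \<bar>norm a - norm v\<bar>" using c v by simp
  also have "... \<le> norm (a - v)" by (rule norm_triangle_ineq3)
  finally have "norm (a - c) \<le> norm (v - a)" by (simp add: norm_minus_commute)
  moreover have "norm (v - c) \<le> norm (v - a) + norm (a - c)"
   using norm_triangle_ineq[of "v - a" "a - c"] by simp
  ultimately show ?thesis by linarith
 qed
 note [measurable] = outer_normal_borel reduced_boundary_borel
 have BR: "?B \<inter> ?R \<in> sets borel" "bounded (?B \<inter> ?R)"
  using reduced_boundary_borel by (auto intro: bounded_subset[OF bounded_ball])
 have bnd: "norm (?\<nu> z - a) \<le> 1 + norm a" for z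
  using norm_triangle_ineq4[of "?\<nu> z" a] norm_outer_normal[of z] by (simp split: if_splits)
 have i2: "integrable \<sigma> (\<lambda>z. indicator (?B \<inter> ?R) z * (norm (?\<nu> z - a))\<^sup>2)"
 proof -
  have "norm ((norm (?\<nu> z - a))\<^sup>2) \<le> (1 + norm a)\<^sup>2" for z using bnd[of z] by (simp add: power_mono)
  from set_integrable_bdd[OF _ BR this] show ?thesis by (simp add: set_integrable_def)
 qed
 have iB: "integrable \<sigma> (\<lambda>z. indicator ?B z * k)" for k :: real
  using set_integrable_bdd[of "\<lambda>_. k" ?B "norm k"] by (simp add: set_integrable_def)
 have ih: "integrable \<sigma> (\<lambda>z. indicator ?B z * norm (f z - norm (f z) *\<^sub>R c))"
 proof -
  have "norm (norm (f z - norm (f z) *\<^sub>R c)) \<le> 2 * M" for z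
  proof -
   have "norm (f z - norm (f z) *\<^sub>R c) \<le> norm (f z) + norm (norm (f z) *\<^sub>R c)" by (rule norm_triangle_ineq4)
   then show ?thesis using f_bound[of z] c by simp
  qed
  from set_integrable_bdd[OF _ _ _ this, where A="?B"] show ?thesis by (simp add: set_integrable_def)
 qed
 have "(LINT z:?B|\<sigma>. norm (f z - norm (f z) *\<^sub>R c)) = (LINT z|\<sigma>. indicator ?B z * norm (f z - norm (f z) *\<^sub>R c))"
  by (simp add: set_lebesgue_integral_def)
 also have "... \<le> (LINT z|\<sigma>. M / \<epsilon> * (indicator (?B \<inter> ?R) z * (norm (?\<nu> z - a))\<^sup>2) + M * \<epsilon> * (indicator ?B z * 1))"
 proof (rule integral_mono_AE[OF ih])
  show "integrable \<sigma> (\<lambda>z. M / \<epsilon> * (indicator (?B \<inter> ?R) z * (norm (?\<nu> z - a))\<^sup>2) + M * \<epsilon> * (indicator ?B z * 1))"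
   using i2 iB by (intro Bochner_Integration.integrable_add integrable_mult_right)
  show "AE z in \<sigma>. indicator ?B z * norm (f z - norm (f z) *\<^sub>R c) \<le>
    M / \<epsilon> * (indicator (?B \<inter> ?R) z * (norm (?\<nu> z - a))\<^sup>2) + M * \<epsilon> * (indicator ?B z * 1)"
   using AE_outer_normal
  proof eventually_elim
   case (elim z)
   have nn: "0 \<le> M / \<epsilon> * (indicator (?B \<inter> ?R) z * (norm (?\<nu> z - a))\<^sup>2)" "0 \<le> M * \<epsilon>"
    using M_nonneg \<epsilon> by auto
   show ?case
   proof (cases "f z = 0 \<or> z \<notin> ?B")
    case True
    then show ?thesis using nn by (auto simp: indicator_def)
   next
    case False
    then have z: "z \<in> ?R" "f z = norm (f z) *\<^sub>R ?\<nu> z" "z \<in> ?B" using elim by auto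
    have nz: "norm (?\<nu> z) = 1" using z norm_outer_normal[of z] by simp
    let ?w = "norm (?\<nu> z - a)"
    have "norm (f z - norm (f z) *\<^sub>R c) = norm (norm (f z) *\<^sub>R (?\<nu> z - c))"
     using z(2) by (simp only: scaleR_diff_right)
    also have "... = norm (f z) * norm (?\<nu> z - c)" by simp
    also have "... \<le> M * (2 * ?w)" using f_bound[of z] 2[OF nz] M_nonneg by (intro mult_mono) auto
    \<comment> \<open>Young's inequality with weight \<epsilon>: the quadratic term matches the
      squared oscillation, and the constant term integrates to at most
      \<open>M * \<epsilon> * V\<close>.\<close>
    also have "... \<le> M * (?w\<^sup>2 / \<epsilon> + \<epsilon>)"
    proof (rule mult_left_mono[OF _ M_nonneg])
     have "0 \<le> (?w - \<epsilon>)\<^sup>2 / \<epsilon>" using \<epsilon> by simp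
     also have "(?w - \<epsilon>)\<^sup>2 / \<epsilon> = ?w\<^sup>2 / \<epsilon> + \<epsilon> - 2 * ?w"
      using \<epsilon> by (simp add: power2_eq_square field_simps)
     finally show "2 * ?w \<le> ?w\<^sup>2 / \<epsilon> + \<epsilon>" by simp
    qed
    finally show ?thesis using z by (simp add: distrib_left)
   qed
  qed
 qed
 also have "... = M / \<epsilon> * (LINT y:?B \<inter> ?R|\<sigma>. (norm (?\<nu> y - a))\<^sup>2) + M * \<epsilon> * measure \<sigma> ?B"
  using i2 iB[of 1] finite_bounded[of ?B]
  by (subst Bochner_Integration.integral_add) (auto simp: set_lebesgue_integral_def)
 also have "... \<le> M / \<epsilon> * (\<epsilon>\<^sup>2 * V) + M * \<epsilon> * V"
  using osc V M_nonneg \<epsilon> by (intro add_mono mult_left_mono) auto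
 also have "... = 2 * M * \<epsilon> * V" using \<epsilon> by (simp add: power2_eq_square)
 finally show ?thesis using c by blast
qed

end

section \<open>Hausdorff measure\<close>

text \<open>Caratheodory's criterion. \<open>X - F\<close> is exhausted by the sets
  \<open>Y k\<close> at positive distance from \<open>F\<close>, where additivity is given. The
  rings \<open>R k\<close> between them have summable values, because rings with indices of equal
  parity are at positive distance from each other; hence the tails vanish.\<close>

lemma metric_outer_measure_closed:
 fixes f :: "'a::metric_space set \<Rightarrow> ennreal" and F X :: "'a set"
 assumes mono: "\<And>A B. A \<subseteq> B \<Longrightarrow> f A \<le> f B"
  and sub: "\<And>A :: nat \<Rightarrow> 'a set. f (\<Union>i. A i) \<le> (\<Sum>i. f (A i))" and empty: "f {} = 0"
  and metric: "\<And>A B \<eta>. \<eta> > 0 \<Longrightarrow> (\<And>a b. a \<in> A \<Longrightarrow> b \<in> B \<Longrightarrow> \<eta> \<le> dist a b) \<Longrightarrow> f A + f B \<le> f (A \<union> B)"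
  and F: "closed F"
 shows "f (F \<inter> X) + f (X - F) \<le> f X"
proof (cases "F = {} \<or> f X = \<infinity>")
 case True
 then show ?thesis using empty by auto
next
 case False
 then have ne: "F \<noteq> {}" and fin: "f X < \<infinity>" by (auto simp: less_top)
 define Y where "Y k = {x \<in> X. infdist x F \<ge> 1 / real (Suc k)}" for k
 define R where "R k = Y (Suc k) - Y k" for k
 have YX: "Y k \<subseteq> X" "R k \<subseteq> X" for k by (auto simp: Y_def R_def)
 have Ymono: "Y k \<subseteq> Y m" if "k \<le> m" for k m
 proof
  fix x assume x: "x \<in> Y k"
  have "1 / real (Suc m) \<le> 1 / real (Suc k)" using that by (intro divide_left_mono) auto
  then show "x \<in> Y m" using x unfolding Y_def by (auto intro: order_trans)
 qed
 have main: "f (F \<inter> X) + f (Y k) \<le> f X" for k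
 proof -
  have "f (F \<inter> X) + f (Y k) \<le> f (F \<inter> X \<union> Y k)"
  proof (rule metric[of "1 / real (Suc k)"])
   fix a b assume "a \<in> F \<inter> X" "b \<in> Y k"
   then show "1 / real (Suc k) \<le> dist a b" using infdist_le[of a F b] by (simp add: Y_def dist_commute)
  qed simp
  also have "... \<le> f X" by (intro mono) (auto simp: Y_def)
  finally show ?thesis .
 qed
 have sep: "f A + f (R k) \<le> f (A \<union> R k)" if A: "A \<subseteq> Y (k - 1)" "k \<ge> 1" for A k
 proof -
  have e: "1 / real k - 1 / real (Suc k) > 0"
  proof -
   have "1 / real (Suc k) < 1 / real k" using A(2) by (intro divide_strict_left_mono) auto
   then show ?thesis by simp
  qed
  show ?thesis
  proof (rule metric[OF e])
   fix a b assume ab: "a \<in> A" "b \<in> R k"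
   have "infdist a F \<ge> 1 / real k" using ab(1) A by (auto simp: Y_def)
   moreover have "infdist b F < 1 / real (Suc k)" using ab(2) by (auto simp: R_def Y_def)
   moreover have "infdist a F \<le> infdist b F + dist a b" by (rule infdist_triangle)
   ultimately show "1 / real k - 1 / real (Suc k) \<le> dist a b" by linarith
  qed
 qed
 \<comment> \<open>The offset \<open>p\<close> selects the parity; consecutive members are then
   separated by a full ring.\<close>
 have pieces: "(\<Sum>j<m. f (R (2 * j + p))) \<le> f (\<Union>j<m. R (2 * j + p))" for m p
 proof (induction m)
  case 0
  then show ?case by simp
 next
  case (Suc m)
  let ?T = "\<Union>j<m. R (2 * j + p)"
  have "(\<Sum>j<Suc m. f (R (2 * j + p))) \<le> f ?T + f (R (2 * m + p))"
   using Suc by (simp add: add_right_mono)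
  also have "... \<le> f (?T \<union> R (2 * m + p))"
  proof (cases "m = 0")
   case True
   then show ?thesis using empty by simp
  next
   case False
   have "R (2 * j + p) \<subseteq> Y (2 * m + p - 1)" if "j < m" for j
   proof -
    have "Suc (2 * j + p) \<le> 2 * m + p - 1" using that by linarith
    from Ymono[OF this] show ?thesis by (auto simp: R_def)
   qed
   then show ?thesis using False by (intro sep) auto
  qed
  also have "?T \<union> R (2 * m + p) = (\<Union>j<Suc m. R (2 * j + p))" by (auto simp: lessThan_Suc)
  finally show ?case .
 qed
 have half: "(\<Sum>j<m. f (R (2 * j + p))) \<le> f X" for m p
  using YX by (intro order_trans[OF pieces mono]) auto
 have "(\<Sum>i<2 * m. f (R i)) \<le> 2 * f X" for m
 proof -
  have "(\<Sum>i<2 * m. f (R i)) = (\<Sum>j<m. f (R (2 * j))) + (\<Sum>j<m. f (R (2 * j + 1)))"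
   by (induction m) (simp_all add: ac_simps)
  also have "... \<le> f X + f X" using half[where p=0] half[where p=1] by (intro add_mono) auto
  finally show ?thesis by (simp add: mult_2)
 qed
 moreover have "(\<Sum>i<m. f (R i)) \<le> (\<Sum>i<2 * m. f (R i))" for m by (intro sum_mono2) auto
 ultimately have "(\<Sum>i<m. f (R i)) \<le> 2 * f X" for m by (rule order_trans[rotated])
 then have total: "(\<Sum>i. f (R i)) \<le> 2 * f X" by (intro suminf_le_const summableI)
 have fR: "f (R i) = ennreal (enn2real (f (R i)))" for i
  using le_less_trans[OF mono[OF YX(2)[of i]] fin] by simp
 have "(\<Sum>i. ennreal (enn2real (f (R i)))) \<noteq> top"
  using total fin unfolding fR[symmetric] by (auto simp: top_unique ennreal_mult_eq_top_iff)
 then have sm: "summable (\<lambda>i. enn2real (f (R i)))" by (intro summable_suminf_not_top) auto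
 have sub2: "f (A \<union> B) \<le> f A + f B" for A B
 proof -
  have "f (\<Union>i. binaryset A B i) \<le> (\<Sum>i. f (binaryset A B i))" by (rule sub)
  then show ?thesis by (simp add: UN_binaryset_eq suminf_binaryset_eq empty)
 qed
 have tail: "f (X - F) \<le> f (Y k) + (\<Sum>i. f (R (i + k)))" for k
 proof -
  have "X - F \<subseteq> Y k \<union> (\<Union>i. R (i + k))"
  proof
   fix x assume x: "x \<in> X - F"
   then have "infdist x F > 0"
    using F ne in_closed_iff_infdist_zero[of F x] infdist_nonneg[of x F] by auto
   then obtain m where "1 / real (Suc m) < infdist x F" using nat_approx_posE by blast
   then have xm: "x \<in> Y m" using x by (auto simp: Y_def)
   show "x \<in> Y k \<union> (\<Union>i. R (i + k))"
   proof (cases "x \<in> Y k")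
    case False
    define l where "l = (LEAST m. x \<in> Y m)"
    have l: "x \<in> Y l" "\<And>j. j < l \<Longrightarrow> x \<notin> Y j"
     unfolding l_def using xm not_less_Least by (auto intro: LeastI)
    have "k < l" using False l(1) Ymono[of l k] by (meson not_le subsetD)
    then have "x \<in> R ((l - 1 - k) + k)" using l by (simp add: R_def)
    then show ?thesis by blast
   qed simp
  qed
  then have "f (X - F) \<le> f (Y k \<union> (\<Union>i. R (i + k)))" by (rule mono)
  also have "... \<le> f (Y k) + (\<Sum>i. f (R (i + k)))"
   by (rule order_trans[OF sub2 add_left_mono[OF sub]])
  finally show ?thesis .
 qed
 show ?thesis
 proof (rule ennreal_le_epsilon)
  fix e :: real assume e: "e > 0"
  obtain k where k: "norm (\<Sum>i. enn2real (f (R (i + k)))) < e"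
   using suminf_exist_split[OF e sm] by auto
  have "(\<Sum>i. f (R (i + k))) = (\<Sum>i. ennreal (enn2real (f (R (i + k)))))" by (subst fR) simp
  also have "... = ennreal (\<Sum>i. enn2real (f (R (i + k))))"
   using summable_ignore_initial_segment[OF sm, of k] by (intro suminf_ennreal2) auto
  also have "... \<le> ennreal e" using k by (intro ennreal_leI) auto
  finally have t: "(\<Sum>i. f (R (i + k))) \<le> ennreal e" .
  have "f (F \<inter> X) + f (X - F) \<le> f (F \<inter> X) + (f (Y k) + ennreal e)"
   by (rule add_left_mono[OF order_trans[OF tail[of k] add_left_mono[OF t]]])
  also have "... \<le> f X + ennreal e" using add_right_mono[OF main[of k], of "ennreal e"] by (simp only: add.assoc)
  finally show "f (F \<inter> X) + f (X - F) \<le> f X + ennreal e" .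
 qed
qed

lemma metric_outer_measure_borel:
 fixes f :: "'a::metric_space set \<Rightarrow> ennreal"
 assumes mono: "\<And>A B. A \<subseteq> B \<Longrightarrow> f A \<le> f B"
  and sub: "\<And>A :: nat \<Rightarrow> 'a set. f (\<Union>i. A i) \<le> (\<Sum>i. f (A i))" and empty: "f {} = 0"
  and metric: "\<And>A B \<eta>. \<eta> > 0 \<Longrightarrow> (\<And>a b. a \<in> A \<Longrightarrow> b \<in> B \<Longrightarrow> \<eta> \<le> dist a b) \<Longrightarrow> f A + f B \<le> f (A \<union> B)"
 shows "measure_space UNIV (sets borel) f"
proof -
 interpret P: sigma_algebra "UNIV :: 'a set" "UNIV :: 'a set set" by (rule sigma_algebra.intro) (auto intro: algebra.intro simp: sigma_algebra_axioms_def ring_of_sets_iff algebra_iff_Un)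
 have oms: "outer_measure_space UNIV f"
  unfolding outer_measure_space_def positive_def increasing_def countably_subadditive_def
  using mono sub empty by auto
 let ?L = "lambda_system UNIV UNIV f"
 have L: "measure_space UNIV ?L f" by (rule P.caratheodory_lemma[OF oms])
 then interpret L: sigma_algebra UNIV ?L by (simp add: measure_space_def)
 have sub2: "f (A \<union> B) \<le> f A + f B" for A B
 proof -
  have "f (\<Union>i. binaryset A B i) \<le> (\<Sum>i. f (binaryset A B i))" by (rule sub)
  then show ?thesis by (simp add: UN_binaryset_eq suminf_binaryset_eq empty)
 qed
 have closed: "F \<in> ?L" if "closed F" for F
  unfolding lambda_system_def
 proof (intro CollectI conjI ballI UNIV_I antisym)
  fix X :: "'a set"
  have eq: "(UNIV - F) \<inter> X = X - F" by auto
  show "f (F \<inter> X) + f ((UNIV - F) \<inter> X) \<le> f X"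
   unfolding eq by (rule metric_outer_measure_closed[OF mono sub empty metric that]) auto
  have "F \<inter> X \<union> (X - F) = X" by auto
  then show "f X \<le> f (F \<inter> X) + f ((UNIV - F) \<inter> X)"
   unfolding eq using sub2[of "F \<inter> X" "X - F"] by simp
 qed
 have op: "S \<in> ?L" if "open S" for S
 proof -
  have "UNIV - (- S) \<in> ?L" using closed[of "- S"] that by (intro L.compl_sets) auto
  then show ?thesis by (simp add: Compl_eq_Diff_UNIV[symmetric])
 qed
 have "sets borel = sigma_sets UNIV {S :: 'a set. open S}"
  unfolding borel_def by (rule sets_measure_of) simp
 also have "... \<subseteq> ?L" by (rule L.sigma_sets_subset) (use op in auto)
 finally have bL: "sets borel \<subseteq> ?L" .
 have "sigma_algebra UNIV (sets borel :: 'a set set)" using sets.sigma_algebra_axioms[of borel] by simp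
 then show ?thesis
  using L bL unfolding measure_space_def positive_def countably_additive_def by (meson subset_trans subsetD)
qed

section \<open>Hausdorff contents and the measure they define\<close>

text \<open>The case distinction matters for \<open>k = 0\<close>, where the formula would charge an
  empty set with \<open>0 ^ 0 = 1\<close>.\<close>

definition cover_cost :: "nat \<Rightarrow> 'a::metric_space set \<Rightarrow> ennreal" where
 "cover_cost k C = (if C = {} then 0 else ennreal (unit_ball_vol (real k) * (diameter C / 2) ^ k))"

definition fine_covers :: "real \<Rightarrow> 'a::metric_space set \<Rightarrow> (nat \<Rightarrow> 'a set) set" where
 "fine_covers d A = {C. A \<subseteq> (\<Union>i. C i) \<and> (\<forall>i. bounded (C i) \<and> diameter (C i) \<le> d)}"

lemma hausdorff_content_eq:
 "hausdorff_content k d A = (INF C \<in> fine_covers d A. \<Sum>i. cover_cost k (C i))"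
 by (simp add: hausdorff_content_def fine_covers_def cover_cost_def)

lemma hausdorff_content_le: "C \<in> fine_covers d A \<Longrightarrow> hausdorff_content k d A \<le> (\<Sum>i. cover_cost k (C i))"
 unfolding hausdorff_content_eq by (rule INF_lower)

lemma hausdorff_content_mono: "A \<subseteq> B \<Longrightarrow> hausdorff_content k d A \<le> hausdorff_content k d B"
 unfolding hausdorff_content_eq by (rule INF_superset_mono) (auto simp: fine_covers_def)

lemma cover_cost_mono:
 assumes "A \<subseteq> B" "bounded B" shows "cover_cost k A \<le> cover_cost k B"
proof (cases "A = {}")
 case False
 have "diameter A \<le> diameter B" "0 \<le> diameter A"
  using assms by (auto intro: diameter_subset diameter_ge_0 bounded_subset)
 then have "unit_ball_vol (real k) * (diameter A / 2) ^ k \<le> unit_ball_vol (real k) * (diameter B / 2) ^ k"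
  by (intro mult_left_mono power_mono) auto
 moreover have "B \<noteq> {}" using False assms by auto
 ultimately show ?thesis using False by (simp add: cover_cost_def ennreal_leI)
qed (simp add: cover_cost_def)

lemma hausdorff_content_subadditive:
 fixes A :: "nat \<Rightarrow> 'a::metric_space set"
 shows "hausdorff_content k d (\<Union>i. A i) \<le> (\<Sum>i. hausdorff_content k d (A i))"
proof (cases "(\<Sum>i. hausdorff_content k d (A i)) = \<infinity>")
 case False
 then have fin: "hausdorff_content k d (A i) < top" for i
  using sum_le_suminf[of "\<lambda>i. hausdorff_content k d (A i)" "{i}"] by (simp add: less_top[symmetric] top_unique) (metis infinity_ennreal_def top_unique)
 show ?thesis
 proof (rule ennreal_le_epsilon)
  fix e :: real assume e: "e > 0"
  have "\<exists>C\<in>fine_covers d (A i). (\<Sum>j. cover_cost k (C j)) < hausdorff_content k d (A i) + ennreal (e * (1/2) ^ Suc i)" for i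
  proof -
   have "hausdorff_content k d (A i) < hausdorff_content k d (A i) + ennreal (e * (1/2) ^ Suc i)"
    using fin[of i] e by (cases "hausdorff_content k d (A i)") (auto simp: ennreal_plus[symmetric] ennreal_less_iff simp del: ennreal_plus)
   then show ?thesis unfolding hausdorff_content_eq[of k d "A i"] INF_less_iff by blast
  qed
  then obtain C where C: "\<And>i. C i \<in> fine_covers d (A i)"
   "\<And>i. (\<Sum>j. cover_cost k (C i j)) < hausdorff_content k d (A i) + ennreal (e * (1/2) ^ Suc i)" by metis
  define D where "D m = (case prod_decode m of (i, j) \<Rightarrow> C i j)" for m
  have "D \<in> fine_covers d (\<Union>i. A i)"
  proof -
   have "A i \<subseteq> (\<Union>m. D m)" for i
   proof
    fix x assume "x \<in> A i"
    then obtain j where "x \<in> C i j" using C(1)[of i] by (auto simp: fine_covers_def)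
    then have "x \<in> D (prod_encode (i, j))" by (simp add: D_def)
    then show "x \<in> (\<Union>m. D m)" by blast
   qed
   then show ?thesis using C(1) by (auto simp: fine_covers_def D_def split: prod.split)
  qed
  then have "hausdorff_content k d (\<Union>i. A i) \<le> (\<Sum>m. cover_cost k (D m))" by (rule hausdorff_content_le)
  also have "... = (\<Sum>m. (\<lambda>(i, j). cover_cost k (C i j)) (prod_decode m))"
   by (intro suminf_cong) (simp add: D_def split: prod.split)
  also have "... = (\<Sum>i. \<Sum>j. cover_cost k (C i j))"
   by (rule suminf_ennreal_2dimen) simp
  also have "... \<le> (\<Sum>i. hausdorff_content k d (A i) + ennreal (e * (1/2) ^ Suc i))"
   using C(2) by (intro suminf_le summableI) (simp add: less_imp_le)
  also have "... = (\<Sum>i. hausdorff_content k d (A i)) + (\<Sum>i. ennreal (e * (1/2) ^ Suc i))"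
   by (intro suminf_add[symmetric] summableI)
  also have "(\<Sum>i. ennreal (e * (1/2) ^ Suc i)) = ennreal e"
   using sums_mult[OF power_half_series, of e] e by (intro suminf_ennreal_eq) auto
  finally show "hausdorff_content k d (\<Union>i. A i) \<le> (\<Sum>i. hausdorff_content k d (A i)) + ennreal e" .
 qed
qed simp

lemma hausdorff_content_le_outer: "d > 0 \<Longrightarrow> hausdorff_content k d A \<le> hausdorff_outer k A"
 unfolding hausdorff_outer_def by (rule SUP_upper) simp

lemma hausdorff_content_antimono: "d \<le> d' \<Longrightarrow> hausdorff_content k d' A \<le> hausdorff_content k d A"
 unfolding hausdorff_content_eq by (rule INF_superset_mono) (auto simp: fine_covers_def intro: order_trans)

text \<open>No set of diameter at most \<open>d\<close> meets both \<open>A\<close> and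
  \<open>B\<close>, so every fine cover of the union splits into two covers.\<close>

lemma hausdorff_content_separated:
 fixes A B :: "'a::metric_space set"
 assumes sep: "\<And>a b. a \<in> A \<Longrightarrow> b \<in> B \<Longrightarrow> d < dist a b"
 shows "hausdorff_content k d A + hausdorff_content k d B \<le> hausdorff_content k d (A \<union> B)"
 unfolding hausdorff_content_eq[of k d "A \<union> B"]
proof (rule INF_greatest)
 fix C assume C: "C \<in> fine_covers d (A \<union> B)"
 then have Cb: "\<And>i. bounded (C i)" "\<And>i. diameter (C i) \<le> d" "A \<union> B \<subseteq> (\<Union>i. C i)" by (auto simp: fine_covers_def)
 have f: "(\<lambda>i. C i \<inter> X) \<in> fine_covers d X" if "X \<subseteq> (\<Union>i. C i)" for X
 proof -
  have "diameter (C i \<inter> X) \<le> d" for i using diameter_subset[of "C i \<inter> X" "C i"] Cb(1,2)[of i] by simp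
  moreover have "bounded (C i \<inter> X)" for i using Cb(1) by (rule bounded_subset) auto
  ultimately show ?thesis using that by (auto simp: fine_covers_def)
 qed
 have "hausdorff_content k d A + hausdorff_content k d B \<le> (\<Sum>i. cover_cost k (C i \<inter> A)) + (\<Sum>i. cover_cost k (C i \<inter> B))"
  using Cb(3) by (intro add_mono hausdorff_content_le f) auto
 also have "... = (\<Sum>i. cover_cost k (C i \<inter> A) + cover_cost k (C i \<inter> B))"
  by (intro suminf_add summableI)
 also have "... \<le> (\<Sum>i. cover_cost k (C i))"
 proof (intro suminf_le summableI)
  fix i
  have "C i \<inter> A = {} \<or> C i \<inter> B = {}"
  proof (rule ccontr)
   assume "\<not> ?thesis"
   then obtain a b where "a \<in> C i" "a \<in> A" "b \<in> C i" "b \<in> B" by auto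
   then show False using diameter_bounded_bound[OF Cb(1)[of i], of a b] Cb(2)[of i] sep[of a b] by simp
  qed
  then show "cover_cost k (C i \<inter> A) + cover_cost k (C i \<inter> B) \<le> cover_cost k (C i)"
  proof
   assume "C i \<inter> A = {}"
   then show ?thesis using cover_cost_mono[of "C i \<inter> B" "C i" k] Cb(1) by (simp add: cover_cost_def[of k "{}"])
  next
   assume "C i \<inter> B = {}"
   then show ?thesis using cover_cost_mono[of "C i \<inter> A" "C i" k] Cb(1) by (simp add: cover_cost_def[of k "{}"])
  qed
 qed
 finally show "hausdorff_content k d A + hausdorff_content k d B \<le> (\<Sum>i. cover_cost k (C i))" .
qed

text \<open>Subadditivity survives the supremum over \<open>d\<close>. Additivity on separated sets
  holds for the contents once \<open>d\<close> is below the separation, and the two suprema are then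
  taken one after the other.\<close>

lemma measure_space_hausdorff: "measure_space UNIV (sets borel) (hausdorff_outer k :: 'a::metric_space set \<Rightarrow> ennreal)"
proof (rule metric_outer_measure_borel)
 show "hausdorff_outer k A \<le> hausdorff_outer k B" if "A \<subseteq> B" for A B :: "'a set"
  unfolding hausdorff_outer_def by (intro SUP_mono) (use hausdorff_content_mono[OF that] in blast)
 show "hausdorff_outer k (\<Union>i. A i) \<le> (\<Sum>i. hausdorff_outer k (A i))" for A :: "nat \<Rightarrow> 'a set"
  unfolding hausdorff_outer_def[of k "\<Union>i. A i"]
 proof (rule SUP_least)
  fix d :: real assume "d \<in> {0<..}"
  then show "hausdorff_content k d (\<Union>i. A i) \<le> (\<Sum>i. hausdorff_outer k (A i))"
   by (intro order_trans[OF hausdorff_content_subadditive] suminf_le summableI hausdorff_content_le_outer) auto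
 qed
 show "hausdorff_outer k ({} :: 'a set) = 0"
 proof -
  have "hausdorff_content k d ({} :: 'a set) \<le> 0" if "d > 0" for d
  proof -
   have "(\<lambda>_. {}) \<in> fine_covers d ({} :: 'a set)" using that by (simp add: fine_covers_def)
   from hausdorff_content_le[OF this, of k] show ?thesis by (simp add: cover_cost_def)
  qed
  then have "hausdorff_outer k ({} :: 'a set) \<le> 0" unfolding hausdorff_outer_def by (intro SUP_least) simp
  then show ?thesis by simp
 qed
 fix A B :: "'a set" and \<eta> :: real
 assume \<eta>: "\<eta> > 0" and sep: "\<And>a b. a \<in> A \<Longrightarrow> b \<in> B \<Longrightarrow> \<eta> \<le> dist a b"
 have 1: "hausdorff_content k d A + hausdorff_content k d' B \<le> hausdorff_outer k (A \<union> B)" if "d > 0" "d' > 0" for d d'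
 proof -
  define \<delta> where "\<delta> = min (\<eta> / 2) (min d d')"
  have \<delta>: "\<delta> > 0" "\<delta> \<le> d" "\<delta> \<le> d'" "\<delta> < \<eta>" using that \<eta> by (auto simp: \<delta>_def)
  have "hausdorff_content k d A + hausdorff_content k d' B \<le> hausdorff_content k \<delta> A + hausdorff_content k \<delta> B"
   using \<delta> by (intro add_mono hausdorff_content_antimono)
  also have "... \<le> hausdorff_content k \<delta> (A \<union> B)"
   using sep \<delta>(4) by (intro hausdorff_content_separated) (meson less_le_trans)
  also have "... \<le> hausdorff_outer k (A \<union> B)" by (rule hausdorff_content_le_outer[OF \<delta>(1)])
  finally show ?thesis .
 qed
 have ne: "{0<..} \<noteq> ({} :: real set)" by (auto intro: exI[of _ 1])
 have 2: "hausdorff_outer k A + hausdorff_content k d' B \<le> hausdorff_outer k (A \<union> B)" if "d' > 0" for d'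
 proof -
  have "hausdorff_outer k A + hausdorff_content k d' B = (SUP d\<in>{0<..}. hausdorff_content k d A + hausdorff_content k d' B)"
   unfolding hausdorff_outer_def[of k A] by (rule ennreal_SUP_add_left[OF ne, symmetric])
  also have "... \<le> hausdorff_outer k (A \<union> B)" using that by (intro SUP_least 1) auto
  finally show ?thesis .
 qed
 have "hausdorff_outer k A + hausdorff_outer k B = (SUP d\<in>{0<..}. hausdorff_outer k A + hausdorff_content k d B)"
  unfolding hausdorff_outer_def[of k B] by (rule ennreal_SUP_add_right[OF ne])
 also have "... \<le> hausdorff_outer k (A \<union> B)" by (intro SUP_least 2) auto
 finally show "hausdorff_outer k A + hausdorff_outer k B \<le> hausdorff_outer k (A \<union> B)" .
qed

lemma sets_hausdorff_measure [simp, measurable_cong]: "sets (hausdorff_measure k) = sets borel"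
 unfolding hausdorff_measure_def using sets.sigma_sets_eq[of borel] by (simp add: sets_measure_of_conv)

lemma space_hausdorff_measure [simp]: "space (hausdorff_measure k) = UNIV"
 unfolding hausdorff_measure_def by (simp add: space_measure_of_conv)

lemma emeasure_hausdorff_measure: "A \<in> sets borel \<Longrightarrow> emeasure (hausdorff_measure k) A = hausdorff_outer k A"
 using measure_space_hausdorff[of k] unfolding hausdorff_measure_def measure_space_def
 by (intro emeasure_measure_of_sigma) auto

section \<open>Density bounds and comparison with Hausdorff measure\<close>

text \<open>A maximal \<delta>/2-separated subset of a finite \<delta>/2-net: maximality gives the
  cover by balls of radius \<delta>, separation the disjoint quarter balls.\<close>

lemma separated_cover:
 fixes K :: "'a::metric_space set"
 assumes K: "compact K" and \<delta>: "\<delta> > 0"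
 obtains X where "finite X" "X \<subseteq> K" "K \<subseteq> (\<Union>x\<in>X. ball x \<delta>)"
  "\<And>x y. x \<in> X \<Longrightarrow> y \<in> X \<Longrightarrow> x \<noteq> y \<Longrightarrow> ball x (\<delta> / 4) \<inter> ball y (\<delta> / 4) = {}"
proof -
 obtain k where k: "finite k" "k \<subseteq> K" "K \<subseteq> (\<Union>x\<in>k. ball x (\<delta> / 2))"
  using compact_imp_seq_compact[OF K, THEN seq_compact_imp_totally_bounded] \<delta> by (meson half_gt_zero)
 let ?P = "\<lambda>X. X \<subseteq> k \<and> (\<forall>x\<in>X. \<forall>y\<in>X. x \<noteq> y \<longrightarrow> \<delta> / 2 \<le> dist x y)"
 have "finite {X. ?P X}" using k(1) by (rule_tac finite_subset[of _ "Pow k"]) auto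
 moreover have "{X. ?P X} \<noteq> {}" by (auto intro!: exI[of _ "{}"])
 ultimately obtain X where X: "?P X" and max: "\<And>Y. ?P Y \<Longrightarrow> X \<subseteq> Y \<Longrightarrow> X = Y"
  using finite_has_maximal[of "{X. ?P X}"] by auto
 show ?thesis
 proof
  show "finite X" "X \<subseteq> K" using X k finite_subset by auto
  show "K \<subseteq> (\<Union>x\<in>X. ball x \<delta>)"
  proof
   fix z assume "z \<in> K"
   then obtain x where x: "x \<in> k" "dist x z < \<delta> / 2" using k(3) by auto
   have "\<exists>y\<in>X. dist x y < \<delta> / 2"
   proof (rule ccontr)
    assume no: "\<not> ?thesis"
    then have "?P (insert x X)" using X x(1) by (auto simp: not_less dist_commute)
    then have "X = insert x X" by (rule max) auto
    then show False using no \<delta> by (metis dist_self half_gt_zero insertI1)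
   qed
   then obtain y where "y \<in> X" "dist x y < \<delta> / 2" by blast
   then have "dist y z < \<delta>" using x(2) dist_triangle[of y z x] by (simp add: dist_commute)
   then show "z \<in> (\<Union>x\<in>X. ball x \<delta>)" using \<open>y \<in> X\<close> by auto
  qed
  show "ball x (\<delta> / 4) \<inter> ball y (\<delta> / 4) = {}" if "x \<in> X" "y \<in> X" "x \<noteq> y" for x y
  proof (rule ccontr)
   assume "\<not> ?thesis"
   then obtain z where "dist x z < \<delta> / 4" "dist y z < \<delta> / 4" by auto
   then have "dist x y < \<delta> / 2" using dist_triangle2[of x y z] by simp
   then show False using X that by fastforce
  qed
 qed
qed

text \<open>The mass distribution principle: a covering set that meets \<open>S\<close> lies in a
  ball centred in \<open>S\<close> with radius twice its diameter. The factor \<open>4 ^ k\<close>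
  compares this radius with the half diameter in the Hausdorff cost.\<close>

lemma measure_le_hausdorff:
 fixes L :: "(real ^ 'n) measure"
 assumes L: "sets L = sets borel" and S: "S \<in> sets borel" "emeasure L (- S) = 0" and k: "k \<ge> 1" and C: "C > 0" and r0: "r0 > 0"
  and upper: "\<And>x r. x \<in> S \<Longrightarrow> 0 < r \<Longrightarrow> r < r0 \<Longrightarrow> emeasure L (ball x r) \<le> ennreal (C * r ^ k)"
  and A: "A \<in> sets borel"
 shows "emeasure L A \<le> ennreal (C * 4 ^ k / unit_ball_vol (real k)) * hausdorff_outer k A"
proof -
 let ?\<omega> = "unit_ball_vol (real k)"
 define c where "c = C * 4 ^ k / ?\<omega>"
 have cp: "c > 0" using C by (simp add: c_def)
 then have c: "c \<ge> 0" by simp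
 \<comment> \<open>Twice a diameter of at most \<open>r0 / 3\<close> is still below
   \<open>r0\<close>.\<close>
 define d where "d = r0 / 3"
 have d: "d > 0" using r0 by (simp add: d_def)
 \<comment> \<open>A covering set that is a single point costs nothing because
   \<open>k \<ge> 1\<close>, so its measure has to vanish.\<close>
 have point: "emeasure L {x} = 0" if x: "x \<in> S" for x
 proof -
  have "emeasure L {x} \<le> ennreal (C * (r0 / real (m + 2)) ^ k)" for m :: nat
  proof -
   have "emeasure L {x} \<le> emeasure L (ball x (r0 / real (m + 2)))"
    using r0 L by (intro emeasure_mono) auto
   also have "... \<le> ennreal (C * (r0 / real (m + 2)) ^ k)"
    using r0 by (intro upper[OF x]) (auto simp: divide_less_eq)
   finally show ?thesis .
  qed
  moreover have "(\<lambda>m. ennreal (C * (r0 / real (m + 2)) ^ k)) \<longlonglongrightarrow> ennreal (C * 0 ^ k)"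
   by (intro tendsto_ennrealI tendsto_mult tendsto_power tendsto_const LIMSEQ_ignore_initial_segment[OF lim_const_over_n])
  ultimately have "emeasure L {x} \<le> ennreal (C * 0 ^ k)" by (intro LIMSEQ_le_const) auto
  moreover have "C * 0 ^ k = 0" using k by simp
  ultimately show ?thesis by simp
 qed
 have cover: "emeasure L A \<le> ennreal c * (\<Sum>i. cover_cost k (F i))" if F: "F \<in> fine_covers d A" for F
 proof -
  have Fb: "bounded (F i)" "diameter (F i) \<le> d" for i using F by (auto simp: fine_covers_def)
  have "\<exists>D\<in>sets borel. F i \<inter> S \<subseteq> D \<and> emeasure L D \<le> ennreal c * cover_cost k (F i)" for i
  proof (cases "F i \<inter> S = {}")
   case True
   then show ?thesis by (intro bexI[of _ "{}"]) auto
  next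
   case False
   then obtain x where x: "x \<in> F i" "x \<in> S" by auto
   have dist: "dist x y \<le> diameter (F i)" if "y \<in> F i" for y
    by (rule diameter_bounded_bound[OF Fb(1) x(1) that])
   show ?thesis
   proof (cases "diameter (F i) = 0")
    case True
    then have "F i \<subseteq> {x}" using dist by fastforce
    then show ?thesis using point[OF x(2)] by (intro bexI[of _ "{x}"]) auto
   next
    case False
    define \<delta> where "\<delta> = diameter (F i)"
    have \<delta>: "\<delta> > 0" "\<delta> \<le> d" using False diameter_ge_0[OF Fb(1)[of i]] Fb(2)[of i] by (auto simp: \<delta>_def)
    have "F i \<inter> S \<subseteq> ball x (2 * \<delta>)" using dist \<delta> by (fastforce simp: \<delta>_def)
    moreover have "emeasure L (ball x (2 * \<delta>)) \<le> ennreal c * cover_cost k (F i)"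
    proof -
     have "emeasure L (ball x (2 * \<delta>)) \<le> ennreal (C * (2 * \<delta>) ^ k)"
      using \<delta> r0 by (intro upper[OF x(2)]) (auto simp: d_def)
     also have "C * (2 * \<delta>) ^ k = c * (?\<omega> * (\<delta> / 2) ^ k)"
     proof -
      have "?\<omega> > 0" by simp
      then have "?\<omega> \<noteq> 0" by linarith
      moreover have "(2 * \<delta>) ^ k = 4 ^ k * (\<delta> / 2) ^ k"
      proof -
       have "4 * (\<delta> / 2) = 2 * \<delta>" by simp
       then show ?thesis by (metis power_mult_distrib)
      qed
      ultimately show ?thesis by (simp add: c_def)
     qed
     also have "ennreal (c * (?\<omega> * (\<delta> / 2) ^ k)) = ennreal c * cover_cost k (F i)"
      using x(1) c by (auto simp: cover_cost_def \<delta>_def ennreal_mult')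
     finally show ?thesis .
    qed
    ultimately show ?thesis by (intro bexI[of _ "ball x (2 * \<delta>)"]) auto
   qed
  qed
  then obtain D where D: "\<And>i. D i \<in> sets borel" "\<And>i. F i \<inter> S \<subseteq> D i" "\<And>i. emeasure L (D i) \<le> ennreal c * cover_cost k (F i)"
   by metis
  have "A \<subseteq> (\<Union>i. D i) \<union> - S"
  proof
   fix x assume "x \<in> A"
   then have "x \<in> (\<Union>i. F i)" using F unfolding fine_covers_def by blast
   then show "x \<in> (\<Union>i. D i) \<union> - S" using D(2) by blast
  qed
  then have "emeasure L A \<le> emeasure L ((\<Union>i. D i) \<union> - S)" using D(1) S L by (intro emeasure_mono) auto
  also have "... \<le> emeasure L (\<Union>i. D i) + emeasure L (- S)" using D(1) S L by (intro emeasure_subadditive) auto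
  also have "... = emeasure L (\<Union>i. D i)" using S by simp
  also have "... \<le> (\<Sum>i. emeasure L (D i))" using D(1) L by (intro emeasure_subadditive_countably) auto
  also have "... \<le> (\<Sum>i. ennreal c * cover_cost k (F i))" by (intro suminf_le summableI D(3))
  also have "... = ennreal c * (\<Sum>i. cover_cost k (F i))" by simp
  finally show ?thesis .
 qed
 show ?thesis
 proof -
  have "emeasure L A * ennreal (1 / c) \<le> hausdorff_content k d A"
   unfolding hausdorff_content_eq
  proof (rule INF_greatest)
   fix F assume "F \<in> fine_covers d A"
   then have "emeasure L A * ennreal (1 / c) \<le> ennreal c * (\<Sum>i. cover_cost k (F i)) * ennreal (1 / c)"
    by (intro mult_right_mono cover) auto
   also have "... = (ennreal c * ennreal (1 / c)) * (\<Sum>i. cover_cost k (F i))" by (simp add: mult_ac)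
   also have "ennreal c * ennreal (1 / c) = 1" using cp by (simp add: ennreal_mult'[symmetric])
   finally show "emeasure L A * ennreal (1 / c) \<le> (\<Sum>i. cover_cost k (F i))" by simp
  qed
  also have "... \<le> hausdorff_outer k A" by (rule hausdorff_content_le_outer[OF d])
  finally have "ennreal c * (emeasure L A * ennreal (1 / c)) \<le> ennreal c * hausdorff_outer k A" by (rule mult_left_mono) simp
  moreover have "ennreal c * (emeasure L A * ennreal (1 / c)) = (ennreal c * ennreal (1 / c)) * emeasure L A" by (simp add: mult_ac)
  moreover have "ennreal c * ennreal (1 / c) = 1" using cp by (simp add: ennreal_mult'[symmetric])
  ultimately show ?thesis by (simp add: c_def)
 qed
qed

text \<open>Packing: the disjoint balls of radius \<delta>/4 about a separated net lie in
  \<open>W\<close>, and each has measure at least b (\<delta>/4)^k, which bounds their number. The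
  concentric balls of radius \<delta> form the cover.\<close>

lemma hausdorff_le_measure:
 fixes L :: "(real ^ 'n) measure"
 assumes L: "sets L = sets borel" and K: "compact K" and b: "b > 0" and r0: "r0 > 0"
  and lower: "\<And>x r. x \<in> K \<Longrightarrow> 0 < r \<Longrightarrow> r < r0 \<Longrightarrow> ennreal (b * r ^ k) \<le> emeasure L (ball x r)"
  and W: "W \<in> sets borel" "\<delta>0 > 0" "\<And>x. x \<in> K \<Longrightarrow> ball x \<delta>0 \<subseteq> W" and m: "emeasure L W \<le> ennreal m" "m \<ge> 0"
 shows "hausdorff_outer k K \<le> ennreal (unit_ball_vol (real k) * 4 ^ k / b * m)"
 unfolding hausdorff_outer_def
proof (rule SUP_least)
 let ?\<omega> = "unit_ball_vol (real k)"
 fix d :: real assume "d \<in> {0<..}"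
 define \<delta> where "\<delta> = min \<delta>0 (min r0 (d / 2))"
 have \<delta>: "\<delta> > 0" "\<delta> \<le> \<delta>0" "\<delta> \<le> r0" "2 * \<delta> \<le> d" using W(2) r0 \<open>d \<in> {0<..}\<close> by (auto simp: \<delta>_def)
 obtain X where X: "finite X" "X \<subseteq> K" "K \<subseteq> (\<Union>x\<in>X. ball x \<delta>)"
  "\<And>x y. x \<in> X \<Longrightarrow> y \<in> X \<Longrightarrow> x \<noteq> y \<Longrightarrow> ball x (\<delta> / 4) \<inter> ball y (\<delta> / 4) = {}"
  using separated_cover[OF K \<delta>(1)] by blast
 have "of_nat (card X) * ennreal (b * (\<delta> / 4) ^ k) = (\<Sum>x\<in>X. ennreal (b * (\<delta> / 4) ^ k))" by simp
 also have "... \<le> (\<Sum>x\<in>X. emeasure L (ball x (\<delta> / 4)))"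
  using X(2) \<delta> by (intro sum_mono lower) auto
 also have "... = emeasure L (\<Union>x\<in>X. ball x (\<delta> / 4))"
  using X(1,4) L by (intro sum_emeasure) (auto simp: disjoint_family_on_def)
 also have "... \<le> emeasure L W"
 proof (rule emeasure_mono)
  show "(\<Union>x\<in>X. ball x (\<delta> / 4)) \<subseteq> W"
  proof (rule UN_least)
   fix x assume "x \<in> X"
   then have "ball x \<delta>0 \<subseteq> W" using W(3) X(2) by blast
   moreover have "ball x (\<delta> / 4) \<subseteq> ball x \<delta>0" using \<delta> by (intro subset_ball) simp
   ultimately show "ball x (\<delta> / 4) \<subseteq> W" by blast
  qed
 qed (use W L in auto)
 also have "... \<le> ennreal m" by (rule m)
 finally have "ennreal (real (card X) * (b * (\<delta> / 4) ^ k)) \<le> ennreal m"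
  by (simp add: ennreal_mult' ennreal_of_nat_eq_real_of_nat)
 then have card: "real (card X) * (b * (\<delta> / 4) ^ k) \<le> m" using m(2) by (simp add: ennreal_le_iff)
 obtain h where h: "bij_betw h {..<card X} X" using ex_bij_betw_nat_finite[OF X(1)] by (auto simp: atLeast0LessThan)
 define C where "C i = (if i < card X then ball (h i) \<delta> else {})" for i
 have "K \<subseteq> (\<Union>i. C i)"
 proof
  fix z assume "z \<in> K"
  then obtain x where x: "x \<in> X" "z \<in> ball x \<delta>" using X(3) by auto
  then obtain i where "i < card X" "h i = x" using h unfolding bij_betw_def by (metis imageE lessThan_iff)
  then show "z \<in> (\<Union>i. C i)" using x by (auto simp: C_def intro!: exI[of _ i])
 qed
 moreover have "bounded (C i) \<and> diameter (C i) \<le> d" for i using \<delta> by (simp add: C_def)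
 ultimately have "hausdorff_content k d K \<le> (\<Sum>i. cover_cost k (C i))"
  by (intro hausdorff_content_le) (simp add: fine_covers_def)
 also have "... = (\<Sum>i<card X. cover_cost k (C i))"
  by (rule suminf_finite) (auto simp: C_def cover_cost_def)
 also have "... = (\<Sum>i<card X. ennreal (?\<omega> * \<delta> ^ k))"
  using \<delta> by (intro sum.cong refl) (auto simp: C_def cover_cost_def)
 also have "... = ennreal (real (card X) * (?\<omega> * \<delta> ^ k))"
  using \<delta> by (simp add: ennreal_mult' ennreal_of_nat_eq_real_of_nat)
 also have "... \<le> ennreal (?\<omega> * 4 ^ k / b * m)"
 proof (rule ennreal_leI)
  have "real (card X) * (?\<omega> * \<delta> ^ k) = ?\<omega> * 4 ^ k / b * (real (card X) * (b * (\<delta> / 4) ^ k))"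
   using b by (simp add: power_divide)
  also have "... \<le> ?\<omega> * 4 ^ k / b * m" using card b by (intro mult_left_mono) auto
  finally show "real (card X) * (?\<omega> * \<delta> ^ k) \<le> ?\<omega> * 4 ^ k / b * m" .
 qed
 finally show "hausdorff_content k d K \<le> ennreal (?\<omega> * 4 ^ k / b * m)" .
qed

section \<open>Existence of the Gauss--Green measure\<close>

lemma integrable_C1c_deriv:
 assumes \<phi>: "C1c (\<phi> :: real ^ 'n \<Rightarrow> real)"
 shows "integrable lborel (\<lambda>z. frechet_derivative \<phi> (at z) w)"
proof -
 obtain R where R: "\<And>x. \<phi> x \<noteq> 0 \<Longrightarrow> norm x < R" using C1c_support[OF \<phi>] by metis
 obtain K where K: "\<And>x. norm (frechet_derivative \<phi> (at x) w) \<le> K" using C1c_deriv_bounded[OF \<phi>] by metis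
 show ?thesis
  by (rule leb.integrable_bdd[OF C1c_deriv_borel[OF \<phi>] K C1c_deriv_zero_outside[OF \<phi> R]])
qed

text \<open>Near each point either \<Omega> or its exterior fills a neighbourhood, or \<phi>
  vanishes there; locally the product is a constant multiple of \<phi>.\<close>

lemma C1c_indicator_open:
 fixes \<phi> :: "real ^ 'n \<Rightarrow> real"
 assumes \<phi>: "C1c \<phi>" and \<Omega>: "open \<Omega>"
  and vanish: "\<And>z. z \<in> frontier \<Omega> \<Longrightarrow> \<exists>V. open V \<and> z \<in> V \<and> (\<forall>y\<in>V. \<phi> y = 0)"
 shows "C1c (\<lambda>z. indicator \<Omega> z * \<phi> z)"
  "frechet_derivative (\<lambda>z. indicator \<Omega> z * \<phi> z) (at z) v = indicator \<Omega> z * frechet_derivative \<phi> (at z) v"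
proof -
 let ?D = "\<lambda>z v. frechet_derivative \<phi> (at z) v"
 have loc: "\<exists>V k. open V \<and> z \<in> V \<and> (\<forall>y\<in>V. k * \<phi> y = indicator \<Omega> y * \<phi> y \<and> (\<forall>v. k * ?D y v = indicator \<Omega> y * ?D y v))" for z
 proof -
  consider "z \<in> \<Omega>" | "z \<in> - closure \<Omega>" | "z \<in> frontier \<Omega>"
   using \<Omega> closure_subset by (auto simp: frontier_def interior_open)
  then show ?thesis
  proof cases
   case 1
   have "\<forall>y\<in>\<Omega>. 1 * \<phi> y = indicator \<Omega> y * \<phi> y \<and> (\<forall>v. 1 * ?D y v = indicator \<Omega> y * ?D y v)" by simp
   then show ?thesis using \<Omega> 1 by blast
  next
   case 2
   have "y \<notin> \<Omega>" if "y \<in> - closure \<Omega>" for y using that closure_subset by blast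
   then have "\<forall>y\<in>- closure \<Omega>. 0 * \<phi> y = indicator \<Omega> y * \<phi> y \<and> (\<forall>v. 0 * ?D y v = indicator \<Omega> y * ?D y v)"
    by simp
   moreover have "open (- closure \<Omega>)" by (rule open_Compl) (rule closed_closure)
   ultimately show ?thesis using 2 by blast
  next
   case 3
   from vanish[OF this] obtain V where V: "open V" "z \<in> V" "\<And>y. y \<in> V \<Longrightarrow> \<phi> y = 0"
    by (elim exE conjE) (rule that, auto)
   have "?D y v = 0" if "y \<in> V" for y v
   proof -
    have "((\<lambda>_. 0) has_derivative (\<lambda>_. 0)) (at y)" by simp
    then have "(\<phi> has_derivative (\<lambda>_. 0)) (at y)"
     by (rule has_derivative_transform_within_open[OF _ V(1) that]) (simp add: V(3))
    then have "frechet_derivative \<phi> (at y) = (\<lambda>_. 0)" using frechet_derivative_at by metis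
    then show ?thesis by simp
   qed
   then have "\<forall>y\<in>V. 0 * \<phi> y = indicator \<Omega> y * \<phi> y \<and> (\<forall>v. 0 * ?D y v = indicator \<Omega> y * ?D y v)"
    using V(3) by simp
   then show ?thesis using V(1,2) by blast
  qed
 qed
 have der: "((\<lambda>z. indicator \<Omega> z * \<phi> z) has_derivative (\<lambda>v. indicator \<Omega> z * ?D z v)) (at z)" for z
 proof -
  obtain V k where V: "open V" "z \<in> V" "\<And>y. y \<in> V \<Longrightarrow> k * \<phi> y = indicator \<Omega> y * \<phi> y"
    "\<And>v. k * ?D z v = indicator \<Omega> z * ?D z v" using loc[of z] by blast
  have "((\<lambda>z. k * \<phi> z) has_derivative (\<lambda>v. k * ?D z v)) (at z)"
   by (intro has_derivative_mult_right C1c_has_derivative \<phi>)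
  then have "((\<lambda>z. indicator \<Omega> z * \<phi> z) has_derivative (\<lambda>v. k * ?D z v)) (at z)"
   by (rule has_derivative_transform_within_open[OF _ V(1,2,3)])
  then show ?thesis using V(4) by simp
 qed
 obtain R where R: "\<And>x. \<phi> x \<noteq> 0 \<Longrightarrow> norm x < R" using C1c_support[OF \<phi>] by metis
 show "C1c (\<lambda>z. indicator \<Omega> z * \<phi> z)"
 proof (rule C1cI(1)[OF der])
  show "continuous_on UNIV (\<lambda>z. indicator \<Omega> z * ?D z v)" for v
  proof (intro continuous_at_imp_continuous_on ballI)
   fix z
   obtain V k where V: "open V" "z \<in> V" "\<And>y. y \<in> V \<Longrightarrow> k * ?D y v = indicator \<Omega> y * ?D y v"
    using loc[of z] by blast
   have "isCont (\<lambda>z. k * ?D z v) z"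
    using C1c_continuous_deriv[OF \<phi>, of v] by (intro continuous_intros) (simp add: continuous_on_eq_continuous_at)
   moreover have "\<forall>\<^sub>F y in nhds z. k * ?D y v = indicator \<Omega> y * ?D y v"
    using V eventually_nhds by blast
   ultimately show "isCont (\<lambda>z. indicator \<Omega> z * ?D z v) z"
    using isCont_cong by fastforce
  qed
  show "norm x < R" if "indicator \<Omega> x * \<phi> x \<noteq> 0" for x using R[of x] that by auto
 qed
 show "frechet_derivative (\<lambda>z. indicator \<Omega> z * \<phi> z) (at z) v = indicator \<Omega> z * ?D z v"
  using frechet_derivative_at[OF der] by metis
qed

section \<open>The trace estimate for the derivative integrated over the domain\<close>

locale open_ahlfors = borel_radon \<sigma> for \<sigma> :: "(real ^ 'n) measure" +
 fixes \<Omega> :: "(real ^ 'n) set" and b r0 :: real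
 assumes open_\<Omega>: "open \<Omega>" and b_pos: "b > 0" and r0_pos: "r0 > 0"
  and lower: "\<And>x r. x \<in> frontier \<Omega> \<Longrightarrow> 0 < r \<Longrightarrow> r < r0 \<Longrightarrow> b * r ^ (CARD('n) - 1) \<le> measure \<sigma> (ball x r)"
begin

text \<open>The 8 is the gradient factor of the cut-off,
  \<open>ball_vol TYPE('n) * 2 ^ CARD('n)\<close> comes from the volume of balls of radius 2d, and
  \<open>4 ^ (CARD('n) - 1) / b\<close> from the mass bound on balls of radius d/4.\<close>

definition trace_const :: real where
 "trace_const = 8 * ball_vol TYPE('n) * 2 ^ CARD('n) * 4 ^ (CARD('n) - 1) / b"

lemma trace_const_pos: "trace_const > 0"
 unfolding trace_const_def using b_pos by (intro divide_pos_pos mult_pos_pos) auto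

text \<open>The boundary is removed by a cut-off that vanishes on a finite union of balls of radius \<open>d\<close>;
 their number is controlled by the lower density bound, and the error tends to \<open>0\<close> with \<open>d\<close>.\<close>

lemma divergence_cutoff_estimate:
 assumes \<phi>: "C1c (\<phi> :: real ^ 'n \<Rightarrow> real)" and w: "norm w = 1"
  and R: "\<And>x. \<phi> x \<noteq> 0 \<Longrightarrow> norm x < R" and K: "K > 0" "\<And>x v. norm (frechet_derivative \<phi> (at x) v) \<le> K * norm v"
  and d: "0 < d" "d < r0" "d < 1"
 shows "\<bar>LINT z|lborel. indicator \<Omega> z * frechet_derivative \<phi> (at z) w\<bar>
  \<le> trace_const * (LINT z|\<sigma>. \<bar>\<phi> z\<bar>) + trace_const * 19 * K * d * measure \<sigma> (cball 0 (R + 1))"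
proof -
 let ?n = "CARD('n)" and ?K = "frontier \<Omega> \<inter> cball 0 R"
 have "compact ?K" by (intro closed_Int_compact frontier_closed compact_cball)
 then obtain X where X: "finite X" "X \<subseteq> ?K" "?K \<subseteq> (\<Union>x\<in>X. ball x d)"
  "\<And>x y. x \<in> X \<Longrightarrow> y \<in> X \<Longrightarrow> x \<noteq> y \<Longrightarrow> ball x (d / 4) \<inter> ball y (d / 4) = {}"
  using separated_cover[OF _ d(1)] by blast
 have s: "2 * d > 0" using d by simp
 let ?J = "\<lambda>x z. indicator (ball x (2 * d)) z :: real" and ?B = "bump (2 * d)"
 \<comment> \<open>A bump of radius 2d is at least
   \<open>(3 * d\<^sup>2)\<^sup>2 = 9 * d ^ 4\<close> on the ball of radius \<open>d\<close>. Hence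
   \<open>g \<ge> 1\<close> and \<psi> = 0 around the part of the boundary in
   \<open>cball 0 R\<close>.\<close>
 define g where "g z = (\<Sum>x\<in>X. ?B x z) / (9 * d ^ 4)" for z
 define g' where "g' z v = (\<Sum>x\<in>X. frechet_derivative (?B x) (at z) v) / (9 * d ^ 4)" for z v
 define \<psi> where "\<psi> z = (max 0 (1 - g z))\<^sup>2" for z
 define \<psi>' where "\<psi>' z v = 2 * max 0 (1 - g z) * (- g' z v)" for z v
 have dg: "(g has_derivative g' z) (at z)" for z
 proof -
  have "((\<lambda>z. \<Sum>x\<in>X. ?B x z) has_derivative (\<lambda>v. \<Sum>x\<in>X. frechet_derivative (?B x) (at z) v)) (at z)"
   by (intro has_derivative_sum C1c_has_derivative C1c_bump(1) s)
  from has_derivative_mult_right[OF this, of "1 / (9 * d ^ 4)"]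
  show ?thesis unfolding g_def g'_def by (simp add: fun_eq_iff)
 qed
 have d\<psi>: "(\<psi> has_derivative \<psi>' z) (at z)" for z
 proof -
  have "((\<lambda>z. 1 - g z) has_derivative (\<lambda>v. - g' z v)) (at z)"
   using has_derivative_diff[OF has_derivative_const dg, of 1 z] by simp
  from has_derivative_compose[OF this max_sq_has_real_derivative[unfolded has_field_derivative_def]]
  show ?thesis unfolding \<psi>_def \<psi>'_def by simp
 qed
 have c\<psi>: "continuous_on UNIV (\<lambda>z. \<psi>' z v)" for v
 proof -
  have "continuous_on UNIV g" using dg has_derivative_continuous continuous_at_imp_continuous_on by (metis (no_types))
  moreover have "continuous_on UNIV (\<lambda>z. g' z v)"
   unfolding g'_def using d by (intro continuous_intros C1c_continuous_deriv C1c_bump(1) s) auto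
  ultimately show ?thesis unfolding \<psi>'_def by (intro continuous_intros)
 qed
 note \<phi>\<psi> = C1c_scaleR_C1[OF \<phi> d\<psi> c\<psi>]
 have g0: "g z \<ge> 0" for z unfolding g_def using d by (intro divide_nonneg_pos sum_nonneg bump_nonneg) auto
 have \<psi>01: "0 \<le> \<psi> z" "\<psi> z \<le> 1" for z
  using power_mono[of "max 0 (1 - g z)" 1 2] g0[of z] by (simp_all add: \<psi>_def)
 have one_minus: "1 - \<psi> z \<le> (\<Sum>x\<in>X. ?J x z)" for z
 proof (cases "\<exists>x\<in>X. z \<in> ball x (2 * d)")
  case True
  then obtain x where x: "x \<in> X" "z \<in> ball x (2 * d)" by blast
  have "?J x z \<le> (\<Sum>x\<in>X. ?J x z)" using X(1) x(1) by (intro member_le_sum) auto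
  then show ?thesis using x(2) \<psi>01[of z] by simp
 next
  case False
  then have "g z = 0" using bump_eq_0[OF s] unfolding g_def by (auto intro!: sum.neutral)
  then show ?thesis by (simp add: \<psi>_def sum_nonneg)
 qed
 have bd: "\<bar>frechet_derivative (?B x) (at z) w\<bar> \<le> 32 * d ^ 3 * ?J x z" for x z :: "real ^ 'n"
 proof (cases "z \<in> ball x (2 * d)")
  case True
  have "\<bar>(z - x) \<bullet> w\<bar> \<le> 2 * d"
   using Cauchy_Schwarz_ineq2[of "z - x" w] True w by (simp add: dist_norm norm_minus_commute)
  moreover have "max 0 ((2 * d)\<^sup>2 - (norm (z - x))\<^sup>2) \<le> (2 * d)\<^sup>2" by simp
  ultimately have "max 0 ((2 * d)\<^sup>2 - (norm (z - x))\<^sup>2) * \<bar>(z - x) \<bullet> w\<bar> \<le> (2 * d)\<^sup>2 * (2 * d)"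
   by (intro mult_mono) auto
  moreover have "(2 * d)\<^sup>2 * (2 * d) = 8 * d ^ 3" by (simp add: power2_eq_square power3_eq_cube)
  ultimately have "4 * (max 0 ((2 * d)\<^sup>2 - (norm (z - x))\<^sup>2) * \<bar>(z - x) \<bullet> w\<bar>) \<le> 32 * d ^ 3" by linarith
  then show ?thesis using True unfolding C1c_bump(2)[OF s] by (simp add: abs_mult)
 next
  case False
  then have "2 * d \<le> norm (z - x)" by (simp add: dist_norm norm_minus_commute)
  then have "(2 * d)\<^sup>2 \<le> (norm (z - x))\<^sup>2" using s by (intro power_mono) auto
  then show ?thesis using False by (simp add: C1c_bump(2)[OF s])
 qed
 have \<psi>'_bd: "\<bar>\<psi>' z w\<bar> \<le> 8 / d * (\<Sum>x\<in>X. ?J x z)" for z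
 proof -
  have "\<bar>\<Sum>x\<in>X. frechet_derivative (?B x) (at z) w\<bar> \<le> (\<Sum>x\<in>X. 32 * d ^ 3 * ?J x z)"
   by (rule order_trans[OF sum_abs sum_mono[OF bd]])
  then have "\<bar>g' z w\<bar> \<le> (\<Sum>x\<in>X. 32 * d ^ 3 * ?J x z) / (9 * d ^ 4)"
   unfolding g'_def abs_divide using d by (simp add: divide_right_mono)
  also have "... = 32 / (9 * d) * (\<Sum>x\<in>X. ?J x z)"
   using d by (simp add: sum_distrib_left[symmetric] eval_nat_numeral)
  finally have g'b: "\<bar>g' z w\<bar> \<le> 32 / (9 * d) * (\<Sum>x\<in>X. ?J x z)" .
  have "\<bar>\<psi>' z w\<bar> = 2 * max 0 (1 - g z) * \<bar>g' z w\<bar>" by (simp add: \<psi>'_def abs_mult)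
  also have "... \<le> 2 * 1 * (32 / (9 * d) * (\<Sum>x\<in>X. ?J x z))"
   using g0[of z] g'b by (intro mult_mono) auto
  also have "... = 64 / 9 / d * (\<Sum>x\<in>X. ?J x z)" by simp
  also have "... \<le> 8 / d * (\<Sum>x\<in>X. ?J x z)"
   using d by (intro mult_right_mono sum_nonneg divide_right_mono) auto
  finally show ?thesis .
 qed
 have vanish: "\<exists>V. open V \<and> z \<in> V \<and> (\<forall>y\<in>V. \<phi> y *\<^sub>R \<psi> y = 0)" if z: "z \<in> frontier \<Omega>" for z
 proof (cases "norm z \<le> R")
  case True
  then obtain x where x: "x \<in> X" "z \<in> ball x d" using X(3) z by auto
  have "\<psi> y = 0" if y: "y \<in> ball x d" for y
  proof -
   have "(norm (y - x))\<^sup>2 \<le> d\<^sup>2" using y by (intro power_mono) (auto simp: dist_norm norm_minus_commute)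
   then have "3 * d\<^sup>2 \<le> max 0 ((2 * d)\<^sup>2 - (norm (y - x))\<^sup>2)" by (simp add: power_mult_distrib le_max_iff_disj)
   then have "(3 * d\<^sup>2)\<^sup>2 \<le> ?B x y" unfolding bump_def by (rule power_mono) simp
   moreover have "(3 * d\<^sup>2)\<^sup>2 = 9 * d ^ 4" by (simp add: power_mult_distrib power_mult[symmetric])
   moreover have "?B x y \<le> (\<Sum>x\<in>X. ?B x y)" using X(1) x(1) bump_nonneg by (intro member_le_sum) auto
   ultimately have "9 * d ^ 4 \<le> (\<Sum>x\<in>X. ?B x y)" by linarith
   then have "1 \<le> g y" unfolding g_def using d by (simp add: le_divide_eq)
   then show ?thesis by (simp add: \<psi>_def)
  qed
  then show ?thesis using x by (intro exI[of _ "ball x d"]) auto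
 next
  case False
  have "open {y :: real ^ 'n. R < norm y}" by (intro open_Collect_less continuous_intros)
  moreover have "\<phi> y = 0" if "R < norm y" for y using R[of y] that by force
  ultimately show ?thesis using False by (intro exI[of _ "{y. R < norm y}"]) auto
 qed
 note cut = C1c_indicator_open[OF \<phi>\<psi>(1) open_\<Omega> vanish]
 let ?D = "\<lambda>z. frechet_derivative \<phi> (at z) w"
 let ?F = "\<lambda>z. indicator \<Omega> z * (\<phi> z * \<psi>' z w + ?D z * \<psi> z)"
 have cutw: "frechet_derivative (\<lambda>z. indicator \<Omega> z * (\<phi> z *\<^sub>R \<psi> z)) (at z) w = ?F z" for z
  using cut(2)[of z w] \<phi>\<psi>(2)[of z w] by simp
 \<comment> \<open>After the cut-off, multiplication with the indicator of \<Omega> still yields a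
   test function, whose derivative integrates to 0.\<close>
 have zero: "(LINT z|lborel. ?F z) = 0" and int_F: "integrable lborel ?F"
  using integral_deriv_C1c_eq_0[OF cut(1), of w] integrable_C1c_deriv[OF cut(1), of w] unfolding cutw by simp_all
 have int_D: "integrable lborel (\<lambda>z. indicator \<Omega> z * ?D z)"
  using integrable_mult_indicator[OF _ integrable_C1c_deriv[OF \<phi>, of w], of \<Omega>] open_\<Omega> by simp
 \<comment> \<open>19 = 17 + 8/4: passing from a centre \<open>x\<close> to a point of
   \<open>ball x (d / 4)\<close> changes \<phi> by at most \<open>K * (d / 4)\<close>.\<close>
 let ?H = "\<lambda>z. 19 * K * d + 8 * \<bar>\<phi> z\<bar>"
 have "\<bar>LINT z|lborel. indicator \<Omega> z * ?D z\<bar> = \<bar>LINT z|lborel. indicator \<Omega> z * ?D z - ?F z\<bar>"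
  using int_D int_F zero by simp
 also have "... \<le> (LINT z|lborel. \<bar>indicator \<Omega> z * ?D z - ?F z\<bar>)" by (rule integral_abs_bound)
 \<comment> \<open>17 = 1 + 16: one \<open>K\<close> bounds the derivative of \<phi>, and
   \<open>16 * K\<close> arises from replacing \<phi> z by \<phi> x under the factor
   \<open>8 / d\<close>, at distance at most 2d.\<close>
 also have "... \<le> (LINT z|lborel. (\<Sum>x\<in>X. (17 * K + 8 / d * \<bar>\<phi> x\<bar>) * ?J x z))"
 proof (rule integral_mono)
  show "integrable lborel (\<lambda>z. \<bar>indicator \<Omega> z * ?D z - ?F z\<bar>)"
   using int_D int_F by (intro integrable_abs Bochner_Integration.integrable_diff)
  show "integrable lborel (\<lambda>z. \<Sum>x\<in>X. (17 * K + 8 / d * \<bar>\<phi> x\<bar>) * ?J x z)"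
   by (intro Bochner_Integration.integrable_sum integrable_mult_right integrable_real_indicator leb.finite_bounded) auto
  fix z
  have "\<bar>indicator \<Omega> z * ?D z - ?F z\<bar> \<le> \<bar>?D z * (1 - \<psi> z) - \<phi> z * \<psi>' z w\<bar>"
   by (simp add: indicator_def algebra_simps)
  also have "... \<le> \<bar>?D z\<bar> * (1 - \<psi> z) + \<bar>\<phi> z\<bar> * \<bar>\<psi>' z w\<bar>"
   using \<psi>01[of z] abs_triangle_ineq4[of "?D z * (1 - \<psi> z)" "\<phi> z * \<psi>' z w"] by (simp add: abs_mult)
  also have "... \<le> K * (\<Sum>x\<in>X. ?J x z) + \<bar>\<phi> z\<bar> * (8 / d * (\<Sum>x\<in>X. ?J x z))"
   using K(2)[of z w] w one_minus[of z] \<psi>01[of z] \<psi>'_bd[of z] by (intro add_mono mult_mono) auto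
  also have "... = (\<Sum>x\<in>X. (K + 8 / d * \<bar>\<phi> z\<bar>) * ?J x z)"
   unfolding sum_distrib_left[symmetric] by (simp add: distrib_right)
  also have "... \<le> (\<Sum>x\<in>X. (17 * K + 8 / d * \<bar>\<phi> x\<bar>) * ?J x z)"
  proof (rule sum_mono)
   fix x
   show "(K + 8 / d * \<bar>\<phi> z\<bar>) * ?J x z \<le> (17 * K + 8 / d * \<bar>\<phi> x\<bar>) * ?J x z"
   proof (cases "z \<in> ball x (2 * d)")
    case True
    have "\<bar>\<phi> z - \<phi> x\<bar> \<le> K * norm (z - x)" by (rule C1c_lipschitz[OF \<phi> K(2)])
    also have "... \<le> K * (2 * d)" using True K(1) by (intro mult_left_mono) (auto simp: dist_norm norm_minus_commute)
    finally have "\<bar>\<phi> z\<bar> \<le> \<bar>\<phi> x\<bar> + K * (2 * d)" by linarith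
    then have "8 / d * \<bar>\<phi> z\<bar> \<le> 8 / d * (\<bar>\<phi> x\<bar> + K * (2 * d))" using d by (intro mult_left_mono) auto
    also have "... = 8 / d * \<bar>\<phi> x\<bar> + 16 * K" using d by (simp add: distrib_left)
    finally show ?thesis using True by simp
   qed simp
  qed
  finally show "\<bar>indicator \<Omega> z * ?D z - ?F z\<bar> \<le> (\<Sum>x\<in>X. (17 * K + 8 / d * \<bar>\<phi> x\<bar>) * ?J x z)" .
 qed
 also have "... = (\<Sum>x\<in>X. (17 * K + 8 / d * \<bar>\<phi> x\<bar>) * (ball_vol TYPE('n) * (2 * d) ^ ?n))"
 proof (subst Bochner_Integration.integral_sum)
  show "integrable lborel (\<lambda>z. (17 * K + 8 / d * \<bar>\<phi> x\<bar>) * ?J x z)" for x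
   by (intro integrable_mult_right integrable_real_indicator leb.finite_bounded) auto
 qed (use s in \<open>simp add: measure_ball\<close>)
 \<comment> \<open>Prepares the exchange of volumes for \<sigma>-masses:
   \<open>b * (d / 4) ^ (?n - 1)\<close> is the lower bound for the mass of the disjoint quarter
   balls.\<close>
 also have "... = (\<Sum>x\<in>X. trace_const / 8 * ((17 * K * d + 8 * \<bar>\<phi> x\<bar>) * (b * (d / 4) ^ (?n - 1))))"
 proof (intro sum.cong refl)
  fix x
  have "d ^ ?n = d * d ^ (?n - 1)" by (simp add: power_eq_if)
  moreover have "(4::real) ^ (?n - 1) \<noteq> 0" by simp
  ultimately show "(17 * K + 8 / d * \<bar>\<phi> x\<bar>) * (ball_vol TYPE('n) * (2 * d) ^ ?n) =
    trace_const / 8 * ((17 * K * d + 8 * \<bar>\<phi> x\<bar>) * (b * (d / 4) ^ (?n - 1)))"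
   unfolding trace_const_def power_mult_distrib power_divide using b_pos d by (simp add: field_simps)
 qed
 also have "... \<le> trace_const / 8 * (LINT z|\<sigma>. 19 * K * d * indicator (cball 0 (R + 1)) z + 8 * \<bar>\<phi> z\<bar>)"
  unfolding sum_distrib_left[symmetric]
 proof (rule mult_left_mono)
  let ?A = "\<lambda>x. ball x (d / 4)"
  obtain B where B: "\<And>z. norm (\<phi> z) \<le> B" using C1c_bounded[OF \<phi>] by metis
  have si: "set_integrable \<sigma> A ?H" if "A \<in> sets borel" "bounded A" for A
  proof (rule set_integrable_bdd[OF _ that])
   show "?H \<in> borel_measurable borel" using C1c_borel[OF \<phi>] by measurable
   show "norm (?H z) \<le> 19 * K * d + 8 * B" for z using B[of z] K(1) d(1) by (simp add: abs_of_nonneg)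
  qed
  have "(\<Sum>x\<in>X. (17 * K * d + 8 * \<bar>\<phi> x\<bar>) * (b * (d / 4) ^ (?n - 1))) \<le> (\<Sum>x\<in>X. LINT z:?A x|\<sigma>. ?H z)"
  proof (rule sum_mono)
   fix x assume x: "x \<in> X"
   have "(17 * K * d + 8 * \<bar>\<phi> x\<bar>) * (b * (d / 4) ^ (?n - 1)) \<le> (17 * K * d + 8 * \<bar>\<phi> x\<bar>) * measure \<sigma> (?A x)"
    using x X(2) d K(1) by (intro mult_left_mono lower) auto
   also have "... = (LINT z:?A x|\<sigma>. 17 * K * d + 8 * \<bar>\<phi> x\<bar>)"
    using finite_bounded[of "?A x"] by (simp add: set_lebesgue_integral_def)
   also have "... \<le> (LINT z:?A x|\<sigma>. ?H z)"
   proof (rule set_integral_mono[OF _ si])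
    show "set_integrable \<sigma> (?A x) (\<lambda>z. 17 * K * d + 8 * \<bar>\<phi> x\<bar>)"
     by (rule set_integrable_bdd[where K="norm (17 * K * d + 8 * \<bar>\<phi> x\<bar>)"]) auto
    fix z assume "z \<in> ?A x"
    have "\<bar>\<phi> x - \<phi> z\<bar> \<le> K * norm (x - z)" by (rule C1c_lipschitz[OF \<phi> K(2)])
    also have "... \<le> K * (d / 4)" using \<open>z \<in> ?A x\<close> K(1) by (intro mult_left_mono) (auto simp: dist_norm)
    finally show "17 * K * d + 8 * \<bar>\<phi> x\<bar> \<le> ?H z" by linarith
   qed auto
   finally show "(17 * K * d + 8 * \<bar>\<phi> x\<bar>) * (b * (d / 4) ^ (?n - 1)) \<le> (LINT z:?A x|\<sigma>. ?H z)" .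
  qed
  also have "... = (LINT z:(\<Union>x\<in>X. ?A x)|\<sigma>. ?H z)"
   using X(1,4) by (intro set_integral_finite_Union[symmetric] si) (auto simp: disjoint_family_on_def)
  also have "... \<le> (LINT z|\<sigma>. 19 * K * d * indicator (cball 0 (R + 1)) z + 8 * \<bar>\<phi> z\<bar>)"
   unfolding set_lebesgue_integral_def
  proof (rule integral_mono)
   show "integrable \<sigma> (\<lambda>z. indicator (\<Union>x\<in>X. ?A x) z *\<^sub>R ?H z)"
    using X(1) unfolding set_integrable_def[symmetric] by (intro si) auto
   show "integrable \<sigma> (\<lambda>z. 19 * K * d * indicator (cball 0 (R + 1)) z + 8 * \<bar>\<phi> z\<bar>)"
    using finite_cball integrable_C1c[OF \<phi>]
    by (intro Bochner_Integration.integrable_add integrable_mult_right integrable_real_indicator integrable_abs) auto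
   fix z
   have "z \<in> cball 0 (R + 1)" if "z \<in> (\<Union>x\<in>X. ?A x)"
   proof -
    from that obtain x where x: "x \<in> X" "z \<in> ?A x" by blast
    have "norm x \<le> R" using x(1) X(2) by auto
    moreover have "norm z \<le> norm x + dist x z" using norm_triangle_sub[of z x] by (simp add: dist_norm norm_minus_commute)
    ultimately show ?thesis using x(2) d(3) by simp
   qed
   then show "indicator (\<Union>x\<in>X. ?A x) z *\<^sub>R ?H z \<le> 19 * K * d * indicator (cball 0 (R + 1)) z + 8 * \<bar>\<phi> z\<bar>"
    using K(1) d(1) by (auto simp: indicator_def)
  qed
  finally show "(\<Sum>x\<in>X. (17 * K * d + 8 * \<bar>\<phi> x\<bar>) * (b * (d / 4) ^ (?n - 1)))
   \<le> (LINT z|\<sigma>. 19 * K * d * indicator (cball 0 (R + 1)) z + 8 * \<bar>\<phi> z\<bar>)" .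
 qed (use trace_const_pos in simp)
 also have "(LINT z|\<sigma>. 19 * K * d * indicator (cball 0 (R + 1)) z + 8 * \<bar>\<phi> z\<bar>) = 19 * K * d * measure \<sigma> (cball 0 (R + 1)) + 8 * (LINT z|\<sigma>. \<bar>\<phi> z\<bar>)"
  using finite_cball[of "R + 1"] integrable_C1c[OF \<phi>]
  by (subst Bochner_Integration.integral_add) auto
 also have "trace_const / 8 * ... \<le> trace_const * (LINT z|\<sigma>. \<bar>\<phi> z\<bar>) + trace_const * 19 * K * d * measure \<sigma> (cball 0 (R + 1))"
  using trace_const_pos K(1) d(1) by (simp add: algebra_simps)
 finally show ?thesis .
qed

text \<open>In the cut-off estimate the second term is linear in \<open>d\<close>, and
  \<open>d\<close> tends to 0.\<close>

lemma divergence_bound: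
 assumes \<phi>: "C1c (\<phi> :: real ^ 'n \<Rightarrow> real)" and w: "norm w = 1"
 shows "\<bar>LINT z|lborel. indicator \<Omega> z * frechet_derivative \<phi> (at z) w\<bar> \<le> trace_const * (LINT z|\<sigma>. \<bar>\<phi> z\<bar>)"
proof -
 obtain R where R: "\<And>x. \<phi> x \<noteq> 0 \<Longrightarrow> norm x < R" using C1c_support[OF \<phi>] by metis
 obtain K where K: "K > 0" "\<And>x v. norm (frechet_derivative \<phi> (at x) v) \<le> K * norm v" using C1c_grad_bounded[OF \<phi>] by metis
 let ?l = "\<bar>LINT z|lborel. indicator \<Omega> z * frechet_derivative \<phi> (at z) w\<bar>"
 let ?g = "\<lambda>\<delta>. trace_const * (LINT z|\<sigma>. \<bar>\<phi> z\<bar>) + trace_const * 19 * K * \<delta> * measure \<sigma> (cball 0 (R + 1))"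
 have "(?g \<longlongrightarrow> trace_const * (LINT z|\<sigma>. \<bar>\<phi> z\<bar>) + trace_const * 19 * K * 0 * measure \<sigma> (cball 0 (R + 1))) (at_right 0)"
  by (intro tendsto_intros)
 then have "(?g \<longlongrightarrow> trace_const * (LINT z|\<sigma>. \<bar>\<phi> z\<bar>)) (at_right 0)" by simp
 moreover have "\<forall>\<^sub>F \<delta> in at_right 0. ?l \<le> ?g \<delta>"
  unfolding eventually_at_right_field using r0_pos
  by (intro exI[of _ "min r0 1"]) (auto intro!: divergence_cutoff_estimate[OF \<phi> w R K])
 ultimately show ?thesis by (intro tendsto_lowerbound) auto
qed

end

section \<open>Test functions are dense in L^1; bounded functionals on L^1\<close>

context borel_radon
begin

definition C1c_approximable :: "(real ^ 'n \<Rightarrow> real) \<Rightarrow> bool" where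
 "C1c_approximable h \<longleftrightarrow> integrable \<sigma> h \<and> (\<forall>e>0. \<exists>\<phi>. C1c \<phi> \<and> (LINT x|\<sigma>. \<bar>h x - \<phi> x\<bar>) < e)"

lemma L1_triangle:
 fixes a b c :: "real ^ 'n \<Rightarrow> real"
 assumes "integrable \<sigma> a" "integrable \<sigma> b" "integrable \<sigma> c"
 shows "(LINT x|\<sigma>. \<bar>a x - c x\<bar>) \<le> (LINT x|\<sigma>. \<bar>a x - b x\<bar>) + (LINT x|\<sigma>. \<bar>b x - c x\<bar>)"
proof -
 have "(LINT x|\<sigma>. \<bar>a x - c x\<bar>) \<le> (LINT x|\<sigma>. \<bar>a x - b x\<bar> + \<bar>b x - c x\<bar>)"
  using assms by (intro integral_mono integrable_abs Bochner_Integration.integrable_diff Bochner_Integration.integrable_add) auto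
 also have "... = (LINT x|\<sigma>. \<bar>a x - b x\<bar>) + (LINT x|\<sigma>. \<bar>b x - c x\<bar>)"
  using assms by (intro Bochner_Integration.integral_add integrable_abs Bochner_Integration.integrable_diff)
 finally show ?thesis .
qed

lemma dominated_L1_limit:
 fixes h w :: "real ^ 'n \<Rightarrow> real" and s :: "nat \<Rightarrow> real ^ 'n \<Rightarrow> real"
 assumes s: "\<And>i. integrable \<sigma> (s i)" and lim: "\<And>x. (\<lambda>i. s i x) \<longlonglongrightarrow> h x"
  and w: "integrable \<sigma> w" "\<And>i x. \<bar>s i x\<bar> \<le> w x"
 shows "integrable \<sigma> h" "(\<lambda>i. LINT x|\<sigma>. \<bar>h x - s i x\<bar>) \<longlonglongrightarrow> 0"
proof -
 have hm: "h \<in> borel_measurable \<sigma>"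
  by (rule borel_measurable_LIMSEQ_real[OF lim borel_measurable_integrable[OF s]])
 have hw: "\<bar>h x\<bar> \<le> w x" for x
  by (rule tendsto_upperbound[OF tendsto_rabs[OF lim]]) (auto intro: always_eventually w(2))
 show h: "integrable \<sigma> h"
  by (rule Bochner_Integration.integrable_bound[OF w(1) hm]) (use hw in \<open>auto intro!: always_eventually intro: order_trans[OF _ abs_ge_self]\<close>)
 have "(\<lambda>i. LINT x|\<sigma>. \<bar>h x - s i x\<bar>) \<longlonglongrightarrow> (LINT x|\<sigma>. 0)"
 proof (rule integral_dominated_convergence[where w="\<lambda>x. 2 * w x"])
  show "(\<lambda>x. \<bar>h x - s i x\<bar>) \<in> borel_measurable \<sigma>" for i
   using hm borel_measurable_integrable[OF s] by measurable
  show "AE x in \<sigma>. (\<lambda>i. \<bar>h x - s i x\<bar>) \<longlonglongrightarrow> 0"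
  proof (intro always_eventually allI)
   fix x
   have "(\<lambda>i. \<bar>h x - s i x\<bar>) \<longlonglongrightarrow> \<bar>h x - h x\<bar>" by (intro tendsto_intros lim)
   then show "(\<lambda>i. \<bar>h x - s i x\<bar>) \<longlonglongrightarrow> 0" by simp
  qed
  show "AE x in \<sigma>. norm \<bar>h x - s i x\<bar> \<le> 2 * w x" for i
  proof (intro always_eventually allI)
   fix x
   show "norm \<bar>h x - s i x\<bar> \<le> 2 * w x" using hw[of x] w(2)[of i x] by simp
  qed
 qed (use w(1) in auto)
 then show "(\<lambda>i. LINT x|\<sigma>. \<bar>h x - s i x\<bar>) \<longlonglongrightarrow> 0" by simp
qed

lemma C1c_approximable_limit:
 assumes s: "\<And>i :: nat. C1c_approximable (s i)" and lim: "\<And>x. (\<lambda>i. s i x) \<longlonglongrightarrow> h x"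
  and w: "integrable \<sigma> w" "\<And>i x. \<bar>s i x\<bar> \<le> w x"
 shows "C1c_approximable h"
proof -
 have si: "integrable \<sigma> (s i)" for i using s by (simp add: C1c_approximable_def)
 note h = dominated_L1_limit[OF si lim w]
 have "\<exists>\<phi>. C1c \<phi> \<and> (LINT x|\<sigma>. \<bar>h x - \<phi> x\<bar>) < e" if e: "e > 0" for e
 proof -
  have "\<forall>\<^sub>F i in sequentially. (LINT x|\<sigma>. \<bar>h x - s i x\<bar>) < e / 2"
   by (rule order_tendstoD(2)[OF h(2)]) (use e in simp)
  then obtain i where i: "(LINT x|\<sigma>. \<bar>h x - s i x\<bar>) < e / 2"
   using eventually_happens'[OF sequentially_bot] by blast
  obtain \<phi> where \<phi>: "C1c \<phi>" "(LINT x|\<sigma>. \<bar>s i x - \<phi> x\<bar>) < e / 2"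
   using s[of i] e unfolding C1c_approximable_def by (meson half_gt_zero)
  have "(LINT x|\<sigma>. \<bar>h x - \<phi> x\<bar>) < e"
   using L1_triangle[OF h(1) si[of i] integrable_C1c[OF \<phi>(1)]] i \<phi>(2) by linarith
  then show ?thesis using \<phi>(1) by blast
 qed
 then show ?thesis using h(1) by (simp add: C1c_approximable_def)
qed

lemma C1c_approximable_C1c: "C1c \<phi> \<Longrightarrow> C1c_approximable \<phi>"
 unfolding C1c_approximable_def using integrable_C1c by (intro conjI allI impI exI[of _ \<phi>]) auto

lemma L1_linear:
 fixes h g \<phi> \<psi> :: "real ^ 'n \<Rightarrow> real"
 assumes "integrable \<sigma> h" "integrable \<sigma> g" "integrable \<sigma> \<phi>" "integrable \<sigma> \<psi>"
  and "(LINT x|\<sigma>. \<bar>h x - \<phi> x\<bar>) < e / (\<bar>a\<bar> + 1)" "(LINT x|\<sigma>. \<bar>g x - \<psi> x\<bar>) < e / (\<bar>a\<bar> + 1)"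
 shows "(LINT x|\<sigma>. \<bar>(a * h x + g x) - (a * \<phi> x + \<psi> x)\<bar>) < e"
proof -
 have "(LINT x|\<sigma>. \<bar>(a * h x + g x) - (a * \<phi> x + \<psi> x)\<bar>) \<le> (LINT x|\<sigma>. \<bar>a\<bar> * \<bar>h x - \<phi> x\<bar> + \<bar>g x - \<psi> x\<bar>)"
 proof (rule integral_mono)
  fix x
  have "(a * h x + g x) - (a * \<phi> x + \<psi> x) = a * (h x - \<phi> x) + (g x - \<psi> x)" by (simp add: algebra_simps)
  then show "\<bar>(a * h x + g x) - (a * \<phi> x + \<psi> x)\<bar> \<le> \<bar>a\<bar> * \<bar>h x - \<phi> x\<bar> + \<bar>g x - \<psi> x\<bar>"
   using abs_triangle_ineq[of "a * (h x - \<phi> x)" "g x - \<psi> x"] by (simp add: abs_mult)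
 qed (use assms in auto)
 also have "... = \<bar>a\<bar> * (LINT x|\<sigma>. \<bar>h x - \<phi> x\<bar>) + (LINT x|\<sigma>. \<bar>g x - \<psi> x\<bar>)"
  using assms by (subst Bochner_Integration.integral_add) auto
 also have "... < \<bar>a\<bar> * (e / (\<bar>a\<bar> + 1)) + e / (\<bar>a\<bar> + 1)"
  using assms(5,6) by (intro add_le_less_mono mult_left_mono) auto
 also have "... = (\<bar>a\<bar> + 1) * (e / (\<bar>a\<bar> + 1))" by (simp only: distrib_right mult_1_left)
 also have "... = e" by simp
 finally show ?thesis .
qed

lemma C1c_linear: "C1c \<phi> \<Longrightarrow> C1c \<psi> \<Longrightarrow> C1c (\<lambda>x. c * \<phi> x + \<psi> x)" for \<phi> \<psi> :: "real ^ 'n \<Rightarrow> real"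
 using C1c_add(1)[OF C1c_scaleR_left(1)[of \<phi> c]] by simp

lemma C1c_approximable_linear:
 assumes "C1c_approximable h" "C1c_approximable g"
 shows "C1c_approximable (\<lambda>x. a * h x + g x)"
proof -
 have i: "integrable \<sigma> h" "integrable \<sigma> g" using assms by (auto simp: C1c_approximable_def)
 have "\<exists>\<phi>. C1c \<phi> \<and> (LINT x|\<sigma>. \<bar>(a * h x + g x) - \<phi> x\<bar>) < e" if e: "e > 0" for e
 proof -
  have e': "e / (\<bar>a\<bar> + 1) > 0" using e by (intro divide_pos_pos) auto
  obtain \<phi> \<psi> where "C1c \<phi>" "(LINT x|\<sigma>. \<bar>h x - \<phi> x\<bar>) < e / (\<bar>a\<bar> + 1)"
   "C1c \<psi>" "(LINT x|\<sigma>. \<bar>g x - \<psi> x\<bar>) < e / (\<bar>a\<bar> + 1)"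
   using assms e' unfolding C1c_approximable_def by blast
  then show ?thesis using L1_linear[OF i integrable_C1c integrable_C1c] C1c_linear by blast
 qed
 then show ?thesis using i by (simp add: C1c_approximable_def)
qed

lemma C1c_approximable_sum:
 assumes "\<And>i. C1c_approximable (s i)"
 shows "C1c_approximable (\<lambda>x. \<Sum>i<(m::nat). s i x)"
proof (induction m)
 case 0
 have "C1c (\<lambda>x::real^'n. 0::real)" by (rule C1cI[where \<phi>'="\<lambda>_ _. 0"]) auto
 then show ?case using C1c_approximable_C1c by simp
next
 case (Suc m)
 show ?case using C1c_approximable_linear[OF assms[of m] Suc, of 1] by (simp add: add.commute)
qed

text \<open>Sets of the generator are bounded limits of test functions. The approximable functions
  are closed under linear combinations and dominated limits, so a Dynkin induction inside a fixed
  ball reaches all Borel sets.\<close>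

lemma C1c_approximable_indicator:
 assumes A: "A \<in> sets borel"
 shows "C1c_approximable (indicator (A \<inter> ball 0 R))"
proof -
 let ?B = "ball (0::real^'n) R"
 have intB: "integrable \<sigma> (indicator ?B :: _ \<Rightarrow> real)"
  using finite_bounded[of ?B] by (intro integrable_real_indicator) auto
 have G: "C1c_approximable (indicator G)" if pG: "G \<in> positivity_sets" for G
 proof -
  obtain \<phi> where \<phi>: "G = {x. \<phi> x > 0}" "C1c \<phi>" "\<And>x. \<phi> x \<ge> (0::real)"
   using pG unfolding positivity_sets_def by blast
  obtain Q where Q: "\<And>x. \<phi> x \<noteq> 0 \<Longrightarrow> norm x < Q" using C1c_support[OF \<phi>(2)] by metis
  note ap = positivity_sets_approx[OF \<phi>(2,3)]
  show ?thesis unfolding \<phi>(1)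
  proof (rule C1c_approximable_limit[OF C1c_approximable_C1c[OF ap(1)] ap(5), where w="indicator (cball 0 Q)"])
   show "integrable \<sigma> (indicat_real (cball 0 Q))"
    using finite_cball by (intro integrable_real_indicator) (auto simp: less_top)
   show "\<bar>real k * \<phi> x / (1 + real k * \<phi> x)\<bar> \<le> indicator (cball 0 Q) x" for k x
    using ap(2)[of k x] ap(3)[of k x] ap(4)[of x k] Q[of x]
    unfolding abs_of_nonneg[OF ap(2)[of k x]] by (cases "\<phi> x = 0") (simp_all add: less_imp_le)
  qed
 qed
 have sub: "(positivity_sets :: (real^'n) set set) \<subseteq> Pow UNIV" by simp
 have "A \<in> sigma_sets UNIV positivity_sets" using A by (simp add: sigma_sets_positivity_sets)
 with positivity_sets_Int_stable sub show ?thesis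
 proof (induction rule: sigma_sets_induct_disjoint)
  case (basic H)
  then have "H \<inter> ?B \<in> positivity_sets"
   using positivity_sets_Int_stable ball_in_positivity_sets unfolding Int_stable_def by blast
  then show ?case by (rule G)
 next
  case empty
  have "C1c (\<lambda>x::real^'n. 0::real)" by (rule C1cI[where \<phi>'="\<lambda>_ _. 0"]) auto
  then show ?case using C1c_approximable_C1c by simp
 next
  case (compl C)
  have "indicator ((UNIV - C) \<inter> ?B) x = - 1 * indicator (C \<inter> ?B) x + (indicator ?B x :: real)" for x
   by (simp add: indicator_def)
  then show ?case
   using C1c_approximable_linear[OF compl(2) G[OF ball_in_positivity_sets[of 0 R]], of "- 1"] by presburger
 next
  case (union C)
  show ?case
  proof (rule C1c_approximable_limit[OF C1c_approximable_sum[OF union(3)] _ intB])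
   fix x :: "real ^ 'n"
   have d: "disjoint_family (\<lambda>i. C i \<inter> ?B)" using union(1) by (auto simp: disjoint_family_on_def)
   have eq: "(\<Sum>i<m. indicator (C i \<inter> ?B) x) = (indicator (\<Union>i<m. C i \<inter> ?B) x :: real)" for m
    using d by (intro indicator_UN_disjoint[symmetric]) (auto simp: disjoint_family_on_def)
   have "(\<lambda>m. indicator (\<Union>i<m. C i \<inter> ?B) x :: real) \<longlonglongrightarrow> indicator (\<Union>i. C i \<inter> ?B) x"
    by (rule LIMSEQ_indicator_UN)
   moreover have "(\<Union>i. C i \<inter> ?B) = (\<Union>i. C i) \<inter> ?B" by auto
   ultimately show "(\<lambda>m. \<Sum>i<m. indicator (C i \<inter> ?B) x :: real) \<longlonglongrightarrow> indicator ((\<Union>i. C i) \<inter> ?B) x"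
    unfolding eq by simp
   show "\<bar>\<Sum>i<m. indicator (C i \<inter> ?B) x\<bar> \<le> (indicator ?B x :: real)" for m
    unfolding eq by (auto simp: indicator_def)
  qed
 qed
qed

text \<open>An induction principle whose base case is cut down to bounded sets. It serves both the
  density of test functions and the integral representation.\<close>

lemma integrable_imp_dominated_limits:
 fixes P :: "(real ^ 'n \<Rightarrow> real) \<Rightarrow> bool"
 assumes h: "integrable \<sigma> h"
  and base: "\<And>A R. A \<in> sets borel \<Longrightarrow> P (indicator (A \<inter> ball 0 R))"
  and lin: "\<And>a h g. integrable \<sigma> h \<Longrightarrow> P h \<Longrightarrow> integrable \<sigma> g \<Longrightarrow> P g \<Longrightarrow> P (\<lambda>x. a * h x + g x)"
  and lim: "\<And>s h w. (\<And>i :: nat. integrable \<sigma> (s i)) \<Longrightarrow> (\<And>i. P (s i)) \<Longrightarrow> (\<And>x. (\<lambda>i. s i x) \<longlonglongrightarrow> h x) \<Longrightarrow>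
   integrable \<sigma> w \<Longrightarrow> (\<And>i x. \<bar>s i x\<bar> \<le> w x) \<Longrightarrow> P h"
 shows "P h"
 using h
proof (induction rule: integrable_induct)
 case (base A c)
 have A: "A \<in> sets borel" using base by simp
 have i: "integrable \<sigma> (indicat_real (A \<inter> ball 0 R))" for R
  using A finite_bounded[of "A \<inter> ball 0 R"] by (intro integrable_real_indicator) auto
 have "indicat_real ({} \<inter> ball (0 :: real ^ 'n) 0) = (\<lambda>x. 0)" by (simp add: fun_eq_iff)
 then have 0: "P (\<lambda>x. 0)" using assms(2)[of "{}" 0] by simp
 have s: "P (\<lambda>x. c * indicat_real (A \<inter> ball 0 R) x)" for R
  using lin[OF i[of R] assms(2)[OF A] _ 0, of c] by simp
 have "P (\<lambda>x. c * indicat_real A x)"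
 proof (rule lim[where s="\<lambda>k x. c * indicat_real (A \<inter> ball 0 (real k)) x"])
  show "integrable \<sigma> (\<lambda>x. c * indicat_real (A \<inter> ball 0 (real k)) x)" for k using i by simp
  show "P (\<lambda>x. c * indicat_real (A \<inter> ball 0 (real k)) x)" for k by (rule s)
  show "(\<lambda>k. c * indicat_real (A \<inter> ball 0 (real k)) x) \<longlonglongrightarrow> c * indicat_real A x" for x
  proof (rule tendsto_eventually)
   obtain K where "norm x < real K" using reals_Archimedean2 by blast
   then show "\<forall>\<^sub>F k in sequentially. c * indicat_real (A \<inter> ball 0 (real k)) x = c * indicat_real A x"
    by (intro eventually_sequentiallyI[of K]) (auto simp: indicator_def)
  qed
  show "integrable \<sigma> (\<lambda>x. \<bar>c\<bar> * indicat_real A x)"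
   using base by (intro integrable_mult_right integrable_real_indicator) auto
  show "\<bar>c * indicat_real (A \<inter> ball 0 (real k)) x\<bar> \<le> \<bar>c\<bar> * indicat_real A x" for k x
   by (auto simp: indicator_def)
 qed
 then show ?case by (simp add: mult.commute)
next
 case (add f g)
 show ?case using lin[OF add(1,3,2,4), of 1] by simp
next
 case (lim f s)
 have "integrable \<sigma> (\<lambda>x. 2 * \<bar>f x\<bar>)" using lim by simp
 show ?case
  by (rule assms(4)[OF lim(1,5) _ \<open>integrable \<sigma> (\<lambda>x. 2 * \<bar>f x\<bar>)\<close>]) (use lim(2,3) in auto)
qed

lemma C1c_dense_L1: "integrable \<sigma> h \<Longrightarrow> C1c_approximable h"
 by (erule integrable_imp_dominated_limits)
   (blast intro: C1c_approximable_indicator C1c_approximable_linear C1c_approximable_limit)+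

text \<open>The duality of L^1 and L^\<infinity> with an explicit bound. The functional is extended
  from test functions to L^1 by density; its values on indicators form a signed measure bounded by
  \<open>C\<close> times \<sigma>, and \<open>f\<close> is the density of that measure.\<close>

lemma L1_functional_representation:
 fixes L :: "(real ^ 'n \<Rightarrow> real) \<Rightarrow> real"
 assumes C: "C \<ge> 0"
  and add: "\<And>\<phi> \<psi>. C1c \<phi> \<Longrightarrow> C1c \<psi> \<Longrightarrow> L (\<lambda>x. \<phi> x + \<psi> x) = L \<phi> + L \<psi>"
  and scale: "\<And>\<phi> c. C1c \<phi> \<Longrightarrow> L (\<lambda>x. c * \<phi> x) = c * L \<phi>"
  and bound: "\<And>\<phi>. C1c \<phi> \<Longrightarrow> \<bar>L \<phi>\<bar> \<le> C * (LINT x|\<sigma>. \<bar>\<phi> x\<bar>)"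
 obtains f where "f \<in> borel_measurable borel" "\<And>x. \<bar>f x\<bar> \<le> C"
  "\<And>\<phi>. C1c \<phi> \<Longrightarrow> L \<phi> = (LINT x|\<sigma>. \<phi> x * f x)"
proof -
 \<comment> \<open>Says that \<open>l\<close> is a limit of \<open>L\<close> along test functions
   approximating \<open>h\<close> in L^1. As a relation it lets the bound, linearity and uniqueness
   be proved before a value is selected in \<Lambda>.\<close>
 define ext where "ext h l \<longleftrightarrow> (\<forall>e>0. \<exists>\<phi>. C1c \<phi> \<and> (LINT x|\<sigma>. \<bar>h x - \<phi> x\<bar>) < e \<and> \<bar>l - L \<phi>\<bar> < e)" for h l
 have C1c_0: "C1c (\<lambda>x::real^'n. 0::real)" by (rule C1cI[where \<phi>'="\<lambda>_ _. 0"]) auto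
 have lin: "L (\<lambda>x. c * \<phi> x + \<psi> x) = c * L \<phi> + L \<psi>" if "C1c \<phi>" "C1c \<psi>" for \<phi> \<psi> c
  using add[OF C1c_scaleR_left(1)[OF that(1), of c] that(2)] scale[OF that(1), of c] by simp
 have diff: "\<bar>L \<phi> - L \<psi>\<bar> \<le> C * (LINT x|\<sigma>. \<bar>\<phi> x - \<psi> x\<bar>)" if "C1c \<phi>" "C1c \<psi>" for \<phi> \<psi>
  using bound[OF C1c_linear[OF that(2,1), of "- 1"]] lin[OF that(2,1), of "- 1"] by simp
 have ext_C1c: "ext \<phi> (L \<phi>)" if "C1c \<phi>" for \<phi> unfolding ext_def using that by (auto intro!: exI[of _ \<phi>])
 have ext_bound: "\<bar>l\<bar> \<le> C * (LINT x|\<sigma>. \<bar>h x\<bar>)" if h: "integrable \<sigma> h" and l: "ext h l" for h l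
 proof (rule field_le_epsilon)
  fix e :: real assume "e > 0"
  then have "e / (C + 1) > 0" using C by simp
  with l obtain \<phi> where \<phi>: "C1c \<phi>" "(LINT x|\<sigma>. \<bar>h x - \<phi> x\<bar>) < e / (C + 1)" "\<bar>l - L \<phi>\<bar> < e / (C + 1)"
   unfolding ext_def by blast
  have "(LINT x|\<sigma>. \<bar>\<phi> x\<bar>) \<le> (LINT x|\<sigma>. \<bar>h x - \<phi> x\<bar>) + (LINT x|\<sigma>. \<bar>h x\<bar>)"
   using L1_triangle[OF integrable_C1c[OF \<phi>(1)] h integrable_C1c[OF C1c_0]] by (simp add: abs_minus_commute)
  also have "... \<le> e / (C + 1) + (LINT x|\<sigma>. \<bar>h x\<bar>)" using \<phi>(2) by simp
  finally have "\<bar>L \<phi>\<bar> \<le> C * (e / (C + 1) + (LINT x|\<sigma>. \<bar>h x\<bar>))"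
   using order_trans[OF bound[OF \<phi>(1)] mult_left_mono[OF _ C]] by blast
  from add_mono[OF this less_imp_le[OF \<phi>(3)]]
  have "\<bar>l\<bar> \<le> C * (e / (C + 1) + (LINT x|\<sigma>. \<bar>h x\<bar>)) + e / (C + 1)" by simp
  also have "... = C * (LINT x|\<sigma>. \<bar>h x\<bar>) + (C + 1) * (e / (C + 1))" by (simp only: distrib_left distrib_right mult_1_left add_ac)
  also have "(C + 1) * (e / (C + 1)) = e" using C by simp
  finally show "\<bar>l\<bar> \<le> C * (LINT x|\<sigma>. \<bar>h x\<bar>) + e" .
 qed
 have ext_lin: "ext (\<lambda>x. a * h x + g x) (a * l + m)"
  if h: "integrable \<sigma> h" "ext h l" and g: "integrable \<sigma> g" "ext g m" for a h g l m
  unfolding ext_def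
 proof (intro allI impI)
  fix e :: real assume e: "e > 0"
  let ?d = "e / (\<bar>a\<bar> + 1)"
  have "?d > 0" using e by (intro divide_pos_pos) auto
  then obtain \<phi> \<psi> where p: "C1c \<phi>" "(LINT x|\<sigma>. \<bar>h x - \<phi> x\<bar>) < ?d" "\<bar>l - L \<phi>\<bar> < ?d"
   and q: "C1c \<psi>" "(LINT x|\<sigma>. \<bar>g x - \<psi> x\<bar>) < ?d" "\<bar>m - L \<psi>\<bar> < ?d"
   using h(2) g(2) unfolding ext_def by blast
  have "(a * l + m) - (a * L \<phi> + L \<psi>) = a * (l - L \<phi>) + (m - L \<psi>)" by (simp add: algebra_simps)
  then have "\<bar>(a * l + m) - (a * L \<phi> + L \<psi>)\<bar> \<le> \<bar>a\<bar> * \<bar>l - L \<phi>\<bar> + \<bar>m - L \<psi>\<bar>"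
   using abs_triangle_ineq[of "a * (l - L \<phi>)" "m - L \<psi>"] by (simp add: abs_mult)
  also have "... < \<bar>a\<bar> * ?d + ?d" using p(3) q(3) by (intro add_le_less_mono mult_left_mono) auto
  also have "... = (\<bar>a\<bar> + 1) * ?d" by (simp only: distrib_right mult_1_left)
  also have "... = e" by simp
  finally have "\<bar>(a * l + m) - L (\<lambda>x. a * \<phi> x + \<psi> x)\<bar> < e" by (simp only: lin[OF p(1) q(1)])
  then show "\<exists>\<phi>. C1c \<phi> \<and> (LINT x|\<sigma>. \<bar>a * h x + g x - \<phi> x\<bar>) < e \<and> \<bar>a * l + m - L \<phi>\<bar> < e"
   using L1_linear[OF h(1) g(1) integrable_C1c[OF p(1)] integrable_C1c[OF q(1)] p(2) q(2)] C1c_linear[OF p(1) q(1)] by blast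
 qed
 have unique: "l = m" if "integrable \<sigma> h" "ext h l" "ext h m" for h l m
  using ext_bound[OF _ ext_lin[OF that(1,2) that(1,3), of "- 1"]] that(1) by simp
 have ex: "\<exists>l. ext h l" if h: "integrable \<sigma> h" for h
 proof -
  have "\<exists>\<phi>. C1c \<phi> \<and> (LINT x|\<sigma>. \<bar>h x - \<phi> x\<bar>) < 1 / real (Suc k)" for k
   using C1c_dense_L1[OF h] unfolding C1c_approximable_def by simp
  then obtain \<phi> where \<phi>: "\<And>k. C1c (\<phi> k)" "\<And>k. (LINT x|\<sigma>. \<bar>h x - \<phi> k x\<bar>) < 1 / real (Suc k)" by metis
  have key: "\<bar>L (\<phi> i) - L (\<phi> j)\<bar> \<le> C * (1 / real (Suc i) + 1 / real (Suc j))" for i j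
  proof (rule order_trans[OF diff[OF \<phi>(1) \<phi>(1)] mult_left_mono[OF _ C]])
   show "(LINT x|\<sigma>. \<bar>\<phi> i x - \<phi> j x\<bar>) \<le> 1 / real (Suc i) + 1 / real (Suc j)"
    using L1_triangle[OF integrable_C1c[OF \<phi>(1)] h integrable_C1c[OF \<phi>(1)], of i j]
     add_mono[OF less_imp_le[OF \<phi>(2)[of i]] less_imp_le[OF \<phi>(2)[of j]]]
    by (simp only: abs_minus_commute[of "\<phi> i _"])
  qed
  have "Cauchy (\<lambda>k. L (\<phi> k))"
  proof (rule CauchyI)
   fix e :: real assume "e > 0"
   then have "e / (2 * (C + 1)) > 0" using C by simp
   then obtain K where K: "1 / real (Suc K) < e / (2 * (C + 1))" using reals_Archimedean by (auto simp: inverse_eq_divide)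
   have "norm (L (\<phi> i) - L (\<phi> j)) < e" if "i \<ge> K" "j \<ge> K" for i j
   proof -
    have "1 / real (Suc m) \<le> 1 / real (Suc K)" if "m \<ge> K" for m using that by (intro divide_left_mono) auto
    from add_mono[OF this[OF that(1)] this[OF that(2)]]
    have "C * (1 / real (Suc i) + 1 / real (Suc j)) \<le> (C + 1) * (2 * (1 / real (Suc K)))"
     using C by (intro mult_mono) auto
    also have "... < (C + 1) * (2 * (e / (2 * (C + 1))))" using C K by (intro mult_strict_left_mono) auto
    also have "... = e" using C by (simp add: field_simps)
    finally show ?thesis using key[of i j] unfolding real_norm_def by (rule le_less_trans[rotated])
   qed
   then show "\<exists>K. \<forall>i\<ge>K. \<forall>j\<ge>K. norm (L (\<phi> i) - L (\<phi> j)) < e" by blast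
  qed
  then obtain l where l: "(\<lambda>k. L (\<phi> k)) \<longlonglongrightarrow> l" using real_Cauchy_convergent convergent_def by blast
  have "ext h l"
   unfolding ext_def
  proof (intro allI impI)
   fix e :: real assume e: "e > 0"
   have "\<forall>\<^sub>F k in sequentially. 1 / real (Suc k) < e"
    by (rule order_tendstoD(2)[OF lim_1_over_n[THEN LIMSEQ_Suc] e])
   moreover have "\<forall>\<^sub>F k in sequentially. dist (L (\<phi> k)) l < e" by (rule tendstoD[OF l e])
   ultimately have "\<forall>\<^sub>F k in sequentially. 1 / real (Suc k) < e \<and> dist (L (\<phi> k)) l < e" by (rule eventually_conj)
   then obtain k where "1 / real (Suc k) < e" "dist (L (\<phi> k)) l < e"
    using eventually_happens'[OF sequentially_bot] by blast
   then show "\<exists>\<phi>. C1c \<phi> \<and> (LINT x|\<sigma>. \<bar>h x - \<phi> x\<bar>) < e \<and> \<bar>l - L \<phi>\<bar> < e"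
    using \<phi>(1) less_trans[OF \<phi>(2)[of k]] by (intro exI[of _ "\<phi> k"]) (simp add: dist_real_def abs_minus_commute)
  qed
  then show ?thesis by blast
 qed
 define \<Lambda> where "\<Lambda> h = (SOME l. ext h l)" for h
 have ext: "ext h (\<Lambda> h)" if "integrable \<sigma> h" for h
  unfolding \<Lambda>_def using someI_ex[OF ex[OF that]] .
 have \<Lambda>_bound: "\<bar>\<Lambda> h\<bar> \<le> C * (LINT x|\<sigma>. \<bar>h x\<bar>)" if "integrable \<sigma> h" for h
  by (rule ext_bound[OF that ext[OF that]])
 have \<Lambda>_C1c: "\<Lambda> \<phi> = L \<phi>" if "C1c \<phi>" for \<phi>
  using unique[OF integrable_C1c ext[OF integrable_C1c] ext_C1c] that by blast
 have L0: "L (\<lambda>x. 0) = 0" using scale[OF C1c_0, of 0] by simp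
 have \<Lambda>_lin: "\<Lambda> (\<lambda>x. a * h x + g x) = a * \<Lambda> h + \<Lambda> g" if h: "integrable \<sigma> h" and g: "integrable \<sigma> g" for a h g
 proof -
  have "integrable \<sigma> (\<lambda>x. a * h x + g x)" using h g by simp
  from unique[OF this ext[OF this] ext_lin[OF h ext[OF h] g ext[OF g]]] show ?thesis .
 qed
 have \<Lambda>_diff: "\<bar>\<Lambda> h - \<Lambda> g\<bar> \<le> C * (LINT x|\<sigma>. \<bar>h x - g x\<bar>)" if h: "integrable \<sigma> h" and g: "integrable \<sigma> g" for h g
 proof -
  have "integrable \<sigma> (\<lambda>x. - 1 * g x + h x)" using h g by simp
  from \<Lambda>_bound[OF this] show ?thesis unfolding \<Lambda>_lin[OF g h] by simp
 qed
 have \<Lambda>_lim: "(\<lambda>i. \<Lambda> (s i)) \<longlonglongrightarrow> \<Lambda> h"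
  if s: "\<And>i. integrable \<sigma> (s i)" and lim: "\<And>x. (\<lambda>i. s i x) \<longlonglongrightarrow> h x"
   and w: "integrable \<sigma> w" "\<And>i x. \<bar>s i x\<bar> \<le> w x" for s :: "nat \<Rightarrow> real ^ 'n \<Rightarrow> real" and h w
 proof -
  note d = dominated_L1_limit[OF s lim w]
  have "(\<lambda>i. \<Lambda> h - \<Lambda> (s i)) \<longlonglongrightarrow> 0"
  proof (rule Lim_null_comparison)
   show "\<forall>\<^sub>F i in sequentially. norm (\<Lambda> h - \<Lambda> (s i)) \<le> C * (LINT x|\<sigma>. \<bar>h x - s i x\<bar>)"
    using \<Lambda>_diff[OF d(1) s] by (intro always_eventually) simp
   show "(\<lambda>i. C * (LINT x|\<sigma>. \<bar>h x - s i x\<bar>)) \<longlonglongrightarrow> 0" using tendsto_mult_right_zero[OF d(2)] .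
  qed
  from tendsto_diff[OF tendsto_const this, of "\<Lambda> h"] show ?thesis by simp
 qed
 define \<nu> where "\<nu> A = \<Lambda> (indicator A)" for A :: "(real ^ 'n) set"
 have ii: "integrable \<sigma> (indicat_real A)" if "A \<in> sets borel" "bounded A" for A
  using that finite_bounded[of A] by (intro integrable_real_indicator) auto
 have "signed_radon \<nu>"
  unfolding signed_radon_def sums_def
 proof (intro allI impI, elim conjE)
  fix A :: "nat \<Rightarrow> (real ^ 'n) set"
  assume A: "range A \<subseteq> sets borel" "disjoint_family A" "bounded (\<Union>i. A i)"
  have bA: "bounded (A i)" for i using A(3) by (rule bounded_subset) auto
  have iA: "integrable \<sigma> (indicat_real (A i))" for i using A(1) bA[of i] by (intro ii) auto
  have eq: "indicat_real (\<Union>i<m. A i) x = (\<Sum>i<m. indicat_real (A i) x)" for m x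
   using A(2) by (intro indicator_UN_disjoint) (auto simp: disjoint_family_on_def)
  have iS: "integrable \<sigma> (\<lambda>x. \<Sum>i<m. indicat_real (A i) x)" for m using iA by simp
  have sum: "(\<Sum>i<m. \<nu> (A i)) = \<Lambda> (\<lambda>x. \<Sum>i<m. indicat_real (A i) x)" for m
  proof (induction m)
   case 0
   then show ?case using \<Lambda>_C1c[OF C1c_0] L0 by simp
  next
   case (Suc m)
   then show ?case using \<Lambda>_lin[OF iA[of m] iS[of m], of 1] by (simp add: \<nu>_def add.commute)
  qed
  show "(\<lambda>m. \<Sum>i<m. \<nu> (A i)) \<longlonglongrightarrow> \<nu> (\<Union>i. A i)"
   unfolding sum \<nu>_def[of "\<Union>i. A i"]
  proof (rule \<Lambda>_lim[OF iS])
   show "(\<lambda>m. \<Sum>i<m. indicat_real (A i) x) \<longlonglongrightarrow> indicat_real (\<Union>i. A i) x" for x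
    unfolding eq[symmetric] by (rule LIMSEQ_indicator_UN)
   show "integrable \<sigma> (indicat_real (\<Union>i. A i))" using A by (intro ii) auto
   show "\<bar>\<Sum>i<m. indicat_real (A i) x\<bar> \<le> indicat_real (\<Union>i. A i) x" for m x
    unfolding eq[symmetric] by (auto simp: indicator_def)
  qed
 qed
 moreover have "ennreal \<bar>\<nu> A\<bar> \<le> ennreal C * emeasure \<sigma> A" if "A \<in> sets borel" "bounded A" for A
 proof -
  have "\<bar>\<nu> A\<bar> \<le> C * measure \<sigma> A" using \<Lambda>_bound[OF ii[OF that]] that by (simp add: \<nu>_def)
  then have "ennreal \<bar>\<nu> A\<bar> \<le> ennreal (C * measure \<sigma> A)" by (rule ennreal_leI)
  then show ?thesis using C that by (simp add: ennreal_mult emeasure_eq_measure_bounded)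
 qed
 ultimately obtain f where f: "f \<in> borel_measurable borel" "\<And>x. \<bar>f x\<bar> \<le> C"
  "\<And>A. A \<in> sets borel \<Longrightarrow> bounded A \<Longrightarrow> \<nu> A = (LINT x:A|\<sigma>. f x)"
  using signed_radon_density[OF _ C] by metis
 have hf: "integrable \<sigma> (\<lambda>x. h x * f x)" if h: "integrable \<sigma> h" for h
 proof (rule Bochner_Integration.integrable_bound)
  show "integrable \<sigma> (\<lambda>x. C * \<bar>h x\<bar>)" using h by simp
  show "(\<lambda>x. h x * f x) \<in> borel_measurable \<sigma>" using h f(1) by measurable
  show "AE x in \<sigma>. norm (h x * f x) \<le> norm (C * \<bar>h x\<bar>)"
   using f(2) C by (intro always_eventually) (simp add: abs_mult mult.commute mult_right_mono)
 qed
 have rep: "\<Lambda> h = (LINT x|\<sigma>. h x * f x)" if "integrable \<sigma> h" for h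
  using that
 proof (rule integrable_imp_dominated_limits[where P="\<lambda>h. \<Lambda> h = (LINT x|\<sigma>. h x * f x)"])
  fix A :: "(real ^ 'n) set" and R assume "A \<in> sets borel"
  then show "\<Lambda> (indicator (A \<inter> ball 0 R)) = (LINT x|\<sigma>. indicator (A \<inter> ball 0 R) x * f x)"
   using f(3)[of "A \<inter> ball 0 R"] by (simp add: \<nu>_def set_lebesgue_integral_def bounded_Int)
 next
  fix a h g
  assume *: "integrable \<sigma> h" "\<Lambda> h = (LINT x|\<sigma>. h x * f x)" "integrable \<sigma> g" "\<Lambda> g = (LINT x|\<sigma>. g x * f x)"
  have "(LINT x|\<sigma>. (a * h x + g x) * f x) = (LINT x|\<sigma>. a * (h x * f x) + g x * f x)" by (simp add: algebra_simps)
  also have "... = a * (LINT x|\<sigma>. h x * f x) + (LINT x|\<sigma>. g x * f x)"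
   using hf[OF *(1)] hf[OF *(3)] by simp
  finally show "\<Lambda> (\<lambda>x. a * h x + g x) = (LINT x|\<sigma>. (a * h x + g x) * f x)"
   using \<Lambda>_lin[OF *(1,3)] *(2,4) by simp
 next
  fix s h w
  assume *: "\<And>i :: nat. integrable \<sigma> (s i)" "\<And>i. \<Lambda> (s i) = (LINT x|\<sigma>. s i x * f x)"
   "\<And>x. (\<lambda>i. s i x) \<longlonglongrightarrow> h x" "integrable \<sigma> w" "\<And>i x. \<bar>s i x\<bar> \<le> w x"
  have "(\<lambda>i. LINT x|\<sigma>. s i x * f x) \<longlonglongrightarrow> (LINT x|\<sigma>. h x * f x)"
  proof (rule integral_dominated_convergence[where w="\<lambda>x. w x * C"])
   show "(\<lambda>x. h x * f x) \<in> borel_measurable \<sigma>"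
    using borel_measurable_integrable[OF hf[OF dominated_L1_limit(1)[OF *(1,3,4,5)]]] .
   show "(\<lambda>x. s i x * f x) \<in> borel_measurable \<sigma>" for i using borel_measurable_integrable[OF hf[OF *(1)]] .
   show "integrable \<sigma> (\<lambda>x. w x * C)" using *(4) by simp
   show "AE x in \<sigma>. (\<lambda>i. s i x * f x) \<longlonglongrightarrow> h x * f x"
    by (intro always_eventually allI tendsto_mult *(3) tendsto_const)
   show "AE x in \<sigma>. norm (s i x * f x) \<le> w x * C" for i
   proof (intro always_eventually allI)
    fix x show "norm (s i x * f x) \<le> w x * C"
     unfolding real_norm_def abs_mult using *(5)[of i x] f(2)[of x] by (intro mult_mono) auto
   qed
  qed
  moreover have "(\<lambda>i. \<Lambda> (s i)) \<longlonglongrightarrow> \<Lambda> h" by (rule \<Lambda>_lim[OF *(1,3,4,5)])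
  ultimately show "\<Lambda> h = (LINT x|\<sigma>. h x * f x)" unfolding *(2) using LIMSEQ_unique by blast
 qed
 show ?thesis
  by (rule that[OF f(1,2)]) (use rep integrable_C1c \<Lambda>_C1c in metis)
qed

end

context open_ahlfors
begin

text \<open>By \<open>divergence_bound\<close>, integration of the i-th partial derivative over
  \<Omega> is a functional bounded in L^1(\<sigma>); the representing functions are the components
  of the density. The factor \<open>real CARD('n)\<close> bounds the Euclidean norm by the sum of
  the coordinates.\<close>

theorem gauss_green_exists:
 obtains f where "gauss_green_density \<sigma> f (real CARD('n) * trace_const) \<Omega>"
proof -
 let ?L = "\<lambda>i \<phi>. LINT z|lborel. indicator \<Omega> z * frechet_derivative \<phi> (at z) (axis i (1::real))"
 have om: "\<Omega> \<in> sets borel" using open_\<Omega> by simp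
 have int: "integrable lborel (\<lambda>z. indicator \<Omega> z * frechet_derivative \<phi> (at z) w)"
  if "C1c \<phi>" for \<phi> :: "real ^ 'n \<Rightarrow> real" and w
  using integrable_mult_indicator[of \<Omega> lborel, OF _ integrable_C1c_deriv[OF that, of w]] om by simp
 define Q where "Q i g \<longleftrightarrow> g \<in> borel_measurable borel \<and> (\<forall>x. \<bar>g x\<bar> \<le> trace_const) \<and>
  (\<forall>\<phi>. C1c \<phi> \<longrightarrow> ?L i \<phi> = (LINT x|\<sigma>. \<phi> x * g x))" for i :: 'n and g
 have "\<exists>g. Q i g" for i
  unfolding Q_def
 proof (rule L1_functional_representation[of trace_const "?L i"])
  show "trace_const \<ge> 0" using trace_const_pos by simp
  fix \<phi> :: "real ^ 'n \<Rightarrow> real" assume \<phi>: "C1c \<phi>"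
  show "?L i (\<lambda>x. c * \<phi> x) = c * ?L i \<phi>" for c
   using C1c_scaleR_left(2)[OF \<phi>, of c] by (simp add: mult.left_commute)
  show "\<bar>?L i \<phi>\<bar> \<le> trace_const * (LINT x|\<sigma>. \<bar>\<phi> x\<bar>)" by (rule divergence_bound[OF \<phi>]) simp
  fix \<psi> :: "real ^ 'n \<Rightarrow> real" assume \<psi>: "C1c \<psi>"
  show "?L i (\<lambda>x. \<phi> x + \<psi> x) = ?L i \<phi> + ?L i \<psi>"
   unfolding C1c_add(2)[OF \<phi> \<psi>] distrib_left by (rule Bochner_Integration.integral_add[OF int[OF \<phi>] int[OF \<psi>]])
 qed blast
 then obtain g where Q: "\<And>i. Q i (g i)" by metis
 have g: "\<And>i :: 'n. g i \<in> borel_measurable borel" "\<And>i x. \<bar>g i x\<bar> \<le> trace_const"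
  "\<And>i \<phi>. C1c \<phi> \<Longrightarrow> ?L i \<phi> = (LINT x|\<sigma>. \<phi> x * g i x)"
  using Q unfolding Q_def by auto
 let ?f = "\<lambda>x. \<chi> i. g i x"
 interpret density_field \<sigma> ?f "real CARD('n) * trace_const" by (rule density_field_components[OF g(1,2)])
 have "(LINT x:\<Omega>|lebesgue. divergence T x) = (LINT x|\<sigma>. T x \<bullet> ?f x)" if T: "C1c T" for T
 proof -
  note Ti = C1c_component[OF T]
  have "(LINT x:\<Omega>|lebesgue. divergence T x) = (LINT x|lborel. indicator \<Omega> x *\<^sub>R divergence T x)"
   unfolding set_lebesgue_integral_def
  proof (rule integral_completion)
   have "(\<lambda>x. divergence T x) \<in> borel_measurable borel"
    unfolding divergence_def Ti(2)[symmetric] using C1c_deriv_borel[OF Ti(1)] by measurable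
   then show "(\<lambda>x. indicat_real \<Omega> x *\<^sub>R divergence T x) \<in> borel_measurable lborel" using om by measurable
  qed
  also have "... = (LINT x|lborel. (\<Sum>i\<in>UNIV. indicator \<Omega> x * frechet_derivative (\<lambda>x. T x $ i) (at x) (axis i 1)))"
   by (simp add: divergence_def Ti(2) sum_distrib_left)
  also have "... = (\<Sum>i\<in>UNIV. ?L i (\<lambda>x. T x $ i))"
   by (intro Bochner_Integration.integral_sum int Ti(1))
  also have "... = (\<Sum>i\<in>UNIV. (LINT x|\<sigma>. T x $ i * g i x))" by (intro sum.cong refl g(3) Ti(1))
  also have "... = (LINT x|\<sigma>. (\<Sum>i\<in>UNIV. T x $ i * g i x))"
  proof (rule Bochner_Integration.integral_sum[symmetric])
   fix i
   show "integrable \<sigma> (\<lambda>x. T x $ i * g i x)"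
   proof (rule Bochner_Integration.integrable_bound)
    show "integrable \<sigma> (\<lambda>x. \<bar>T x $ i\<bar> * trace_const)" using integrable_C1c[OF Ti(1)] by simp
    show "(\<lambda>x. T x $ i * g i x) \<in> borel_measurable \<sigma>"
     using C1c_borel[OF Ti(1)] g(1) by measurable
    show "AE x in \<sigma>. norm (T x $ i * g i x) \<le> norm (\<bar>T x $ i\<bar> * trace_const)"
     using g(2) trace_const_pos by (intro always_eventually) (simp add: abs_mult mult_left_mono)
   qed
  qed
  also have "... = (LINT x|\<sigma>. T x \<bullet> ?f x)" by (simp add: inner_vec_def)
  finally show ?thesis .
 qed
 then have "gauss_green_density \<sigma> ?f (real CARD('n) * trace_const) \<Omega>"
  using om by unfold_locales (auto simp: is_gauss_green_measure_fm_iff)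
 then show ?thesis by (rule that)
qed

end

section \<open>Oscillation of the normal\<close>

text \<open>The local bounds are given around points of \<open>S\<close>; compactness of
  \<open>S\<close> within the ball leaves finitely many of them.\<close>

lemma emeasure_cball_finite:
 fixes L :: "(real ^ 'n) measure"
 assumes L: "sets L = sets borel" and S: "closed S" "emeasure L (- S) = 0"
  and loc: "r > 0" "\<And>x. x \<in> S \<Longrightarrow> emeasure L (ball x r) < \<infinity>"
 shows "emeasure L (cball 0 R) < \<infinity>"
proof -
 have cpt: "compact (S \<inter> cball 0 R)" using S(1) by (intro closed_Int_compact compact_cball)
 obtain X where X: "finite X" "X \<subseteq> S \<inter> cball 0 R" "S \<inter> cball 0 R \<subseteq> (\<Union>x\<in>X. ball x r)"
  by (rule separated_cover[OF cpt loc(1)]) (erule (2) that)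
 have m: "(\<Union>x\<in>X. ball x r) \<in> sets L" "- S \<in> sets L"
  unfolding L using S(1) by (auto intro!: borel_open open_UN)
 have "emeasure L (cball 0 R) \<le> emeasure L ((\<Union>x\<in>X. ball x r) \<union> - S)"
  using X(3) m by (intro emeasure_mono) auto
 also have "... \<le> emeasure L (\<Union>x\<in>X. ball x r) + emeasure L (- S)"
  by (rule emeasure_subadditive[OF m])
 also have "... \<le> (\<Sum>x\<in>X. emeasure L (ball x r))"
  unfolding S(2) using emeasure_subadditive_finite[of X "\<lambda>x. ball x r" L] X(1) by (simp add: L image_subset_iff)
 also have "... < \<infinity>"
 proof -
  have "emeasure L (ball x r) < top" if "x \<in> X" for x using loc(2) X(2) that by auto
  then show ?thesis using X(1) by simp
 qed
 finally show ?thesis .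
qed

context doubling_gauss_green
begin

lemma gmass_le: "gmass (ball x r) \<le> M * measure \<sigma> (ball x r)"
proof -
 have "gmass (ball x r) \<le> (LINT z:ball x r|\<sigma>. M)"
  unfolding gmass_def
 proof (rule set_integral_mono)
  show "set_integrable \<sigma> (ball x r) (\<lambda>z. norm (f z))"
   by (rule set_integrable_bdd[where K=M]) (auto simp: f_bound)
  show "set_integrable \<sigma> (ball x r) (\<lambda>z. M)"
   by (rule set_integrable_bdd[where K="norm M"]) auto
 qed (rule f_bound)
 also have "... = M * measure \<sigma> (ball x r)"
  using finite_bounded[of "ball x r"] by (simp add: set_lebesgue_integral_def)
 finally show ?thesis .
qed

text \<open>The excess estimate is returned together with the half-space, because
  \<open>both_phases_of_mass\<close> has to be applied with the same vector \<open>c\<close>. The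
  factor \<open>2 ^ CARD('n)\<close> rescales the defect from \<open>r\<close> to
  \<open>r / 2\<close>.\<close>

lemma half_space_of_oscillation:
 assumes r: "r > 0" and \<epsilon>: "\<epsilon> > 0" and V: "measure \<sigma> (ball x r) \<le> V * r ^ (CARD('n) - 1)"
  and osc: "(LINT y:ball x r \<inter> reduced_boundary E|\<sigma>. (norm (outer_normal E y - a))\<^sup>2) \<le> \<epsilon>\<^sup>2 * (V * r ^ (CARD('n) - 1))"
  and \<theta>: "0 < \<theta>" "\<theta> \<le> 1 / 4" and small: "2 * M * \<epsilon> * V \<le> bump_mass TYPE('n) * \<theta> ^ CARD('n) / 4"
 shows "\<exists>c t. norm c = 1 \<and> (LINT z:ball x r|\<sigma>. norm (f z - norm (f z) *\<^sub>R c)) \<le> 2 * M * \<epsilon> * V * r ^ (CARD('n) - 1) \<and>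
  half_space_close E x c t (r / 2) (8 * mollify_const * (M * V) * \<theta> * 2 ^ CARD('n))"
proof -
 from excess_of_oscillation[OF \<epsilon> V osc] obtain c where c: "norm c = 1"
  "(LINT z:ball x r|\<sigma>. norm (f z - norm (f z) *\<^sub>R c)) \<le> 2 * M * \<epsilon> * (V * r ^ (CARD('n) - 1))" by blast
 then have ex: "(LINT z:ball x r|\<sigma>. norm (f z - norm (f z) *\<^sub>R c)) \<le> 2 * M * \<epsilon> * V * r ^ (CARD('n) - 1)"
  by (simp only: mult.assoc)
 have "gmass (ball x r) \<le> M * V * r ^ (CARD('n) - 1)"
  using order_trans[OF gmass_le mult_left_mono[OF V M_nonneg]] by (simp only: mult.assoc)
 from half_space_approximation[OF r c(1) \<theta> this ex small] obtain t where
  t: "measure lebesgue ({z \<in> ball x (r / 2). (z - x) \<bullet> c < t} - E) \<le> 8 * mollify_const * (M * V) * \<theta> * r ^ CARD('n)"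
    "measure lebesgue ({z \<in> ball x (r / 2). (z - x) \<bullet> c > t} \<inter> E) \<le> 8 * mollify_const * (M * V) * \<theta> * r ^ CARD('n)"
  by blast
 have "r ^ CARD('n) = 2 ^ CARD('n) * (r / 2) ^ CARD('n)" by (simp add: power_divide)
 then have "half_space_close E x c t (r / 2) (8 * mollify_const * (M * V) * \<theta> * 2 ^ CARD('n))"
  using t unfolding half_space_close_def by (simp only: mult.assoc)
 then show ?thesis using c(1) ex by blast
qed

text \<open>The volume of both phases near a boundary point comes directly from the lower perimeter
  bound. The three conditions \<open>small\<close> give, in order, the monotonicity of the mollified
  indicator, an excess below the perimeter in balls of relative radius \<eta>, and a half-space
  defect below the volume of each phase there. The powers of 2 under \<open>b\<close> arise because
  the mass is measured on the half ball.\<close>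

lemma flat_of_mass:
 assumes x: "x \<in> frontier E" and \<rho>: "\<rho> > 0" and \<epsilon>: "\<epsilon> > 0" and V: "measure \<sigma> (ball x (8 * \<rho>)) \<le> V * (8 * \<rho>) ^ (CARD('n) - 1)"
  and osc: "(LINT y:ball x (8 * \<rho>) \<inter> reduced_boundary E|\<sigma>. (norm (outer_normal E y - a))\<^sup>2) \<le> \<epsilon>\<^sup>2 * (V * (8 * \<rho>) ^ (CARD('n) - 1))"
  and b: "b > 0" "\<And>y s. y \<in> frontier E \<Longrightarrow> 0 < s \<Longrightarrow> s < \<rho> \<Longrightarrow> b * s ^ (CARD('n) - 1) \<le> gmass (ball y s)"
  and \<eta>: "0 < \<eta>" "\<eta> \<le> 1 / 16"
  and \<theta>: "0 < \<theta>" "\<theta> \<le> 1 / 4" and small: "2 * M * \<epsilon> * V \<le> bump_mass TYPE('n) * \<theta> ^ CARD('n) / 4"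
   "2 * M * \<epsilon> * V \<le> b / 2 ^ (CARD('n) - 1) / 16 * (\<eta> / 2) ^ (CARD('n) - 1)"
   "8 * mollify_const * (M * V) * \<theta> * 2 ^ CARD('n) < b / 2 ^ (CARD('n) - 1) / 8 * \<eta> ^ CARD('n)"
 shows "flatness (frontier E) x \<rho> \<le> 32 * \<eta>"
proof -
 let ?n = "CARD('n)" and ?r = "8 * \<rho>" and ?b = "b / 2 ^ (CARD('n) - 1)"
 let ?\<tau> = "8 * mollify_const * (M * V) * \<theta> * 2 ^ CARD('n)" and ?p = "4 * \<rho>"
 have r: "?r > 0" using \<rho> by simp
 from half_space_of_oscillation[OF r \<epsilon> V osc \<theta> small(1)] obtain c t where
  c: "norm c = 1" "(LINT z:ball x ?r|\<sigma>. norm (f z - norm (f z) *\<^sub>R c)) \<le> 2 * M * \<epsilon> * V * ?r ^ (?n - 1)"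
  and hs: "half_space_close E x c t ?p ?\<tau>" by auto
 let ?s = "\<eta> * ?p"
 have s: "?s > 0" using \<eta> \<rho> by simp
 have s\<rho>: "?s \<le> \<rho> / 4" using \<eta>(2) \<rho> by simp
 have both: "?\<tau> * ?p ^ ?n < measure lebesgue (ball y ?s \<inter> E) \<and> ?\<tau> * ?p ^ ?n < measure lebesgue (ball y ?s - E)"
  if y: "y \<in> frontier E" "y \<in> ball x (?p / 2)" for y
 proof -
  have sub: "ball y ?s \<subseteq> ball x ?r"
  proof (rule ball_subset_ball_of_dist)
   have "dist x y \<le> 2 * \<rho>" using y(2) by simp
   from add_mono[OF this s\<rho>] show "dist x y + ?s \<le> ?r" using \<rho> by simp
  qed
  have "?b * ?s ^ (?n - 1) = b * (?s / 2) ^ (?n - 1)" unfolding power_divide by simp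
  also have "... \<le> gmass (ball y (?s / 2))" using y(1) s s\<rho> \<rho> by (intro b(2)) auto
  finally have mass: "?b * ?s ^ (?n - 1) \<le> gmass (ball y (?s / 2))" .
  have e0: "2 * M * \<epsilon> * V * ?r ^ (?n - 1) \<le> ?b / 16 * ?s ^ (?n - 1)"
  proof -
   have "2 * M * \<epsilon> * V * ?r ^ (?n - 1) \<le> ?b / 16 * (\<eta> / 2) ^ (?n - 1) * ?r ^ (?n - 1)"
    using small(2) r by (intro mult_right_mono) auto
   also have "... = ?b / 16 * ((\<eta> / 2) * ?r) ^ (?n - 1)" by (simp only: power_mult_distrib mult.assoc)
   also have "(\<eta> / 2) * ?r = ?s" by simp
   finally show ?thesis .
  qed
  have "?\<tau> * ?p ^ ?n < ?b / 8 * \<eta> ^ ?n * ?p ^ ?n" using small(3) \<rho> by (intro mult_strict_right_mono) auto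
  also have "... = ?b / 8 * ?s ^ ?n" by (simp only: power_mult_distrib mult.assoc)
  finally have lt: "?\<tau> * ?p ^ ?n < ?b / 8 * ?s ^ ?n" .
  show ?thesis
   using both_phases_of_mass[OF s c(1) sub c(2) mass e0] less_le_trans[OF lt] by blast
 qed
 have p: "?p > 0" using \<rho> by simp
 note slab = slab_separation[OF E_lebesgue x c(1) p \<eta> hs both]
 have "flatness (frontier E) x (?p / 4) \<le> 32 * \<eta>"
  by (rule slab_flatness[OF x c(1) p \<eta> slab])
 then show ?thesis by simp
qed

end

text \<open>On subsets of \<open>S\<close> the restricted measure agrees with Hausdorff measure, so
  the normalised integral can be read with respect to \<sigma>. Positivity of the measure excludes
  the convention 1/0 = 0.\<close>

lemma (in gauss_green_density) oscillation_integral_le: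
 fixes S S' :: "(real ^ 'n) set"
 assumes \<sigma>: "\<sigma> = density codim1_measure (indicator S)" and S: "S \<in> sets borel" "S' \<in> sets borel" "S' \<subseteq> S"
  and pos: "measure \<sigma> (ball x r \<inter> S') > 0"
  and osc: "normal_oscillation E S' x r \<le> \<epsilon>" and \<epsilon>: "\<epsilon> > 0"
 shows "(LINT y:ball x r \<inter> S'|\<sigma>. (norm (outer_normal E y - normal_average E x r))\<^sup>2) \<le> \<epsilon>\<^sup>2 * measure \<sigma> (ball x r \<inter> S')"
proof -
 let ?h = "\<lambda>y. (norm (outer_normal E y - normal_average E x r))\<^sup>2" and ?B = "ball x r \<inter> S'"
 have B: "?B \<in> sets borel" "S \<inter> ?B = ?B" using S by auto
 have hm: "?h \<in> borel_measurable borel" using outer_normal_borel by measurable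
 have \<sigma>': "\<sigma> = density codim1_measure (\<lambda>y. ennreal (indicat_real S y))"
  unfolding \<sigma> by (simp add: ennreal_indicator)
 have "(LINT y:?B|\<sigma>. ?h y) = (LINT y|codim1_measure. indicat_real S y *\<^sub>R (indicat_real ?B y *\<^sub>R ?h y))"
  unfolding set_lebesgue_integral_def \<sigma>' using hm B(1) S(1) by (intro integral_density) auto
 also have "... = (LINT y:?B|codim1_measure. ?h y)"
  unfolding set_lebesgue_integral_def
 proof (intro Bochner_Integration.integral_cong refl)
  fix y show "indicat_real S y *\<^sub>R (indicat_real ?B y *\<^sub>R ?h y) = indicat_real ?B y *\<^sub>R ?h y"
   using S(3) by (cases "y \<in> ?B") auto
 qed
 finally have I: "(LINT y:?B|\<sigma>. ?h y) = (LINT y:?B|codim1_measure. ?h y)" .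
 have m: "measure codim1_measure ?B = measure \<sigma> ?B"
  unfolding \<sigma> using B S(1) by (simp add: measure_restricted)
 have "sqrt (1 / measure \<sigma> ?B * (LINT y:?B|\<sigma>. ?h y)) \<le> \<epsilon>"
  using osc unfolding normal_oscillation_def m I .
 then have "1 / measure \<sigma> ?B * (LINT y:?B|\<sigma>. ?h y) \<le> \<epsilon>\<^sup>2"
  by (rule sqrt_le_D)
 then show ?thesis using pos by (simp add: pos_divide_le_eq)
qed

text \<open>\<open>measure_of\<close> yields the null measure unless the given set function is a measure, so one nonzero value
 certifies the supremum formula.\<close>

lemma norm_le_total_variation:
 fixes \<mu> :: "(real ^ 'n) set \<Rightarrow> real ^ 'n"
 assumes \<mu>: "vector_radon_measure \<mu>" and nz: "emeasure (total_variation \<mu>) B \<noteq> 0" and A: "A \<in> sets borel" "bounded A"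
 shows "ennreal (norm (\<mu> A)) \<le> emeasure (total_variation \<mu>) A"
proof -
 let ?P = "\<lambda>A. SUP F \<in> {F :: nat \<Rightarrow> (real ^ 'n) set. disjoint_family F \<and>
          (\<forall>i. F i \<in> sets borel \<and> bounded (F i)) \<and> (\<Union>i. F i) = A}.
      \<Sum>i. ennreal (norm (\<mu> (F i)))"
 have ss: "sigma_sets UNIV (sets borel) = sets (borel :: (real ^ 'n) measure)"
  using sets.sigma_sets_eq[of "borel :: (real ^ 'n) measure"] by simp
 have eq: "emeasure (total_variation \<mu>) B =
   (if B \<in> sets borel \<and> measure_space UNIV (sets borel) ?P then ?P B else 0)" for B
  unfolding total_variation_def by (simp add: emeasure_measure_of_conv ss)
 have "measure_space UNIV (sets borel) ?P" using nz unfolding eq by metis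
 then have P: "emeasure (total_variation \<mu>) A = ?P A" unfolding eq using A by simp
 let ?F = "\<lambda>i :: nat. if i = 0 then A else {}"
 have \<mu>0: "\<mu> {} = 0"
  using signed_radon_empty[OF signed_radon_component[OF \<mu>]] by (simp add: vec_eq_iff)
 have "ennreal (norm (\<mu> A)) = (\<Sum>i. ennreal (norm (\<mu> (?F i))))"
 proof -
  have "(\<Sum>i. ennreal (norm (\<mu> (?F i)))) = (\<Sum>i\<in>{0}. ennreal (norm (\<mu> (?F i))))"
  proof (rule suminf_finite)
   fix i :: nat assume "i \<notin> {0}"
   then have "?F i = {}" by simp
   then show "ennreal (norm (\<mu> (?F i))) = 0" unfolding \<open>?F i = {}\<close> \<mu>0 by simp
  qed simp
  then show ?thesis by simp
 qed
 also have "... \<le> ?P A"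
 proof (rule SUP_upper)
  have "(\<Union>i. ?F i) = A"
  proof (rule equalityI)
   show "A \<subseteq> (\<Union>i. ?F i)" using UN_upper[of 0 UNIV ?F] by simp
   show "(\<Union>i. ?F i) \<subseteq> A" by (rule UN_least) simp
  qed
  moreover have "disjoint_family ?F" by (simp add: disjoint_family_on_def)
  ultimately show "?F \<in> {F :: nat \<Rightarrow> (real ^ 'n) set. disjoint_family F \<and>
          (\<forall>i. F i \<in> sets borel \<and> bounded (F i)) \<and> (\<Union>i. F i) = A}"
   using A by simp
 qed
 finally show ?thesis unfolding P .
qed

section \<open>The perimeter class in terms of a bounded density\<close>

text \<open>The complement of the support is covered by null balls, and Lindelof's theorem leaves
  countably many.\<close>

lemma emeasure_off_support:
 fixes L :: "(real ^ 'n) measure"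
 assumes L: "sets L = sets borel" and S: "closed (measure_support L)"
 shows "emeasure L (- measure_support L) = 0"
proof -
 let ?B = "{B. \<exists>x r. B = ball x r \<and> emeasure L B = 0}"
 obtain F where F: "F \<subseteq> ?B" "countable F" "\<Union>F = \<Union>?B"
 proof (rule Lindelof[of ?B])
  show "open B" if "B \<in> ?B" for B using that by auto
 qed
 have sub: "- measure_support L \<subseteq> \<Union>F"
 proof
  fix x assume "x \<in> - measure_support L"
  then obtain r where r: "r > 0" "emeasure L (ball x r) = 0" by (auto simp: measure_support_def)
  then have "ball x r \<in> ?B" "x \<in> ball x r" by auto
  then show "x \<in> \<Union>F" unfolding F(3) by (rule UnionI)
 qed
 have "B \<in> null_sets L" if "B \<in> F" for B
 proof -
  from subsetD[OF F(1) that] obtain x r where "B = ball x r" "emeasure L B = 0" by auto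
  then show ?thesis using L by (intro null_setsI) auto
 qed
 then have "(\<Union>B\<in>F. B) \<in> null_sets L" by (intro null_sets_UN' F(2))
 then have "\<Union>F \<in> null_sets L" by simp
 moreover have "- measure_support L \<in> sets L" unfolding L by (rule borel_comp) (rule borel_closed[OF S])
 ultimately have "- measure_support L \<in> null_sets L" using sub by (rule null_sets_subset)
 then show ?thesis by blast
qed

text \<open>The upper perimeter bound gives perimeter \<le> M1 \<sigma> by the mass distribution
  principle, hence a bounded density. Packing with the lower perimeter bound gives the upper bound
  for \<sigma> on balls. The lower perimeter bound and the first comparison bound \<sigma> on balls
  from below, so \<sigma> is doubling.\<close>

lemma regular_perimeter_density:
 fixes E :: "(real ^ 'n) set"
 defines "k \<equiv> CARD('n) - 1"
 defines "\<sigma> \<equiv> density codim1_measure (indicator (frontier E))"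
 assumes n: "CARD('n) \<ge> 2" and CA: "CA > 0" and r0: "r0 > 0" and E: "E \<in> regular_perimeter_class CA r0"
  and ne: "frontier E \<noteq> {}"
 defines "M1 \<equiv> CA * 4 ^ k / unit_ball_vol (real k)"
 defines "V \<equiv> unit_ball_vol (real k) * 4 ^ k * CA * (CA * 2 ^ k)"
 obtains f where "doubling_gauss_green \<sigma> f (real CARD('n) * M1) E (frontier E) (V * 6 ^ k * (CA * M1)) (r0 / 6)"
  "\<And>x r. x \<in> frontier E \<Longrightarrow> 0 < r \<Longrightarrow> r < r0 \<Longrightarrow> measure \<sigma> (ball x r) \<le> V * r ^ k"
proof -
 let ?S = "frontier E" and ?P = "perimeter_measure E" and ?\<omega> = "unit_ball_vol (real k)"
 have k: "k \<ge> 1" using n by (simp add: k_def)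
 have \<omega>: "?\<omega> > 0" by (rule unit_ball_vol_pos) simp
 have M1: "M1 > 0" unfolding M1_def using CA \<omega> by simp
 have S: "?S = measure_support ?P" using E by (simp add: regular_perimeter_class_def)
 have S': "closed ?S" "?S \<in> sets borel" by (rule frontier_closed, rule borel_closed, rule frontier_closed)
 have P_sets: "sets ?P = sets borel"
  unfolding perimeter_measure_def total_variation_def
  using sets.sigma_sets_eq[of "borel :: (real ^ 'n) measure"] by (simp add: sets_measure_of_conv)
 have lo: "ennreal (r ^ k / CA) \<le> emeasure ?P (ball x r)" and up: "emeasure ?P (ball x r) \<le> ennreal (CA * r ^ k)"
  if "x \<in> ?S" "0 < r" "r < r0" for x r
  using E that unfolding regular_perimeter_class_def k_def by auto
 have P_off: "emeasure ?P (- ?S) = 0"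
  using emeasure_off_support[OF P_sets] S'(1) unfolding S .
 obtain \<mu> where \<mu>: "is_gauss_green_measure E \<mu>" and E_leb: "E \<in> sets lebesgue"
  using E by (auto simp: regular_perimeter_class_def locally_finite_perimeter_def)
 have P: "?P = total_variation \<mu>" by (simp add: perimeter_measure_def gauss_green_measure_eq[OF \<mu>])
 have vr: "vector_radon_measure \<mu>" using \<mu> by (simp add: is_gauss_green_measure_def)
 have P_le: "emeasure ?P A \<le> ennreal M1 * hausdorff_outer k A" if "A \<in> sets borel" for A
  unfolding M1_def by (rule measure_le_hausdorff[OF P_sets S'(2) P_off k CA r0 up that])
 have \<sigma>_eq: "emeasure \<sigma> A = hausdorff_outer k (?S \<inter> A)" if "A \<in> sets borel" for A
  unfolding \<sigma>_def k_def using S'(2) that by (simp add: emeasure_restricted emeasure_hausdorff_measure)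
 have P_le_\<sigma>: "emeasure ?P A \<le> ennreal M1 * emeasure \<sigma> A" if A: "A \<in> sets borel" for A
 proof -
  have "emeasure ?P A \<le> emeasure ?P ((?S \<inter> A) \<union> - ?S)" using A S'(2) P_sets by (intro emeasure_mono) auto
  also have "... \<le> emeasure ?P (?S \<inter> A) + emeasure ?P (- ?S)"
   using A S'(2) P_sets by (intro emeasure_subadditive) auto
  also have "... \<le> ennreal M1 * hausdorff_outer k (?S \<inter> A)"
   using P_le[of "?S \<inter> A"] A S'(2) by (simp add: P_off)
  finally show ?thesis unfolding \<sigma>_eq[OF A] .
 qed
 have \<sigma>_le: "emeasure \<sigma> (ball x r) \<le> ennreal (V * r ^ k)" if x: "x \<in> ?S" and r: "0 < r" "r < r0" for x r
 proof -
  \<comment> \<open>A radius strictly between \<open>r\<close> and \<open>r0\<close>: it leaves room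
    around \<open>cball x r\<close> for the packing balls, while the perimeter bound still
    applies.\<close>
  define r' where "r' = min (2 * r) ((r + r0) / 2)"
  have r': "r < r'" "r' < r0" "r' \<le> 2 * r" using r unfolding r'_def min_def by (auto split: if_splits)
  have K: "compact (?S \<inter> cball x r)" by (intro closed_Int_compact compact_cball S'(1))
  have low: "ennreal (1 / CA * s ^ k) \<le> emeasure ?P (ball y s)" if "y \<in> ?S \<inter> cball x r" "0 < s" "s < r0" for y s
   using lo that by simp
  have sub: "ball y (r' - r) \<subseteq> ball x r'" if "y \<in> ?S \<inter> cball x r" for y
   using that by (intro ball_subset_ball_of_dist) simp
  have "emeasure \<sigma> (ball x r) = hausdorff_outer k (?S \<inter> ball x r)" by (simp add: \<sigma>_eq)
  also have "... = emeasure codim1_measure (?S \<inter> ball x r)"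
   using S'(2) by (simp add: emeasure_hausdorff_measure k_def)
  also have "... \<le> emeasure codim1_measure (?S \<inter> cball x r)"
   using S'(2) by (intro emeasure_mono) auto
  also have "... = hausdorff_outer k (?S \<inter> cball x r)"
   using S'(2) by (simp add: emeasure_hausdorff_measure k_def)
  also have "... \<le> ennreal (?\<omega> * 4 ^ k / (1 / CA) * (CA * r' ^ k))"
  proof (rule hausdorff_le_measure[OF P_sets K _ r0 low _ _ sub])
   show "emeasure ?P (ball x r') \<le> ennreal (CA * r' ^ k)" using up[OF x, of r'] r r' by simp
  qed (use CA r r' in auto)
  also have "... \<le> ennreal (V * r ^ k)"
  proof (rule ennreal_leI)
   have "r' ^ k \<le> (2 * r) ^ k" using r r' by (intro power_mono) auto
   then have "?\<omega> * 4 ^ k / (1 / CA) * (CA * r' ^ k) \<le> ?\<omega> * 4 ^ k / (1 / CA) * (CA * (2 * r) ^ k)"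
    using CA \<omega> by (intro mult_left_mono) auto
   also have "... = V * r ^ k" by (simp add: V_def power_mult_distrib)
   finally show "?\<omega> * 4 ^ k / (1 / CA) * (CA * r' ^ k) \<le> V * r ^ k" .
  qed
  finally show ?thesis .
 qed
 have \<sigma>_sets: "sets \<sigma> = sets borel" by (simp add: \<sigma>_def)
 have \<sigma>_off: "emeasure \<sigma> (- ?S) = 0" using S'(2) \<sigma>_eq[of "- ?S"] emeasure_hausdorff_measure[of "{} :: (real ^ 'n) set" k] by simp
 interpret borel_radon \<sigma>
 proof
  show "emeasure \<sigma> (cball 0 R) < \<infinity>" for R
  proof (rule emeasure_cball_finite[OF \<sigma>_sets S'(1) \<sigma>_off, of "r0 / 2"])
   show "emeasure \<sigma> (ball x (r0 / 2)) < \<infinity>" if "x \<in> ?S" for x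
    using \<sigma>_le[OF that, of "r0 / 2"] r0 by (simp add: le_less_trans[OF _ ennreal_less_top])
  qed (use r0 in simp)
 qed (rule \<sigma>_sets)
 obtain x where x: "x \<in> ?S" using ne by blast
 \<comment> \<open>The nonzero value required by \<open>norm_le_total_variation\<close>; a boundary
   point exists by \<open>ne\<close>.\<close>
 have nz: "emeasure (total_variation \<mu>) (ball x (r0 / 2)) \<noteq> 0"
 proof -
  have "0 < (r0 / 2) ^ k / CA" using CA r0 by simp
  then show ?thesis using lo[OF x, of "r0 / 2"] r0 unfolding P by (metis ennreal_eq_0_iff half_gt_zero field_sum_of_halves less_add_same_cancel1 le_zero_eq not_le)
 qed
 have comp: "ennreal \<bar>\<mu> A $ i\<bar> \<le> ennreal M1 * emeasure \<sigma> A" if A: "A \<in> sets borel" "bounded A" for A i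
 proof -
  have "ennreal \<bar>\<mu> A $ i\<bar> \<le> ennreal (norm (\<mu> A))" by (rule ennreal_leI[OF component_le_norm_cart])
  also have "... \<le> emeasure ?P A" unfolding P by (rule norm_le_total_variation[OF vr nz A])
  finally show ?thesis using P_le_\<sigma>[OF A(1)] by (rule order_trans)
 qed
 obtain f where f: "density_field \<sigma> f (real CARD('n) * M1)" "\<mu> = density_field.fm \<sigma> f"
  using vector_radon_density[OF vr less_imp_le[OF M1] comp] by metis
 have m_le: "measure \<sigma> (ball x r) \<le> V * r ^ k" if "x \<in> ?S" "0 < r" "r < r0" for x r
 proof -
  have "0 \<le> V * r ^ k" using CA \<omega> that by (simp add: V_def)
  then show ?thesis using \<sigma>_le[OF that] by (simp add: emeasure_eq_measure_bounded)
 qed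
 have m_ge: "r ^ k \<le> CA * M1 * measure \<sigma> (ball x r)" if x: "x \<in> ?S" and r: "0 < r" "r < r0" for x r
 proof -
  have "ennreal (r ^ k / CA) \<le> ennreal M1 * ennreal (measure \<sigma> (ball x r))"
   using order_trans[OF lo[OF x r] P_le_\<sigma>[of "ball x r"]] by (simp add: emeasure_eq_measure_bounded)
  also have "... = ennreal (M1 * measure \<sigma> (ball x r))" using M1 by (simp add: ennreal_mult)
  finally have "r ^ k / CA \<le> M1 * measure \<sigma> (ball x r)" using M1 by (simp add: ennreal_le_iff)
  then show ?thesis using CA by (simp add: divide_le_eq mult_ac)
 qed
 have V: "V \<ge> 0" using CA \<omega> by (simp add: V_def)
 have "doubling_gauss_green \<sigma> f (real CARD('n) * M1) E ?S (V * 6 ^ k * (CA * M1)) (r0 / 6)"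
 proof (intro doubling_gauss_green.intro gauss_green_density.intro gauss_green_density_axioms.intro f(1) E_leb
   doubling_radon.intro borel_radon_axioms doubling_radon_axioms.intro S'(2) \<sigma>_off)
  show "is_gauss_green_measure E (density_field.fm \<sigma> f)" using \<mu> f(2) by simp
  show "0 < r0 / 6" using r0 by simp
  show "0 \<le> V * 6 ^ k * (CA * M1)" using V CA M1 by simp
  fix x r assume x: "x \<in> ?S" and r: "0 < r" "r < r0 / 6"
  have rk: "0 < r ^ k" using r by simp
  have ge: "r ^ k \<le> CA * M1 * measure \<sigma> (ball x r)" using r by (intro m_ge x) auto
  show "0 < measure \<sigma> (ball x r)"
  proof (rule ccontr)
   assume "\<not> 0 < measure \<sigma> (ball x r)"
   then have "measure \<sigma> (ball x r) = 0" using measure_nonneg[of \<sigma> "ball x r"] by linarith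
   then show False using ge rk by simp
  qed
  have "measure \<sigma> (cball x (5 * r)) \<le> measure \<sigma> (ball x (6 * r))"
   using r by (intro measure_mono_bounded) auto
  also have "... \<le> V * (6 * r) ^ k" using r by (intro m_le x) auto
  also have "... = V * 6 ^ k * r ^ k" by (simp only: power_mult_distrib mult.assoc)
  also have "... \<le> V * 6 ^ k * (CA * M1 * measure \<sigma> (ball x r))" using V by (intro mult_left_mono ge) auto
  finally show "measure \<sigma> (cball x (5 * r)) \<le> V * 6 ^ k * (CA * M1) * measure \<sigma> (ball x r)"
   by (simp only: mult.assoc)
 qed
 then show ?thesis using m_le by (rule that)
qed

text \<open>First \<theta>, then \<epsilon> in terms of \<theta>; the denominators
  \<open>A + 1\<close> and \<open>C + 1\<close> cover the value 0.\<close>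

lemma small_parameters:
 fixes A t m C e :: real
 assumes "A \<ge> 0" "t > 0" "m > 0" "C \<ge> 0" "e > 0"
 obtains \<theta> \<epsilon> where "0 < \<theta>" "\<theta> \<le> 1 / 4" "A * \<theta> < t" "\<epsilon> > 0" "C * \<epsilon> \<le> m * \<theta> ^ n / 4" "C * \<epsilon> \<le> e"
proof -
 have small: "a * (b / (a + 1)) < b" if "a \<ge> 0" "b > 0" for a b :: real
  using that by (simp add: divide_less_eq)
 define \<theta> where "\<theta> = min (1 / 4) (t / (A + 1))"
 have \<theta>: "0 < \<theta>" "\<theta> \<le> 1 / 4" "\<theta> \<le> t / (A + 1)"
  unfolding \<theta>_def using assms(1,2) min.cobounded1 min.cobounded2 by (simp_all only: min_less_iff_conj) auto
 have "A * \<theta> < t" using mult_left_mono[OF \<theta>(3) assms(1)] small[OF assms(1,2)] by linarith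
 define b where "b = min (m * \<theta> ^ n / 4) e"
 have b: "b > 0" "b \<le> m * \<theta> ^ n / 4" "b \<le> e"
  unfolding b_def using assms(3,5) \<theta>(1) min.cobounded1 min.cobounded2 by (simp_all only: min_less_iff_conj) auto
 show ?thesis
 proof (rule that[OF \<theta>(1,2) \<open>A * \<theta> < t\<close>])
  show "b / (C + 1) > 0" using b assms by simp
  show "C * (b / (C + 1)) \<le> m * \<theta> ^ n / 4" "C * (b / (C + 1)) \<le> e"
   using small[OF assms(4) b(1)] b by linarith+
 qed
qed

section \<open>Conclusion\<close>

text \<open>If the reduced boundary were null in the ball, \<open>f\<close> would vanish there
  almost everywhere by \<open>AE_outer_normal\<close>.\<close>

lemma (in doubling_gauss_green) measure_reduced_boundary_pos:
 assumes "gmass (ball x r) > 0"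
 shows "measure \<sigma> (ball x r \<inter> reduced_boundary E) > 0"
proof (rule ccontr)
 let ?B = "ball x r \<inter> reduced_boundary E"
 assume "\<not> measure \<sigma> ?B > 0"
 then have "measure \<sigma> ?B = 0" using measure_nonneg[of \<sigma> ?B] by linarith
 then have "emeasure \<sigma> ?B = 0" by (simp add: emeasure_eq_measure_bounded bounded_Int)
 then have "?B \<in> null_sets \<sigma>" using reduced_boundary_borel by (intro null_setsI) auto
 from AE_not_in[OF this] AE_outer_normal
 have "AE y in \<sigma>. indicat_real (ball x r) y *\<^sub>R norm (f y) = 0"
  by eventually_elim (auto simp: indicator_def)
 then have "gmass (ball x r) = 0"
  unfolding gmass_def set_lebesgue_integral_def by (rule integral_eq_zero_AE)
 then show False using assms by simp
qed

theorem flatness_of_oscillation: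
 fixes CA \<delta> :: real
 assumes n: "CARD('n) \<ge> 2" and CA: "CA > 0" and \<delta>: "\<delta> > 0"
 shows "\<exists>\<epsilon>>0. \<forall>(E :: (real ^ 'n) set) r0 x \<rho>. r0 > 0 \<and> E \<in> regular_perimeter_class CA r0 \<and> x \<in> frontier E \<and>
    (\<forall>r. 0 < r \<and> r < r0 \<longrightarrow> normal_oscillation E (reduced_boundary E) x r \<le> \<epsilon>) \<and> 0 < \<rho> \<and> \<rho> < r0 / 8
    \<longrightarrow> flatness (frontier E) x \<rho> \<le> \<delta>"
proof -
 define k where "k = CARD('n) - 1"
 define M where "M = real CARD('n) * (CA * 4 ^ k / unit_ball_vol (real k))"
 define V where "V = unit_ball_vol (real k) * 4 ^ k * CA * (CA * 2 ^ k)"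
 \<comment> \<open>\<open>mollify_const\<close> written out: that constant lives in a locale which
   is interpreted only after \<open>E\<close> is given, whereas \<epsilon> must be chosen
   before.\<close>
 define K where "K = ball_vol TYPE('n) * 2 ^ (CARD('n) - 1) / bump_mass TYPE('n)"
 define b where "b = 1 / CA"
 define \<eta> where "\<eta> = min (1 / 16) (\<delta> / 32)"
 have \<omega>: "unit_ball_vol (real k) > 0" by (rule unit_ball_vol_pos) simp
 have M: "M \<ge> 0" and V: "V \<ge> 0" and b: "b > 0" using CA \<omega> by (simp_all add: M_def V_def b_def)
 have K: "K \<ge> 0" unfolding K_def using bump_mass_pos[where 'n='n] by simp
 have \<eta>: "0 < \<eta>" "\<eta> \<le> 1 / 16" "32 * \<eta> \<le> \<delta>" using \<delta> by (simp_all add: \<eta>_def min_def)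
 obtain \<theta> \<epsilon> where p: "0 < \<theta>" "\<theta> \<le> 1 / 4" "8 * K * (M * V) * 2 ^ CARD('n) * \<theta> < b / 2 ^ k / 8 * \<eta> ^ CARD('n)"
  "\<epsilon> > 0" "2 * M * V * \<epsilon> \<le> bump_mass TYPE('n) * \<theta> ^ CARD('n) / 4" "2 * M * V * \<epsilon> \<le> b / 2 ^ k / 16 * (\<eta> / 2) ^ k"
  by (rule small_parameters[of "8 * K * (M * V) * 2 ^ CARD('n)" "b / 2 ^ k / 8 * \<eta> ^ CARD('n)" "bump_mass TYPE('n)" "2 * M * V"
     "b / 2 ^ k / 16 * (\<eta> / 2) ^ k" "CARD('n)"])
    (use K M V b \<eta> bump_mass_pos[where 'n='n] in simp_all)
 show ?thesis
 proof (intro exI[of _ \<epsilon>] conjI p(4) allI impI, elim conjE)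
  fix E :: "(real ^ 'n) set" and r0 x \<rho>
  assume r0: "r0 > 0" and E: "E \<in> regular_perimeter_class CA r0" and x: "x \<in> frontier E"
   and osc: "\<forall>r. 0 < r \<and> r < r0 \<longrightarrow> normal_oscillation E (reduced_boundary E) x r \<le> \<epsilon>"
   and \<rho>: "0 < \<rho>" "\<rho> < r0 / 8"
  define \<sigma> where "\<sigma> = density codim1_measure (indicator (frontier E))"
  have ne: "frontier E \<noteq> {}" using x by blast
  obtain f where f: "doubling_gauss_green \<sigma> f M E (frontier E) (V * 6 ^ k * (CA * (CA * 4 ^ k / unit_ball_vol (real k)))) (r0 / 6)"
   and up: "\<And>x r. x \<in> frontier E \<Longrightarrow> 0 < r \<Longrightarrow> r < r0 \<Longrightarrow> measure \<sigma> (ball x r) \<le> V * r ^ k"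
   using regular_perimeter_density[OF n CA r0 E ne] unfolding M_def V_def k_def \<sigma>_def by metis
  interpret doubling_gauss_green \<sigma> f M E "frontier E" "V * 6 ^ k * (CA * (CA * 4 ^ k / unit_ball_vol (real k)))" "r0 / 6"
   by (rule f)
  let ?r = "8 * \<rho>" and ?R = "reduced_boundary E"
  have r: "0 < ?r" "?r < r0" using \<rho> by auto
  have supp: "frontier E = measure_support (perimeter_measure E)" using E by (simp add: regular_perimeter_class_def)
  have RS: "?R \<subseteq> frontier E" unfolding supp reduced_boundary_def by blast
  have mass: "b * s ^ (CARD('n) - 1) \<le> gmass (ball y s)" if y: "y \<in> frontier E" and s: "0 < s" "s < r0" for y s
  proof -
   have "ennreal (s ^ (CARD('n) - 1) / CA) \<le> emeasure (perimeter_measure E) (ball y s)"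
    using E y s unfolding regular_perimeter_class_def by auto
   then have "ennreal (s ^ (CARD('n) - 1) / CA) \<le> ennreal (gmass (ball y s))"
    by (simp add: measure_perimeter_bounded gmass_def)
   then show ?thesis using gmass_nonneg by (simp add: b_def)
  qed
  have "0 < b * ?r ^ (CARD('n) - 1)" using b r by simp
  then have "gmass (ball x ?r) > 0" using mass[OF x r] by linarith
  then have pos: "measure \<sigma> (ball x ?r \<inter> ?R) > 0" by (rule measure_reduced_boundary_pos)
  have V1: "measure \<sigma> (ball x ?r) \<le> V * ?r ^ (CARD('n) - 1)" using up[OF x r] by (simp add: k_def)
  have "(LINT y:ball x ?r \<inter> ?R|\<sigma>. (norm (outer_normal E y - normal_average E x ?r))\<^sup>2) \<le> \<epsilon>\<^sup>2 * measure \<sigma> (ball x ?r \<inter> ?R)"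
   by (rule oscillation_integral_le[OF \<sigma>_def S_borel reduced_boundary_borel RS pos _ p(4)]) (use osc r in blast)
  also have "... \<le> \<epsilon>\<^sup>2 * (V * ?r ^ (CARD('n) - 1))"
  proof (rule mult_left_mono)
   have "measure \<sigma> (ball x ?r \<inter> ?R) \<le> measure \<sigma> (ball x ?r)"
    using reduced_boundary_borel by (intro measure_mono_bounded) auto
   then show "measure \<sigma> (ball x ?r \<inter> ?R) \<le> V * ?r ^ (CARD('n) - 1)" using V1 by linarith
  qed simp
  finally have osc': "(LINT y:ball x ?r \<inter> ?R|\<sigma>. (norm (outer_normal E y - normal_average E x ?r))\<^sup>2) \<le> \<epsilon>\<^sup>2 * (V * ?r ^ (CARD('n) - 1))" .
  have "flatness (frontier E) x \<rho> \<le> 32 * \<eta>"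
  proof (rule flat_of_mass[OF x \<rho>(1) p(4) V1 osc' b _ \<eta>(1,2) p(1,2)])
   show "b * s ^ (CARD('n) - 1) \<le> gmass (ball y s)" if "y \<in> frontier E" "0 < s" "s < \<rho>" for y s
    using that \<rho> by (intro mass) auto
   show "2 * M * \<epsilon> * V \<le> bump_mass TYPE('n) * \<theta> ^ CARD('n) / 4" using p(5) by (simp only: mult_ac)
   show "2 * M * \<epsilon> * V \<le> b / 2 ^ (CARD('n) - 1) / 16 * (\<eta> / 2) ^ (CARD('n) - 1)"
    using p(6) unfolding k_def by (simp only: mult_ac)
   show "8 * mollify_const * (M * V) * \<theta> * 2 ^ CARD('n) < b / 2 ^ (CARD('n) - 1) / 8 * \<eta> ^ CARD('n)"
    using p(3) unfolding k_def K_def mollify_const_def by (simp only: mult_ac)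
  qed
  then show "flatness (frontier E) x \<rho> \<le> \<delta>" using \<eta>(3) by linarith
 qed
qed

text \<open>If the set had measure 0 in one ball, the density quotient would be 0 at all smaller
  radii.\<close>

lemma upper_density_pos:
 assumes E: "E \<in> sets lebesgue" and d: "upper_density E x > 0" and e: "e > 0"
 shows "measure lebesgue (ball x e \<inter> E) > 0"
proof (rule ccontr)
 assume "\<not> ?thesis"
 then have "measure lebesgue (ball x e \<inter> E) = 0" using measure_nonneg[of lebesgue "ball x e \<inter> E"] by linarith
 moreover have lm: "ball x e \<inter> E \<in> lmeasurable" using lmeasurable_bounded_subset[OF E, of "ball x e"] by simp
 ultimately have 0: "emeasure lebesgue (ball x e \<inter> E) = 0" using emeasure_eq_measure2 by fastforce
 have "\<forall>\<^sub>F r in at_right 0. emeasure lebesgue (E \<inter> ball x r) / emeasure lebesgue (ball x r) \<le> 0"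
  unfolding eventually_at_right_field
 proof (intro exI[of _ e] conjI e allI impI)
  fix r assume r: "0 < r" "r < e"
  have "emeasure lebesgue (E \<inter> ball x r) \<le> emeasure lebesgue (ball x e \<inter> E)"
   using r lm by (intro emeasure_mono fmeasurableD) auto
  then show "emeasure lebesgue (E \<inter> ball x r) / emeasure lebesgue (ball x r) \<le> 0" using 0 by simp
 qed
 then have "upper_density E x \<le> 0" unfolding upper_density_def by (rule Limsup_bounded)
 then show False using d by simp
qed

lemma measure_theoretic_boundary_both:
 assumes E: "E \<in> sets lebesgue" and x: "x \<in> measure_theoretic_boundary E" and e: "e > 0"
 shows "measure lebesgue (ball x e \<inter> E) > 0 \<and> measure lebesgue (ball x e - E) > 0"
proof
 have d: "upper_density E x > 0" "upper_density (- E) x > 0" using x by (auto simp: measure_theoretic_boundary_def)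
 show "measure lebesgue (ball x e \<inter> E) > 0" by (rule upper_density_pos[OF E d(1) e])
 have "- E \<in> sets lebesgue" using E by (simp add: Compl_in_sets_lebesgue)
 from upper_density_pos[OF this d(2) e] show "measure lebesgue (ball x e - E) > 0" by (simp add: Diff_eq)
qed

text \<open>For bounded sets Ahlfors regularity speaks of radii below the diameter, which must
  therefore be positive. If the boundary were one point \<open>p\<close>, its complement, connected
  in dimension at least 2, would lie in one phase, leaving measure 0 for the other.\<close>

lemma diameter_frontier_pos:
 fixes \<Omega> :: "(real ^ 'n) set"
 assumes n: "CARD('n) \<ge> 2" and \<Omega>: "\<Omega> \<in> sets lebesgue" and mtb: "measure_theoretic_boundary \<Omega> = frontier \<Omega>"
  and ne: "frontier \<Omega> \<noteq> {}" and b: "bounded (frontier \<Omega>)"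
 shows "diameter (frontier \<Omega>) > 0"
proof (rule ccontr)
 assume "\<not> ?thesis"
 then have d: "diameter (frontier \<Omega>) \<le> 0" by simp
 obtain p where p: "p \<in> frontier \<Omega>" using ne by blast
 have single: "y = p" if "y \<in> frontier \<Omega>" for y
  using order_trans[OF diameter_bounded_bound[OF b that p] d] by simp
 have both: "measure lebesgue (ball p 1 \<inter> \<Omega>) > 0" "measure lebesgue (ball p 1 - \<Omega>) > 0"
  using measure_theoretic_boundary_both[OF \<Omega>, of p 1] p mtb by auto
 have "\<not> ball p 1 \<inter> \<Omega> \<subseteq> {p}" "\<not> ball p 1 - \<Omega> \<subseteq> {p}"
  using both negligible_imp_measure0[OF negligible_subset[OF negligible_sing[of p]]] by force+
 then have "(- {p}) \<inter> \<Omega> \<noteq> {}" "- {p} - \<Omega> \<noteq> {}" by auto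
 moreover have "connected (- {p})"
  using n connected_punctured_universe[of p] by simp
 ultimately have "- {p} \<inter> frontier \<Omega> \<noteq> {}" by (intro connected_Int_frontier)
 then show False using single by blast
qed

text \<open>Ahlfors regularity bounds \<sigma> from below, but a priori \<open>f\<close> may vanish
  on part of the boundary, so it yields no lower perimeter bound. The volume of both phases
  therefore comes from \<open>flat_of_half_spaces\<close>.\<close>

theorem separation_of_oscillation:
 fixes CA \<eta> :: real
 assumes n: "CARD('n) \<ge> 2" and CA: "CA > 0" and \<eta>: "0 < \<eta>" "\<eta> \<le> 1 / 16"
 shows "\<exists>\<epsilon>>0. \<forall>(\<Omega> :: (real ^ 'n) set) r0. r0 > 0 \<and> open \<Omega> \<and> measure_theoretic_boundary \<Omega> = frontier \<Omega> \<and>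
    ahlfors_regular CA (frontier \<Omega>) \<and>
    (\<forall>r x. 0 < r \<and> r < r0 \<and> x \<in> frontier \<Omega> \<longrightarrow> normal_oscillation \<Omega> (frontier \<Omega>) x r \<le> \<epsilon>)
    \<longrightarrow> (\<exists>R>0. \<forall>x\<in>frontier \<Omega>. \<forall>\<rho>. 0 < \<rho> \<longrightarrow> \<rho> < R \<longrightarrow> flatness (frontier \<Omega>) x (\<rho> / 4) \<le> 32 * \<eta> \<and>
  (\<exists>c. norm c = 1 \<and> (\<forall>z \<in> ball x (\<rho> / 2).
    ((z - x) \<bullet> c > 2 * \<eta> * \<rho> \<longrightarrow> z \<notin> \<Omega>) \<and> ((z - x) \<bullet> c < - 2 * \<eta> * \<rho> \<longrightarrow> z \<in> \<Omega>))))"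
proof -
 let ?n = "CARD('n)" and ?m = "bump_mass TYPE('n)" and ?\<omega> = "ball_vol TYPE('n)"
 \<comment> \<open>\<open>M\<close> and \<open>K\<close> are
   \<open>real CARD('n) * trace_const\<close> for \<open>b = 1 / CA\<close> and
   \<open>mollify_const\<close>, written out before a domain is given.\<close>
 define M where "M = real ?n * (8 * ?\<omega> * 2 ^ ?n * 4 ^ (?n - 1) / (1 / CA))"
 define K where "K = ?\<omega> * 2 ^ (?n - 1) / ?m"
 \<comment> \<open>Collects the three bounds on the half-space defect in
   \<open>flat_of_half_spaces\<close>, the first two divided by \<open>16 ^ ?n\<close>.\<close>
 define t where "t = min (min (?m / 2 / 2 ^ ?n / 16 ^ ?n) (?\<omega> / 4 ^ ?n / 2 / 16 ^ ?n)) (?\<omega> / 4 ^ ?n / 2 / 2 ^ ?n * \<eta> ^ ?n)"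
 have m: "?m > 0" by (rule bump_mass_pos)
 have M: "M \<ge> 0" using CA by (simp add: M_def)
 have K: "K \<ge> 0" unfolding K_def using m by simp
 have t: "t > 0" unfolding t_def using m \<eta> by simp
 obtain \<theta> \<epsilon> where p: "0 < \<theta>" "\<theta> \<le> 1 / 4" "8 * K * (M * CA) * 2 ^ ?n * \<theta> < t"
  "\<epsilon> > 0" "2 * M * CA * \<epsilon> \<le> ?m * \<theta> ^ ?n / 4" "2 * M * CA * \<epsilon> \<le> 1"
  by (rule small_parameters[of "8 * K * (M * CA) * 2 ^ ?n" t ?m "2 * M * CA" 1 ?n])
    (use K M CA m t in simp_all)
 show ?thesis
 proof (rule exI[of _ \<epsilon>], intro conjI p(4) allI impI, elim conjE)
  fix \<Omega> :: "(real ^ 'n) set" and r0 :: real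
  assume r0: "r0 > 0" and op: "open \<Omega>" and mtb: "measure_theoretic_boundary \<Omega> = frontier \<Omega>"
   and reg: "ahlfors_regular CA (frontier \<Omega>)"
   and osc: "\<forall>r x. 0 < r \<and> r < r0 \<and> x \<in> frontier \<Omega> \<longrightarrow> normal_oscillation \<Omega> (frontier \<Omega>) x r \<le> \<epsilon>"
  let ?S = "frontier \<Omega>"
  let ?concl = "\<lambda>x \<rho>. flatness ?S x (\<rho> / 4) \<le> 32 * \<eta> \<and> (\<exists>c. norm c = 1 \<and> (\<forall>z \<in> ball x (\<rho> / 2).
    ((z - x) \<bullet> c > 2 * \<eta> * \<rho> \<longrightarrow> z \<notin> \<Omega>) \<and> ((z - x) \<bullet> c < - 2 * \<eta> * \<rho> \<longrightarrow> z \<in> \<Omega>)))"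
  show "\<exists>R>0. \<forall>x\<in>?S. \<forall>\<rho>. 0 < \<rho> \<longrightarrow> \<rho> < R \<longrightarrow> ?concl x \<rho>"
  proof (cases "?S = {}")
   case True
   then show ?thesis by (intro exI[of _ 1]) simp
  next
   case False
   have \<Omega>: "\<Omega> \<in> sets lebesgue" using op by (simp add: borel_open)
   have S: "closed ?S" "?S \<in> sets borel" by (rule frontier_closed, rule borel_closed, rule frontier_closed)
   \<comment> \<open>Below this radius both the oscillation bound and the regularity bounds
     apply.\<close>
   define r1 where "r1 = (if bounded ?S then min r0 (diameter ?S) else r0)"
   have r1: "r1 > 0" "r1 \<le> r0" "bounded ?S \<longrightarrow> r1 \<le> diameter ?S"
    using r0 diameter_frontier_pos[OF n \<Omega> mtb False] by (auto simp: r1_def)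
   define \<sigma> where "\<sigma> = density codim1_measure (indicator ?S)"
   have \<sigma>_eq: "emeasure \<sigma> A = emeasure codim1_measure (?S \<inter> A)" if "A \<in> sets borel" for A
    unfolding \<sigma>_def using S(2) that by (simp add: emeasure_restricted)
   have \<sigma>_ball: "ennreal (r ^ (?n - 1) / CA) \<le> emeasure \<sigma> (ball x r)" "emeasure \<sigma> (ball x r) \<le> ennreal (CA * r ^ (?n - 1))"
    if x: "x \<in> ?S" and r: "0 < r" "r < r1" for x r
   proof -
    have "bounded ?S \<longrightarrow> r < diameter ?S" using r r1(3) by auto
    then show "ennreal (r ^ (?n - 1) / CA) \<le> emeasure \<sigma> (ball x r)" "emeasure \<sigma> (ball x r) \<le> ennreal (CA * r ^ (?n - 1))"
     using reg x r(1) unfolding ahlfors_regular_def \<sigma>_eq[OF borel_open[OF open_ball]] by auto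
   qed
   have \<sigma>_sets: "sets \<sigma> = sets borel" by (simp add: \<sigma>_def)
   have \<sigma>_off: "emeasure \<sigma> (- ?S) = 0" using S(2) \<sigma>_eq[of "- ?S"] by simp
   interpret borel_radon \<sigma>
   proof
    show "emeasure \<sigma> (cball 0 R) < \<infinity>" for R
    proof (rule emeasure_cball_finite[OF \<sigma>_sets S(1) \<sigma>_off, of "r1 / 2"])
     show "emeasure \<sigma> (ball x (r1 / 2)) < \<infinity>" if "x \<in> ?S" for x
      using \<sigma>_ball(2)[OF that, of "r1 / 2"] r1(1) by (simp add: le_less_trans[OF _ ennreal_less_top])
    qed (use r1 in simp)
   qed (rule \<sigma>_sets)
   have lo: "1 / CA * r ^ (?n - 1) \<le> measure \<sigma> (ball x r)" and up: "measure \<sigma> (ball x r) \<le> CA * r ^ (?n - 1)"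
    if "x \<in> ?S" "0 < r" "r < r1" for x r
    using \<sigma>_ball[OF that] CA that by (simp_all add: emeasure_eq_measure_bounded)
   interpret open_ahlfors \<sigma> \<Omega> "1 / CA" r1
    by unfold_locales (use op CA r1 lo in auto)
   obtain f where f: "gauss_green_density \<sigma> f (real ?n * trace_const) \<Omega>" by (rule gauss_green_exists)
   have "real ?n * trace_const = M" by (simp add: M_def trace_const_def)
   with f have f: "gauss_green_density \<sigma> f M \<Omega>" by simp
   interpret gauss_green_density \<sigma> f M \<Omega> by (rule f)
   interpret doubling_gauss_green \<sigma> f M \<Omega> ?S "CA * 6 ^ (?n - 1) * CA" "r1 / 6"
   proof
    show "0 < r1 / 6" "0 \<le> CA * 6 ^ (?n - 1) * CA" using r1(1) CA by auto
    fix x r assume x: "x \<in> ?S" and r: "0 < r" "r < r1 / 6"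
    have ge: "1 / CA * r ^ (?n - 1) \<le> measure \<sigma> (ball x r)" using r by (intro lo x) auto
    moreover have "0 < 1 / CA * r ^ (?n - 1)" using CA r by simp
    ultimately show "0 < measure \<sigma> (ball x r)" by linarith
    have "measure \<sigma> (cball x (5 * r)) \<le> measure \<sigma> (ball x (6 * r))"
     using r by (intro measure_mono_bounded) auto
    also have "... \<le> CA * (6 * r) ^ (?n - 1)" using r by (intro up x) auto
    also have "... = CA * 6 ^ (?n - 1) * CA * (1 / CA * r ^ (?n - 1))" using CA by (simp add: power_mult_distrib)
    also have "... \<le> CA * 6 ^ (?n - 1) * CA * measure \<sigma> (ball x r)" using CA by (intro mult_left_mono ge) auto
    finally show "measure \<sigma> (cball x (5 * r)) \<le> CA * 6 ^ (?n - 1) * CA * measure \<sigma> (ball x r)" .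
   qed (rule S(2), rule \<sigma>_off)
   let ?R = "reduced_boundary \<Omega>"
   \<comment> \<open>Off the boundary \<sigma> vanishes, hence so does the perimeter, whose support
     contains the reduced boundary.\<close>
   have RS: "?R \<subseteq> ?S"
   proof
    fix x assume x: "x \<in> ?R"
    show "x \<in> ?S"
    proof (rule ccontr)
     assume "x \<notin> ?S"
     then obtain e where e: "e > 0" "ball x e \<subseteq> - ?S" using S(1) open_contains_ball[of "- ?S"] by (auto simp: open_Compl)
     have "gmass (ball x e) \<le> M * measure \<sigma> (ball x e)" by (rule gmass_le)
     moreover have "emeasure \<sigma> (ball x e) \<le> emeasure \<sigma> (- ?S)" using e(2) S(2) by (intro emeasure_mono) auto
     then have "measure \<sigma> (ball x e) = 0" unfolding \<sigma>_off measure_def by simp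
     moreover have "gmass (ball x e) > 0" using x e(1) support_iff by (auto simp: reduced_boundary_def gmass_def)
     ultimately show False by simp
    qed
   qed
   let ?\<tau> = "8 * mollify_const * (M * CA) * \<theta> * 2 ^ ?n"
   have hs: "\<exists>c t. norm c = 1 \<and> half_space_close \<Omega> x c t \<rho> ?\<tau>" if x: "x \<in> ?S" and \<rho>: "0 < \<rho>" "\<rho> < r1 / 2" for x \<rho>
   proof -
    let ?r = "2 * \<rho>" and ?a = "normal_average \<Omega> x (2 * \<rho>)"
    let ?h = "\<lambda>y. (norm (outer_normal \<Omega> y - ?a))\<^sup>2"
    have r: "0 < ?r" "?r < r1" "?r < r0" using \<rho> r1(2) by auto
    have BS: "measure \<sigma> (ball x ?r \<inter> ?S) = measure \<sigma> (ball x ?r)"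
    proof -
     have "emeasure \<sigma> (ball x ?r \<inter> ?S) = emeasure \<sigma> (ball x ?r)"
      using S(2) by (simp add: \<sigma>_eq Int_ac)
     then show ?thesis by (simp add: measure_def)
    qed
    have "0 < 1 / CA * ?r ^ (?n - 1)" using CA r by simp
    then have pos: "measure \<sigma> (ball x ?r \<inter> ?S) > 0" unfolding BS using lo[OF x r(1,2)] by linarith
    have hm: "?h \<in> borel_measurable borel" using outer_normal_borel by measurable
    have hb: "norm (?h y) \<le> (1 + norm ?a)\<^sup>2" for y
    proof -
     have "norm (outer_normal \<Omega> y) \<le> 1" using norm_outer_normal[of y] by simp
     then have "norm (outer_normal \<Omega> y - ?a) \<le> 1 + norm ?a"
      using norm_triangle_ineq4[of "outer_normal \<Omega> y" ?a] by linarith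
     then have "(norm (outer_normal \<Omega> y - ?a))\<^sup>2 \<le> (1 + norm ?a)\<^sup>2" by (rule power_mono) simp
     then show ?thesis by simp
    qed
    \<comment> \<open>The hypothesis integrates over the whole boundary, the excess estimate over
      the reduced boundary; the integrand is nonnegative.\<close>
    have "(LINT y:ball x ?r \<inter> ?R|\<sigma>. ?h y) \<le> (LINT y:ball x ?r \<inter> ?S|\<sigma>. ?h y)"
     unfolding set_lebesgue_integral_def
    proof (rule integral_mono)
     have "set_integrable \<sigma> (ball x ?r \<inter> A) ?h" if "A \<in> sets borel" for A
      by (rule set_integrable_bdd[OF hm _ _ hb]) (use that in \<open>auto simp: bounded_Int\<close>)
     then show "integrable \<sigma> (\<lambda>y. indicator (ball x ?r \<inter> ?R) y *\<^sub>R ?h y)"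
      "integrable \<sigma> (\<lambda>y. indicator (ball x ?r \<inter> ?S) y *\<^sub>R ?h y)"
      using S(2) reduced_boundary_borel unfolding set_integrable_def by blast+
     show "indicator (ball x ?r \<inter> ?R) y *\<^sub>R ?h y \<le> indicator (ball x ?r \<inter> ?S) y *\<^sub>R ?h y" for y
      using RS by (auto simp: indicator_def)
    qed
    also have "... \<le> \<epsilon>\<^sup>2 * measure \<sigma> (ball x ?r \<inter> ?S)"
     by (rule oscillation_integral_le[OF \<sigma>_def S(2) S(2) subset_refl pos _ p(4)]) (use osc r(1,3) x in blast)
    also have "... \<le> \<epsilon>\<^sup>2 * (CA * ?r ^ (?n - 1))"
     unfolding BS by (intro mult_left_mono up[OF x r(1,2)]) simp
    finally have osc': "(LINT y:ball x ?r \<inter> ?R|\<sigma>. ?h y) \<le> \<epsilon>\<^sup>2 * (CA * ?r ^ (?n - 1))" .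
    have small: "2 * M * \<epsilon> * CA \<le> ?m * \<theta> ^ ?n / 4" using p(5) by (simp only: mult_ac)
    obtain c t where "norm c = 1" "half_space_close \<Omega> x c t (?r / 2) ?\<tau>"
     using half_space_of_oscillation[OF r(1) p(4) up[OF x r(1,2)] osc' p(1,2) small] by blast
    then show ?thesis by auto
   qed
   have both: "measure lebesgue (ball x e \<inter> \<Omega>) > 0 \<and> measure lebesgue (ball x e - \<Omega>) > 0"
    if "x \<in> ?S" "e > 0" for x e
    using measure_theoretic_boundary_both[OF \<Omega>] that mtb by blast
   have "?\<tau> = 8 * K * (M * CA) * 2 ^ ?n * \<theta>" unfolding K_def mollify_const_def by (simp only: mult_ac)
   then have \<tau>t: "?\<tau> < t" using p(3) by (rule ssubst)
   have \<tau>: "0 \<le> ?\<tau>" using mollify_const_pos M CA p(1) by simp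
   have t_le: "t \<le> ?m / 2 / 2 ^ ?n / 16 ^ ?n" "t \<le> ?\<omega> / 4 ^ ?n / 2 / 16 ^ ?n" "t \<le> ?\<omega> / 4 ^ ?n / 2 / 2 ^ ?n * \<eta> ^ ?n"
    unfolding t_def by (rule min.coboundedI1 min.coboundedI2, simp)+
   have \<tau>': "?\<tau> * 16 ^ ?n < ?m / 2 / 2 ^ ?n" "?\<tau> * 16 ^ ?n < ?\<omega> / 4 ^ ?n / 2" "?\<tau> < ?\<omega> / 4 ^ ?n / 2 / 2 ^ ?n * \<eta> ^ ?n"
    using less_le_trans[OF \<tau>t t_le(1)] less_le_trans[OF \<tau>t t_le(2)] less_le_trans[OF \<tau>t t_le(3)]
    by (simp_all only: pos_less_divide_eq zero_less_power zero_less_numeral)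
   have "?concl x \<rho>" if "x \<in> ?S" "0 < \<rho>" "\<rho> < r1 / 2" for x \<rho>
    by (rule flat_of_half_spaces[OF hs both \<eta> \<tau> \<tau>' that])
   then show ?thesis using r1(1) by (intro exI[of _ "r1 / 2"]) auto
  qed
 qed
qed

theorem corollary3p10:
  fixes CA \<delta>n :: real
  assumes "CARD('n::finite) \<ge> 2" and "CA \<ge> 1" and "\<delta>n > 0"
  shows "\<exists>\<epsilon>2>0. \<exists>C2>0.
    (\<forall>(E :: (real ^ 'n) set) r0 x.
       r0 > 0 \<and> E \<in> regular_perimeter_class CA r0 \<and> x \<in> frontier E \<and>
       (SUP r\<in>{0<..<r0}. ereal (normal_oscillation E (reduced_boundary E) x r)) \<le> ereal \<epsilon>2 \<longrightarrow>
       (SUP \<rho>\<in>{0<..<r0 / 8}. ereal (flatness (frontier E) x \<rho>))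
         \<le> ereal (C2 * \<epsilon>2 powr (1 / (real CARD('n) - 1)))) \<and>
    (\<forall>(\<Omega> :: (real ^ 'n) set) r0.
       r0 > 0 \<and> is_domain \<Omega> \<and> measure_theoretic_boundary \<Omega> = frontier \<Omega> \<and>
       ahlfors_regular CA (frontier \<Omega>) \<and>
       (SUP r\<in>{0<..<r0}. SUP x\<in>frontier \<Omega>. ereal (normal_oscillation \<Omega> (frontier \<Omega>) x r))
         \<le> ereal \<epsilon>2 \<longrightarrow>
       (let \<delta> = C2 * \<epsilon>2 powr (1 / (real CARD('n) - 1)) in
          0 < \<delta> \<and> \<delta> < \<delta>n \<and> reifenberg_flat \<delta> (frontier \<Omega>) \<and> separation_property \<delta> \<Omega> \<and>
          (two_components_if_unbounded \<Omega> \<longrightarrow> reifenberg_flat_domain \<delta>n \<delta> \<Omega>)))"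
proof -
 define \<delta> where "\<delta> = \<delta>n / 2"
 \<comment> \<open>Half of what flatness \<delta> would allow:
   \<open>32 * \<eta> \<le> \<delta> / 2\<close> leaves the strict inequality required by
   \<open>reifenberg_flat\<close>, and the slab bound \<open>4 * \<eta>\<close> is at most
   \<delta>.\<close>
 define \<eta> where "\<eta> = min (1 / 16) (\<delta> / 64)"
 have \<delta>: "0 < \<delta>" "\<delta> < \<delta>n" using assms(3) by (auto simp: \<delta>_def)
 have \<eta>: "0 < \<eta>" "\<eta> \<le> 1 / 16" "\<eta> \<le> \<delta> / 64" using \<delta>(1) by (simp_all add: \<eta>_def min_def)
 have CA: "CA > 0" using assms(2) by simp
 obtain \<epsilon>a where a: "\<epsilon>a > 0"
  "\<And>(E :: (real ^ 'n) set) r0 x \<rho>. r0 > 0 \<and> E \<in> regular_perimeter_class CA r0 \<and> x \<in> frontier E \<and>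
    (\<forall>r. 0 < r \<and> r < r0 \<longrightarrow> normal_oscillation E (reduced_boundary E) x r \<le> \<epsilon>a) \<and> 0 < \<rho> \<and> \<rho> < r0 / 8
    \<Longrightarrow> flatness (frontier E) x \<rho> \<le> \<delta>"
  using flatness_of_oscillation[OF assms(1) CA \<delta>(1)] by blast
 let ?concl = "\<lambda>(\<Omega> :: (real ^ 'n) set) x \<rho>. flatness (frontier \<Omega>) x (\<rho> / 4) \<le> 32 * \<eta> \<and>
  (\<exists>c. norm c = 1 \<and> (\<forall>z \<in> ball x (\<rho> / 2).
    ((z - x) \<bullet> c > 2 * \<eta> * \<rho> \<longrightarrow> z \<notin> \<Omega>) \<and> ((z - x) \<bullet> c < - 2 * \<eta> * \<rho> \<longrightarrow> z \<in> \<Omega>)))"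
 obtain \<epsilon>b where b: "\<epsilon>b > 0"
  "\<And>(\<Omega> :: (real ^ 'n) set) r0. r0 > 0 \<and> open \<Omega> \<and> measure_theoretic_boundary \<Omega> = frontier \<Omega> \<and>
    ahlfors_regular CA (frontier \<Omega>) \<and>
    (\<forall>r x. 0 < r \<and> r < r0 \<and> x \<in> frontier \<Omega> \<longrightarrow> normal_oscillation \<Omega> (frontier \<Omega>) x r \<le> \<epsilon>b)
    \<Longrightarrow> \<exists>R>0. \<forall>x\<in>frontier \<Omega>. \<forall>\<rho>. 0 < \<rho> \<longrightarrow> \<rho> < R \<longrightarrow> ?concl \<Omega> x \<rho>"
  using separation_of_oscillation[OF assms(1) CA \<eta>(1,2)] by blast
 define \<epsilon> where "\<epsilon> = min \<epsilon>a \<epsilon>b"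
 have \<epsilon>: "0 < \<epsilon>" "\<epsilon> \<le> \<epsilon>a" "\<epsilon> \<le> \<epsilon>b" using a(1) b(1) by (auto simp: \<epsilon>_def)
 define p where "p = \<epsilon> powr (1 / (real CARD('n) - 1))"
 have p: "p > 0" using \<epsilon>(1) by (simp add: p_def)
 have \<delta>_eq: "\<delta> / p * p = \<delta>" using p by simp
 have part1: "(SUP \<rho>\<in>{0<..<r0 / 8}. ereal (flatness (frontier E) x \<rho>)) \<le> ereal \<delta>"
  if r0: "r0 > 0" and E: "E \<in> regular_perimeter_class CA r0" "x \<in> frontier E"
   and osc: "(SUP r\<in>{0<..<r0}. ereal (normal_oscillation E (reduced_boundary E) x r)) \<le> ereal \<epsilon>"
  for E :: "(real ^ 'n) set" and r0 x
 proof (rule SUP_least)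
  fix \<rho> assume \<rho>: "\<rho> \<in> {0<..<r0 / 8}"
  have "normal_oscillation E (reduced_boundary E) x r \<le> \<epsilon>a" if "0 < r" "r < r0" for r
  proof -
   have "ereal (normal_oscillation E (reduced_boundary E) x r) \<le> ereal \<epsilon>"
    using SUP_le_iff[THEN iffD1, OF osc] that by simp
   then show ?thesis using \<epsilon>(2) by simp
  qed
  then have "flatness (frontier E) x \<rho> \<le> \<delta>" using r0 E \<rho> by (intro a(2)[of r0 E x]) auto
  then show "ereal (flatness (frontier E) x \<rho>) \<le> ereal \<delta>" by simp
 qed
 have part2: "reifenberg_flat \<delta> (frontier \<Omega>) \<and> separation_property \<delta> \<Omega>"
  if r0: "r0 > 0" and dom: "is_domain \<Omega>" and mtb: "measure_theoretic_boundary \<Omega> = frontier \<Omega>"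
   and reg: "ahlfors_regular CA (frontier \<Omega>)"
   and osc: "(SUP r\<in>{0<..<r0}. SUP x\<in>frontier \<Omega>. ereal (normal_oscillation \<Omega> (frontier \<Omega>) x r)) \<le> ereal \<epsilon>"
  for \<Omega> :: "(real ^ 'n) set" and r0
 proof -
  have "normal_oscillation \<Omega> (frontier \<Omega>) x r \<le> \<epsilon>b" if "0 < r" "r < r0" "x \<in> frontier \<Omega>" for r x
  proof -
   have "(SUP x\<in>frontier \<Omega>. ereal (normal_oscillation \<Omega> (frontier \<Omega>) x r)) \<le> ereal \<epsilon>"
    using SUP_le_iff[THEN iffD1, OF osc] that by simp
   from SUP_le_iff[THEN iffD1, OF this] have "ereal (normal_oscillation \<Omega> (frontier \<Omega>) x r) \<le> ereal \<epsilon>"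
    using that(3) by blast
   then show ?thesis using \<epsilon>(3) by simp
  qed
  then obtain R where R: "R > 0" "\<And>x \<rho>. x \<in> frontier \<Omega> \<Longrightarrow> 0 < \<rho> \<Longrightarrow> \<rho> < R \<Longrightarrow> ?concl \<Omega> x \<rho>"
   using b(2)[of r0 \<Omega>] r0 mtb reg dom unfolding is_domain_def by blast
  \<comment> \<open>Flatness at radius \<open>r\<close> is the result for \<rho> = 4 r, and
    \<open>r \<le> R / 8\<close> keeps 4 r below \<open>R\<close>.\<close>
  have "(SUP r\<in>{0<..R / 8}. SUP x\<in>K \<inter> frontier \<Omega>. ereal (flatness (frontier \<Omega>) x r)) < ereal \<delta>" for K
  proof -
   have "(SUP r\<in>{0<..R / 8}. SUP x\<in>K \<inter> frontier \<Omega>. ereal (flatness (frontier \<Omega>) x r)) \<le> ereal (32 * \<eta>)"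
   proof (intro SUP_least)
    fix r x assume "r \<in> {0<..R / 8}" "x \<in> K \<inter> frontier \<Omega>"
    then show "ereal (flatness (frontier \<Omega>) x r) \<le> ereal (32 * \<eta>)" using R(2)[of x "4 * r"] R(1) by simp
   qed
   also have "... < ereal \<delta>" using \<eta> by simp
   finally show ?thesis .
  qed
  then have "reifenberg_flat \<delta> (frontier \<Omega>)"
   unfolding reifenberg_flat_def using R(1) by (metis zero_less_divide_iff zero_less_numeral)
  moreover have "separation_property \<delta> \<Omega>"
   unfolding separation_property_def
  proof (intro allI impI exI[of _ "R / 2"] conjI ballI)
   show "0 < R / 2" using R(1) by simp
   fix K y r assume y: "y \<in> frontier \<Omega> \<inter> K" and r: "0 < r \<and> r < R / 2"
   \<comment> \<open>With \<rho> = 2 r the ball of radius \<rho>/2 is the ball of radius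
     \<open>r\<close> in the separation property.\<close>
   have "?concl \<Omega> y (2 * r)" using y r by (intro R(2)) auto
   then obtain c where c: "norm c = 1"
    "\<And>z. z \<in> ball y r \<Longrightarrow> (z - y) \<bullet> c > 4 * \<eta> * r \<Longrightarrow> z \<notin> \<Omega>"
    "\<And>z. z \<in> ball y r \<Longrightarrow> (z - y) \<bullet> c < - 4 * \<eta> * r \<Longrightarrow> z \<in> \<Omega>" by auto
   have le: "4 * \<eta> * r \<le> \<delta> * r" using \<eta> r by (intro mult_right_mono) auto
   show "\<exists>v. norm v = 1 \<and> (\<forall>x\<in>ball y r. (\<delta> * r < (x - y) \<bullet> v \<longrightarrow> x \<in> - \<Omega>) \<and> ((x - y) \<bullet> v < - \<delta> * r \<longrightarrow> x \<in> \<Omega>))"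
   proof (intro exI[of _ c] conjI c(1) ballI impI)
    fix z assume z: "z \<in> ball y r"
    show "z \<in> - \<Omega>" if "\<delta> * r < (z - y) \<bullet> c" using c(2)[OF z] that le by simp
    show "z \<in> \<Omega>" if "(z - y) \<bullet> c < - \<delta> * r" using c(3)[OF z] that le by simp
   qed
  qed
  ultimately show ?thesis by blast
 qed
 show ?thesis
 proof (rule exI[of _ \<epsilon>], rule conjI[OF \<epsilon>(1)], rule exI[of _ "\<delta> / p"], intro conjI allI impI)
  show "0 < \<delta> / p" using \<delta> p by simp
 next
  fix E :: "(real ^ 'n) set" and r0 x
  assume "r0 > 0 \<and> E \<in> regular_perimeter_class CA r0 \<and> x \<in> frontier E \<and>
    (SUP r\<in>{0<..<r0}. ereal (normal_oscillation E (reduced_boundary E) x r)) \<le> ereal \<epsilon>"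
  then show "(SUP \<rho>\<in>{0<..<r0 / 8}. ereal (flatness (frontier E) x \<rho>))
     \<le> ereal (\<delta> / p * \<epsilon> powr (1 / (real CARD('n) - 1)))"
   unfolding p_def[symmetric] \<delta>_eq by (elim conjE) (rule part1)
 next
  fix \<Omega> :: "(real ^ 'n) set" and r0
  assume *: "r0 > 0 \<and> is_domain \<Omega> \<and> measure_theoretic_boundary \<Omega> = frontier \<Omega> \<and>
    ahlfors_regular CA (frontier \<Omega>) \<and>
    (SUP r\<in>{0<..<r0}. SUP x\<in>frontier \<Omega>. ereal (normal_oscillation \<Omega> (frontier \<Omega>) x r))
     \<le> ereal \<epsilon>"
  then have "reifenberg_flat \<delta> (frontier \<Omega>) \<and> separation_property \<delta> \<Omega>"
   by (elim conjE) (rule part2)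
  then show "let \<delta> = \<delta> / p * \<epsilon> powr (1 / (real CARD('n) - 1)) in
     0 < \<delta> \<and> \<delta> < \<delta>n \<and> reifenberg_flat \<delta> (frontier \<Omega>) \<and> separation_property \<delta> \<Omega> \<and>
     (two_components_if_unbounded \<Omega> \<longrightarrow> reifenberg_flat_domain \<delta>n \<delta> \<Omega>)"
   unfolding p_def[symmetric] \<delta>_eq Let_def reifenberg_flat_domain_def using \<delta> * by blast
 qed
qed

end
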